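(* Let $\Gamma$ be a sofic group generated by a finite set $S$, let $(\mathcal G_n,\Phi_n)_n$ be a sofic approximation to $\Gamma$ (with $S$-labelled graphings), and let $\mathfrak u$ be a non-principal ultrafilter on $\mathbb N$. Then $$\mathscr C^*(\Gamma)\ \geq\ \mathcal C(\mathcal G_{\mathfrak u})=c\mathcal C_{\mathfrak u}((\mathcal G_n,\Phi_n)_n)\ \geq\ \lim_{n\in\mathfrak u}\mathcal C(\mathcal G_n)\ \geq\ \liminf_{n\to\infty}\mathcal C(\mathcal G_n)\ \geq\ 1.$$ If $\Gamma$ has moreover fixed price $\mathscr C_*(\Gamma)$, then $\mathscr C_*(\Gamma)=c\mathcal C((\mathcal G_n,\Phi_n)_n)$; and hence if $\Gamma$ has fixed price $\mathscr C_*(\Gamma)=1$, we obtain $c\mathcal C((\mathcal G_n,\Phi_n)_n)=\lim_{n\to\infty}\mathcal C(\mathcal G_n)=1$.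
   Context: Groupoids. Probability spaces $(X,\mu)$ are arbitrary (not necessarily standard). A countable fibred space over $(X,\mu)$ is a measure space $(\mathcal F,\tilde\mu)$ with a measurable map $\pi:\mathcal F\to X$ for which there are a measurable $\widetilde{\mathcal F}\subset X\times\mathbb N$ (with the product of $\mu$ and counting measure) and a bi-measurable measure-preserving bijection $u:\mathcal F\to\widetilde{\mathcal F}$ with $u(f)\in\{\pi(f)\}\times\mathbb N$. A p.m.p. groupoid $\mathcal G$ over $(X,\mu)$ is a groupoid with unit space $X\subset\mathcal G$, source and target maps $s,t$ (the product $gh$ being defined when $s(g)=t(h)$), with a $\sigma$-algebra and a measure $\tilde\mu$ making $(\mathcal G,s)$ and $(\mathcal G,t)$ countable fibred spaces over $X$, and with measurable inverse and product. It is finite if it is a finite set. A countable group is a p.m.p. groupoid over a point, with the counting measure. A p.m.p. equivalence relation is a p.m.p. groupoid with trivial isotropy groups. Cost. A bisection is a measurable subset $\varphi\subset\mathcal G$ on which $s$ and $t$ are injective. A graphing is an at most countable ordered family $\Phi=(\varphi_i)$ of bisections, with cost $\mathcal C(\Phi)=\sum_i\tilde\mu(\varphi_i)$; it is generating if the smallest groupoid containing all $\varphi_i$ is $\mathcal G$. $\mathcal C(\mathcal G)$ is the infimum of $\mathcal C(\Phi)$ over the generating graphings $\Phi$ of $\mathcal G$. A graphed groupoid $(\mathcal G,\Phi)$ is a p.m.p. groupoid with a prescribed generating graphing. Ultraproducts. Let $(\mathcal G_n,\Phi_n)$, with $\Phi_n=(\varphi_{n,s})_{s\in S}$, be graphed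 p.m.p. groupoids over $(X_n,\mu_n)$, and write $[\cdot]_{\mathfrak u}$ for classes of sequences modulo equality for $\mathfrak u$-almost every $n$. $X_{\mathfrak u}$ is the set of classes of sequences in $\prod_nX_n$, with the Loeb probability measure: $\mu_{\mathfrak u}([A_n]_{\mathfrak u})=\lim_{n\in\mathfrak u}\mu_n(A_n)$ for measurable $A_n\subset X_n$, every measurable set being of the form $[A_n]_{\mathfrak u}$ up to a null set. $\mathcal G_{\mathfrak u}$ is the p.m.p. groupoid over $X_{\mathfrak u}$ of classes of sequences $(g_n)_n$, $g_n\in\mathcal G_n$, such that the word length of $g_n$ with respect to $\Phi_n$ is bounded independently of $n$, with coordinatewise operations; for measurable $E_n\subset\mathcal G_n$ of uniformly bounded word length, $[E_n]_{\mathfrak u}$ carries the Loeb structure with measure $\lim_{n\in\mathfrak u}\tilde\mu_n(E_n)$. It is generated by $\Phi_{\mathfrak u}=([\varphi_{n,s}]_{\mathfrak u})_{s\in S}$. Soficity. A factor map $T:\mathcal G\to\mathcal H$ between p.m.p. groupoids is a measurable groupoid homomorphism (commuting with source, target, product and inverse) which maps the measure of $\mathcal G$ to that of $\mathcal H$. The group $\Gamma$ is sofic if, setting $[[\Gamma]]=\Gamma\cup\{\emptyset\}$ with trace $\tau(1)=1$ and $\tau=0$ elsewhere, for every finite $K\subset[[\Gamma]]$ and $\varepsilon>0$ there are a finite p.m.p. groupoid $\mathcal G$ over some $(X,\mu)$ and a map $\pi$ from $[[\Gamma]]$ to the bisections of $\mathcal G$ with $\tilde\mu(\pi(\varphi\psi)\triangle\pi(\varphi)\pi(\psi))\leq\varepsilon$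 and $|\tau(\varphi)-\tilde\mu(\pi(\varphi)\cap X)|<\varepsilon$ for all $\varphi,\psi\in K$. A sofic approximation of $\Gamma$ (with $S$-labelled graphings) is a sequence of finite graphed p.m.p. groupoids $(\mathcal G_n,\Phi_n)_n$ with $\Phi_n=(\varphi_{n,s})_{s\in S}$ (for instance finite transitive equivalence relations with graphings) such that, for every non-principal ultrafilter $\mathfrak u$, $\Gamma$ is a factor of the ultraproduct $(\mathcal G_{\mathfrak u},\Phi_{\mathfrak u})$, the bisection $[\varphi_{n,s}]_{\mathfrak u}$ being the preimage of $s$ up to a null set for each $s\in S$. Combinatorial cost. For finite graphings $\Phi,\Psi$ of $\mathcal G$ and $L\in\mathbb N$, write $\Psi\subset_L\Phi$ if every $\psi\in\Psi$ is, up to null sets, contained in the union of the products of at most $L$ elements of $\Phi\cup\Phi^{-1}$ (the empty product being $X$). $\Phi,\Psi$ are $L$-Lipschitz equivalent if $\Psi\subset_L\Phi$ and $\Phi\subset_L\Psi$. $\mathcal C_L(\mathcal G,\Phi)$ is the infimum of $\mathcal C(\Psi)$ over the graphings $\Psi$ that are $L$-Lipschitz equivalent to $\Phi$. Then $c\mathcal C_{\mathfrak u}((\mathcal G_n,\Phi_n)_n)=\inf_L\lim_{n\in\mathfrak u}\mathcal C_L(\mathcal G_n,\Phi_n)$ and $c\mathcal C((\mathcal G_n,\Phi_n)_n)=\inf_L\liminf_{n\to\infty}\mathcal C_L(\mathcal G_n,\Phi_n)$. $\mathscr C_*(\Gamma)$ (resp. $\mathscr C^*(\Gamma)$) is the infimum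 (resp. supremum) of the costs of the orbit equivalence relations of essentially free p.m.p. actions of $\Gamma$ on standard probability spaces. $\Gamma$ has fixed price if they coincide.
   Formalization: The bound ≥ 1 is stated for infinite Γ; C^*(Γ) ≥ C(G_u) and the fixed-price claims assume the ultraproduct groupoid has essentially trivial isotropy (automatic for equivalence relations; false for Z² with (Z/n)² over a point); finite groupoids carry the discrete σ-algebra. *)

theory Defs
  imports
    "HOL-Probability.Probability_Measure"
    "HOL-Algebra.Generated_Groups"
    "HOL-Algebra.Group_Action"
begin

section \<open>Probability measure preserving groupoids\<close>

definition measurable_iso :: "'x measure \<Rightarrow> 'y measure \<Rightarrow> ('x \<Rightarrow> 'y) \<Rightarrow> bool" where
  "measurable_iso M N f \<longleftrightarrow>
     bij_betw f (space M) (space N) \<and> f \<in> M \<rightarrow>\<^sub>M N \<and> the_inv_into (space M) f \<in> N \<rightarrow>\<^sub>M M"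

definition countable_fibred_space :: "'f measure \<Rightarrow> ('f \<Rightarrow> 'x) \<Rightarrow> 'x measure \<Rightarrow> bool" where
  "countable_fibred_space F p M \<longleftrightarrow>
     p \<in> F \<rightarrow>\<^sub>M M \<and>
     (\<exists>U u. U \<in> sets (M \<Otimes>\<^sub>M count_space (UNIV :: nat set)) \<and>
        measurable_iso F (restrict_space (M \<Otimes>\<^sub>M count_space UNIV) U) u \<and>
        distr F (restrict_space (M \<Otimes>\<^sub>M count_space UNIV) U) u
          = restrict_space (M \<Otimes>\<^sub>M count_space UNIV) U \<and>
        (\<forall>f\<in>space F. fst (u f) = p f))"

text \<open>
  The set of arrows is \<open>space (arrows \<G>)\<close> and the unit space is its subset \<open>space (base \<G>)\<close>; the
  four operations are only meaningful on arrows, and \<open>gmult \<G> g h\<close> only if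
  \<open>source \<G> g = target \<G> h\<close>.
\<close>

record 'a groupoid =
  arrows :: "'a measure"
  base :: "'a measure"
  source :: "'a \<Rightarrow> 'a"
  target :: "'a \<Rightarrow> 'a"
  gmult :: "'a \<Rightarrow> 'a \<Rightarrow> 'a"
  ginv :: "'a \<Rightarrow> 'a"

definition groupoid_laws :: "'a groupoid \<Rightarrow> bool" where
  "groupoid_laws \<G> \<longleftrightarrow>
     space (base \<G>) \<subseteq> space (arrows \<G>) \<and>
     (\<forall>g\<in>space (arrows \<G>). source \<G> g \<in> space (base \<G>) \<and> target \<G> g \<in> space (base \<G>)) \<and>
     (\<forall>x\<in>space (base \<G>). source \<G> x = x \<and> target \<G> x = x) \<and>
     (\<forall>g\<in>space (arrows \<G>). \<forall>h\<in>space (arrows \<G>). source \<G> g = target \<G> h \<longrightarrow>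
        gmult \<G> g h \<in> space (arrows \<G>) \<and>
        source \<G> (gmult \<G> g h) = source \<G> h \<and> target \<G> (gmult \<G> g h) = target \<G> g) \<and>
     (\<forall>g\<in>space (arrows \<G>). \<forall>h\<in>space (arrows \<G>). \<forall>k\<in>space (arrows \<G>).
        source \<G> g = target \<G> h \<longrightarrow> source \<G> h = target \<G> k \<longrightarrow>
        gmult \<G> (gmult \<G> g h) k = gmult \<G> g (gmult \<G> h k)) \<and>
     (\<forall>g\<in>space (arrows \<G>). gmult \<G> g (source \<G> g) = g \<and> gmult \<G> (target \<G> g) g = g) \<and>
     (\<forall>g\<in>space (arrows \<G>).
        ginv \<G> g \<in> space (arrows \<G>) \<and>
        source \<G> (ginv \<G> g) = target \<G> g \<and> target \<G> (ginv \<G> g) = source \<G> g \<and>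
        gmult \<G> (ginv \<G> g) g = source \<G> g \<and> gmult \<G> g (ginv \<G> g) = target \<G> g)"

text \<open>
  The composable pairs carry the trace of the product \<open>\<sigma>\<close>-algebra. That the unit space is a
  measurable set of arrows whose induced measure is that of \<open>base \<G>\<close> follows from these axioms.
\<close>

definition pmp_groupoid :: "'a groupoid \<Rightarrow> bool" where
  "pmp_groupoid \<G> \<longleftrightarrow>
     groupoid_laws \<G> \<and>
     prob_space (base \<G>) \<and>
     countable_fibred_space (arrows \<G>) (source \<G>) (base \<G>) \<and>
     countable_fibred_space (arrows \<G>) (target \<G>) (base \<G>) \<and>
     ginv \<G> \<in> arrows \<G> \<rightarrow>\<^sub>M arrows \<G> \<and>
     (\<lambda>(g, h). gmult \<G> g h)
       \<in> restrict_space (arrows \<G> \<Otimes>\<^sub>M arrows \<G>) {(g, h). source \<G> g = target \<G> h} \<rightarrow>\<^sub>M arrows \<G>"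

text \<open>A finite set of arrows is understood to carry the discrete \<open>\<sigma>\<close>-algebra.\<close>

definition finite_pmp_groupoid :: "'a groupoid \<Rightarrow> bool" where
  "finite_pmp_groupoid \<G> \<longleftrightarrow>
     pmp_groupoid \<G> \<and> finite (space (arrows \<G>)) \<and> sets (arrows \<G>) = Pow (space (arrows \<G>))"

text \<open>
  Up to a null set, the groupoid is a p.m.p. equivalence relation. For the ultraproduct of a sofic
  approximation of \<open>\<Gamma>\<close> this says that the action of \<open>\<Gamma>\<close> on the ultraproduct of the unit spaces
  is essentially free. It holds if the finite groupoids are equivalence relations
  (\<open>ultraproduct_essentially_trivial_isotropy\<close> below), but not for arbitrary finite groupoids:
  the groups \<open>(\<int>/n)\<^sup>2\<close>, as groupoids over a point, approximate \<open>\<int>\<^sup>2\<close> and their ultraproduct is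
  \<open>\<int>\<^sup>2\<close> over a point, of cost 2, whereas free p.m.p. actions of \<open>\<int>\<^sup>2\<close> have cost 1.
\<close>

definition essentially_trivial_isotropy :: "'a groupoid \<Rightarrow> bool" where
  "essentially_trivial_isotropy \<G> \<longleftrightarrow>
     (AE g in arrows \<G>. source \<G> g = target \<G> g \<longrightarrow> g \<in> space (base \<G>))"

definition factor_map :: "'a groupoid \<Rightarrow> 'b groupoid \<Rightarrow> ('a \<Rightarrow> 'b) \<Rightarrow> bool" where
  "factor_map \<G> \<H> T \<longleftrightarrow>
     T \<in> arrows \<G> \<rightarrow>\<^sub>M arrows \<H> \<and>
     (\<forall>g\<in>space (arrows \<G>).
        T (source \<G> g) = source \<H> (T g) \<and> T (target \<G> g) = target \<H> (T g) \<and>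
        T (ginv \<G> g) = ginv \<H> (T g)) \<and>
     (\<forall>g\<in>space (arrows \<G>). \<forall>h\<in>space (arrows \<G>). source \<G> g = target \<G> h \<longrightarrow>
        T (gmult \<G> g h) = gmult \<H> (T g) (T h)) \<and>
     distr (arrows \<G>) (arrows \<H>) T = arrows \<H>"

definition group_groupoid :: "('g, 'b) monoid_scheme \<Rightarrow> 'g groupoid" where
  "group_groupoid \<Gamma> =
     \<lparr>arrows = count_space (carrier \<Gamma>), base = count_space {\<one>\<^bsub>\<Gamma>\<^esub>},
      source = (\<lambda>_. \<one>\<^bsub>\<Gamma>\<^esub>), target = (\<lambda>_. \<one>\<^bsub>\<Gamma>\<^esub>),
      gmult = (\<lambda>g h. g \<otimes>\<^bsub>\<Gamma>\<^esub> h), ginv = (\<lambda>g. inv\<^bsub>\<Gamma>\<^esub> g)\<rparr>"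


section \<open>Graphings and cost\<close>

definition bisection :: "'a groupoid \<Rightarrow> 'a set \<Rightarrow> bool" where
  "bisection \<G> \<phi> \<longleftrightarrow> \<phi> \<in> sets (arrows \<G>) \<and> inj_on (source \<G>) \<phi> \<and> inj_on (target \<G>) \<phi>"

definition gset_mult :: "'a groupoid \<Rightarrow> 'a set \<Rightarrow> 'a set \<Rightarrow> 'a set" where
  "gset_mult \<G> A B = {gmult \<G> g h | g h. g \<in> A \<and> h \<in> B \<and> source \<G> g = target \<G> h}"

definition graphing :: "'a groupoid \<Rightarrow> 'i set \<Rightarrow> ('i \<Rightarrow> 'a set) \<Rightarrow> bool" where
  "graphing \<G> I \<Phi> \<longleftrightarrow> countable I \<and> (\<forall>i\<in>I. bisection \<G> (\<Phi> i))"

definition graphing_cost :: "'a groupoid \<Rightarrow> 'i set \<Rightarrow> ('i \<Rightarrow> 'a set) \<Rightarrow> ennreal" where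
  "graphing_cost \<G> I \<Phi> = (\<Sum>\<^sub>\<infinity>i\<in>I. emeasure (arrows \<G>) (\<Phi> i))"

definition subgroupoid :: "'a groupoid \<Rightarrow> 'a set \<Rightarrow> bool" where
  "subgroupoid \<G> H \<longleftrightarrow>
     space (base \<G>) \<subseteq> H \<and> H \<subseteq> space (arrows \<G>) \<and>
     (\<forall>g\<in>H. ginv \<G> g \<in> H) \<and>
     (\<forall>g\<in>H. \<forall>h\<in>H. source \<G> g = target \<G> h \<longrightarrow> gmult \<G> g h \<in> H)"

definition generating :: "'a groupoid \<Rightarrow> 'i set \<Rightarrow> ('i \<Rightarrow> 'a set) \<Rightarrow> bool" where
  "generating \<G> I \<Phi> \<longleftrightarrow>
     \<Inter>{H. subgroupoid \<G> H \<and> (\<forall>i\<in>I. \<Phi> i \<subseteq> H)} = space (arrows \<G>)"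

definition graphed_groupoid :: "'a groupoid \<Rightarrow> 'i set \<Rightarrow> ('i \<Rightarrow> 'a set) \<Rightarrow> bool" where
  "graphed_groupoid \<G> I \<Phi> \<longleftrightarrow> pmp_groupoid \<G> \<and> graphing \<G> I \<Phi> \<and> generating \<G> I \<Phi>"

text \<open>At most countable families are indexed by sets of natural numbers.\<close>

definition cost :: "'a groupoid \<Rightarrow> ennreal" where
  "cost \<G> = Inf {graphing_cost \<G> I \<Psi> | (I :: nat set) \<Psi>. graphing \<G> I \<Psi> \<and> generating \<G> I \<Psi>}"

primrec word_product :: "'a groupoid \<Rightarrow> 'a set list \<Rightarrow> 'a set" where
  "word_product \<G> [] = space (base \<G>)"
| "word_product \<G> (\<phi> # w) = gset_mult \<G> \<phi> (word_product \<G> w)"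

text \<open>The arrows of word length at most \<open>L\<close> with respect to the set \<open>F\<close> of bisections.\<close>

definition word_ball :: "'a groupoid \<Rightarrow> 'a set set \<Rightarrow> nat \<Rightarrow> 'a set" where
  "word_ball \<G> F L =
     \<Union>{word_product \<G> w | w. set w \<subseteq> F \<union> (\<lambda>\<phi>. ginv \<G> ` \<phi>) ` F \<and> length w \<le> L}"

definition lipschitz_sub ::
    "'a groupoid \<Rightarrow> nat \<Rightarrow> 'j set \<Rightarrow> ('j \<Rightarrow> 'a set) \<Rightarrow> 'i set \<Rightarrow> ('i \<Rightarrow> 'a set) \<Rightarrow> bool" where
  "lipschitz_sub \<G> L J \<Psi> I \<Phi> \<longleftrightarrow>
     (\<forall>j\<in>J. \<exists>N\<in>null_sets (arrows \<G>). \<Psi> j \<subseteq> word_ball \<G> (\<Phi> ` I) L \<union> N)"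

definition lipschitz_equivalent ::
    "'a groupoid \<Rightarrow> nat \<Rightarrow> 'j set \<Rightarrow> ('j \<Rightarrow> 'a set) \<Rightarrow> 'i set \<Rightarrow> ('i \<Rightarrow> 'a set) \<Rightarrow> bool" where
  "lipschitz_equivalent \<G> L J \<Psi> I \<Phi> \<longleftrightarrow>
     lipschitz_sub \<G> L J \<Psi> I \<Phi> \<and> lipschitz_sub \<G> L I \<Phi> J \<Psi>"

definition lipschitz_cost :: "nat \<Rightarrow> 'a groupoid \<Rightarrow> 'i set \<Rightarrow> ('i \<Rightarrow> 'a set) \<Rightarrow> ennreal" where
  "lipschitz_cost L \<G> I \<Phi> =
     Inf {graphing_cost \<G> J \<Psi> | (J :: nat set) \<Psi>.
            finite J \<and> graphing \<G> J \<Psi> \<and> lipschitz_equivalent \<G> L J \<Psi> I \<Phi>}"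


section \<open>Ultraproducts\<close>

definition nonprincipal_ultrafilter :: "nat filter \<Rightarrow> bool" where
  "nonprincipal_ultrafilter \<UU> \<longleftrightarrow>
     \<UU> \<noteq> bot \<and>
     (\<forall>P. eventually P \<UU> \<or> eventually (\<lambda>n. \<not> P n) \<UU>) \<and>
     (\<forall>k. \<UU> \<noteq> principal {k})"

definition ultraclass :: "nat filter \<Rightarrow> (nat \<Rightarrow> 'a) \<Rightarrow> (nat \<Rightarrow> 'a) set" where
  "ultraclass \<UU> g = {h. \<forall>\<^sub>F n in \<UU>. h n = g n}"

definition ultraset :: "nat filter \<Rightarrow> (nat \<Rightarrow> 'a set) \<Rightarrow> (nat \<Rightarrow> 'a) set set" where
  "ultraset \<UU> A = {ultraclass \<UU> g | g. \<forall>\<^sub>F n in \<UU>. g n \<in> A n}"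

text \<open>
  The measure on \<open>\<Omega>\<close> which extends \<open>[A\<^sub>n] \<mapsto> lim \<mu>\<^sub>n(A\<^sub>n)\<close> (for \<open>A\<close> in the family \<open>\<A>\<close>) to the
  generated \<open>\<sigma>\<close>-algebra, completed by the null sets.
\<close>

definition loeb_measure ::
    "nat filter \<Rightarrow> (nat \<Rightarrow> 'a) set set \<Rightarrow> (nat \<Rightarrow> 'a set) set \<Rightarrow> (nat \<Rightarrow> 'a measure) \<Rightarrow>
     (nat \<Rightarrow> 'a) set measure" where
  "loeb_measure \<UU> \<Omega> \<A> M =
     completion (extend_measure \<Omega> \<A> (ultraset \<UU>) (\<lambda>A. Lim \<UU> (\<lambda>n. emeasure (M n) (A n))))"

definition bounded_sets ::
    "(nat \<Rightarrow> 'a groupoid) \<Rightarrow> 'i set \<Rightarrow> (nat \<Rightarrow> 'i \<Rightarrow> 'a set) \<Rightarrow> (nat \<Rightarrow> 'a set) set" where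
  "bounded_sets \<G> I \<Phi> =
     {E. (\<forall>n. E n \<in> sets (arrows (\<G> n))) \<and> (\<exists>L. \<forall>n. E n \<subseteq> word_ball (\<G> n) (\<Phi> n ` I) L)}"

text \<open>
  The unions over representatives in the four operations are unions of a single class.
\<close>

definition ultraproduct ::
    "nat filter \<Rightarrow> (nat \<Rightarrow> 'a groupoid) \<Rightarrow> 'i set \<Rightarrow> (nat \<Rightarrow> 'i \<Rightarrow> 'a set) \<Rightarrow>
     (nat \<Rightarrow> 'a) set groupoid" where
  "ultraproduct \<UU> \<G> I \<Phi> =
     \<lparr>arrows = loeb_measure \<UU>
        {ultraclass \<UU> g | g. (\<forall>n. g n \<in> space (arrows (\<G> n))) \<and>
                              (\<exists>L. \<forall>n. g n \<in> word_ball (\<G> n) (\<Phi> n ` I) L)}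
        (bounded_sets \<G> I \<Phi>) (\<lambda>n. arrows (\<G> n)),
      base = loeb_measure \<UU>
        {ultraclass \<UU> x | x. \<forall>n. x n \<in> space (base (\<G> n))}
        {A. \<forall>n. A n \<in> sets (base (\<G> n))} (\<lambda>n. base (\<G> n)),
      source = (\<lambda>c. \<Union>g\<in>c. ultraclass \<UU> (\<lambda>n. source (\<G> n) (g n))),
      target = (\<lambda>c. \<Union>g\<in>c. ultraclass \<UU> (\<lambda>n. target (\<G> n) (g n))),
      gmult = (\<lambda>c d. \<Union>g\<in>c. \<Union>h\<in>d. ultraclass \<UU> (\<lambda>n. gmult (\<G> n) (g n) (h n))),
      ginv = (\<lambda>c. \<Union>g\<in>c. ultraclass \<UU> (\<lambda>n. ginv (\<G> n) (g n)))\<rparr>"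

lemma ultraclass_eq_iff: "ultraclass \<UU> g = ultraclass \<UU> h \<longleftrightarrow> (\<forall>\<^sub>F n in \<UU>. g n = h n)"
proof
  assume "ultraclass \<UU> g = ultraclass \<UU> h"
  moreover have "g \<in> ultraclass \<UU> g" by (simp add: ultraclass_def)
  ultimately show "\<forall>\<^sub>F n in \<UU>. g n = h n" by (simp add: ultraclass_def)
next
  assume "\<forall>\<^sub>F n in \<UU>. g n = h n"
  then show "ultraclass \<UU> g = ultraclass \<UU> h"
    unfolding ultraclass_def by (auto elim: eventually_elim2)
qed

lemma Union_ultraclass:
  "(\<Union>h\<in>ultraclass \<UU> g. ultraclass \<UU> (\<lambda>n. f n (h n))) = ultraclass \<UU> (\<lambda>n. f n (g n))"
proof -
  have "ultraclass \<UU> (\<lambda>n. f n (h n)) = ultraclass \<UU> (\<lambda>n. f n (g n))" if "h \<in> ultraclass \<UU> g" for h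
    using that unfolding ultraclass_eq_iff by (auto simp: ultraclass_def elim: eventually_mono)
  moreover have "g \<in> ultraclass \<UU> g" by (simp add: ultraclass_def)
  ultimately show ?thesis by blast
qed

lemma space_loeb_measure: "space (loeb_measure \<UU> \<Omega> \<A> M) = \<Omega>"
  by (simp add: loeb_measure_def extend_measure_def space_measure_of_conv)

lemma ultraproduct_essentially_trivial_isotropy:
  assumes laws: "\<And>n. groupoid_laws (\<G> n)"
    and triv: "\<And>n g. g \<in> space (arrows (\<G> n)) \<Longrightarrow> source (\<G> n) g = target (\<G> n) g \<Longrightarrow>
                 g \<in> space (base (\<G> n))"
  shows "essentially_trivial_isotropy (ultraproduct \<UU> \<G> I \<Phi>)"
  unfolding essentially_trivial_isotropy_def
proof (intro AE_I2 impI)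
  fix c assume c: "c \<in> space (arrows (ultraproduct \<UU> \<G> I \<Phi>))"
    and st: "source (ultraproduct \<UU> \<G> I \<Phi>) c = target (ultraproduct \<UU> \<G> I \<Phi>) c"
  from c obtain g where cg: "c = ultraclass \<UU> g" and g: "\<And>n. g n \<in> space (arrows (\<G> n))"
    by (auto simp: ultraproduct_def space_loeb_measure)
  have "\<forall>\<^sub>F n in \<UU>. source (\<G> n) (g n) = target (\<G> n) (g n)"
    using st Union_ultraclass[of \<UU> "\<lambda>n. source (\<G> n)" g] Union_ultraclass[of \<UU> "\<lambda>n. target (\<G> n)" g]
    by (simp add: cg ultraproduct_def ultraclass_eq_iff)
  then have "\<forall>\<^sub>F n in \<UU>. g n = source (\<G> n) (g n)"
  proof (rule eventually_mono)
    fix n assume "source (\<G> n) (g n) = target (\<G> n) (g n)"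
    then show "g n = source (\<G> n) (g n)"
      using triv[OF g] laws[of n] unfolding groupoid_laws_def by metis
  qed
  then have "c = ultraclass \<UU> (\<lambda>n. source (\<G> n) (g n))"
    by (simp add: cg ultraclass_eq_iff)
  moreover have "source (\<G> n) (g n) \<in> space (base (\<G> n))" for n
    using g[of n] laws[of n] unfolding groupoid_laws_def by blast
  ultimately have "c \<in> {ultraclass \<UU> x | x. \<forall>n. x n \<in> space (base (\<G> n))}" by blast
  then show "c \<in> space (base (ultraproduct \<UU> \<G> I \<Phi>))"
    by (simp add: ultraproduct_def space_loeb_measure)
qed

definition combinatorial_cost_ultra ::
    "nat filter \<Rightarrow> (nat \<Rightarrow> 'a groupoid) \<Rightarrow> 'i set \<Rightarrow> (nat \<Rightarrow> 'i \<Rightarrow> 'a set) \<Rightarrow> ennreal" where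
  "combinatorial_cost_ultra \<UU> \<G> I \<Phi> = (INF L. Lim \<UU> (\<lambda>n. lipschitz_cost L (\<G> n) I (\<Phi> n)))"

definition combinatorial_cost ::
    "(nat \<Rightarrow> 'a groupoid) \<Rightarrow> 'i set \<Rightarrow> (nat \<Rightarrow> 'i \<Rightarrow> 'a set) \<Rightarrow> ennreal" where
  "combinatorial_cost \<G> I \<Phi> = (INF L. liminf (\<lambda>n. lipschitz_cost L (\<G> n) I (\<Phi> n)))"


section \<open>Soficity\<close>

text \<open>
  The bisections of the groupoid \<open>\<Gamma>\<close>: the singletons and the empty set, multiplied as sets.
\<close>

definition full_pseudogroup :: "('g, 'b) monoid_scheme \<Rightarrow> 'g set set" where
  "full_pseudogroup \<Gamma> = insert {} ((\<lambda>g. {g}) ` carrier \<Gamma>)"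

definition group_trace :: "('g, 'b) monoid_scheme \<Rightarrow> 'g set \<Rightarrow> real" where
  "group_trace \<Gamma> \<phi> = (if \<phi> = {\<one>\<^bsub>\<Gamma>\<^esub>} then 1 else 0)"

text \<open>Finite groupoids may be assumed to have natural numbers as arrows.\<close>

definition sofic_group :: "('g, 'b) monoid_scheme \<Rightarrow> bool" where
  "sofic_group \<Gamma> \<longleftrightarrow>
     (\<forall>K \<epsilon>. finite K \<longrightarrow> K \<subseteq> full_pseudogroup \<Gamma> \<longrightarrow> \<epsilon> > 0 \<longrightarrow>
        (\<exists>(\<G> :: nat groupoid) \<pi>.
           finite_pmp_groupoid \<G> \<and>
           (\<forall>\<phi>\<in>full_pseudogroup \<Gamma>. bisection \<G> (\<pi> \<phi>)) \<and>
           (\<forall>\<phi>\<in>K. \<forall>\<psi>\<in>K.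
              measure (arrows \<G>) (sym_diff (\<pi> (\<phi> <#>\<^bsub>\<Gamma>\<^esub> \<psi>)) (gset_mult \<G> (\<pi> \<phi>) (\<pi> \<psi>))) \<le> \<epsilon>) \<and>
           (\<forall>\<phi>\<in>K. \<bar>group_trace \<Gamma> \<phi> - measure (arrows \<G>) (\<pi> \<phi> \<inter> space (base \<G>))\<bar> < \<epsilon>)))"

definition sofic_approximation ::
    "('g, 'b) monoid_scheme \<Rightarrow> 'g set \<Rightarrow> (nat \<Rightarrow> 'a groupoid) \<Rightarrow> (nat \<Rightarrow> 'g \<Rightarrow> 'a set) \<Rightarrow> bool" where
  "sofic_approximation \<Gamma> S \<G> \<Phi> \<longleftrightarrow>
     (\<forall>n. finite_pmp_groupoid (\<G> n) \<and> graphed_groupoid (\<G> n) S (\<Phi> n)) \<and>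
     (\<forall>\<UU>. nonprincipal_ultrafilter \<UU> \<longrightarrow>
        (\<exists>T. factor_map (ultraproduct \<UU> \<G> S \<Phi>) (group_groupoid \<Gamma>) T \<and>
           (\<forall>s\<in>S. sym_diff (ultraset \<UU> (\<lambda>n. \<Phi> n s))
                     (T -` {s} \<inter> space (arrows (ultraproduct \<UU> \<G> S \<Phi>)))
                   \<in> null_sets (arrows (ultraproduct \<UU> \<G> S \<Phi>)))))"


section \<open>Costs of free actions\<close>

text \<open>Standard Borel spaces are those isomorphic to a Borel subset of the line.\<close>

definition standard_prob_space :: "'x measure \<Rightarrow> bool" where
  "standard_prob_space M \<longleftrightarrow>
     prob_space M \<and> (\<exists>B\<in>sets (borel :: real measure). \<exists>f. measurable_iso M (restrict_space borel B) f)"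

definition pmp_action :: "('g, 'b) monoid_scheme \<Rightarrow> 'x measure \<Rightarrow> ('g \<Rightarrow> 'x \<Rightarrow> 'x) \<Rightarrow> bool" where
  "pmp_action \<Gamma> M a \<longleftrightarrow>
     group_action \<Gamma> (space M) a \<and>
     (\<forall>g\<in>carrier \<Gamma>. a g \<in> M \<rightarrow>\<^sub>M M \<and> distr M M (a g) = M)"

definition essentially_free ::
    "('g, 'b) monoid_scheme \<Rightarrow> 'x measure \<Rightarrow> ('g \<Rightarrow> 'x \<Rightarrow> 'x) \<Rightarrow> bool" where
  "essentially_free \<Gamma> M a \<longleftrightarrow> (AE x in M. \<forall>g\<in>carrier \<Gamma>. a g x = x \<longrightarrow> g = \<one>\<^bsub>\<Gamma>\<^esub>)"

definition orbit_relation ::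
    "('g, 'b) monoid_scheme \<Rightarrow> 'x measure \<Rightarrow> ('g \<Rightarrow> 'x \<Rightarrow> 'x) \<Rightarrow> ('x \<times> 'x) set" where
  "orbit_relation \<Gamma> M a = {(y, x). x \<in> space M \<and> y \<in> orbit \<Gamma> a x}"

text \<open>
  The arrow \<open>(y, x)\<close> goes from \<open>x\<close> to \<open>y\<close>, the point \<open>x\<close> being identified with the unit
  \<open>(x, x)\<close>; the measure of \<open>E\<close> is the integral of the number of arrows in \<open>E\<close> with source \<open>x\<close>.
\<close>

definition orbit_groupoid ::
    "('g, 'b) monoid_scheme \<Rightarrow> 'x measure \<Rightarrow> ('g \<Rightarrow> 'x \<Rightarrow> 'x) \<Rightarrow> ('x \<times> 'x) groupoid" where
  "orbit_groupoid \<Gamma> M a =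
     \<lparr>arrows = measure_of (orbit_relation \<Gamma> M a)
        (sets (restrict_space (M \<Otimes>\<^sub>M M) (orbit_relation \<Gamma> M a)))
        (\<lambda>E. \<integral>\<^sup>+x. emeasure (count_space UNIV) {y. (y, x) \<in> E} \<partial>M),
      base = distr M (restrict_space (M \<Otimes>\<^sub>M M) {(x, x) | x. x \<in> space M}) (\<lambda>x. (x, x)),
      source = (\<lambda>(y, x). (x, x)),
      target = (\<lambda>(y, x). (y, y)),
      gmult = (\<lambda>(z, y) (y', x). (z, x)),
      ginv = (\<lambda>(y, x). (x, y))\<rparr>"

text \<open>Up to isomorphism, every standard probability space lives on a set of reals.\<close>

definition free_action_costs :: "('g, 'b) monoid_scheme \<Rightarrow> ennreal set" where
  "free_action_costs \<Gamma> =
     {cost (orbit_groupoid \<Gamma> M a) | (M :: real measure) a.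
        standard_prob_space M \<and> pmp_action \<Gamma> M a \<and> essentially_free \<Gamma> M a}"

definition inf_cost :: "('g, 'b) monoid_scheme \<Rightarrow> ennreal" where
  "inf_cost \<Gamma> = Inf (free_action_costs \<Gamma>)"

definition sup_cost :: "('g, 'b) monoid_scheme \<Rightarrow> ennreal" where
  "sup_cost \<Gamma> = Sup (free_action_costs \<Gamma>)"

definition fixed_price :: "('g, 'b) monoid_scheme \<Rightarrow> bool" where
  "fixed_price \<Gamma> \<longleftrightarrow> inf_cost \<Gamma> = sup_cost \<Gamma>"

end

theory Submission
  imports Defs
begin

text \<open>
  The ultraproduct carries Loeb measures, obtained from Caratheodory's theorem by saturation, and its
  measurable sets are internal modulo null sets. A graphing that is Lipschitz equivalent to \<open>\<Phi>\<^sub>n\<close> consists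
  of arrows of bounded word length, so it may be cut into a bounded number of bisections and passes to
  the ultraproduct; conversely a generating graphing of the ultraproduct generates \<open>\<Phi>\<close> with bounded
  words up to small measure. This identifies the cost of the ultraproduct with the combinatorial cost.

  The factor map onto \<open>\<Gamma>\<close> turns the ultraproduct into an action of \<open>\<Gamma>\<close> off a null set. Coding
  countably many measurable sets and their translates by reals gives a standard factor of this action; it is
  free as soon as the coded sets separate the two ends of every arrow, and a 3-colouring of partial injections of
  finite sets provides such sets. Graphings of the standard factor pull back, which bounds the
  cost of the ultraproduct by the supremum over free actions; coding also the pieces of a given graphing lets that
  graphing descend, which bounds it from below by the infimum.

  A finite groupoid with weights \<open>w\<close> has cost at least \<open>\<Sum> w(x) (1 - 1/N(x))\<close>, where \<open>N(x)\<close> is the number of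
  arrows with source \<open>x\<close>, because a connected graph on \<open>N\<close> vertices has at least \<open>N - 1\<close> edges. If \<open>\<Gamma>\<close> is
  infinite then \<open>N(x)\<close> is large for most \<open>x\<close>. Lower limits are limits along suitable ultrafilters, so the
  statements about sequences follow from those about ultraproducts.
\<close>

section \<open>Non-principal ultrafilters on the natural numbers\<close>

text \<open>Generation of a groupoid is exact, whereas measurable sets are known only modulo null
  sets. Two devices bridge this. Countably many bisections of measure zero may be added to a
  graphing at no cost (\<open>cost_le_null\<close>), so a null set of arrows that a graphing misses
  can be supplied separately. And a null set of units is replaced by its saturation, the set of all
  points joined to it, which is again null because countably many bisections cover the arrows; a
  word that starts outside a saturated set stays outside it, so all of its letters are good ones.

  The two conditions in the statement have different origins. The comparison with free actions asks
  for an essentially free action on the ultraproduct, hence the condition on isotropy. The bound 1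
  asks for an infinite group: a free transitive action of a group of order k has cost 1 - 1/k. In
  the last clause the group is infinite automatically, because a finite group has
  \<open>inf_cost\<close> below 1.\<close>

locale np_ultrafilter =
  fixes \<UU> :: "nat filter"
  assumes np: "nonprincipal_ultrafilter \<UU>"
begin

lemma proper: "\<UU> \<noteq> bot"
  using np by (simp add: nonprincipal_ultrafilter_def)

lemma ev_not_iff: "eventually (\<lambda>n. \<not> P n) \<UU> \<longleftrightarrow> \<not> eventually P \<UU>"
proof
  assume "eventually (\<lambda>n. \<not> P n) \<UU>"
  then show "\<not> eventually P \<UU>"
    using proper eventually_conj by (fastforce simp: trivial_limit_def)
next
  show "\<not> eventually P \<UU> \<Longrightarrow> eventually (\<lambda>n. \<not> P n) \<UU>"
    using np unfolding nonprincipal_ultrafilter_def by blast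
qed

lemma ev_disj_iff: "eventually (\<lambda>n. P n \<or> Q n) \<UU> \<longleftrightarrow> eventually P \<UU> \<or> eventually Q \<UU>"
  using ev_not_iff[of "\<lambda>n. \<not> P n \<and> \<not> Q n"]
  by (simp add: eventually_conj_iff ev_not_iff)

lemma ev_const: "eventually (\<lambda>_. P) \<UU> \<longleftrightarrow> P"
  using ev_not_iff[of "\<lambda>_. True"] by (cases P) auto

lemma ev_neq: "eventually (\<lambda>n. n \<noteq> k) \<UU>"
proof (rule ccontr)
  assume "\<not> ?thesis"
  then have k: "eventually (\<lambda>n. n = k) \<UU>" by (simp add: ev_not_iff)
  have "eventually P \<UU> \<longleftrightarrow> P k" for P
  proof
    assume "eventually P \<UU>"
    with k have "eventually (\<lambda>n. P k) \<UU>" by eventually_elim simp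
    then show "P k" by (simp add: ev_const)
  next
    assume "P k" with k show "eventually P \<UU>" by (auto elim: eventually_mono)
  qed
  then have "\<UU> = principal {k}" by (simp add: filter_eq_iff eventually_principal)
  with np show False by (simp add: nonprincipal_ultrafilter_def)
qed

lemma ev_ge: "eventually (\<lambda>n. n \<ge> k) \<UU>"
proof (induction k)
  case (Suc k)
  with ev_neq[of k] show ?case by eventually_elim simp
qed simp

lemma le_sequentially: "\<UU> \<le> sequentially"
proof (rule filter_leI)
  fix P :: "nat \<Rightarrow> bool" assume "eventually P sequentially"
  then obtain k where "\<And>n. n \<ge> k \<Longrightarrow> P n" by (auto simp: eventually_sequentially)
  with ev_ge[of k] show "eventually P \<UU>" by (auto elim: eventually_mono)
qed

text \<open>For a bound a above the lower limit, the alternative to \<open>f n < a\<close> holding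
  almost everywhere is that \<open>a \<le> f n\<close> does, which would raise the lower limit to a.
  So the lower limit is a limit, and \<open>Lim\<close> denotes a genuine limit throughout.\<close>

lemma has_Lim:
  fixes f :: "nat \<Rightarrow> 'b :: {complete_linorder, linorder_topology}"
  shows "(f \<longlongrightarrow> Lim \<UU> f) \<UU>"
proof -
  have "(f \<longlongrightarrow> Liminf \<UU> f) \<UU>"
  proof (rule order_tendstoI)
    fix a assume "a < Liminf \<UU> f"
    then show "\<forall>\<^sub>F n in \<UU>. a < f n" by (simp add: less_LiminfD)
  next
    fix a assume *: "Liminf \<UU> f < a"
    show "\<forall>\<^sub>F n in \<UU>. f n < a"
    proof (rule ccontr)
      assume "\<not> ?thesis"
      then have "\<forall>\<^sub>F n in \<UU>. a \<le> f n" by (simp add: ev_not_iff[symmetric] not_less)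
      then have "a \<le> Liminf \<UU> f" by (rule Liminf_bounded)
      with * show False by simp
    qed
  qed
  with proper show ?thesis by (simp add: tendsto_Lim)
qed

lemma LimI: "(f \<longlongrightarrow> (l :: 'b :: t2_space)) \<UU> \<Longrightarrow> Lim \<UU> f = l"
  using proper by (rule tendsto_Lim)

lemma Lim_mono:
  fixes f g :: "nat \<Rightarrow> 'b :: {complete_linorder, linorder_topology}"
  assumes "eventually (\<lambda>n. f n \<le> g n) \<UU>"
  shows "Lim \<UU> f \<le> Lim \<UU> g"
  by (rule tendsto_le[OF proper has_Lim has_Lim assms])

lemma Lim_cong: "eventually (\<lambda>n. f n = g n) \<UU> \<Longrightarrow> Lim \<UU> f = Lim \<UU> g"
  unfolding Topological_Spaces.Lim_def using tendsto_cong[of f g \<UU>] by simp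

lemma Lim_le:
  fixes f :: "nat \<Rightarrow> 'b :: {complete_linorder, linorder_topology}"
  shows "eventually (\<lambda>n. f n \<le> c) \<UU> \<Longrightarrow> Lim \<UU> f \<le> c"
  using tendsto_le[OF proper tendsto_const has_Lim] by blast

lemma Lim_ge:
  fixes f :: "nat \<Rightarrow> 'b :: {complete_linorder, linorder_topology}"
  shows "eventually (\<lambda>n. c \<le> f n) \<UU> \<Longrightarrow> c \<le> Lim \<UU> f"
  using tendsto_le[OF proper has_Lim tendsto_const] by blast

lemma Lim_add:
  fixes f g :: "nat \<Rightarrow> ennreal"
  shows "Lim \<UU> (\<lambda>n. f n + g n) = Lim \<UU> f + Lim \<UU> g"
  by (intro LimI tendsto_add has_Lim)

lemma Lim_sum:
  fixes f :: "'i \<Rightarrow> nat \<Rightarrow> ennreal"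
  shows "Lim \<UU> (\<lambda>n. \<Sum>i\<in>A. f i n) = (\<Sum>i\<in>A. Lim \<UU> (f i))"
  by (intro LimI tendsto_sum has_Lim)

text \<open>The diagonal argument behind the \<open>\<aleph>\<^sub>1\<close>-saturation of ultraproducts.\<close>

lemma diagonal:
  fixes P :: "nat \<Rightarrow> nat \<Rightarrow> bool"
  assumes "\<And>k. eventually (P k) \<UU>"
  shows "\<exists>\<kappa>. (\<forall>K. eventually (\<lambda>n. K \<le> \<kappa> n) \<UU>) \<and> eventually (\<lambda>n. \<forall>k\<le>\<kappa> n. P k n) \<UU>"
proof -
  \<comment> \<open>The bound \<open>k \<le> n\<close> only makes the maximum exist; it does no
    harm, since a non-principal ultrafilter contains all tails. Where \<open>P 0\<close> fails the
    set is empty and \<open>\<kappa> n\<close> is arbitrary.\<close>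
  let ?S = "\<lambda>n :: nat. {k. k \<le> n \<and> (\<forall>j\<le>k. P j n)}"
  define \<kappa> where "\<kappa> n = Max (?S n)" for n
  have fin: "finite (?S n)" for n by auto
  have all: "eventually (\<lambda>n. \<forall>j\<le>K. P j n) \<UU>" for K
    using assms by (simp add: eventually_ball_finite_distrib flip: Ball_def atMost_iff)
  have 1: "eventually (\<lambda>n. K \<le> \<kappa> n) \<UU>" for K
    using all[of K] ev_ge[of K]
  proof eventually_elim
    case (elim n)
    then show ?case unfolding \<kappa>_def by (intro Max_ge fin) auto
  qed
  have "eventually (\<lambda>n. \<forall>k\<le>\<kappa> n. P k n) \<UU>"
    using assms[of 0]
  proof eventually_elim
    case (elim n)
    then have "0 \<in> ?S n" by auto
    then have "Max (?S n) \<in> ?S n" using fin Max_in by blast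
    then show ?case unfolding \<kappa>_def by blast
  qed
  with 1 show ?thesis by blast
qed

end

lemma liminf_le_Lim:
  fixes f :: "nat \<Rightarrow> 'b :: {complete_linorder, linorder_topology}"
  assumes "nonprincipal_ultrafilter \<UU>"
  shows "liminf f \<le> Lim \<UU> f"
proof -
  interpret np_ultrafilter \<UU> by standard fact
  have "Liminf \<UU> f = Lim \<UU> f"
    using proper has_Lim lim_imp_Liminf by blast
  moreover have "liminf f \<le> Liminf \<UU> f"
    unfolding Liminf_def using le_sequentially by (intro SUP_subset_mono) (auto simp: le_filter_def)
  ultimately show ?thesis by simp
qed

text \<open>Restricting the filter to P keeps it proper unless the complement of P is already large;
  by minimality the restriction changes nothing, so P was large.\<close>

lemma minimal_filter_ultra:
  assumes "F \<noteq> bot" and min: "\<And>G. G \<noteq> bot \<Longrightarrow> G \<le> F \<Longrightarrow> G = F"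
  shows "eventually P F \<or> eventually (\<lambda>x. \<not> P x) F"
proof (rule disjCI)
  assume *: "\<not> eventually (\<lambda>x. \<not> P x) F"
  have "inf F (principal {x. P x}) \<noteq> bot"
    using * by (simp add: trivial_limit_def eventually_inf_principal)
  then have "inf F (principal {x. P x}) = F" by (rule min) simp
  moreover have "eventually P (inf F (principal {x. P x}))"
    by (simp add: eventually_inf_principal)
  ultimately show "eventually P F" by simp
qed

text \<open>Zorn's lemma for the reversed order of filters, since a finer filter is a smaller one.
  Starting from the filter generated by all tails and P rules out principal filters and secures P at
  once.\<close>

lemma ex_nonprincipal_ultrafilter:
  assumes inf: "infinite {n. P n}"
  obtains \<UU> where "nonprincipal_ultrafilter \<UU>" and "eventually P \<UU>"
proof -
  define F0 where "F0 = inf sequentially (principal {n. P n})"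
  define A where "A = {F. F \<noteq> bot \<and> F \<le> F0}"
  let ?R = "\<lambda>F G :: nat filter. G \<le> F"
  have "frequently P sequentially"
    using inf by (simp add: INFM_nat_le infinite_nat_iff_unbounded_le frequently_sequentially)
  then have "F0 \<noteq> bot"
    by (simp add: F0_def trivial_limit_def eventually_inf_principal frequently_def)
  then have F0: "F0 \<in> A" by (simp add: A_def)
  have "\<exists>m\<in>A. \<forall>a\<in>A. ?R m a \<longrightarrow> a = m"
  proof (rule predicate_Zorn)
    show "partial_order_on A (relation_of ?R A)"
      by (rule partial_order_on_relation_ofI) auto
  next
    fix C assume C: "C \<in> Chains (relation_of ?R A)"
    show "\<exists>u\<in>A. \<forall>a\<in>C. ?R a u"
    proof (cases "C = {}")
      case False
      have sub: "C \<subseteq> A" and lin: "\<And>F G. F \<in> C \<Longrightarrow> G \<in> C \<Longrightarrow> F \<le> G \<or> G \<le> F"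
        using C by (auto simp: Chains_def relation_of_def)
      have "eventually Q (Inf C) \<longleftrightarrow> (\<exists>F\<in>C. eventually Q F)" for Q
        using False lin by (intro eventually_Inf_base) (metis inf.absorb1 inf.absorb2 order_refl)+
      \<comment> \<open>Eventual truth for the infimum of a chain is eventual truth for one of its
        members, so \<open>False\<close> is never eventually true.\<close>
      then have "Inf C \<noteq> bot"
        using sub by (auto simp: trivial_limit_def A_def)
      moreover have "Inf C \<le> F0"
      proof -
        obtain F where "F \<in> C" "F \<le> F0" using False sub by (auto simp: A_def)
        then show ?thesis by (rule Inf_lower2)
      qed
      ultimately show ?thesis by (auto simp: A_def intro!: bexI[of _ "Inf C"] Inf_lower)
    qed (use F0 in auto)
  qed
  then obtain \<UU> where U: "\<UU> \<in> A" and min: "\<And>G. G \<in> A \<Longrightarrow> G \<le> \<UU> \<Longrightarrow> G = \<UU>" by blast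
  have ult: "eventually Q \<UU> \<or> eventually (\<lambda>x. \<not> Q x) \<UU>" for Q
    using U by (intro minimal_filter_ultra min) (auto simp: A_def)
  have "\<UU> \<noteq> principal {k}" for k
  proof
    assume "\<UU> = principal {k}"
    moreover have "eventually (\<lambda>n. n > k) F0"
      unfolding F0_def eventually_inf_principal
      by (rule eventually_mono[OF eventually_gt_at_top[of k]]) simp
    ultimately show False
      using U by (auto simp: A_def le_filter_def eventually_principal)
  qed
  with ult U have "nonprincipal_ultrafilter \<UU>"
    by (auto simp: nonprincipal_ultrafilter_def A_def)
  moreover have "eventually P F0" by (simp add: F0_def eventually_inf_principal)
  then have "eventually P \<UU>" using U by (auto simp: A_def le_filter_def)
  ultimately show thesis by (rule that)
qed

section \<open>Loeb measures\<close>

context np_ultrafilter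
begin

abbreviation "cl \<equiv> ultraclass \<UU>"
abbreviation "us \<equiv> ultraset \<UU>"

lemma cl_mem_us: "cl g \<in> us A \<longleftrightarrow> (\<forall>\<^sub>F n in \<UU>. g n \<in> A n)"
proof
  assume "cl g \<in> us A"
  then obtain h where "cl g = cl h" and h: "\<forall>\<^sub>F n in \<UU>. h n \<in> A n"
    by (auto simp: ultraset_def)
  then have "\<forall>\<^sub>F n in \<UU>. g n = h n" by (simp add: ultraclass_eq_iff)
  with h show "\<forall>\<^sub>F n in \<UU>. g n \<in> A n" by eventually_elim simp
qed (auto simp: ultraset_def)

lemma us_cases:
  assumes "c \<in> us A"
  obtains g where "c = cl g" "\<forall>\<^sub>F n in \<UU>. g n \<in> A n"
  using assms by (auto simp: ultraset_def)

lemma us_range: "us A \<subseteq> range cl"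
  by (auto simp: ultraset_def)

lemma range_cl_eqI:
  assumes "X \<subseteq> range cl" "Y \<subseteq> range cl" "\<And>g. cl g \<in> X \<longleftrightarrow> cl g \<in> Y"
  shows "X = Y"
proof (rule Set.set_eqI)
  fix c
  show "c \<in> X \<longleftrightarrow> c \<in> Y"
  proof (cases "c \<in> range cl")
    case True then show ?thesis using assms(3) by (elim rangeE) simp
  next
    case False then show ?thesis using assms(1,2) by auto
  qed
qed

lemma us_subset_iff: "us A \<subseteq> us B \<longleftrightarrow> (\<forall>\<^sub>F n in \<UU>. A n \<subseteq> B n)"
proof
  assume *: "us A \<subseteq> us B"
  show "\<forall>\<^sub>F n in \<UU>. A n \<subseteq> B n"
  proof (rule ccontr)
    assume "\<not> ?thesis"
    then have ev: "\<forall>\<^sub>F n in \<UU>. \<not> A n \<subseteq> B n" by (simp add: ev_not_iff)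
    define g where "g n = (SOME x. x \<in> A n \<and> x \<notin> B n)" for n
    have "g n \<in> A n \<and> g n \<notin> B n" if "\<not> A n \<subseteq> B n" for n
      unfolding g_def by (rule someI_ex) (use that in blast)
    with ev have g: "\<forall>\<^sub>F n in \<UU>. g n \<in> A n \<and> g n \<notin> B n" by (rule eventually_mono)
    then have "cl g \<in> us A" by (auto simp: cl_mem_us elim: eventually_mono)
    with * have "\<forall>\<^sub>F n in \<UU>. g n \<in> B n" by (metis cl_mem_us subsetD)
    with g have "\<forall>\<^sub>F n in \<UU>. False" by eventually_elim simp
    then show False by (simp add: ev_const)
  qed
next
  assume *: "\<forall>\<^sub>F n in \<UU>. A n \<subseteq> B n"
  show "us A \<subseteq> us B"
  proof
    fix c assume "c \<in> us A"
    then obtain g where "c = cl g" and g: "\<forall>\<^sub>F n in \<UU>. g n \<in> A n" by (rule us_cases)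
    from * g have "\<forall>\<^sub>F n in \<UU>. g n \<in> B n" by eventually_elim blast
    then show "c \<in> us B" by (simp add: \<open>c = cl g\<close> cl_mem_us)
  qed
qed

lemma us_mono: "(\<And>n. A n \<subseteq> B n) \<Longrightarrow> us A \<subseteq> us B"
  by (simp add: us_subset_iff)

lemma us_eq_iff: "us A = us B \<longleftrightarrow> (\<forall>\<^sub>F n in \<UU>. A n = B n)"
  by (simp add: set_eq_subset us_subset_iff eventually_conj_iff)

lemma us_Int: "us (\<lambda>n. A n \<inter> B n) = us A \<inter> us B"
  by (rule range_cl_eqI[OF us_range le_infI1[OF us_range]]) (simp add: cl_mem_us eventually_conj_iff)

lemma us_Diff: "us (\<lambda>n. A n - B n) = us A - us B"
  by (rule range_cl_eqI[OF us_range order_trans[OF Diff_subset us_range]])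
    (simp add: cl_mem_us eventually_conj_iff ev_not_iff)

lemma us_Un: "us (\<lambda>n. A n \<union> B n) = us A \<union> us B"
  by (rule range_cl_eqI[OF us_range Un_least[OF us_range us_range]]) (simp add: cl_mem_us ev_disj_iff)

lemma us_empty [simp]: "us (\<lambda>n. {}) = {}"
  by (rule range_cl_eqI[OF us_range empty_subsetI]) (simp add: cl_mem_us ev_const)

lemma us_UN: "finite I \<Longrightarrow> us (\<lambda>n. \<Union>i\<in>I. A i n) = (\<Union>i\<in>I. us (A i))"
  by (induction I rule: finite_induct) (simp_all add: us_Un)

lemma us_INT: "us (\<lambda>n. \<Inter>i\<in>{..(k::nat)}. A i n) = (\<Inter>i\<in>{..k}. us (A i))"
  by (induction k) (simp_all add: atMost_Suc us_Int)

lemma us_eq_empty_iff: "us A = {} \<longleftrightarrow> (\<forall>\<^sub>F n in \<UU>. A n = {})"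
  using us_eq_iff[of A "\<lambda>_. {}"] by simp

text \<open>At index n an element is chosen in the intersection of the first sets up to
  \<open>\<kappa> n\<close>, where \<open>\<kappa>\<close> exceeds every bound almost everywhere; so
  a single class lies in all the sets. The countable additivity of Loeb measures rests on
  this.\<close>

lemma saturated:
  fixes A :: "nat \<Rightarrow> nat \<Rightarrow> 'b set"
  assumes ne: "\<And>k. (\<Inter>j\<le>k. us (A j)) \<noteq> {}"
  shows "(\<Inter>k. us (A k)) \<noteq> {}"
proof -
  have "\<forall>\<^sub>F n in \<UU>. (\<Inter>j\<in>{..k}. A j n) \<noteq> {}" for k
    using ne[of k] by (simp add: us_INT[symmetric] us_eq_empty_iff ev_not_iff)
  from diagonal[where P = "\<lambda>k n. (\<Inter>j\<in>{..k}. A j n) \<noteq> {}", OF this]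
  obtain \<kappa> where \<kappa>: "\<And>K. eventually (\<lambda>n. K \<le> \<kappa> n) \<UU>"
    and ev: "eventually (\<lambda>n. \<forall>k\<le>\<kappa> n. (\<Inter>j\<in>{..k}. A j n) \<noteq> {}) \<UU>"
    by blast
  define g where "g n = (SOME x. x \<in> (\<Inter>j\<in>{..\<kappa> n}. A j n))" for n
  have g: "\<forall>\<^sub>F n in \<UU>. g n \<in> (\<Inter>j\<in>{..\<kappa> n}. A j n)"
    using ev
  proof eventually_elim
    case (elim n)
    then show ?case unfolding g_def by (metis some_in_eq order_refl)
  qed
  have "cl g \<in> us (A k)" for k
    unfolding cl_mem_us using g \<kappa>[of k] by eventually_elim auto
  then show ?thesis by blast
qed

end

text \<open>Used twice: for arrows, with \<open>B L\<close> the words of length at most L, and for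
  units, with \<open>B\<close> constant in L. The uniform bound \<open>B_fin\<close> keeps the
  limits of measures of bounded sequences finite, although the whole space may have infinite
  measure.\<close>

locale loeb_space = np_ultrafilter \<UU> for \<UU> +
  fixes M :: "nat \<Rightarrow> 'a measure" and B :: "nat \<Rightarrow> nat \<Rightarrow> 'a set"
  assumes B_sets: "B L n \<in> sets (M n)"
    and B_mono: "L \<le> L' \<Longrightarrow> B L n \<subseteq> B L' n"
    and B_ne: "B 0 n \<noteq> {}"
    and B_fin: "\<exists>C::real. \<forall>n. emeasure (M n) (B L n) \<le> ennreal C"
begin

definition "internal = {E. (\<forall>n. E n \<in> sets (M n)) \<and> (\<exists>L. \<forall>n. E n \<subseteq> B L n)}"
definition "\<Omega> = {cl g | g. \<exists>L. \<forall>n. g n \<in> B L n}"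
definition "loeb = loeb_measure \<UU> \<Omega> internal M"
definition "vol E = Lim \<UU> (\<lambda>n. emeasure (M n) (E n))"

lemma internal_sets: "E \<in> internal \<Longrightarrow> E n \<in> sets (M n)"
  by (auto simp: internal_def)

lemma internal_bound: "E \<in> internal \<Longrightarrow> \<exists>L. \<forall>n. E n \<subseteq> B L n"
  by (auto simp: internal_def)

lemma internal_sub:
  assumes "F \<in> internal" "\<And>n. E n \<in> sets (M n)" "\<And>n. E n \<subseteq> F n"
  shows "E \<in> internal"
proof -
  obtain L where "\<And>n. F n \<subseteq> B L n" using internal_bound[OF assms(1)] by blast
  then have "\<And>n. E n \<subseteq> B L n" using assms(3) by (meson order_trans)
  with assms(2) show ?thesis by (auto simp: internal_def)
qed

lemma internal_B: "B L \<in> internal"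
  unfolding internal_def using B_sets by blast

lemma internal_empty: "(\<lambda>n. {}) \<in> internal"
  by (auto simp: internal_def)

lemma internal_Diff: "E \<in> internal \<Longrightarrow> F \<in> internal \<Longrightarrow> (\<lambda>n. E n - F n) \<in> internal"
  by (rule internal_sub[of E]) (auto simp: internal_sets)

lemma internal_Int: "E \<in> internal \<Longrightarrow> F \<in> internal \<Longrightarrow> (\<lambda>n. E n \<inter> F n) \<in> internal"
  by (rule internal_sub[of E]) (auto simp: internal_sets)

lemma internal_Un:
  assumes "E \<in> internal" "F \<in> internal" shows "(\<lambda>n. E n \<union> F n) \<in> internal"
proof -
  obtain L L' where "\<forall>n. E n \<subseteq> B L n" "\<forall>n. F n \<subseteq> B L' n"
    using assms internal_bound by metis
  then have "E n \<union> F n \<subseteq> B (max L L') n" for n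
    using B_mono[of L "max L L'" n] B_mono[of L' "max L L'" n] by (meson Un_least max.cobounded1 max.cobounded2 order_trans)
  moreover have "\<And>n. E n \<union> F n \<in> sets (M n)" using assms by (intro sets.Un internal_sets)
  ultimately show ?thesis unfolding internal_def by blast
qed

lemma internal_UN: "finite I \<Longrightarrow> (\<And>i. i \<in> I \<Longrightarrow> E i \<in> internal) \<Longrightarrow> (\<lambda>n. \<Union>i\<in>I. E i n) \<in> internal"
proof (induction I rule: finite_induct)
  case empty
  then show ?case by (simp add: internal_empty)
next
  case (insert i I)
  then have "(\<lambda>n. E i n \<union> (\<Union>i\<in>I. E i n)) \<in> internal" by (intro internal_Un) auto
  then show ?case by simp
qed

lemma cl_mem_\<Omega>: "cl g \<in> \<Omega> \<longleftrightarrow> (\<exists>L. \<forall>\<^sub>F n in \<UU>. g n \<in> B L n)"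
proof
  assume "cl g \<in> \<Omega>"
  then obtain h L where "cl g = cl h" and h: "\<forall>n. h n \<in> B L n" by (auto simp: \<Omega>_def)
  then have "\<forall>\<^sub>F n in \<UU>. g n = h n" by (simp add: ultraclass_eq_iff)
  then have "\<forall>\<^sub>F n in \<UU>. g n \<in> B L n" by eventually_elim (simp add: h)
  then show "\<exists>L. \<forall>\<^sub>F n in \<UU>. g n \<in> B L n" ..
next
  assume "\<exists>L. \<forall>\<^sub>F n in \<UU>. g n \<in> B L n"
  then obtain L where L: "\<forall>\<^sub>F n in \<UU>. g n \<in> B L n" ..
  \<comment> \<open>The representative is changed at negligibly many indices, with a point of
    \<open>B 0 n\<close> as default value, so that it becomes bounded at every index.\<close>
  define h where "h n = (if g n \<in> B L n then g n else (SOME x. x \<in> B 0 n))" for n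
  have "(SOME x. x \<in> B 0 n) \<in> B L n" for n
    using B_mono[of 0 L n] some_in_eq[of "B 0 n"] B_ne[of n] by blast
  then have "h n \<in> B L n" for n by (simp add: h_def)
  moreover have "cl g = cl h"
    unfolding ultraclass_eq_iff using L by eventually_elim (simp add: h_def)
  ultimately show "cl g \<in> \<Omega>" by (auto simp: \<Omega>_def)
qed

lemma \<Omega>_cases:
  assumes "c \<in> \<Omega>" obtains g L where "c = cl g" "\<And>n. g n \<in> B L n"
  using assms by (auto simp: \<Omega>_def)

lemma \<Omega>_eq: "\<Omega> = (\<Union>L. us (B L))"
proof (intro Set.set_eqI iffI)
  fix c assume "c \<in> \<Omega>"
  then obtain g L where "c = cl g" "\<And>n. g n \<in> B L n" by (auto simp: \<Omega>_def)
  then have "c \<in> us (B L)" by (simp add: cl_mem_us)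
  then show "c \<in> (\<Union>L. us (B L))" by blast
next
  fix c assume "c \<in> (\<Union>L. us (B L))"
  then obtain L where "c \<in> us (B L)" by blast
  then obtain g where "c = cl g" "\<forall>\<^sub>F n in \<UU>. g n \<in> B L n" by (rule us_cases)
  then show "c \<in> \<Omega>" unfolding cl_mem_\<Omega> by (auto simp only: cl_mem_\<Omega>)
qed

lemma us_B_mono: "L \<le> L' \<Longrightarrow> us (B L) \<subseteq> us (B L')"
  by (intro us_mono B_mono)

lemma us_internal: "E \<in> internal \<Longrightarrow> \<exists>L. us E \<subseteq> us (B L)"
  by (metis internal_bound us_mono)

lemma us_internal_\<Omega>: "E \<in> internal \<Longrightarrow> us E \<subseteq> \<Omega>"
  using us_internal \<Omega>_eq by fastforce

lemma vol_internal_fin: assumes "E \<in> internal" shows "vol E \<noteq> \<infinity>"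
proof -
  obtain L where L: "\<And>n. E n \<subseteq> B L n" using internal_bound[OF assms] by blast
  obtain C where C: "\<And>n. emeasure (M n) (B L n) \<le> ennreal C" using B_fin by blast
  have "emeasure (M n) (E n) \<le> ennreal C" for n
    by (rule order_trans[OF emeasure_mono[OF L B_sets] C])
  then have "vol E \<le> ennreal C" unfolding vol_def by (intro Lim_le always_eventually allI)
  from le_less_trans[OF this ennreal_less_top] show ?thesis by (simp add: less_top)
qed

lemma vol_cong: "us E = us F \<Longrightarrow> vol E = vol F"
  unfolding vol_def us_eq_iff by (rule Lim_cong) (auto elim: eventually_mono)

lemma vol_Un:
  assumes "E \<in> internal" "F \<in> internal" "us E \<inter> us F = {}"
  shows "vol (\<lambda>n. E n \<union> F n) = vol E + vol F"
proof -
  have "\<forall>\<^sub>F n in \<UU>. E n \<inter> F n = {}"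
    using assms(3) us_eq_empty_iff by (metis us_Int)
  then have "vol (\<lambda>n. E n \<union> F n) = Lim \<UU> (\<lambda>n. emeasure (M n) (E n) + emeasure (M n) (F n))"
    unfolding vol_def
    by (intro Lim_cong) (auto elim!: eventually_mono simp: plus_emeasure assms internal_sets)
  then show ?thesis by (simp add: Lim_add vol_def)
qed

section \<open>Existence of the Loeb measure\<close>

lemma ring_us: "ring_of_sets \<Omega> (us ` internal)"
proof (rule ring_of_setsI)
  show "us ` internal \<subseteq> Pow \<Omega>" using us_internal_\<Omega> by blast
  show "{} \<in> us ` internal" using internal_empty us_empty by (metis image_eqI)
  fix a b assume "a \<in> us ` internal" "b \<in> us ` internal"
  then obtain E F where "E \<in> internal" "F \<in> internal" "a = us E" "b = us F" by blast
  then show "a \<union> b \<in> us ` internal" "a - b \<in> us ` internal"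
    using internal_Un[of E F] internal_Diff[of E F] by (simp_all only: us_Un[symmetric] us_Diff[symmetric] imageI)
qed

text \<open>Caratheodory's condition of continuity at the empty set holds trivially: by saturation a
  decreasing sequence of internal sets with empty intersection reaches the empty set after finitely
  many steps.\<close>

lemma pre_loeb_exists:
  "\<exists>\<mu>. (\<forall>E\<in>internal. \<mu> (us E) = vol E) \<and> measure_space \<Omega> (sigma_sets \<Omega> (us ` internal)) \<mu>"
proof -
  interpret ring_of_sets \<Omega> "us ` internal" by (rule ring_us)
  \<comment> \<open>The volume must be a function of sets rather than of the sequences that
    represent them; \<open>vol_cong\<close> shows that every representative gives the same
    value.\<close>
  define f where "f A = vol (SOME E. E \<in> internal \<and> us E = A)" for A
  have f: "f (us E) = vol E" if "E \<in> internal" for E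
    unfolding f_def
  proof (rule someI2[where Q = "\<lambda>F. vol F = vol E"])
    show "E \<in> internal \<and> us E = us E" using that by simp
    show "vol F = vol E" if "F \<in> internal \<and> us F = us E" for F using that by (intro vol_cong) simp
  qed
  have "\<exists>\<mu>. (\<forall>s \<in> us ` internal. \<mu> s = f s) \<and> measure_space \<Omega> (sigma_sets \<Omega> (us ` internal)) \<mu>"
  proof (rule caratheodory_empty_continuous)
    have "f {} = vol (\<lambda>n. {})" using f[OF internal_empty] by simp
    then show "positive (us ` internal) f" by (simp add: positive_def vol_def LimI[OF tendsto_const])
    show "additive (us ` internal) f"
      unfolding additive_def
    proof (intro ballI impI, elim imageE)
      fix A B E F assume EF: "A \<inter> B = {}" "A = us E" "E \<in> internal" "B = us F" "F \<in> internal"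
      have "f (us E \<union> us F) = vol (\<lambda>n. E n \<union> F n)"
        by (simp only: f[OF internal_Un[OF EF(3,5)]] us_Un[symmetric])
      then show "f (A \<union> B) = f A + f B" using EF by (simp only: vol_Un f)
    qed
    show "f A \<noteq> \<infinity>" if "A \<in> us ` internal" for A
      using that f vol_internal_fin by auto
    fix A :: "nat \<Rightarrow> (nat \<Rightarrow> 'a) set set"
    assume A: "range A \<subseteq> us ` internal" "decseq A" "(\<Inter>i. A i) = {}"
    then have "\<forall>i. \<exists>E. E \<in> internal \<and> A i = us E" by blast
    then obtain E where E: "\<And>i. E i \<in> internal" "\<And>i. A i = us (E i)" by metis
    have "\<exists>k. A k = {}"
    proof (rule ccontr)
      assume ne: "\<not> ?thesis"
      have "(\<Inter>j\<le>k. us (E j)) \<noteq> {}" for k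
        using ne A(2) E(2) unfolding decseq_def
        by (metis INT_greatest atMost_iff subset_empty)
      then have "(\<Inter>k. us (E k)) \<noteq> {}" by (rule saturated)
      with A(3) E(2) show False by simp
    qed
    then obtain k where "A k = {}" ..
    then have "\<forall>i\<ge>k. A i = {}" using A(2) unfolding decseq_def by blast
    moreover have "f {} = 0"
      using \<open>f {} = vol (\<lambda>n. {})\<close> by (simp add: vol_def LimI[OF tendsto_const])
    ultimately have "\<forall>\<^sub>F i in sequentially. f (A i) = 0"
      by (intro eventually_sequentiallyI[of k]) simp
    then show "(\<lambda>i. f (A i)) \<longlonglongrightarrow> 0" by (rule tendsto_eventually)
  qed
  with f show ?thesis by (metis imageI)
qed

definition "pre_loeb = extend_measure \<Omega> internal us (\<lambda>A. Lim \<UU> (\<lambda>n. emeasure (M n) (A n)))"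

lemma loeb_eq: "loeb = completion pre_loeb"
  by (simp add: loeb_def loeb_measure_def pre_loeb_def)

lemma us_sub_Pow: "us ` internal \<subseteq> Pow \<Omega>"
  using us_internal_\<Omega> by blast

lemma sets_pre_loeb: "sets pre_loeb = sigma_sets \<Omega> (us ` internal)"
  unfolding pre_loeb_def by (rule sets_extend_measure) (rule us_sub_Pow)

lemma space_pre_loeb: "space pre_loeb = \<Omega>"
  unfolding pre_loeb_def by (rule space_extend_measure) (rule us_sub_Pow)

text \<open>\<open>extend_measure\<close> has the prescribed values only if some measure extends
  them, hence the detour through existence.\<close>

lemma emeasure_pre_loeb: assumes "E \<in> internal" shows "emeasure pre_loeb (us E) = vol E"
proof -
  obtain \<mu> where \<mu>: "\<And>E. E \<in> internal \<Longrightarrow> \<mu> (us E) = vol E"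
    "measure_space \<Omega> (sigma_sets \<Omega> (us ` internal)) \<mu>"
    using pre_loeb_exists by blast
  have "emeasure pre_loeb (us E) = Lim \<UU> (\<lambda>n. emeasure (M n) (E n))"
    unfolding pre_loeb_def
    by (rule emeasure_extend_measure[OF refl, where \<mu>' = \<mu>])
      (use \<mu> us_sub_Pow assms in \<open>auto simp: vol_def measure_space_def sets_extend_measure\<close>)
  then show ?thesis by (simp add: vol_def)
qed

lemma space_loeb: "space loeb = \<Omega>"
  by (simp add: loeb_eq space_pre_loeb)

lemma us_pre_sets: "E \<in> internal \<Longrightarrow> us E \<in> sets pre_loeb"
  by (simp add: sets_pre_loeb sigma_sets.Basic)

lemma us_sets: "E \<in> internal \<Longrightarrow> us E \<in> sets loeb"
  by (simp add: loeb_eq us_pre_sets sets_completionI_sets)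

lemma emeasure_us: "E \<in> internal \<Longrightarrow> emeasure loeb (us E) = vol E"
  by (simp add: loeb_eq emeasure_pre_loeb us_pre_sets sets_completionI_sets)

lemma emeasure_us_fin: "E \<in> internal \<Longrightarrow> emeasure loeb (us E) \<noteq> \<infinity>"
  using vol_internal_fin[of E] by (simp add: emeasure_us)

lemma us_B_sets: "us (B L) \<in> sets loeb" by (simp add: us_sets internal_B)

section \<open>Approximation of Loeb measurable sets by internal sets\<close>

lemma complete_loeb: "N \<in> null_sets loeb \<Longrightarrow> A \<subseteq> N \<Longrightarrow> A \<in> null_sets loeb"
  unfolding loeb_eq using null_sets_completion_subset by blast

text \<open>A countable union of internal sets is rarely internal. Taking at index n those up to
  \<open>\<kappa> n\<close>, where \<open>\<kappa>\<close> grows so slowly that their measure at n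
  hardly exceeds its limit \<open>c (\<kappa> n)\<close>, gives an internal set that contains them
  all and has no larger measure.\<close>

lemma internal_hull:
  fixes G :: "nat \<Rightarrow> nat \<Rightarrow> 'a set"
  assumes G: "\<And>k. G k \<in> internal" and GL: "\<And>k. us (G k) \<subseteq> us (B L)"
  shows "\<exists>F\<in>internal. (\<forall>k. us (G k) \<subseteq> us F) \<and> us F \<subseteq> us (B L) \<and>
    us F - (\<Union>k. us (G k)) \<in> null_sets loeb"
proof -
  \<comment> \<open>That \<open>us (G k)\<close> lies in \<open>us (B L)\<close> gives the inclusion
    of sequences only almost everywhere; the intersection with \<open>B L n\<close> enforces it at
    every index.\<close>
  define H :: "nat \<Rightarrow> nat \<Rightarrow> 'a set" where "H k n = (\<Union>j\<le>k. G j n) \<inter> B L n" for k n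
  define c where "c k = vol (H k)" for k
  have H: "H k \<in> internal" for k
    unfolding H_def by (intro internal_Int internal_UN internal_B G) auto
  have usH: "us (H k) = (\<Union>j\<le>k. us (G j))" for k
    unfolding H_def using us_UN[of "{..k}" G] GL by (auto simp: us_Int)
  have cfin: "c k \<noteq> \<infinity>" for k unfolding c_def by (rule vol_internal_fin[OF H])
  have "\<forall>\<^sub>F n in \<UU>. emeasure (M n) (H k n) < c k + ennreal (1 / Suc k)" for k
  proof (rule order_tendstoD(2))
    show "((\<lambda>n. emeasure (M n) (H k n)) \<longlongrightarrow> c k) \<UU>" unfolding c_def vol_def by (rule has_Lim)
    show "c k < c k + ennreal (1 / Suc k)" using cfin[of k]
      by (simp add: ennreal_add_left_cancel_less[of _ 0, simplified] top.not_eq_extremum)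
  qed
  from diagonal[where P = "\<lambda>k n. emeasure (M n) (H k n) < c k + ennreal (1 / Suc k)", OF this]
  obtain \<kappa> where \<kappa>: "\<And>K. eventually (\<lambda>n. K \<le> \<kappa> n) \<UU>"
    and ev: "eventually (\<lambda>n. \<forall>k\<le>\<kappa> n. emeasure (M n) (H k n) < c k + ennreal (1 / Suc k)) \<UU>"
    by blast
  define F where "F n = H (\<kappa> n) n" for n
  have F: "F \<in> internal"
    by (rule internal_sub[OF internal_B[of L]]) (auto simp: F_def internal_sets H, auto simp: H_def)
  have FL: "us F \<subseteq> us (B L)" by (rule us_mono) (auto simp: F_def H_def)
  have HF: "us (H k) \<subseteq> us F" for k
    unfolding us_subset_iff using \<kappa>[of k]
  proof eventually_elim
    case (elim n)
    then show ?case unfolding F_def H_def by (intro Int_mono UN_mono) auto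
  qed
  let ?U = "\<Union>k. us (H k)"
  have cU: "c k \<le> emeasure loeb ?U" for k
    unfolding c_def emeasure_us[OF H, symmetric]
    using us_sets[OF H] by (intro emeasure_mono UN_upper UNIV_I sets.countable_UN) auto
  \<comment> \<open>Almost every index has \<open>\<kappa> n \<ge> K\<close>, so that the excess
    over \<open>c (\<kappa> n)\<close> is below \<open>1 / Suc K\<close>; and every value of c is at
    most the measure of the union.\<close>
  have "vol F \<le> emeasure loeb ?U"
  proof (rule ennreal_le_epsilon)
    fix e :: real assume "e > 0"
    then obtain K where K: "1 / Suc K < e" using nat_approx_posE by blast
    show "vol F \<le> emeasure loeb ?U + ennreal e"
      unfolding vol_def
    proof (rule Lim_le)
      show "\<forall>\<^sub>F n in \<UU>. emeasure (M n) (F n) \<le> emeasure loeb ?U + ennreal e"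
        using ev \<kappa>[of K]
      proof eventually_elim
        case (elim n)
        have "1 / Suc (\<kappa> n) \<le> 1 / Suc K" using elim by (simp add: frac_le)
        then have "ennreal (1 / Suc (\<kappa> n)) \<le> ennreal e" using K by (intro ennreal_leI) simp
        moreover have "emeasure (M n) (F n) \<le> c (\<kappa> n) + ennreal (1 / Suc (\<kappa> n))"
          using elim by (auto simp: F_def less_imp_le)
        ultimately show ?case using cU[of "\<kappa> n"] by (meson add_mono order_trans)
      qed
    qed
  qed
  moreover have "emeasure loeb (us F) = emeasure loeb ?U + emeasure loeb (us F - ?U)"
    using HF F H us_sets by (subst plus_emeasure) (auto intro!: arg_cong[where f = "emeasure loeb"])
  moreover have "emeasure loeb ?U \<noteq> \<infinity>"
    using emeasure_us_fin[OF F] HF emeasure_mono[of ?U "us F" loeb] us_sets[OF F]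
    by (metis UN_least infinity_ennreal_def neq_top_trans)
  ultimately have "emeasure loeb (us F - ?U) = 0"
    using emeasure_us[OF F] ennreal_add_left_cancel_le[of "emeasure loeb ?U" "emeasure loeb (us F - ?U)" 0]
    by simp
  moreover have "?U = (\<Union>k. us (G k))" unfolding usH by auto
  ultimately have "us F - (\<Union>k. us (G k)) \<in> null_sets loeb"
    using us_sets F G by (auto simp: null_sets_def)
  moreover have "us (G k) \<subseteq> us F" for k using HF[of k] unfolding usH by auto
  ultimately show ?thesis using F FL by (intro bexI[of _ F] conjI allI)
qed

text \<open>Stated ball by ball because the whole space may have infinite measure. Asking for inner
  and outer sets together makes the property stable under complements, which interchange the
  two.\<close>

definition sandwiched :: "(nat \<Rightarrow> 'a) set set \<Rightarrow> bool" where
  "sandwiched A \<longleftrightarrow> (\<forall>L. \<forall>e>0. \<exists>E\<in>internal. \<exists>F\<in>internal.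
     us E \<subseteq> A \<inter> us (B L) \<and> A \<inter> us (B L) \<subseteq> us F \<and> us F \<subseteq> us (B L) \<and>
     emeasure loeb (us F - us E) \<le> ennreal e)"

lemma sandwichedD:
  assumes "sandwiched A" "e > 0"
  obtains E F where "E \<in> internal" "F \<in> internal" "us E \<subseteq> A" "us E \<subseteq> us (B L)"
    "A \<inter> us (B L) \<subseteq> us F" "us F \<subseteq> us (B L)" "emeasure loeb (us F - us E) \<le> ennreal e"
  using assms unfolding sandwiched_def by (metis le_inf_iff)

lemma sandwiched_us: assumes "G \<in> internal" shows "sandwiched (us G)"
  unfolding sandwiched_def
proof (intro allI impI)
  fix L and e :: real
  have G: "(\<lambda>n. G n \<inter> B L n) \<in> internal" by (intro internal_Int internal_B assms)
  show "\<exists>E\<in>internal. \<exists>F\<in>internal. us E \<subseteq> us G \<inter> us (B L) \<and> us G \<inter> us (B L) \<subseteq> us F \<and>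
     us F \<subseteq> us (B L) \<and> emeasure loeb (us F - us E) \<le> ennreal e"
    by (rule bexI[OF _ G], rule bexI[OF _ G]) (simp add: us_Int)
qed

lemma sandwiched_Compl: assumes "sandwiched A" shows "sandwiched (\<Omega> - A)"
  unfolding sandwiched_def
proof (intro allI impI)
  fix L and e :: real assume "e > 0"
  obtain E F where EF: "E \<in> internal" "F \<in> internal" "us E \<subseteq> A" "us E \<subseteq> us (B L)"
    "A \<inter> us (B L) \<subseteq> us F" "us F \<subseteq> us (B L)" "emeasure loeb (us F - us E) \<le> ennreal e"
    using sandwichedD[OF assms \<open>e > 0\<close>] by blast
  have O: "us (B L) \<subseteq> \<Omega>" using us_internal_\<Omega>[OF internal_B] .
  show "\<exists>E\<in>internal. \<exists>F\<in>internal. us E \<subseteq> (\<Omega> - A) \<inter> us (B L) \<and> (\<Omega> - A) \<inter> us (B L) \<subseteq> us F \<and>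
     us F \<subseteq> us (B L) \<and> emeasure loeb (us F - us E) \<le> ennreal e"
  proof (intro bexI conjI)
    show "us (\<lambda>n. B L n - F n) \<subseteq> (\<Omega> - A) \<inter> us (B L)"
      using O EF unfolding us_Diff by blast
    show "(\<Omega> - A) \<inter> us (B L) \<subseteq> us (\<lambda>n. B L n - E n)"
      using O EF unfolding us_Diff by blast
    show "us (\<lambda>n. B L n - E n) \<subseteq> us (B L)" by (rule us_mono) blast
    have "us (\<lambda>n. B L n - E n) - us (\<lambda>n. B L n - F n) \<subseteq> us F - us E"
      unfolding us_Diff by blast
    then show "emeasure loeb (us (\<lambda>n. B L n - E n) - us (\<lambda>n. B L n - F n)) \<le> ennreal e"
      using EF us_sets by (intro order_trans[OF emeasure_mono EF(7)]) auto
  qed (intro internal_Diff internal_B EF)+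
qed

lemma sum_half_powers: "(\<Sum>k. ennreal (e / 2 ^ Suc k)) = ennreal e" if "e > 0" for e :: real
proof -
  have "(\<lambda>k. e * (1 / 2) ^ Suc k) sums (e * 1)"
    using power_half_series by (rule sums_mult)
  moreover have "e * (1 / 2) ^ Suc k = e / 2 ^ Suc k" for k by (simp add: power_divide)
  ultimately have "(\<lambda>k. e / 2 ^ Suc k) sums e" by (simp add: mult.commute)
  then show ?thesis using that by (intro suminf_ennreal_eq) auto
qed

text \<open>The outer sets are joined by \<open>internal_hull\<close>, at the expense of a null set.
  Inner sets can be joined only finitely often; continuity from above, inside the hull of finite
  measure, shows that finitely many suffice.\<close>

lemma sandwiched_UN:
  fixes A :: "nat \<Rightarrow> _"
  assumes A: "\<And>k. sandwiched (A k)"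
  shows "sandwiched (\<Union>k. A k)"
  unfolding sandwiched_def
proof (intro allI impI)
  fix L and e :: real assume "e > 0"
  \<comment> \<open>The errors of the single sets add up to \<open>e / 2\<close>; the other half is
    left for the truncation to finitely many inner sets.\<close>
  define d where "d k = (e / 2) / 2 ^ Suc k" for k :: nat
  have "\<exists>E F. E \<in> internal \<and> F \<in> internal \<and> us E \<subseteq> A k \<and> us E \<subseteq> us (B L) \<and>
    A k \<inter> us (B L) \<subseteq> us F \<and> us F \<subseteq> us (B L) \<and> emeasure loeb (us F - us E) \<le> ennreal (d k)" for k
  proof -
    have "d k > 0" using \<open>e > 0\<close> by (simp add: d_def)
    from sandwichedD[OF A[of k] this] show ?thesis by metis
  qed
  then obtain E F where EF: "\<And>k. E k \<in> internal" "\<And>k. F k \<in> internal" "\<And>k. us (E k) \<subseteq> A k"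
    "\<And>k. us (E k) \<subseteq> us (B L)" "\<And>k. A k \<inter> us (B L) \<subseteq> us (F k)" "\<And>k. us (F k) \<subseteq> us (B L)"
    "\<And>k. emeasure loeb (us (F k) - us (E k)) \<le> ennreal (d k)"
    by metis
  obtain G where G: "G \<in> internal" "\<And>k. us (F k) \<subseteq> us G" "us G \<subseteq> us (B L)"
    "us G - (\<Union>k. us (F k)) \<in> null_sets loeb"
    using internal_hull[of F L, OF EF(2,6)] by blast
  note [measurable] = us_sets[OF G(1)] us_sets[OF EF(1)] us_sets[OF EF(2)]
  let ?D = "\<lambda>K. us G - (\<Union>k\<le>K. us (E k))"
  have "emeasure loeb (us G - (\<Union>k. us (E k))) \<le>
      emeasure loeb ((us G - (\<Union>k. us (F k))) \<union> (\<Union>k. us (F k) - us (E k)))"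
    by (rule emeasure_mono) auto
  also have "\<dots> \<le> emeasure loeb (us G - (\<Union>k. us (F k))) + emeasure loeb (\<Union>k. us (F k) - us (E k))"
    by (rule emeasure_subadditive) auto
  also have "emeasure loeb (us G - (\<Union>k. us (F k))) = 0" using G(4) by auto
  also have "emeasure loeb (\<Union>k. us (F k) - us (E k)) \<le> (\<Sum>k. emeasure loeb (us (F k) - us (E k)))"
    by (rule emeasure_subadditive_countably) auto
  also have "\<dots> \<le> (\<Sum>k. ennreal (d k))" by (intro suminf_le EF(7)) auto
  also have "\<dots> = ennreal (e / 2)" unfolding d_def using \<open>e > 0\<close> by (intro sum_half_powers) simp
  finally have le: "emeasure loeb (us G - (\<Union>k. us (E k))) \<le> ennreal (e / 2)" by simp
  have lim: "(\<lambda>K. emeasure loeb (?D K)) \<longlonglongrightarrow> emeasure loeb (\<Inter>K. ?D K)"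
  proof (rule Lim_emeasure_decseq)
    show "emeasure loeb (?D i) \<noteq> \<infinity>" for i
      using emeasure_us_fin[OF G(1)] emeasure_mono[of "?D i" "us G" loeb] us_sets[OF G(1)]
      by (metis Diff_subset infinity_ennreal_def neq_top_trans)
  qed (auto simp: decseq_def)
  have Int: "(\<Inter>K. ?D K) = us G - (\<Union>k. us (E k))" by auto
  have "emeasure loeb (\<Inter>K. ?D K) < ennreal e"
    unfolding Int using \<open>e > 0\<close> by (intro le_less_trans[OF le]) (simp add: ennreal_less_iff)
  from order_tendstoD(2)[OF lim this] obtain K where K: "emeasure loeb (?D K) < ennreal e"
    by (auto simp: eventually_sequentially)
  have usE: "us (\<lambda>n. \<Union>k\<in>{..K}. E k n) = (\<Union>k\<le>K. us (E k))" by (rule us_UN) simp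
  show "\<exists>E\<in>internal. \<exists>F\<in>internal. us E \<subseteq> (\<Union>k. A k) \<inter> us (B L) \<and> (\<Union>k. A k) \<inter> us (B L) \<subseteq> us F \<and>
     us F \<subseteq> us (B L) \<and> emeasure loeb (us F - us E) \<le> ennreal e"
  proof (intro bexI conjI)
    show "us (\<lambda>n. \<Union>k\<in>{..K}. E k n) \<subseteq> (\<Union>k. A k) \<inter> us (B L)"
      unfolding usE using EF(3,4) by blast
    show "(\<Union>k. A k) \<inter> us (B L) \<subseteq> us G" using EF(5) G(2) by blast
    show "emeasure loeb (us G - us (\<lambda>n. \<Union>k\<in>{..K}. E k n)) \<le> ennreal e"
      unfolding usE using K by simp
  qed (use G EF in \<open>auto intro!: internal_UN\<close>)
qed

lemma sandwiched_pre_loeb: assumes "A \<in> sets pre_loeb" shows "sandwiched A"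
  using assms unfolding sets_pre_loeb
proof (induction rule: sigma_sets.induct)
  case (Basic a)
  then show ?case using sandwiched_us by auto
next
  case Empty
  then show ?case using sandwiched_us[OF internal_empty] by simp
next
  case (Compl a)
  then show ?case using sandwiched_Compl by simp
next
  case (Union a)
  then show ?case using sandwiched_UN[of a] by simp
qed

lemma null_cover:
  assumes N: "N \<in> null_sets loeb" and "e > 0"
  obtains F where "F \<in> internal" "N \<inter> us (B L) \<subseteq> us F" "us F \<subseteq> us (B L)" "vol F \<le> ennreal e"
proof -
  from N obtain N' where N': "N' \<in> null_sets pre_loeb" "N \<subseteq> N'"
    unfolding loeb_eq null_sets_completion_iff2 by blast
  then have "sandwiched N'" by (intro sandwiched_pre_loeb) auto
  then obtain E F where EF: "E \<in> internal" "F \<in> internal" "us E \<subseteq> N'" "us E \<subseteq> us (B L)"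
    "N' \<inter> us (B L) \<subseteq> us F" "us F \<subseteq> us (B L)" "emeasure loeb (us F - us E) \<le> ennreal e"
    using \<open>e > 0\<close> by (rule sandwichedD)
  have "us E \<in> null_sets loeb"
    by (rule complete_loeb[OF _ EF(3)]) (use N' loeb_eq null_sets_completionI in auto)
  then have "emeasure loeb (us F - us E) = emeasure loeb (us F)"
    using us_sets[OF EF(2)] by (rule emeasure_Diff_null_set)
  then have "vol F \<le> ennreal e" using EF(2,7) emeasure_us by simp
  then show thesis using EF N'(2) by (intro that[of F]) auto
qed

text \<open>The set is not assumed measurable: inside each ball it is contained in a countable
  intersection of internal sets of vanishing volume, and completeness does the rest.\<close>

lemma null_criterion:
  assumes "N \<subseteq> \<Omega>"
    and cov: "\<And>L e. e > 0 \<Longrightarrow> \<exists>F\<in>internal. N \<inter> us (B L) \<subseteq> us F \<and> vol F \<le> ennreal e"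
  shows "N \<in> null_sets loeb"
proof -
  have "N \<inter> us (B L) \<in> null_sets loeb" for L
  proof -
    have "\<exists>F\<in>internal. N \<inter> us (B L) \<subseteq> us F \<and> vol F \<le> ennreal (1 / Suc k)" for k
      by (rule cov) simp
    then obtain F where F: "\<And>k. F k \<in> internal" "\<And>k. N \<inter> us (B L) \<subseteq> us (F k)"
      "\<And>k. vol (F k) \<le> ennreal (1 / Suc k)" by metis
    have sets: "(\<Inter>k. us (F k)) \<in> sets loeb" using us_sets[OF F(1)] by auto
    have "emeasure loeb (\<Inter>k. us (F k)) \<le> 0"
    proof (rule ennreal_le_epsilon)
      fix e :: real assume "e > 0"
      then obtain K where K: "1 / Suc K < e" using nat_approx_posE by blast
      have "emeasure loeb (\<Inter>k. us (F k)) \<le> emeasure loeb (us (F K))"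
        by (rule emeasure_mono) (use us_sets[OF F(1)] in auto)
      also have "\<dots> \<le> ennreal (1 / Suc K)" using F by (simp add: emeasure_us)
      also have "\<dots> \<le> ennreal e" using K by (intro ennreal_leI) simp
      finally show "emeasure loeb (\<Inter>k. us (F k)) \<le> 0 + ennreal e" by simp
    qed
    with sets have "(\<Inter>k. us (F k)) \<in> null_sets loeb" by auto
    then show ?thesis by (rule complete_loeb) (use F(2) in auto)
  qed
  then have "(\<Union>L. N \<inter> us (B L)) \<in> null_sets loeb" by (rule null_sets_UN)
  moreover have "(\<Union>L. N \<inter> us (B L)) = N" using assms(1) unfolding \<Omega>_eq by auto
  ultimately show ?thesis by simp
qed

lemma sandwiched_loeb: assumes "A \<in> sets loeb" shows "sandwiched A"
proof -
  from assms obtain S N N' where A: "A = S \<union> N" "N \<subseteq> N'" "N' \<in> null_sets pre_loeb" "S \<in> sets pre_loeb"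
    unfolding loeb_eq by (rule sets_completionE)
  have null: "N \<in> null_sets loeb"
    using A(2,3) loeb_eq null_sets_completionI by (intro complete_loeb[of N' N]) auto
  have "sandwiched N"
    unfolding sandwiched_def
  proof (intro allI impI)
    fix L and e :: real assume "e > 0"
    obtain F where F: "F \<in> internal" "N \<inter> us (B L) \<subseteq> us F" "us F \<subseteq> us (B L)" "vol F \<le> ennreal e"
      using null_cover[OF null \<open>e > 0\<close>] by blast
    show "\<exists>E\<in>internal. \<exists>F\<in>internal. us E \<subseteq> N \<inter> us (B L) \<and> N \<inter> us (B L) \<subseteq> us F \<and>
       us F \<subseteq> us (B L) \<and> emeasure loeb (us F - us E) \<le> ennreal e"
      by (rule bexI[OF _ internal_empty], rule bexI[OF _ F(1)]) (use F in \<open>auto simp: emeasure_us\<close>)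
  qed
  moreover have "sandwiched S" using A(4) by (rule sandwiched_pre_loeb)
  ultimately have "sandwiched (\<Union>k::nat. if k = 0 then S else N)"
    by (intro sandwiched_UN) auto
  moreover have "(\<Union>k::nat. if k = 0 then S else N) = S \<union> N"
    by (auto split: if_splits)
  ultimately show ?thesis using A(1) by simp
qed

text \<open>The hull of a sequence of inner approximations differs by a null set from their union,
  which lies in A and fills A up to a null set. Inside a ball, questions about Loeb sets can
  therefore be settled coordinatewise.\<close>

lemma internal_approx:
  assumes A: "A \<in> sets loeb" and AL: "A \<subseteq> us (B L)"
  obtains E where "E \<in> internal" "us E \<subseteq> us (B L)" "sym_diff A (us E) \<in> null_sets loeb"
proof -
  have "\<exists>E. E \<in> internal \<and> us E \<subseteq> A \<and> us E \<subseteq> us (B L) \<and> emeasure loeb (A - us E) \<le> ennreal (1 / Suc k)" for k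
  proof -
    obtain E F where EF: "E \<in> internal" "F \<in> internal" "us E \<subseteq> A" "us E \<subseteq> us (B L)"
      "A \<inter> us (B L) \<subseteq> us F" "us F \<subseteq> us (B L)" "emeasure loeb (us F - us E) \<le> ennreal (1 / Suc k)"
      using sandwichedD[OF sandwiched_loeb[OF A], of "1 / Suc k" L] by auto
    have "emeasure loeb (A - us E) \<le> emeasure loeb (us F - us E)"
      using EF us_sets AL by (intro emeasure_mono) auto
    with EF show ?thesis by (meson order_trans)
  qed
  then obtain E where E: "\<And>k. E k \<in> internal" "\<And>k. us (E k) \<subseteq> A" "\<And>k. us (E k) \<subseteq> us (B L)"
    "\<And>k. emeasure loeb (A - us (E k)) \<le> ennreal (1 / Suc k)" by metis
  note [measurable] = us_sets[OF E(1)] A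
  obtain G where G: "G \<in> internal" "\<And>k. us (E k) \<subseteq> us G" "us G \<subseteq> us (B L)"
    "us G - (\<Union>k. us (E k)) \<in> null_sets loeb"
    using internal_hull[of E L, OF E(1,3)] by blast
  note [measurable] = us_sets[OF G(1)]
  have 1: "us G - A \<in> null_sets loeb"
    by (rule complete_loeb[OF G(4)]) (use E(2) in auto)
  have "emeasure loeb (A - us G) \<le> 0"
  proof (rule ennreal_le_epsilon)
    fix e :: real assume "e > 0"
    then obtain K where K: "1 / Suc K < e" using nat_approx_posE by blast
    have "emeasure loeb (A - us G) \<le> emeasure loeb (A - us (E K))"
      using G(2)[of K] by (intro emeasure_mono) auto
    also have "\<dots> \<le> ennreal (1 / Suc K)" by (rule E)
    also have "\<dots> \<le> ennreal e" using K by (intro ennreal_leI) simp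
    finally show "emeasure loeb (A - us G) \<le> 0 + ennreal e" by simp
  qed
  then have "A - us G \<in> null_sets loeb" by (auto simp: null_sets_def)
  with 1 have "sym_diff A (us G) \<in> null_sets loeb" by auto
  with G show thesis by (intro that)
qed

lemma sets_loeb_local:
  assumes "A \<subseteq> \<Omega>" "\<And>L. A \<inter> us (B L) \<in> sets loeb" shows "A \<in> sets loeb"
proof -
  have "(\<Union>L. A \<inter> us (B L)) \<in> sets loeb" using assms(2) by (intro sets.countable_UN) auto
  moreover have "(\<Union>L. A \<inter> us (B L)) = A" using assms(1) unfolding \<Omega>_eq by auto
  ultimately show ?thesis by simp
qed

lemma null_diff_sets:
  assumes "E \<in> sets loeb" "sym_diff A E \<in> null_sets loeb"
  shows "A \<in> sets loeb" "emeasure loeb A = emeasure loeb E"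
proof -
  have 1: "A - E \<in> null_sets loeb" and 2: "E - A \<in> null_sets loeb"
    by (auto intro: complete_loeb[OF assms(2)])
  have eq: "A = (E \<union> (A - E)) - (E - A)" by auto
  have U: "E \<union> (A - E) \<in> sets loeb" using assms(1) null_setsD2[OF 1] by (rule sets.Un)
  show "A \<in> sets loeb" using sets.Diff[OF U null_setsD2[OF 2]] eq by metis
  have "emeasure loeb ((E \<union> (A - E)) - (E - A)) = emeasure loeb (E \<union> (A - E))"
    using 2 U by (rule emeasure_Diff_null_set)
  also have "\<dots> = emeasure loeb E" using assms(1) 1 by (rule emeasure_Un_null_set)
  finally show "emeasure loeb A = emeasure loeb E" using eq by metis
qed

end

section \<open>Groupoid algebra and word balls\<close>

text \<open>Word length for one set of arrows instead of a family of bisections. By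
  \<open>word_ball_eq\<close> the division into bisections does not affect the balls, and plain sets
  are easier to enlarge, cut and restrict.\<close>

primrec arrow_ball :: "'a groupoid \<Rightarrow> 'a set \<Rightarrow> nat \<Rightarrow> 'a set" where
  "arrow_ball G E 0 = space (base G)"
| "arrow_ball G E (Suc L) = arrow_ball G E L \<union> gset_mult G (E \<union> ginv G ` E) (arrow_ball G E L)"

lemma gset_mult_UN_left: "gset_mult G (\<Union>i\<in>I. A i) B = (\<Union>i\<in>I. gset_mult G (A i) B)"
  by (auto simp: gset_mult_def)

lemma gset_mult_mono: "A \<subseteq> A' \<Longrightarrow> B \<subseteq> B' \<Longrightarrow> gset_mult G A B \<subseteq> gset_mult G A' B'"
  by (auto simp: gset_mult_def)

lemma arrow_ball_mono_len: "L \<le> L' \<Longrightarrow> arrow_ball G E L \<subseteq> arrow_ball G E L'"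
  by (rule lift_Suc_mono_le) auto

lemma arrow_ball_mono: "E \<subseteq> F \<Longrightarrow> arrow_ball G E L \<subseteq> arrow_ball G F L"
proof (induction L)
  case (Suc L)
  then have "gset_mult G (E \<union> ginv G ` E) (arrow_ball G E L) \<subseteq> gset_mult G (F \<union> ginv G ` F) (arrow_ball G F L)"
    by (intro gset_mult_mono) auto
  with Suc show ?case by auto
qed simp

lemma word_ball_Suc:
  "word_ball G F (Suc L) = word_ball G F L \<union> (\<Union>\<phi>\<in>F \<union> (\<lambda>\<phi>. ginv G ` \<phi>) ` F. gset_mult G \<phi> (word_ball G F L))"
  (is "?l = ?r")
proof
  let ?F = "F \<union> (\<lambda>\<phi>. ginv G ` \<phi>) ` F"
  show "?l \<subseteq> ?r"
  proof
    fix g assume "g \<in> ?l"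
    then obtain w where w: "g \<in> word_product G w" "set w \<subseteq> ?F" "length w \<le> Suc L"
      by (auto simp: word_ball_def)
    show "g \<in> ?r"
    proof (cases w)
      case Nil
      then show ?thesis using w by (auto simp: word_ball_def intro!: exI[of _ "[]"])
    next
      case (Cons \<phi> w')
      have "word_product G w' \<subseteq> word_ball G F L"
        using w Cons unfolding word_ball_def by (intro Union_upper) auto
      then have "word_product G w \<subseteq> gset_mult G \<phi> (word_ball G F L)"
        using Cons by (simp add: gset_mult_mono)
      with w Cons show ?thesis by auto
    qed
  qed
  show "?r \<subseteq> ?l"
  proof (intro Un_least UN_least)
    show "word_ball G F L \<subseteq> ?l" unfolding word_ball_def by (intro Union_mono) auto
    fix \<phi> assume \<phi>: "\<phi> \<in> ?F"
    have "gset_mult G \<phi> (word_product G w) \<subseteq> ?l" if "set w \<subseteq> ?F" "length w \<le> L" for w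
    proof -
      have "word_product G (\<phi> # w) \<subseteq> ?l"
        unfolding word_ball_def using that \<phi> by (intro Union_upper CollectI exI[of _ "\<phi> # w"]) auto
      then show ?thesis by simp
    qed
    then show "gset_mult G \<phi> (word_ball G F L) \<subseteq> ?l"
      unfolding word_ball_def[of G F L] Union_eq[symmetric] gset_mult_def by blast
  qed
qed

lemma word_ball_eq: "word_ball G F L = arrow_ball G (\<Union>F) L"
proof (induction L)
  case 0
  show ?case by (auto simp: word_ball_def)
next
  case (Suc L)
  have "(\<Union>\<phi>\<in>F \<union> (\<lambda>\<phi>. ginv G ` \<phi>) ` F. \<phi>) = \<Union>F \<union> ginv G ` \<Union>F" by auto
  then have "gset_mult G (\<Union>F \<union> ginv G ` \<Union>F) B =
      (\<Union>\<phi>\<in>F \<union> (\<lambda>\<phi>. ginv G ` \<phi>) ` F. gset_mult G \<phi> B)" for B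
    using gset_mult_UN_left[of G "\<lambda>\<phi>. \<phi>" "F \<union> (\<lambda>\<phi>. ginv G ` \<phi>) ` F" B] by simp
  then show ?case by (simp only: word_ball_Suc Suc arrow_ball.simps)
qed

lemma subgroupoid_unit: "subgroupoid G H \<Longrightarrow> x \<in> space (base G) \<Longrightarrow> x \<in> H"
  by (auto simp: subgroupoid_def)

lemma subgroupoid_inv: "subgroupoid G H \<Longrightarrow> g \<in> H \<Longrightarrow> ginv G g \<in> H"
  by (auto simp: subgroupoid_def)

lemma subgroupoid_mult:
  "subgroupoid G H \<Longrightarrow> g \<in> H \<Longrightarrow> h \<in> H \<Longrightarrow> source G g = target G h \<Longrightarrow> gmult G g h \<in> H"
  by (auto simp: subgroupoid_def)

lemma generatingD:
  assumes "generating G I \<Psi>" "subgroupoid G H" "\<And>i. i \<in> I \<Longrightarrow> \<Psi> i \<subseteq> H"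
  shows "space (arrows G) \<subseteq> H"
  unfolding assms(1)[unfolded generating_def, symmetric] using assms(2,3) by (intro Inter_lower) auto

lemma subgroupoid_ball_sub:
  assumes H: "subgroupoid G H" and "E \<subseteq> H"
  shows "arrow_ball G E L \<subseteq> H"
proof (induction L)
  case 0
  show ?case using H by (simp add: subgroupoid_def)
next
  case (Suc L)
  have "E \<union> ginv G ` E \<subseteq> H"
    using H assms(2) unfolding subgroupoid_def by auto
  then have "gset_mult G (E \<union> ginv G ` E) (arrow_ball G E L) \<subseteq> H"
    using H Suc unfolding subgroupoid_def gset_mult_def by blast
  with Suc show ?case by simp
qed

locale groupoid =
  fixes G :: "'a groupoid"
  assumes laws: "groupoid_laws G"
begin

abbreviation "Ar \<equiv> space (arrows G)"
abbreviation "Ob \<equiv> space (base G)"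

lemma Ob_sub: "Ob \<subseteq> Ar" using laws by (simp add: groupoid_laws_def)
lemma s_in: "g \<in> Ar \<Longrightarrow> source G g \<in> Ob" using laws by (simp add: groupoid_laws_def)
lemma t_in: "g \<in> Ar \<Longrightarrow> target G g \<in> Ob" using laws by (simp add: groupoid_laws_def)
lemma s_unit: "x \<in> Ob \<Longrightarrow> source G x = x" using laws by (simp add: groupoid_laws_def)
lemma t_unit: "x \<in> Ob \<Longrightarrow> target G x = x" using laws by (simp add: groupoid_laws_def)
lemma mult_in: "g \<in> Ar \<Longrightarrow> h \<in> Ar \<Longrightarrow> source G g = target G h \<Longrightarrow> gmult G g h \<in> Ar"
  using laws by (simp add: groupoid_laws_def)
lemma s_mult: "g \<in> Ar \<Longrightarrow> h \<in> Ar \<Longrightarrow> source G g = target G h \<Longrightarrow> source G (gmult G g h) = source G h"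
  using laws by (simp add: groupoid_laws_def)
lemma t_mult: "g \<in> Ar \<Longrightarrow> h \<in> Ar \<Longrightarrow> source G g = target G h \<Longrightarrow> target G (gmult G g h) = target G g"
  using laws by (simp add: groupoid_laws_def)
lemma mult_assoc: "g \<in> Ar \<Longrightarrow> h \<in> Ar \<Longrightarrow> k \<in> Ar \<Longrightarrow> source G g = target G h \<Longrightarrow> source G h = target G k \<Longrightarrow>
    gmult G (gmult G g h) k = gmult G g (gmult G h k)"
  using laws by (simp add: groupoid_laws_def)
lemma mult_s: "g \<in> Ar \<Longrightarrow> gmult G g (source G g) = g" using laws by (simp add: groupoid_laws_def)
lemma mult_t: "g \<in> Ar \<Longrightarrow> gmult G (target G g) g = g" using laws by (simp add: groupoid_laws_def)
lemma inv_in: "g \<in> Ar \<Longrightarrow> ginv G g \<in> Ar" using laws by (simp add: groupoid_laws_def)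
lemma s_inv: "g \<in> Ar \<Longrightarrow> source G (ginv G g) = target G g" using laws by (simp add: groupoid_laws_def)
lemma t_inv: "g \<in> Ar \<Longrightarrow> target G (ginv G g) = source G g" using laws by (simp add: groupoid_laws_def)
lemma inv_mult: "g \<in> Ar \<Longrightarrow> gmult G (ginv G g) g = source G g" using laws by (simp add: groupoid_laws_def)
lemma mult_inv: "g \<in> Ar \<Longrightarrow> gmult G g (ginv G g) = target G g" using laws by (simp add: groupoid_laws_def)

lemmas groupoid_simps = s_in t_in s_unit t_unit mult_in s_mult t_mult mult_s mult_t inv_in s_inv t_inv
  inv_mult mult_inv subsetD[OF Ob_sub]

lemma inv_unique:
  assumes "g \<in> Ar" "h \<in> Ar" "source G g = target G h" "gmult G g h = target G g"
  shows "h = ginv G g"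
proof -
  have "gmult G (ginv G g) (gmult G g h) = gmult G (gmult G (ginv G g) g) h"
    using assms(1-3) by (intro mult_assoc[symmetric]) (simp_all add: groupoid_simps)
  also have "\<dots> = h" using assms by (simp add: inv_mult mult_t)
  finally have "h = gmult G (ginv G g) (target G g)" unfolding assms(4) by (rule sym)
  also have "\<dots> = gmult G (ginv G g) (source G (ginv G g))" using assms by (simp add: groupoid_simps)
  also have "\<dots> = ginv G g" using assms by (intro mult_s inv_in)
  finally show ?thesis .
qed

lemma ginv_ginv: "g \<in> Ar \<Longrightarrow> ginv G (ginv G g) = g"
  by (rule inv_unique[symmetric]) (simp_all add: groupoid_simps)

lemma inv_unit: "x \<in> Ob \<Longrightarrow> ginv G x = x"
  by (metis inv_unique mult_s s_unit subsetD[OF Ob_sub] t_unit)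

lemma inv_prod:
  assumes "g \<in> Ar" "h \<in> Ar" "source G g = target G h"
  shows "ginv G (gmult G g h) = gmult G (ginv G h) (ginv G g)"
proof (rule inv_unique[symmetric])
  have "gmult G (gmult G g h) (gmult G (ginv G h) (ginv G g)) = gmult G g (gmult G h (gmult G (ginv G h) (ginv G g)))"
    using assms by (intro mult_assoc) (simp_all add: groupoid_simps)
  also have "gmult G h (gmult G (ginv G h) (ginv G g)) = gmult G (gmult G h (ginv G h)) (ginv G g)"
    using assms by (intro mult_assoc[symmetric]) (simp_all add: groupoid_simps)
  also have "\<dots> = gmult G (target G (ginv G g)) (ginv G g)" using assms by (simp add: groupoid_simps)
  also have "\<dots> = ginv G g" using assms by (intro mult_t inv_in)
  finally show "gmult G (gmult G g h) (gmult G (ginv G h) (ginv G g)) = target G (gmult G g h)"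
    using assms by (simp add: groupoid_simps)
qed (use assms in \<open>simp_all add: groupoid_simps\<close>)

text \<open>Reduces injectivity on a source fibre to the question which arrows are units; it is
  applied to the kernel of \<open>T\<close> and to arrows that become loops in a coded
  factor.\<close>

lemma cancel_right:
  assumes "g \<in> Ar" "h \<in> Ar" "source G g = source G h" "gmult G g (ginv G h) \<in> Ob"
  shows "g = h"
proof -
  have "gmult G (gmult G g (ginv G h)) h = gmult G g (gmult G (ginv G h) h)"
    using assms by (intro mult_assoc) (simp_all add: groupoid_simps)
  also have "\<dots> = g" using assms by (metis inv_mult mult_s)
  finally have g: "gmult G (gmult G g (ginv G h)) h = g" .
  have "source G (gmult G g (ginv G h)) = target G h" using assms(1-3) by (simp add: groupoid_simps)
  then have "gmult G g (ginv G h) = target G h" using s_unit[OF assms(4)] by metis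
  then show ?thesis using g assms by (simp add: groupoid_simps)
qed

lemma gset_mult_sub: "A \<subseteq> Ar \<Longrightarrow> B \<subseteq> Ar \<Longrightarrow> gset_mult G A B \<subseteq> Ar"
  by (auto simp: gset_mult_def intro!: mult_in)

lemma inv_image_sub: "A \<subseteq> Ar \<Longrightarrow> ginv G ` A \<subseteq> Ar"
  by (auto intro: inv_in)

lemma arrow_ball_sub: "E \<subseteq> Ar \<Longrightarrow> arrow_ball G E L \<subseteq> Ar"
  by (induction L) (use Ob_sub gset_mult_sub inv_image_sub in \<open>simp_all\<close>)

lemma gset_mult_Ob: "A \<subseteq> Ar \<Longrightarrow> gset_mult G A Ob = A"
proof
  assume A: "A \<subseteq> Ar"
  show "gset_mult G A Ob \<subseteq> A"
  proof
    fix k assume "k \<in> gset_mult G A Ob"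
    then obtain g x where k: "k = gmult G g x" "g \<in> A" "x \<in> Ob" "source G g = target G x"
      by (auto simp: gset_mult_def)
    then have "x = source G g" by (simp add: t_unit)
    then have "k = g" using k A mult_s[of g] t_unit by auto
    then show "k \<in> A" using k by simp
  qed
  show "A \<subseteq> gset_mult G A Ob"
  proof
    fix g assume "g \<in> A"
    then show "g \<in> gset_mult G A Ob"
      unfolding gset_mult_def using A
      by (intro CollectI exI[of _ g] exI[of _ "source G g"]) (auto simp: groupoid_simps)
  qed
qed

lemma ball_1: "E \<subseteq> Ar \<Longrightarrow> E \<union> ginv G ` E \<subseteq> arrow_ball G E (Suc 0)"
  using gset_mult_Ob[of "E \<union> ginv G ` E"] inv_image_sub[of E] by simp

lemma ball_Ob: "Ob \<subseteq> arrow_ball G E L"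
  using arrow_ball_mono_len[of 0 L G E] by simp

lemma ball_mult:
  assumes "E \<subseteq> Ar" "g \<in> arrow_ball G E L" "h \<in> arrow_ball G E L'" "source G g = target G h"
  shows "gmult G g h \<in> arrow_ball G E (L + L')"
  using assms(2,4)
proof (induction L arbitrary: g)
  case 0
  have "h \<in> Ar" using arrow_ball_sub assms by blast
  with 0 assms have "gmult G g h = h" by (metis arrow_ball.simps(1) mult_t s_unit)
  with assms(3) show ?case by simp
next
  case (Suc L)
  have h: "h \<in> Ar" using arrow_ball_sub assms by blast
  show ?case
  proof (cases "g \<in> arrow_ball G E L")
    case True
    with Suc show ?thesis by simp
  next
    case False
    with Suc obtain e k where ek: "g = gmult G e k" "e \<in> E \<union> ginv G ` E" "k \<in> arrow_ball G E L"
      "source G e = target G k" by (auto simp: gset_mult_def)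
    have Ar: "e \<in> Ar" "k \<in> Ar" using ek arrow_ball_sub assms(1) inv_image_sub by blast+
    then have "source G k = target G h" using Suc(3) ek by (simp add: s_mult)
    then have "gmult G k h \<in> arrow_ball G E (L + L')" and "gmult G g h = gmult G e (gmult G k h)"
      using Suc.IH ek Ar h mult_assoc by auto
    moreover have "source G e = target G (gmult G k h)"
      using ek Ar h \<open>source G k = target G h\<close> by (simp add: t_mult)
    ultimately show ?thesis using ek unfolding add_Suc arrow_ball.simps gset_mult_def by blast
  qed
qed

lemma ball_inv:
  assumes "E \<subseteq> Ar" "g \<in> arrow_ball G E L"
  shows "ginv G g \<in> arrow_ball G E L"
  using assms(2)
proof (induction L arbitrary: g)
  case 0
  then show ?case by (simp add: inv_unit)
next
  case (Suc L)
  show ?case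
  proof (cases "g \<in> arrow_ball G E L")
    case True
    with Suc show ?thesis by simp
  next
    case False
    with Suc obtain e k where ek: "g = gmult G e k" "e \<in> E \<union> ginv G ` E" "k \<in> arrow_ball G E L"
      "source G e = target G k" by (auto simp: gset_mult_def)
    have Ar: "e \<in> Ar" "k \<in> Ar" using ek arrow_ball_sub assms(1) inv_image_sub by blast+
    have "ginv G e \<in> E \<union> ginv G ` E" using ek(2) assms(1) ginv_ginv by (auto simp: subset_iff)
    then have "ginv G e \<in> arrow_ball G E (Suc 0)" using ball_1[OF assms(1)] by blast
    moreover have "ginv G k \<in> arrow_ball G E L" using Suc ek by blast
    ultimately have "gmult G (ginv G k) (ginv G e) \<in> arrow_ball G E (L + Suc 0)"
      using assms(1) ek Ar by (intro ball_mult) (simp_all add: groupoid_simps)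
    then show ?thesis using ek Ar by (simp add: inv_prod)
  qed
qed

text \<open>Each letter from E is a word of length at most k in F, so lengths grow by the factor k
  and bounded length survives a Lipschitz change of generators.\<close>

lemma ball_ball:
  assumes "F \<subseteq> Ar" "E \<subseteq> arrow_ball G F k"
  shows "arrow_ball G E L \<subseteq> arrow_ball G F (L * k)"
proof (induction L)
  case (Suc L)
  have "gset_mult G (E \<union> ginv G ` E) (arrow_ball G E L) \<subseteq> arrow_ball G F (k + L * k)"
  proof
    fix g assume "g \<in> gset_mult G (E \<union> ginv G ` E) (arrow_ball G E L)"
    then obtain e h where g: "g = gmult G e h" "e \<in> E \<union> ginv G ` E" "h \<in> arrow_ball G E L"
      "source G e = target G h" by (auto simp: gset_mult_def)
    then have "e \<in> arrow_ball G F k" using assms ball_inv by blast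
    then show "g \<in> arrow_ball G F (k + L * k)" using g Suc assms by (auto intro: ball_mult)
  qed
  with Suc arrow_ball_mono_len[of "L * k" "k + L * k" G F] show ?case by auto
qed simp

lemma subgroupoid_balls: assumes "E \<subseteq> Ar" shows "subgroupoid G (\<Union>L. arrow_ball G E L)"
  unfolding subgroupoid_def
proof (intro conjI ballI impI)
  show "Ob \<subseteq> (\<Union>L. arrow_ball G E L)" using ball_Ob by blast
  show "(\<Union>L. arrow_ball G E L) \<subseteq> Ar" using arrow_ball_sub[OF assms] by blast
  show "ginv G g \<in> (\<Union>L. arrow_ball G E L)" if "g \<in> (\<Union>L. arrow_ball G E L)" for g
    using that ball_inv[OF assms] by blast
  show "gmult G g h \<in> (\<Union>L. arrow_ball G E L)"
    if "g \<in> (\<Union>L. arrow_ball G E L)" "h \<in> (\<Union>L. arrow_ball G E L)" "source G g = target G h" for g h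
    using that ball_mult[OF assms] by blast
qed

text \<open>The union of the balls is itself a subgroupoid, hence the smallest one containing the
  generators. Generation becomes a statement about words, which can be truncated and
  counted.\<close>

lemma generating_iff:
  assumes "(\<Union>i\<in>I. \<Psi> i) \<subseteq> Ar"
  shows "generating G I \<Psi> \<longleftrightarrow> Ar \<subseteq> (\<Union>L. arrow_ball G (\<Union>i\<in>I. \<Psi> i) L)"
proof -
  let ?E = "\<Union>i\<in>I. \<Psi> i"
  have sub: "subgroupoid G (\<Union>L. arrow_ball G ?E L)" by (rule subgroupoid_balls[OF assms])
  have cont: "?E \<subseteq> (\<Union>L. arrow_ball G ?E L)" using ball_1[OF assms] by blast
  have min: "(\<Union>L. arrow_ball G ?E L) \<subseteq> H" if "subgroupoid G H" "\<forall>i\<in>I. \<Psi> i \<subseteq> H" for H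
    using that subgroupoid_ball_sub[of G H ?E] by blast
  have "\<Inter>{H. subgroupoid G H \<and> (\<forall>i\<in>I. \<Psi> i \<subseteq> H)} = (\<Union>L. arrow_ball G ?E L)"
  proof (rule antisym)
    show "\<Inter>{H. subgroupoid G H \<and> (\<forall>i\<in>I. \<Psi> i \<subseteq> H)} \<subseteq> (\<Union>L. arrow_ball G ?E L)"
      using sub cont by (intro Inter_lower) blast
    show "(\<Union>L. arrow_ball G ?E L) \<subseteq> \<Inter>{H. subgroupoid G H \<and> (\<forall>i\<in>I. \<Psi> i \<subseteq> H)}"
      using min by blast
  qed
  moreover have "(\<Union>L. arrow_ball G ?E L) \<subseteq> Ar" using arrow_ball_sub[OF assms] by blast
  ultimately show ?thesis unfolding generating_def by auto
qed

end

section \<open>Cost\<close>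

lemma ennreal_summable_on: "(f :: _ \<Rightarrow> ennreal) summable_on S"
  by (simp add: nonneg_summable_on_complete)

lemma graphing_cost_Plus:
  "graphing_cost G (I <+> K) (case_sum \<Psi> \<nu>) = graphing_cost G I \<Psi> + graphing_cost G K \<nu>"
proof -
  have "graphing_cost G (I <+> K) (case_sum \<Psi> \<nu>) =
      (\<Sum>\<^sub>\<infinity>i\<in>Inl ` I. emeasure (arrows G) (case_sum \<Psi> \<nu> i)) +
      (\<Sum>\<^sub>\<infinity>i\<in>Inr ` K. emeasure (arrows G) (case_sum \<Psi> \<nu> i))"
    unfolding graphing_cost_def Plus_def by (intro infsum_Un_disjoint ennreal_summable_on) blast
  then show ?thesis
    by (simp add: graphing_cost_def infsum_reindex o_def)
qed

lemma graphing_cost_null: "(\<And>i. i \<in> I \<Longrightarrow> emeasure (arrows G) (\<Psi> i) = 0) \<Longrightarrow> graphing_cost G I \<Psi> = 0"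
  unfolding graphing_cost_def by (rule infsum_0)

lemma graphing_cost_finite: "finite I \<Longrightarrow> graphing_cost G I \<Psi> = (\<Sum>i\<in>I. emeasure (arrows G) (\<Psi> i))"
  by (simp add: graphing_cost_def)

lemma graphing_cost_reindex:
  assumes "countable I"
  shows "graphing_cost G (to_nat_on I ` I) (\<lambda>n. \<Psi> (from_nat_into I n)) = graphing_cost G I \<Psi>"
proof -
  have "graphing_cost G (to_nat_on I ` I) (\<lambda>n. \<Psi> (from_nat_into I n)) =
      infsum ((\<lambda>n. emeasure (arrows G) (\<Psi> (from_nat_into I n))) \<circ> to_nat_on I) I"
    unfolding graphing_cost_def using assms by (intro infsum_reindex inj_on_to_nat_on)
  also have "\<dots> = graphing_cost G I \<Psi>"
    unfolding graphing_cost_def using assms by (intro infsum_cong) simp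
  finally show ?thesis .
qed

text \<open>\<open>cost\<close> quantifies over families indexed by numbers; re-indexing admits any
  countable index set, such as a disjoint sum of two families or a set of group elements.\<close>

lemma cost_le:
  assumes "graphing G I \<Psi>" "generating G I \<Psi>"
  shows "cost G \<le> graphing_cost G I \<Psi>"
proof -
  let ?J = "to_nat_on I ` I" and ?\<Psi> = "\<lambda>n. \<Psi> (from_nat_into I n)"
  have I: "countable I" using assms by (simp add: graphing_def)
  then have "graphing G ?J ?\<Psi>" using assms(1) by (auto simp: graphing_def)
  moreover have "generating G ?J ?\<Psi>" using assms(2) I by (simp add: generating_def)
  ultimately have "cost G \<le> graphing_cost G ?J ?\<Psi>"
    unfolding cost_def by (intro Inf_lower) blast
  then show ?thesis unfolding graphing_cost_reindex[OF I, of G \<Psi>] .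
qed

lemma lipschitz_cost_le:
  assumes "finite J" "graphing G J \<Psi>" "lipschitz_equivalent G L J \<Psi> I \<Phi>"
  shows "lipschitz_cost L G I \<Phi> \<le> graphing_cost G J \<Psi>"
proof -
  let ?J = "to_nat_on J ` J" and ?\<Psi> = "\<lambda>n. \<Psi> (from_nat_into J n)"
  have J: "countable J" using assms by (simp add: graphing_def)
  then have "graphing G ?J ?\<Psi>" using assms(2) by (auto simp: graphing_def)
  moreover have "?\<Psi> ` ?J = \<Psi> ` J" using J by (force simp: image_image)
  then have "lipschitz_equivalent G L ?J ?\<Psi> I \<Phi>"
    using assms(3) J by (simp add: lipschitz_equivalent_def lipschitz_sub_def)
  ultimately have "lipschitz_cost L G I \<Phi> \<le> graphing_cost G ?J ?\<Psi>"
    unfolding lipschitz_cost_def using assms(1) by (intro Inf_lower) blast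
  then show ?thesis unfolding graphing_cost_reindex[OF J, of G \<Psi>] .
qed

lemma emeasure_UN_le_graphing_cost:
  assumes "graphing G I \<Psi>"
  shows "emeasure (arrows G) (\<Union>i\<in>I. \<Psi> i) \<le> graphing_cost G I \<Psi>"
proof -
  have I: "countable I" and sets: "\<And>i. i \<in> I \<Longrightarrow> \<Psi> i \<in> sets (arrows G)"
    using assms by (auto simp: graphing_def bisection_def)
  define \<psi> where "\<psi> n = (if n \<in> to_nat_on I ` I then \<Psi> (from_nat_into I n) else {})" for n
  have "(\<Union>i\<in>I. \<Psi> i) = (\<Union>n. \<psi> n)"
    using I by (auto simp: \<psi>_def split: if_splits)
  also have "emeasure (arrows G) \<dots> \<le> (\<Sum>n. emeasure (arrows G) (\<psi> n))"
    by (rule emeasure_subadditive_countably) (use I sets in \<open>auto simp: \<psi>_def\<close>)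
  also have "\<dots> = (\<Sum>\<^sub>\<infinity>n. emeasure (arrows G) (\<psi> n))"
    by (rule sym, rule sums_unique[OF has_sum_imp_sums[OF has_sum_infsum[OF ennreal_summable_on]]])
  also have "\<dots> = (\<Sum>\<^sub>\<infinity>n\<in>to_nat_on I ` I. emeasure (arrows G) (\<Psi> (from_nat_into I n)))"
    by (rule infsum_cong_neutral) (auto simp: \<psi>_def)
  also have "\<dots> = graphing_cost G I \<Psi>"
    using graphing_cost_reindex[OF I, of G \<Psi>] by (simp only: graphing_cost_def)
  finally show ?thesis .
qed

text \<open>The null bisections are appended as a second family over a disjoint sum of index sets:
  they help to generate and contribute nothing to the cost.\<close>

lemma (in groupoid) cost_le_null:
  assumes \<Psi>: "graphing G I \<Psi>" and K: "countable K"
    and \<nu>: "\<And>k. k \<in> K \<Longrightarrow> bisection G (\<nu> k)" "\<And>k. k \<in> K \<Longrightarrow> emeasure (arrows G) (\<nu> k) = 0"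
    and gen: "Ar \<subseteq> (\<Union>L. arrow_ball G ((\<Union>i\<in>I. \<Psi> i) \<union> (\<Union>k\<in>K. \<nu> k)) L)"
  shows "cost G \<le> graphing_cost G I \<Psi>"
proof -
  have gr: "graphing G (I <+> K) (case_sum \<Psi> \<nu>)"
    using \<Psi> K \<nu> by (auto simp: graphing_def)
  have eq: "(\<Union>i\<in>I <+> K. case_sum \<Psi> \<nu> i) = (\<Union>i\<in>I. \<Psi> i) \<union> (\<Union>k\<in>K. \<nu> k)"
    by (auto simp: Plus_def)
  have "(\<Union>i\<in>I. \<Psi> i) \<union> (\<Union>k\<in>K. \<nu> k) \<subseteq> Ar"
    using \<Psi> \<nu>(1) sets.sets_into_space by (fastforce simp: graphing_def bisection_def)
  then have "generating G (I <+> K) (case_sum \<Psi> \<nu>)"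
    using gen by (subst generating_iff) (simp_all only: eq)
  with gr have "cost G \<le> graphing_cost G (I <+> K) (case_sum \<Psi> \<nu>)" by (rule cost_le)
  also have "\<dots> = graphing_cost G I \<Psi>"
    unfolding graphing_cost_Plus using graphing_cost_null[of K G \<nu>] \<nu>(2) by simp
  finally show ?thesis .
qed

section \<open>Finite groupoids\<close>

locale fin_groupoid = groupoid +
  assumes fin: "finite_pmp_groupoid G"
begin

lemma pmp: "pmp_groupoid G" using fin by (simp add: finite_pmp_groupoid_def)
lemma fin_Ar: "finite Ar" using fin by (simp add: finite_pmp_groupoid_def)
lemma sets_Ar: "sets (arrows G) = Pow Ar" using fin by (simp add: finite_pmp_groupoid_def)
lemma fin_Ob: "finite Ob" using fin_Ar Ob_sub by (rule finite_subset[rotated])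
lemma prob_base: "prob_space (base G)" using pmp by (simp add: pmp_groupoid_def)

text \<open>The coordinate map carries g to a single point \<open>(p g, k)\<close> of the product
  with the counting measure, so the mass of g is that of its end. The measure on the arrows is
  thereby reduced to weights of units.\<close>

lemma fibred_point:
  assumes cf: "countable_fibred_space (arrows G) p (base G)" and g: "g \<in> Ar"
  shows "{p g} \<in> sets (base G)" "emeasure (arrows G) {g} = emeasure (base G) {p g}"
proof -
  let ?P = "base G \<Otimes>\<^sub>M count_space (UNIV :: nat set)"
  obtain U u where U: "U \<in> sets ?P"
    and iso: "measurable_iso (arrows G) (restrict_space ?P U) u"
    and dist: "distr (arrows G) (restrict_space ?P U) u = restrict_space ?P U"
    and fst: "\<And>f. f \<in> Ar \<Longrightarrow> fst (u f) = p f"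
    using cf unfolding countable_fibred_space_def by blast
  obtain k where ug: "u g = (p g, k)" using fst[OF g] by (metis prod.collapse)
  have spU: "space (restrict_space ?P U) = U"
    using U sets.sets_into_space by (fastforce simp: space_restrict_space)
  have bij: "bij_betw u Ar U" and um: "u \<in> arrows G \<rightarrow>\<^sub>M restrict_space ?P U"
    and inv: "the_inv_into Ar u \<in> restrict_space ?P U \<rightarrow>\<^sub>M arrows G"
    using iso spU by (auto simp: measurable_iso_def)
  have ugU: "u g \<in> U" using bij g by (auto simp: bij_betw_def)
  have pre: "u -` {u g} \<inter> Ar = {g}"
  proof (intro Set.set_eqI iffI)
    fix x assume "x \<in> u -` {u g} \<inter> Ar"
    then have "u x = u g" "x \<in> Ar" by simp_all
    then show "x \<in> {g}" using bij g by (metis bij_betw_def inj_onD singletonI)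
  qed (use g in simp)
  \<comment> \<open>Singletons of arrows are measurable; the measurable inverse of the coordinate
    map transports this to the product, and the section at height k transports it to the
    base.\<close>
  have "the_inv_into Ar u -` {g} \<inter> U \<in> sets (restrict_space ?P U)"
    using measurable_sets[OF inv, of "{g}"] g spU by (simp add: sets_Ar)
  moreover have "the_inv_into Ar u -` {g} \<inter> U = {u g}"
  proof (intro Set.set_eqI iffI)
    fix x assume "x \<in> the_inv_into Ar u -` {g} \<inter> U"
    then have "u g = x" using bij by (metis IntE bij_betw_def f_the_inv_into_f vimage_singleton_eq)
    then show "x \<in> {u g}" by simp
  next
    fix x assume "x \<in> {u g}"
    then show "x \<in> the_inv_into Ar u -` {g} \<inter> U"
      using bij g ugU by (simp add: bij_betw_def the_inv_into_f_f)
  qed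
  ultimately have ugs: "{u g} \<in> sets (restrict_space ?P U)" by simp
  then have ugP: "{u g} \<in> sets ?P" using U by (simp add: sets_restrict_space_iff)
  have "(\<lambda>x. (x, k)) \<in> base G \<rightarrow>\<^sub>M ?P" by measurable
  from measurable_sets[OF this ugP] have "(\<lambda>x. (x, k)) -` {u g} \<inter> Ob \<in> sets (base G)" .
  moreover have pOb: "p g \<in> Ob"
    using cf g unfolding countable_fibred_space_def by (auto dest: measurable_space)
  then have "(\<lambda>x. (x, k)) -` {u g} \<inter> Ob = {p g}" by (auto simp: ug)
  ultimately show pset: "{p g} \<in> sets (base G)" by simp
  have "emeasure (restrict_space ?P U) {u g} = emeasure (distr (arrows G) (restrict_space ?P U) u) {u g}"
    by (simp add: dist)
  also have "\<dots> = emeasure (arrows G) {g}" using um ugs pre by (simp add: emeasure_distr)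
  finally have "emeasure (arrows G) {g} = emeasure ?P {u g}"
    using U ugU by (simp add: emeasure_restrict_space)
  also have "{u g} = {p g} \<times> {k}" by (auto simp: ug)
  also have "emeasure ?P ({p g} \<times> {k}) = emeasure (base G) {p g} * emeasure (count_space UNIV) {k}"
  proof -
    interpret sigma_finite_measure "count_space (UNIV :: nat set)"
      by (rule sigma_finite_measure_count_space_countable) simp
    show ?thesis using pset by (intro emeasure_pair_measure_Times) auto
  qed
  finally show "emeasure (arrows G) {g} = emeasure (base G) {p g}" by simp
qed

lemma fib_s: "countable_fibred_space (arrows G) (source G) (base G)"
  and fib_t: "countable_fibred_space (arrows G) (target G) (base G)"
  using pmp by (auto simp: pmp_groupoid_def)

text \<open>The discrete \<sigma>-algebra is assumed for the arrows only. Units are arrows and their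
  own sources, so their singletons are measurable in the base as well.\<close>

lemma sets_Ob: "sets (base G) = Pow Ob"
proof (rule antisym[OF sets.space_closed subsetI])
  fix A assume A: "A \<in> Pow Ob"
  then have "{x} \<in> sets (base G)" if "x \<in> A" for x
    using fibred_point(1)[OF fib_s, of x] that s_unit[of x] subsetD[OF Ob_sub, of x] A by auto
  moreover have "finite A" using A fin_Ob by (auto intro: finite_subset)
  ultimately have "(\<Union>x\<in>A. {x}) \<in> sets (base G)" by (intro sets.finite_UN) auto
  then show "A \<in> sets (base G)" by simp
qed

definition w :: "'a \<Rightarrow> ennreal" where "w x = emeasure (base G) {x}"

lemma emeasure_Ob: "A \<subseteq> Ob \<Longrightarrow> emeasure (base G) A = (\<Sum>x\<in>A. w x)"
  unfolding w_def using fin_Ob finite_subset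
  by (intro emeasure_eq_sum_singleton) (auto simp: sets_Ob)

lemma emeasure_Ar_s: "A \<subseteq> Ar \<Longrightarrow> emeasure (arrows G) A = (\<Sum>g\<in>A. w (source G g))"
proof -
  assume A: "A \<subseteq> Ar"
  then have "emeasure (arrows G) A = (\<Sum>g\<in>A. emeasure (arrows G) {g})"
    using fin_Ar finite_subset by (intro emeasure_eq_sum_singleton) (auto simp: sets_Ar)
  then show ?thesis using A fibred_point(2)[OF fib_s] by (auto simp: w_def intro!: sum.cong)
qed

text \<open>Both fibrations compute the mass of the same arrow. This is the invariance of the
  measure: weights are constant on orbits.\<close>

lemma w_st: "g \<in> Ar \<Longrightarrow> w (target G g) = w (source G g)"
  using fibred_point(2)[OF fib_s] fibred_point(2)[OF fib_t] by (metis w_def)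

lemma emeasure_Ar_t: "A \<subseteq> Ar \<Longrightarrow> emeasure (arrows G) A = (\<Sum>g\<in>A. w (target G g))"
  using emeasure_Ar_s w_st by (simp add: subset_eq)

lemma w_sum: "(\<Sum>x\<in>Ob. w x) = 1"
  using emeasure_Ob[of Ob] prob_space.emeasure_space_1[OF prob_base] by simp

definition is_st :: "('a \<Rightarrow> 'a) \<Rightarrow> bool" where "is_st p \<longleftrightarrow> p = source G \<or> p = target G"

lemma emeasure_Ar_st: "is_st p \<Longrightarrow> A \<subseteq> Ar \<Longrightarrow> emeasure (arrows G) A = (\<Sum>g\<in>A. w (p g))"
  using emeasure_Ar_s emeasure_Ar_t by (auto simp: is_st_def)

lemma st_in: "is_st p \<Longrightarrow> A \<subseteq> Ar \<Longrightarrow> p ` A \<subseteq> Ob"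
  using s_in t_in by (auto simp: is_st_def)

lemma emeasure_st_image_le:
  assumes "is_st p" "A \<subseteq> Ar" shows "emeasure (base G) (p ` A) \<le> emeasure (arrows G) A"
proof -
  have "sum w (p ` A) \<le> sum (w \<circ> p) A"
    using finite_subset[OF assms(2) fin_Ar] by (rule sum_image_le) simp
  then show ?thesis using st_in[OF assms] assms by (simp add: emeasure_Ob emeasure_Ar_st o_def)
qed

lemma emeasure_st_image_eq:
  assumes "is_st p" "A \<subseteq> Ar" "inj_on p A" shows "emeasure (base G) (p ` A) = emeasure (arrows G) A"
  using assms st_in by (simp add: emeasure_Ob emeasure_Ar_st sum.reindex)

lemma bisection_iff: "bisection G \<phi> \<longleftrightarrow> \<phi> \<subseteq> Ar \<and> inj_on (source G) \<phi> \<and> inj_on (target G) \<phi>"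
  by (simp add: bisection_def sets_Ar)

lemma bisection_unit: "bisection G Ob"
  by (auto simp: bisection_iff inj_on_def s_unit t_unit dest: subsetD[OF Ob_sub])

lemma bisection_inv: "bisection G \<phi> \<Longrightarrow> bisection G (ginv G ` \<phi>)"
  unfolding bisection_iff inj_on_def by (auto simp: s_inv t_inv inv_in subset_eq)

lemma bisection_mult: assumes "bisection G \<phi>" "bisection G \<psi>" shows "bisection G (gset_mult G \<phi> \<psi>)"
proof -
  have sub: "\<phi> \<subseteq> Ar" "\<psi> \<subseteq> Ar" using assms by (auto simp: bisection_iff)
  have "inj_on (source G) (gset_mult G \<phi> \<psi>)"
  proof (rule inj_onI)
    fix x y assume "x \<in> gset_mult G \<phi> \<psi>" "y \<in> gset_mult G \<phi> \<psi>" and eq: "source G x = source G y"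
    then obtain g h g' h' where x: "x = gmult G g h" "g \<in> \<phi>" "h \<in> \<psi>" "source G g = target G h"
      and y: "y = gmult G g' h'" "g' \<in> \<phi>" "h' \<in> \<psi>" "source G g' = target G h'"
      by (auto simp: gset_mult_def)
    have "source G h = source G h'" using eq x y sub by (auto simp: s_mult subset_eq)
    then have "h = h'" using x(3) y(3) assms(2) by (metis bisection_iff inj_onD)
    then have "source G g = source G g'" using x y by simp
    then have "g = g'" using x(2) y(2) assms(1) by (metis bisection_iff inj_onD)
    then show "x = y" using x y \<open>h = h'\<close> by simp
  qed
  moreover have "inj_on (target G) (gset_mult G \<phi> \<psi>)"
  proof (rule inj_onI)
    fix x y assume "x \<in> gset_mult G \<phi> \<psi>" "y \<in> gset_mult G \<phi> \<psi>" and eq: "target G x = target G y"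
    then obtain g h g' h' where x: "x = gmult G g h" "g \<in> \<phi>" "h \<in> \<psi>" "source G g = target G h"
      and y: "y = gmult G g' h'" "g' \<in> \<phi>" "h' \<in> \<psi>" "source G g' = target G h'"
      by (auto simp: gset_mult_def)
    have "target G g = target G g'" using eq x y sub by (auto simp: t_mult subset_eq)
    then have "g = g'" using x(2) y(2) assms(1) by (metis bisection_iff inj_onD)
    then have "target G h = target G h'" using x y by simp
    then have "h = h'" using x(3) y(3) assms(2) by (metis bisection_iff inj_onD)
    then show "x = y" using x y \<open>g = g'\<close> by simp
  qed
  ultimately show ?thesis using gset_mult_sub[OF sub] by (simp add: bisection_iff)
qed

lemma bisection_sub: "bisection G \<phi> \<Longrightarrow> \<psi> \<subseteq> \<phi> \<Longrightarrow> bisection G \<psi>"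
  by (auto simp: bisection_iff intro: inj_on_subset)

lemma bisection_word: "(\<And>\<phi>. \<phi> \<in> set l \<Longrightarrow> bisection G \<phi>) \<Longrightarrow> bisection G (word_product G l)"
  by (induction l) (simp_all add: bisection_unit bisection_mult)

lemma emeasure_bisection_le_1: assumes "bisection G \<phi>" shows "emeasure (arrows G) \<phi> \<le> 1"
proof -
  have "emeasure (arrows G) \<phi> = emeasure (base G) (source G ` \<phi>)"
    using assms by (intro emeasure_st_image_eq[symmetric]) (auto simp: is_st_def bisection_iff)
  also have "\<dots> \<le> 1" using prob_space.measure_le_1[OF prob_base]
    by (simp add: finite_measure.emeasure_eq_measure prob_space_def)
  finally show ?thesis .
qed

end

lemma fin_groupoidI: "finite_pmp_groupoid G \<Longrightarrow> fin_groupoid G"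
  by standard (simp_all add: finite_pmp_groupoid_def pmp_groupoid_def)

section \<open>Ultraproducts of finite graphed groupoids\<close>

locale graphed_ultraproduct = np_ultrafilter \<UU> for \<UU> +
  fixes G :: "nat \<Rightarrow> 'a groupoid" and S :: "'i set" and \<Phi> :: "nat \<Rightarrow> 'i \<Rightarrow> 'a set"
  assumes fin_S: "finite S"
    and fin_G: "\<And>n. finite_pmp_groupoid (G n)"
    and graphed_G: "\<And>n. graphed_groupoid (G n) S (\<Phi> n)"
begin

sublocale fg: fin_groupoid "G n" for n
  using fin_G by (rule fin_groupoidI)

abbreviation "H \<equiv> ultraproduct \<UU> G S \<Phi>"
abbreviation "AA n \<equiv> space (arrows (G n))"
abbreviation "XX n \<equiv> space (base (G n))"
definition "wball L n = word_ball (G n) (\<Phi> n ` S) L"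

lemma wball_eq: "wball L n = arrow_ball (G n) (\<Union>s\<in>S. \<Phi> n s) L"
  by (simp add: wball_def word_ball_eq)

lemma \<Phi>_bis: "s \<in> S \<Longrightarrow> bisection (G n) (\<Phi> n s)"
  using graphed_G[of n] by (simp add: graphed_groupoid_def graphing_def)

lemma \<Phi>_sub: "(\<Union>s\<in>S. \<Phi> n s) \<subseteq> AA n"
  using \<Phi>_bis fg.bisection_iff by blast

lemma \<Phi>_gen: "AA n = (\<Union>L. wball L n)"
proof -
  have "generating (G n) S (\<Phi> n)" using graphed_G[of n] by (simp add: graphed_groupoid_def)
  then have "AA n \<subseteq> (\<Union>L. wball L n)" unfolding wball_eq using fg.generating_iff[OF \<Phi>_sub] by blast
  moreover have "(\<Union>L. wball L n) \<subseteq> AA n" unfolding wball_eq using fg.arrow_ball_sub[OF \<Phi>_sub] by blast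
  ultimately show ?thesis by blast
qed

lemma wball_sub: "wball L n \<subseteq> AA n"
  using \<Phi>_gen by blast

lemma wball_mono: "L \<le> L' \<Longrightarrow> wball L n \<subseteq> wball L' n"
  unfolding wball_eq by (rule arrow_ball_mono_len)

lemma XX_ball: "XX n \<subseteq> wball L n"
  unfolding wball_eq by (rule fg.ball_Ob)

lemma XX_ne: "XX n \<noteq> {}"
  using prob_space.not_empty[OF fg.prob_base] .

text \<open>A formal letter is a label with a sign, so words do not depend on n. The number of words
  of length at most L then bounds the measure of the ball of radius L at every index, and each word
  gives a bisection at every index and hence one in the ultraproduct.\<close>

definition "letter n = (\<lambda>(s, b). if b then \<Phi> n s else ginv (G n) ` \<Phi> n s)"
definition "W w n = word_product (G n) (map (letter n) w)"
definition "words L = {w. set w \<subseteq> S \<times> (UNIV :: bool set) \<and> length w \<le> L}"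

lemma finite_words: "finite (words L)"
  unfolding words_def using fin_S by (intro finite_lists_length_le) simp

lemma words_ball: "wball L n = (\<Union>w\<in>words L. W w n)"
proof -
  let ?F = "\<Phi> n ` S \<union> (\<lambda>\<phi>. ginv (G n) ` \<phi>) ` (\<Phi> n ` S)"
  have F: "?F = letter n ` (S \<times> UNIV)"
  proof (intro Set.set_eqI iffI)
    fix \<phi> assume "\<phi> \<in> ?F"
    then consider s where "s \<in> S" "\<phi> = letter n (s, True)" | s where "s \<in> S" "\<phi> = letter n (s, False)"
      by (auto simp: letter_def)
    then show "\<phi> \<in> letter n ` (S \<times> UNIV)" by cases auto
  next
    fix \<phi> assume "\<phi> \<in> letter n ` (S \<times> UNIV)"
    then show "\<phi> \<in> ?F" by (auto simp: letter_def split: if_splits)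
  qed
  have "{l. set l \<subseteq> ?F \<and> length l \<le> L} = map (letter n) ` words L"
  proof (intro Set.set_eqI iffI)
    fix l assume "l \<in> {l. set l \<subseteq> ?F \<and> length l \<le> L}"
    then have l: "l \<in> lists (letter n ` (S \<times> UNIV))" "length l \<le> L" using F by (auto simp: in_lists_conv_set)
    then obtain w where "w \<in> lists (S \<times> UNIV)" "l = map (letter n) w"
      unfolding lists_image by blast
    then show "l \<in> map (letter n) ` words L" using l by (auto simp: words_def)
  next
    fix l assume "l \<in> map (letter n) ` words L"
    then obtain w where "l = map (letter n) w" "set w \<subseteq> S \<times> UNIV" "length w \<le> L" by (auto simp: words_def)
    then show "l \<in> {l. set l \<subseteq> ?F \<and> length l \<le> L}" unfolding F using image_mono[of "set w"] by simp
  qed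
  then have "{word_product (G n) l | l. set l \<subseteq> ?F \<and> length l \<le> L} = (\<lambda>w. W w n) ` words L"
    unfolding W_def by (auto simp: set_eq_iff image_iff)
  then show ?thesis unfolding wball_def word_ball_def by simp
qed

lemma letter_bis: "l \<in> S \<times> UNIV \<Longrightarrow> bisection (G n) (letter n l)"
  using \<Phi>_bis fg.bisection_inv by (auto simp: letter_def split: prod.splits)

lemma W_bis: "w \<in> words L \<Longrightarrow> bisection (G n) (W w n)"
  unfolding W_def by (rule fg.bisection_word) (auto simp: words_def intro: letter_bis)

lemma W_ball: "w \<in> words L \<Longrightarrow> W w n \<subseteq> wball L n"
  unfolding words_ball by blast

lemma emeasure_ball: "emeasure (arrows (G n)) (wball L n) \<le> ennreal (card (words L))"
proof -
  have "emeasure (arrows (G n)) (wball L n) \<le> (\<Sum>w\<in>words L. emeasure (arrows (G n)) (W w n))"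
    unfolding words_ball using W_bis finite_words
    by (intro emeasure_subadditive_finite) (auto simp: bisection_def)
  also have "\<dots> \<le> (\<Sum>w\<in>words L. 1)" using W_bis fg.emeasure_bisection_le_1 by (intro sum_mono) blast
  also have "\<dots> = ennreal (card (words L))" by (simp add: ennreal_of_nat_eq_real_of_nat)
  finally show ?thesis .
qed

sublocale ar: loeb_space \<UU> "\<lambda>n. arrows (G n)" wball
proof
  show "wball L n \<in> sets (arrows (G n))" for L n using wball_sub by (simp add: fg.sets_Ar)
  show "wball 0 n \<noteq> {}" for n using XX_ball XX_ne by blast
  show "\<exists>C::real. \<forall>n. emeasure (arrows (G n)) (wball L n) \<le> ennreal C" for L
    using emeasure_ball by blast
qed (rule wball_mono)

sublocale ba: loeb_space \<UU> "\<lambda>n. base (G n)" "\<lambda>_ n. XX n"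
proof
  show "\<exists>C::real. \<forall>n. emeasure (base (G n)) (XX n) \<le> ennreal C"
    using prob_space.emeasure_space_1[OF fg.prob_base] by (intro exI[of _ 1]) simp
qed (use XX_ne in auto)

lemma ar_internal: "E \<in> ar.internal \<longleftrightarrow> (\<exists>L. \<forall>n. E n \<subseteq> wball L n)"
  using wball_sub unfolding ar.internal_def fg.sets_Ar by (blast intro: order_trans)

lemma ba_internal: "E \<in> ba.internal \<longleftrightarrow> (\<forall>n. E n \<subseteq> XX n)"
  by (auto simp: ba.internal_def fg.sets_Ob)

lemma arrows_H: "arrows H = ar.loeb"
proof -
  have 1: "{cl g | g. (\<forall>n. g n \<in> AA n) \<and> (\<exists>L. \<forall>n. g n \<in> word_ball (G n) (\<Phi> n ` S) L)} = ar.\<Omega>"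
    unfolding ar.\<Omega>_def wball_def[symmetric] using wball_sub by blast
  have 2: "bounded_sets G S \<Phi> = ar.internal"
    unfolding bounded_sets_def ar.internal_def wball_def ..
  show ?thesis by (simp add: ultraproduct_def ar.loeb_def 1 2)
qed

lemma base_H: "base H = ba.loeb"
proof -
  have 1: "{cl x | x. \<forall>n. x n \<in> XX n} = ba.\<Omega>" by (simp add: ba.\<Omega>_def)
  have 2: "{A. \<forall>n. A n \<in> sets (base (G n))} = ba.internal"
    unfolding ba_internal fg.sets_Ob Pow_iff set_eq_iff[of "{A. \<forall>n. A n \<subseteq> XX n}"] by (simp add: ba_internal)
  show ?thesis by (simp add: ultraproduct_def ba.loeb_def 1 2)
qed

lemma space_arrows_H: "space (arrows H) = ar.\<Omega>" by (simp add: arrows_H ar.space_loeb)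
lemma space_base_H: "space (base H) = ba.\<Omega>" by (simp add: base_H ba.space_loeb)
lemma ba_\<Omega>: "ba.\<Omega> = us XX" using ba.\<Omega>_eq by simp

definition lift :: "(nat \<Rightarrow> 'a \<Rightarrow> 'a) \<Rightarrow> (nat \<Rightarrow> 'a) set \<Rightarrow> (nat \<Rightarrow> 'a) set" where
  "lift p c = (\<Union>g\<in>c. cl (\<lambda>n. p n (g n)))"

lemma lift_cl: "lift p (cl g) = cl (\<lambda>n. p n (g n))"
  unfolding lift_def by (rule Union_ultraclass)

lemma source_H: "source H = lift (\<lambda>n. source (G n))"
  and target_H: "target H = lift (\<lambda>n. target (G n))"
  and ginv_H: "ginv H = lift (\<lambda>n. ginv (G n))"
  by (simp_all add: ultraproduct_def lift_def fun_eq_iff)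

lemma gmult_H: "gmult H (cl g) (cl h) = cl (\<lambda>n. gmult (G n) (g n) (h n))"
proof -
  have "gmult H (cl g) (cl h) = (\<Union>g\<in>cl g. cl (\<lambda>n. gmult (G n) (g n) (h n)))"
    using Union_ultraclass[of \<UU> "\<lambda>n. gmult (G n) (k n)" h for k] by (simp add: ultraproduct_def)
  also have "\<dots> = cl (\<lambda>n. gmult (G n) (g n) (h n))"
    using Union_ultraclass[of \<UU> "\<lambda>n x. gmult (G n) x (h n)" g] by simp
  finally show ?thesis .
qed

text \<open>The existential quantifier in an image is moved inside the ultraproduct by choosing a
  witness at almost every index; \<open>gset_mult_us\<close> repeats this for pairs.\<close>

lemma lift_image: "lift p ` us A = us (\<lambda>n. p n ` A n)"
proof (intro Set.set_eqI iffI)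
  fix c assume "c \<in> lift p ` us A"
  then obtain g where g: "c = lift p (cl g)" "\<forall>\<^sub>F n in \<UU>. g n \<in> A n" by (auto elim: us_cases)
  then show "c \<in> us (\<lambda>n. p n ` A n)"
    by (auto simp: lift_cl cl_mem_us elim: eventually_mono)
next
  fix c assume "c \<in> us (\<lambda>n. p n ` A n)"
  then obtain k where k: "c = cl k" "\<forall>\<^sub>F n in \<UU>. k n \<in> p n ` A n" by (rule us_cases)
  define g where "g n = (SOME x. x \<in> A n \<and> k n = p n x)" for n
  have g: "\<forall>\<^sub>F n in \<UU>. g n \<in> A n \<and> k n = p n (g n)"
    using k(2)
  proof eventually_elim
    case (elim n)
    then have "\<exists>x. x \<in> A n \<and> k n = p n x" by blast
    then show ?case unfolding g_def by (rule someI_ex)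
  qed
  then have "cl g \<in> us A" "c = lift p (cl g)"
    by (auto simp: k(1) lift_cl cl_mem_us ultraclass_eq_iff elim: eventually_mono)
  then show "c \<in> lift p ` us A" by blast
qed

lemma gset_mult_us: "gset_mult H (us A) (us B) = us (\<lambda>n. gset_mult (G n) (A n) (B n))"
proof (intro Set.set_eqI iffI)
  fix c assume "c \<in> gset_mult H (us A) (us B)"
  then obtain a b where "c = gmult H a b" "a \<in> us A" "b \<in> us B" "source H a = target H b"
    by (auto simp: gset_mult_def)
  moreover from this obtain g where "a = cl g" "\<forall>\<^sub>F n in \<UU>. g n \<in> A n" by (elim us_cases)
  moreover from calculation obtain h where "b = cl h" "\<forall>\<^sub>F n in \<UU>. h n \<in> B n" by (elim us_cases)
  ultimately have gh: "c = gmult H (cl g) (cl h)" "\<forall>\<^sub>F n in \<UU>. g n \<in> A n" "\<forall>\<^sub>F n in \<UU>. h n \<in> B n"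
    "\<forall>\<^sub>F n in \<UU>. source (G n) (g n) = target (G n) (h n)"
    by (simp_all add: source_H target_H lift_cl ultraclass_eq_iff)
  have "\<forall>\<^sub>F n in \<UU>. gmult (G n) (g n) (h n) \<in> gset_mult (G n) (A n) (B n)"
    using gh(2-4) by eventually_elim (auto simp: gset_mult_def)
  then show "c \<in> us (\<lambda>n. gset_mult (G n) (A n) (B n))" by (simp add: gh(1) gmult_H cl_mem_us)
next
  fix c assume "c \<in> us (\<lambda>n. gset_mult (G n) (A n) (B n))"
  then obtain k where k: "c = cl k" "\<forall>\<^sub>F n in \<UU>. k n \<in> gset_mult (G n) (A n) (B n)" by (rule us_cases)
  let ?P = "\<lambda>n x. k n = gmult (G n) (fst x) (snd x) \<and> fst x \<in> A n \<and> snd x \<in> B n \<and>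
    source (G n) (fst x) = target (G n) (snd x)"
  define f where "f n = (SOME x. ?P n x)" for n
  have f: "\<forall>\<^sub>F n in \<UU>. ?P n (f n)"
    using k(2)
  proof eventually_elim
    case (elim n)
    then have "\<exists>x. ?P n x" by (auto simp: gset_mult_def)
    then show ?case unfolding f_def by (rule someI_ex)
  qed
  let ?g = "\<lambda>n. fst (f n)" and ?h = "\<lambda>n. snd (f n)"
  have "cl ?g \<in> us A" "cl ?h \<in> us B" "c = gmult H (cl ?g) (cl ?h)" "source H (cl ?g) = target H (cl ?h)"
    using f by (auto simp: k(1) gmult_H source_H target_H lift_cl cl_mem_us ultraclass_eq_iff elim: eventually_mono)
  then show "c \<in> gset_mult H (us A) (us B)" unfolding gset_mult_def by blast
qed

text \<open>Balls of fixed radius use finitely many images, products and unions, each of which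
  commutes with ultraproducts. The union over all radii need not commute, which is why only bounded
  words pass between the groupoids and the ultraproduct.\<close>

lemma arrow_ball_us: "arrow_ball H (us E) L = us (\<lambda>n. arrow_ball (G n) (E n) L)"
proof (induction L)
  case 0
  show ?case by (simp add: space_base_H ba_\<Omega>)
next
  case (Suc L)
  then show ?case
    by (simp only: arrow_ball.simps us_Un ginv_H lift_image gset_mult_us flip: us_Un)
qed

lemma ar_\<Omega>_cases:
  assumes "c \<in> ar.\<Omega>" obtains g L where "c = cl g" "\<And>n. g n \<in> wball L n" "\<And>n. g n \<in> AA n"
  using ar.\<Omega>_cases[OF assms] wball_sub by (metis subsetD)

lemma ba_\<Omega>_cases:
  assumes "c \<in> ba.\<Omega>" obtains x where "c = cl x" "\<And>n. x n \<in> XX n"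
  using ba.\<Omega>_cases[OF assms] by metis

text \<open>The laws hold coordinatewise, but two classes are composable as soon as almost all of
  their coordinates are; a product is therefore bounded only almost everywhere, which
  \<open>ar.cl_mem_\<Omega>\<close> accepts.\<close>

lemma groupoid_H: "groupoid_laws H"
proof -
  have src: "source H (cl g) = cl (\<lambda>n. source (G n) (g n))"
    and tgt: "target H (cl g) = cl (\<lambda>n. target (G n) (g n))"
    and inv: "ginv H (cl g) = cl (\<lambda>n. ginv (G n) (g n))" for g
    by (simp_all add: source_H target_H ginv_H lift_cl)
  note cls = src tgt inv gmult_H ultraclass_eq_iff
  have base: "cl x \<in> ba.\<Omega>" if "\<And>n. x n \<in> XX n" for x
    using that by (auto simp: ba.\<Omega>_def)
  have mult: "cl (\<lambda>n. gmult (G n) (g n) (h n)) \<in> ar.\<Omega>"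
    if "\<And>n. g n \<in> wball L n" "\<And>n. h n \<in> wball L' n" "\<forall>\<^sub>F n in \<UU>. source (G n) (g n) = target (G n) (h n)"
    for g h L L'
  proof -
    have "\<forall>\<^sub>F n in \<UU>. gmult (G n) (g n) (h n) \<in> wball (L + L') n"
      using that(3)
    proof eventually_elim
      case (elim n)
      then show ?case using fg.ball_mult[OF \<Phi>_sub] that(1,2) unfolding wball_eq by blast
    qed
    then show ?thesis using ar.cl_mem_\<Omega> by blast
  qed
  show ?thesis
    unfolding groupoid_laws_def space_arrows_H space_base_H
  proof (intro conjI ballI impI subsetI)
    show "c \<in> ar.\<Omega>" if "c \<in> ba.\<Omega>" for c
    proof -
      obtain x where "c = cl x" "\<And>n. x n \<in> XX n" using \<open>c \<in> ba.\<Omega>\<close> by (rule ba_\<Omega>_cases) blast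
      then show ?thesis unfolding ar.\<Omega>_def using XX_ball[of _ 0] by blast
    qed
    show "source H c \<in> ba.\<Omega>" "target H c \<in> ba.\<Omega>" if "c \<in> ar.\<Omega>" for c
      using that by (auto elim!: ar_\<Omega>_cases simp: src tgt fg.s_in fg.t_in intro!: base)
    show "source H c = c" "target H c = c" if "c \<in> ba.\<Omega>" for c
      using that by (auto elim!: ba_\<Omega>_cases simp: cls fg.s_unit fg.t_unit)
    show "gmult H c (source H c) = c" "gmult H (target H c) c = c" if "c \<in> ar.\<Omega>" for c
      using that by (auto elim!: ar_\<Omega>_cases simp: cls fg.mult_s fg.mult_t)
    show "source H (ginv H c) = target H c" "target H (ginv H c) = source H c"
      "gmult H (ginv H c) c = source H c" "gmult H c (ginv H c) = target H c" if "c \<in> ar.\<Omega>" for c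
      using that by (auto elim!: ar_\<Omega>_cases simp: cls fg.s_inv fg.t_inv fg.mult_inv fg.inv_mult)
    show "ginv H c \<in> ar.\<Omega>" if "c \<in> ar.\<Omega>" for c
    proof -
      obtain g L where g: "c = cl g" "\<And>n. g n \<in> wball L n" using \<open>c \<in> ar.\<Omega>\<close> by (rule ar.\<Omega>_cases) blast
      then have "\<And>n. ginv (G n) (g n) \<in> wball L n" using fg.ball_inv[OF \<Phi>_sub] unfolding wball_eq by blast
      then show ?thesis by (auto simp: g(1) inv ar.\<Omega>_def)
    qed
    fix c d assume "c \<in> ar.\<Omega>" "d \<in> ar.\<Omega>" and cd: "source H c = target H d"
    then obtain g h L L' where g: "c = cl g" "\<And>n. g n \<in> wball L n" "\<And>n. g n \<in> AA n"
      and h: "d = cl h" "\<And>n. h n \<in> wball L' n" "\<And>n. h n \<in> AA n"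
      by (metis ar_\<Omega>_cases)
    have ev: "\<forall>\<^sub>F n in \<UU>. source (G n) (g n) = target (G n) (h n)"
      using cd by (simp add: g(1) h(1) cls)
    show "gmult H c d \<in> ar.\<Omega>" using mult[OF g(2) h(2) ev] by (simp add: g(1) h(1) gmult_H)
    show "source H (gmult H c d) = source H d" "target H (gmult H c d) = target H c"
      using ev by (auto simp: g h cls fg.s_mult fg.t_mult elim!: eventually_mono)
    fix e assume "e \<in> ar.\<Omega>" and de: "source H d = target H e"
    then obtain k where k: "e = cl k" "\<And>n. k n \<in> AA n" by (metis ar_\<Omega>_cases)
    have ev': "\<forall>\<^sub>F n in \<UU>. source (G n) (h n) = target (G n) (k n)"
      using de by (simp add: k(1) h(1) cls)
    show "gmult H (gmult H c d) e = gmult H c (gmult H d e)"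
      unfolding g h k cls using ev ev' by eventually_elim (simp add: fg.mult_assoc g h k)
  qed
qed

sublocale H: groupoid H by standard (rule groupoid_H)

end

text \<open>
  Loeb spaces are not countably separated; the assumption \<open>separated\<close> only distinguishes the two
  ends of an arrow, which is what makes a standard factor of an essentially free action free.
\<close>

locale fibred_groupoid = groupoid +
  assumes prob: "prob_space (base G)"
    and complete_ar: "\<And>N A. N \<in> null_sets (arrows G) \<Longrightarrow> A \<subseteq> N \<Longrightarrow> A \<in> null_sets (arrows G)"
    and complete_ba: "\<And>N A. N \<in> null_sets (base G) \<Longrightarrow> A \<subseteq> N \<Longrightarrow> A \<in> null_sets (base G)"
    and st_meas: "\<And>p. p = source G \<or> p = target G \<Longrightarrow> p \<in> arrows G \<rightarrow>\<^sub>M base G"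
    and st_image: "\<And>p A. p = source G \<or> p = target G \<Longrightarrow> A \<in> sets (arrows G) \<Longrightarrow> inj_on p A \<Longrightarrow>
      p ` A \<in> sets (base G) \<and> emeasure (base G) (p ` A) = emeasure (arrows G) A"
    and Ob_sets: "Ob \<in> sets (arrows G)"
    and cover: "\<exists>\<beta> :: nat \<Rightarrow> _. (\<forall>k. bisection G (\<beta> k)) \<and> (\<Union>k. \<beta> k) = Ar"
    and separated: "\<exists>\<B> :: nat \<Rightarrow> _. (\<forall>k. \<B> k \<in> sets (base G)) \<and>
      (\<forall>c\<in>Ar. source G c \<noteq> target G c \<longrightarrow> (\<exists>k. source G c \<in> \<B> k \<and> target G c \<notin> \<B> k))"

text \<open>View \<phi> as a graph whose edges join \<open>s g\<close> and \<open>t g\<close>. As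
  both maps are injective, a new vertex has at most two neighbours, one along an edge that starts
  there and one along an edge that ends there, so a third colour is free. The number of colours is
  independent of V, which lets the colour classes pass to an ultraproduct.\<close>

lemma three_colouring:
  fixes \<phi> :: "'g set" and s t :: "'g \<Rightarrow> 'v"
  assumes "finite V" "inj_on s \<phi>" "inj_on t \<phi>"
  shows "\<exists>c :: 'v \<Rightarrow> nat. (\<forall>v. c v < 3) \<and>
    (\<forall>g\<in>\<phi>. s g \<in> V \<longrightarrow> t g \<in> V \<longrightarrow> s g \<noteq> t g \<longrightarrow> c (s g) \<noteq> c (t g))"
  using assms(1)
proof (induction V rule: finite_induct)
  case empty
  then show ?case by (intro exI[of _ "\<lambda>_. 0"]) simp
next
  case (insert v V)
  then obtain c where c: "\<And>v. c v < 3" "\<And>g. g \<in> \<phi> \<Longrightarrow> s g \<in> V \<Longrightarrow> t g \<in> V \<Longrightarrow> s g \<noteq> t g \<Longrightarrow> c (s g) \<noteq> (c (t g) :: nat)"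
    by blast
  \<comment> \<open>The colours of the two neighbours of v. On a side without an edge the value is
    arbitrary and merely excludes one more colour.\<close>
  define a where "a = c (t (THE g. g \<in> \<phi> \<and> s g = v))"
  define b where "b = c (s (THE g. g \<in> \<phi> \<and> t g = v))"
  have a: "c (t g) = a" if "g \<in> \<phi>" "s g = v" for g
  proof -
    have "(THE g. g \<in> \<phi> \<and> s g = v) = g"
      using that assms(2) by (intro the_equality) (auto dest: inj_onD)
    then show ?thesis by (simp add: a_def)
  qed
  have b: "c (s g) = b" if "g \<in> \<phi>" "t g = v" for g
  proof -
    have "(THE g. g \<in> \<phi> \<and> t g = v) = g"
      using that assms(3) by (intro the_equality) (auto dest: inj_onD)
    then show ?thesis by (simp add: b_def)
  qed
  have "card {a, b} < card {..<3::nat}" by (simp add: card_insert_if)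
  then have "\<not> {..<3} \<subseteq> {a, b}" by (metis card_mono finite.emptyI finite.insertI leD)
  then obtain d where d: "d < 3" "d \<noteq> a" "d \<noteq> b" by auto
  show ?case
  proof (intro exI[of _ "c(v := d)"] conjI allI ballI impI)
    show "(c(v := d)) x < 3" for x using c d by simp
    fix g assume g: "g \<in> \<phi>" "s g \<in> insert v V" "t g \<in> insert v V" "s g \<noteq> t g"
    show "(c(v := d)) (s g) \<noteq> (c(v := d)) (t g)"
      using g c(2)[of g] d a[of g] b[of g] by (cases "s g = v"; cases "t g = v") auto
  qed
qed

section \<open>Source and target of the ultraproduct as measure preserving maps\<close>

context graphed_ultraproduct
begin

lemma W_internal: "w \<in> words L \<Longrightarrow> W w \<in> ar.internal"
  unfolding ar_internal using W_ball by blast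

lemma ar_internal_sub: "E \<in> ar.internal \<Longrightarrow> (\<And>n. F n \<subseteq> E n) \<Longrightarrow> F \<in> ar.internal"
  unfolding ar_internal by (meson order_trans)

definition is_st :: "(nat \<Rightarrow> 'a \<Rightarrow> 'a) \<Rightarrow> bool" where
  "is_st p \<longleftrightarrow> p = (\<lambda>n. source (G n)) \<or> p = (\<lambda>n. target (G n))"

lemma is_stD: "is_st p \<Longrightarrow> fg.is_st n (p n)"
  by (auto simp: is_st_def fg.is_st_def)

lemma st_in: "is_st p \<Longrightarrow> A \<subseteq> AA n \<Longrightarrow> p n ` A \<subseteq> XX n"
  using fg.st_in is_stD by blast

lemma lift_st_in: "is_st p \<Longrightarrow> c \<in> ar.\<Omega> \<Longrightarrow> lift p c \<in> ba.\<Omega>"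
  using H.s_in H.t_in unfolding space_arrows_H space_base_H source_H target_H is_st_def by blast

lemma W_inj: "is_st p \<Longrightarrow> w \<in> words L \<Longrightarrow> inj_on (p n) (W w n)"
  using W_bis[of w L n] by (auto simp: is_st_def bisection_def)

lemma inj_lift:
  assumes "\<And>n. inj_on (p n) (A n)" shows "inj_on (lift p) (us A)"
proof (rule inj_onI)
  fix c d assume "c \<in> us A" "d \<in> us A" and eq: "lift p c = lift p d"
  then obtain g h where g: "c = cl g" "\<forall>\<^sub>F n in \<UU>. g n \<in> A n" and h: "d = cl h" "\<forall>\<^sub>F n in \<UU>. h n \<in> A n"
    by (elim us_cases) blast
  have "\<forall>\<^sub>F n in \<UU>. p n (g n) = p n (h n)" using eq by (simp add: g h lift_cl ultraclass_eq_iff)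
  with g(2) h(2) have "\<forall>\<^sub>F n in \<UU>. g n = h n"
    by eventually_elim (use assms in \<open>auto dest: inj_onD\<close>)
  then show "c = d" by (simp add: g h ultraclass_eq_iff)
qed

text \<open>On each word p is injective and preserves measure, so inside a ball the measure of a
  preimage grows at most by the number of words. This factor does not depend on n, so null sets of
  units pull back to null sets in the ultraproduct.\<close>

lemma emeasure_preimage:
  assumes p: "is_st p" and F: "F \<subseteq> XX n"
  shows "emeasure (arrows (G n)) {g \<in> wball L n. p n g \<in> F} \<le> of_nat (card (words L)) * emeasure (base (G n)) F"
proof -
  have eq: "{g \<in> wball L n. p n g \<in> F} = (\<Union>w\<in>words L. {g \<in> W w n. p n g \<in> F})"
    unfolding words_ball by blast
  have sub: "{g \<in> W w n. p n g \<in> F} \<subseteq> AA n" if "w \<in> words L" for w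
    using W_ball[OF that, of n] wball_sub by blast
  have "emeasure (arrows (G n)) {g \<in> W w n. p n g \<in> F} \<le> emeasure (base (G n)) F" if "w \<in> words L" for w
  proof -
    have "emeasure (arrows (G n)) {g \<in> W w n. p n g \<in> F} = emeasure (base (G n)) (p n ` {g \<in> W w n. p n g \<in> F})"
      using sub[OF that] W_inj[OF p that] is_stD[OF p]
      by (intro fg.emeasure_st_image_eq[symmetric]) (auto intro: inj_on_subset)
    also have "\<dots> \<le> emeasure (base (G n)) F" using F by (intro emeasure_mono) (auto simp: fg.sets_Ob)
    finally show ?thesis .
  qed
  then have "(\<Sum>w\<in>words L. emeasure (arrows (G n)) {g \<in> W w n. p n g \<in> F}) \<le> (\<Sum>w\<in>words L. emeasure (base (G n)) F)"
    by (rule sum_mono)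
  moreover have "emeasure (arrows (G n)) (\<Union>w\<in>words L. {g \<in> W w n. p n g \<in> F}) \<le>
      (\<Sum>w\<in>words L. emeasure (arrows (G n)) {g \<in> W w n. p n g \<in> F})"
    using sub finite_words by (intro emeasure_subadditive_finite) (auto simp: fg.sets_Ar)
  ultimately have "emeasure (arrows (G n)) (\<Union>w\<in>words L. {g \<in> W w n. p n g \<in> F}) \<le>
      (\<Sum>w\<in>words L. emeasure (base (G n)) F)" by (rule order_trans[rotated])
  then show ?thesis unfolding eq by simp
qed

lemma lift_preimage_us:
  assumes "is_st p" "\<And>n. F n \<subseteq> XX n"
  shows "lift p -` us F \<inter> us (wball L) = us (\<lambda>n. {g \<in> wball L n. p n g \<in> F n})"
proof (rule range_cl_eqI)
  show "lift p -` us F \<inter> us (wball L) \<subseteq> range cl" by (rule le_infI2) (rule us_range)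
  show "us (\<lambda>n. {g \<in> wball L n. p n g \<in> F n}) \<subseteq> range cl" by (rule us_range)
  fix g
  have "cl g \<in> lift p -` us F \<inter> us (wball L) \<longleftrightarrow>
      (\<forall>\<^sub>F n in \<UU>. p n (g n) \<in> F n) \<and> (\<forall>\<^sub>F n in \<UU>. g n \<in> wball L n)"
    by (simp only: Int_iff vimage_eq lift_cl cl_mem_us)
  also have "\<dots> \<longleftrightarrow> cl g \<in> us (\<lambda>n. {g \<in> wball L n. p n g \<in> F n})"
    by (simp only: cl_mem_us mem_Collect_eq eventually_conj_iff conj_commute)
  finally show "cl g \<in> lift p -` us F \<inter> us (wball L) \<longleftrightarrow>
      cl g \<in> us (\<lambda>n. {g \<in> wball L n. p n g \<in> F n})" .
qed

lemma lift_preimage_null: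
  assumes p: "is_st p" and N: "N \<in> null_sets ba.loeb"
  shows "lift p -` N \<inter> ar.\<Omega> \<in> null_sets ar.loeb"
proof (rule ar.null_criterion)
  fix L and e :: real assume "e > 0"
  \<comment> \<open>The summand 1 makes the divisor visibly positive.\<close>
  define K where "K = real (card (words L)) + 1"
  have "K > 0" by (simp add: K_def add_nonneg_pos)
  then have "e / K > 0" using \<open>e > 0\<close> by simp
  then obtain F where F: "F \<in> ba.internal" "N \<inter> us XX \<subseteq> us F" "ba.vol F \<le> ennreal (e / K)"
    by (rule ba.null_cover[OF N])
  have FX: "F n \<subseteq> XX n" for n using F(1) ba_internal by blast
  let ?E = "\<lambda>n. {g \<in> wball L n. p n g \<in> F n}"
  have "?E \<in> ar.internal" unfolding ar_internal by blast
  moreover have "(lift p -` N \<inter> ar.\<Omega>) \<inter> us (wball L) \<subseteq> us ?E"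
  proof -
    have "N \<subseteq> us F"
      using F(2) N sets.sets_into_space[of N ba.loeb] unfolding ba.space_loeb ba_\<Omega> by blast
    then show ?thesis unfolding lift_preimage_us[OF p FX, symmetric] by blast
  qed
  moreover have "ar.vol ?E \<le> ennreal e"
  proof -
    have "ar.vol ?E \<le> Lim \<UU> (\<lambda>n. of_nat (card (words L)) * emeasure (base (G n)) (F n))"
      unfolding ar.vol_def by (intro Lim_mono always_eventually allI emeasure_preimage p FX)
    also have "\<dots> = of_nat (card (words L)) * ba.vol F"
      unfolding ba.vol_def by (intro LimI ennreal_tendsto_cmult has_Lim of_nat_less_top)
    also have "\<dots> \<le> of_nat (card (words L)) * ennreal (e / K)" using F(3) by (intro mult_left_mono) auto
    also have "\<dots> = ennreal (card (words L) * (e / K))"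
      using \<open>e / K > 0\<close> ennreal_mult[of "real (card (words L))" "e / K"]
      by (simp only: ennreal_of_nat_eq_real_of_nat of_nat_0_le_iff less_imp_le)
    also have "\<dots> \<le> ennreal e"
      using \<open>K > 0\<close> \<open>e > 0\<close> by (intro ennreal_leI) (simp add: field_simps K_def)
    finally show ?thesis .
  qed
  ultimately show "\<exists>F\<in>ar.internal. (lift p -` N \<inter> ar.\<Omega>) \<inter> us (wball L) \<subseteq> us F \<and> ar.vol F \<le> ennreal e" by blast
qed simp

text \<open>Modulo a null set a Loeb set of units is internal. The preimage of an internal set is
  internal within each ball, and preimages of null sets are null.\<close>

lemma lift_measurable:
  assumes p: "is_st p" shows "lift p \<in> ar.loeb \<rightarrow>\<^sub>M ba.loeb"
proof (rule measurableI)
  show "lift p c \<in> space ba.loeb" if "c \<in> space ar.loeb" for c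
    using that lift_st_in[OF p] by (simp add: ar.space_loeb ba.space_loeb)
  fix A assume A: "A \<in> sets ba.loeb"
  have "A \<subseteq> us (XX)" using sets.sets_into_space[OF A] by (simp add: ba.space_loeb ba_\<Omega>)
  then obtain E where E: "E \<in> ba.internal" "sym_diff A (us E) \<in> null_sets ba.loeb"
    by (rule ba.internal_approx[OF A])
  have EX: "E n \<subseteq> XX n" for n using E(1) ba_internal by blast
  have 1: "lift p -` us E \<inter> ar.\<Omega> \<in> sets ar.loeb"
  proof (rule ar.sets_loeb_local)
    fix L
    have "us (wball L) \<subseteq> ar.\<Omega>" by (rule ar.us_internal_\<Omega>[OF ar.internal_B])
    then have "(lift p -` us E \<inter> ar.\<Omega>) \<inter> us (wball L) = us (\<lambda>n. {g \<in> wball L n. p n g \<in> E n})"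
      unfolding lift_preimage_us[OF p EX, symmetric] by blast
    also have "\<dots> \<in> sets ar.loeb" by (rule ar.us_sets) (auto simp: ar_internal)
    finally show "(lift p -` us E \<inter> ar.\<Omega>) \<inter> us (wball L) \<in> sets ar.loeb" .
  qed simp
  have "lift p -` sym_diff A (us E) \<inter> ar.\<Omega> \<in> null_sets ar.loeb" by (rule lift_preimage_null[OF p E(2)])
  then have "sym_diff (lift p -` A \<inter> ar.\<Omega>) (lift p -` us E \<inter> ar.\<Omega>) \<in> null_sets ar.loeb"
    by (rule ar.complete_loeb) blast
  from ar.null_diff_sets(1)[OF 1 this] show "lift p -` A \<inter> space ar.loeb \<in> sets ar.loeb"
    by (simp add: ar.space_loeb)
qed

lemma lift_image_null:
  assumes p: "is_st p" and N: "N \<in> null_sets ar.loeb" "N \<subseteq> us (wball L)"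
  shows "lift p ` N \<in> null_sets ba.loeb"
proof (rule ba.null_criterion)
  show "lift p ` N \<subseteq> ba.\<Omega>"
    using lift_st_in[OF p] N(2) ar.us_internal_\<Omega>[OF ar.internal_B] by blast
  fix e :: real assume "e > 0"
  then obtain F where F: "F \<in> ar.internal" "N \<inter> us (wball L) \<subseteq> us F" "ar.vol F \<le> ennreal e"
    using ar.null_cover[OF N(1)] by blast
  have FA: "F n \<subseteq> AA n" for n using F(1) wball_sub unfolding ar_internal by blast
  have "lift p ` N \<inter> us XX \<subseteq> us (\<lambda>n. p n ` F n)" unfolding lift_image[symmetric] using F(2) N(2) by blast
  moreover have "(\<lambda>n. p n ` F n) \<in> ba.internal" unfolding ba_internal using st_in[OF p FA] by blast
  moreover have "ba.vol (\<lambda>n. p n ` F n) \<le> ar.vol F"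
    unfolding ba.vol_def ar.vol_def
    by (intro Lim_mono always_eventually allI fg.emeasure_st_image_le is_stD[OF p] FA)
  ultimately show "\<exists>F\<in>ba.internal. lift p ` N \<inter> us XX \<subseteq> us F \<and> ba.vol F \<le> ennreal e"
    using F(3) by (meson order_trans)
qed

text \<open>Modulo a null set A is internal, and an internal subset of a word is mapped injectively,
  with its measure preserved, at every index. Images of null sets inside a ball are null, so the
  replacement is harmless.\<close>

lemma lift_image_word:
  assumes p: "is_st p" and A: "A \<in> sets ar.loeb" "A \<subseteq> us (W w)" and w: "w \<in> words L"
  shows "lift p ` A \<in> sets ba.loeb" "emeasure ba.loeb (lift p ` A) = emeasure ar.loeb A"
proof -
  have WL: "us (W w) \<subseteq> us (wball L)" by (rule us_mono) (rule W_ball[OF w])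
  with A(2) have "A \<subseteq> us (wball L)" by (rule order_trans)
  then obtain E0 where E0: "E0 \<in> ar.internal" "sym_diff A (us E0) \<in> null_sets ar.loeb"
    by (rule ar.internal_approx[OF A(1)])
  \<comment> \<open>Injectivity at every index requires arrows of the word at every index. Cutting
    down to the word does not enlarge the difference from A, as A lies in the word.\<close>
  define E where "E n = E0 n \<inter> W w n" for n
  have E: "E \<in> ar.internal" "\<And>n. E n \<subseteq> W w n" using W_internal[OF w] by (auto simp: E_def intro: ar_internal_sub)
  have usE: "us E = us E0 \<inter> us (W w)" unfolding E_def by (rule us_Int)
  have null: "sym_diff A (us E) \<in> null_sets ar.loeb"
    by (rule ar.complete_loeb[OF E0(2)]) (use A(2) usE in blast)
  have sub: "sym_diff A (us E) \<subseteq> us (wball L)" using A(2) WL unfolding usE by blast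
  have EA: "E n \<subseteq> AA n" for n using E(2) W_ball[OF w] wball_sub by blast
  have pE: "(\<lambda>n. p n ` E n) \<in> ba.internal" unfolding ba_internal using st_in[OF p EA] by blast
  have d: "sym_diff (lift p ` A) (us (\<lambda>n. p n ` E n)) \<in> null_sets ba.loeb"
    by (rule ba.complete_loeb[OF lift_image_null[OF p null sub]]) (auto simp flip: lift_image)
  show "lift p ` A \<in> sets ba.loeb" by (rule ba.null_diff_sets(1)[OF ba.us_sets[OF pE] d])
  have "emeasure ba.loeb (lift p ` A) = ba.vol (\<lambda>n. p n ` E n)"
    using ba.null_diff_sets(2)[OF ba.us_sets[OF pE] d] ba.emeasure_us[OF pE] by simp
  also have "\<dots> = ar.vol E"
    unfolding ba.vol_def ar.vol_def
    using fg.emeasure_st_image_eq[OF is_stD[OF p] EA inj_on_subset[OF W_inj[OF p w] E(2)]] by simp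
  also have "\<dots> = emeasure ar.loeb A"
    using ar.null_diff_sets(2)[OF ar.us_sets[OF E(1)] null] ar.emeasure_us[OF E(1)] by simp
  finally show "emeasure ba.loeb (lift p ` A) = emeasure ar.loeb A" .
qed

definition "wd k = from_nat_into (\<Union>L. words L) k"

lemma range_wd: "range wd = (\<Union>L. words L)"
  unfolding wd_def
proof (rule range_from_nat_into)
  have "[] \<in> words 0" by (simp add: words_def)
  then show "(\<Union>L. words L) \<noteq> {}" by blast
  show "countable (\<Union>L. words L)" using finite_words by (intro countable_UN) (auto intro: countable_finite)
qed

lemma wd_words: "\<exists>L. wd k \<in> words L"
  using range_wd by blast

lemma \<Omega>_words: "ar.\<Omega> = (\<Union>k. us (W (wd k)))"
proof -
  have "us (wball L) = (\<Union>w\<in>words L. us (W w))" for L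
    unfolding us_UN[OF finite_words, symmetric] words_ball ..
  then have "ar.\<Omega> = (\<Union>L. \<Union>w\<in>words L. us (W w))" unfolding ar.\<Omega>_eq by simp
  also have "\<dots> = (\<Union>w\<in>(\<Union>L. words L). us (W w))" by blast
  finally show ?thesis unfolding range_wd[symmetric] by simp
qed

text \<open>Countably many words cover the arrows. Disjoint pieces of A have disjoint images because
  p is injective on A, so countable additivity on both sides reduces the claim to a single
  word.\<close>

lemma lift_image_inj:
  assumes p: "is_st p" and A: "A \<in> sets ar.loeb" "inj_on (lift p) A"
  shows "lift p ` A \<in> sets ba.loeb \<and> emeasure ba.loeb (lift p ` A) = emeasure ar.loeb A"
proof -
  define D where "D k = A \<inter> disjointed (\<lambda>k. us (W (wd k))) k" for k
  have Ws: "us (W (wd k)) \<in> sets ar.loeb" for k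
    using wd_words[of k] W_internal ar.us_sets by blast
  have D: "D k \<in> sets ar.loeb" for k
    unfolding D_def using A(1) Ws sets.range_disjointed_sets[of "\<lambda>k. us (W (wd k))" ar.loeb] by blast
  have DW: "D k \<subseteq> us (W (wd k))" for k
    unfolding D_def by (rule le_infI2[OF disjointed_subset])
  have "(\<Union>k. D k) = A \<inter> (\<Union>k. us (W (wd k)))"
    using UN_disjointed_eq[of "\<lambda>k. us (W (wd k))"] unfolding D_def by blast
  also have "\<dots> = A"
    using sets.sets_into_space[OF A(1)] unfolding ar.space_loeb \<Omega>_words by (rule inf_absorb1)
  finally have AD: "A = (\<Union>k. D k)" by (rule sym)
  have disj: "disjoint_family D"
    unfolding D_def by (rule disjoint_family_on_bisimulation[OF disjoint_family_disjointed[of "\<lambda>k. us (W (wd k))"]]) blast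
  have im: "lift p ` D k \<in> sets ba.loeb \<and> emeasure ba.loeb (lift p ` D k) = emeasure ar.loeb (D k)" for k
    using wd_words[of k] lift_image_word[OF p D DW] by blast
  have disj': "disjoint_family (\<lambda>k. lift p ` D k)"
    unfolding disjoint_family_on_def
  proof (intro ballI impI)
    fix i j :: nat assume "i \<noteq> j"
    then have "D i \<inter> D j = {}" using disj by (auto simp: disjoint_family_on_def)
    moreover have "D i \<subseteq> A" "D j \<subseteq> A" by (auto simp: D_def)
    ultimately show "lift p ` D i \<inter> lift p ` D j = {}"
      using inj_on_image_Int[OF A(2)] by (metis image_empty)
  qed
  have eq: "lift p ` A = (\<Union>k. lift p ` D k)" using AD by (metis image_UN)
  have "emeasure ba.loeb (lift p ` A) = (\<Sum>k. emeasure ba.loeb (lift p ` D k))"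
    unfolding eq using im disj' by (intro suminf_emeasure[symmetric]) auto
  also have "\<dots> = (\<Sum>k. emeasure ar.loeb (D k))" using im by simp
  also have "\<dots> = emeasure ar.loeb A"
    using suminf_emeasure[of D ar.loeb] D disj AD by auto
  finally show ?thesis unfolding eq using im by auto
qed

text \<open>For every word the units of each finite groupoid are coloured so that the ends of any
  arrow of the word differ unless it is a loop. The ultraproducts of the colour classes form a
  countable family of internal sets, one of which contains the source of a given arrow but not its
  target.\<close>

lemma separated_H:
  "\<exists>\<B> :: nat \<Rightarrow> _. (\<forall>k. \<B> k \<in> sets (base H)) \<and>
      (\<forall>c\<in>space (arrows H). source H c \<noteq> target H c \<longrightarrow> (\<exists>k. source H c \<in> \<B> k \<and> target H c \<notin> \<B> k))"
proof -
  have "\<exists>c :: 'a \<Rightarrow> nat. (\<forall>v. c v < 3) \<and>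
    (\<forall>g\<in>W (wd k) n. source (G n) g \<in> XX n \<longrightarrow> target (G n) g \<in> XX n \<longrightarrow>
      source (G n) g \<noteq> target (G n) g \<longrightarrow> c (source (G n) g) \<noteq> c (target (G n) g))" for k n
  proof -
    obtain L where "wd k \<in> words L" using wd_words by blast
    from W_bis[OF this, of n] show ?thesis
      unfolding bisection_def by (intro three_colouring[OF fg.fin_Ob]) auto
  qed
  then obtain c :: "nat \<Rightarrow> nat \<Rightarrow> 'a \<Rightarrow> nat" where c: "\<And>k n v. c k n v < 3"
    "\<And>k n g. g \<in> W (wd k) n \<Longrightarrow> source (G n) g \<in> XX n \<Longrightarrow> target (G n) g \<in> XX n \<Longrightarrow>
      source (G n) g \<noteq> target (G n) g \<Longrightarrow> c k n (source (G n) g) \<noteq> c k n (target (G n) g)"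
    by metis
  \<comment> \<open>\<open>prod_decode\<close> turns m into the number of a word and a colour;
    colours from 3 on give the empty class.\<close>
  define B where "B m = us (\<lambda>n. {x \<in> XX n. c (fst (prod_decode m)) n x = snd (prod_decode m)})" for m
  have "B m \<in> sets (base H)" for m
    unfolding B_def base_H by (rule ba.us_sets) (auto simp: ba_internal)
  moreover have "\<exists>m. source H a \<in> B m \<and> target H a \<notin> B m"
    if a: "a \<in> space (arrows H)" and ne: "source H a \<noteq> target H a" for a
  proof -
    obtain k where "a \<in> us (W (wd k))" using a unfolding space_arrows_H \<Omega>_words by blast
    then obtain g where g: "a = cl g" "\<forall>\<^sub>F n in \<UU>. g n \<in> W (wd k) n" by (rule us_cases)
    have W: "W (wd k) n \<subseteq> AA n" for n using wd_words[of k] W_ball wball_sub by blast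
    have "\<not> (\<forall>\<^sub>F n in \<UU>. source (G n) (g n) = target (G n) (g n))"
      using ne by (simp add: g source_H target_H lift_cl ultraclass_eq_iff)
    then have ne': "\<forall>\<^sub>F n in \<UU>. source (G n) (g n) \<noteq> target (G n) (g n)" by (simp add: ev_not_iff)
    have X: "\<forall>\<^sub>F n in \<UU>. source (G n) (g n) \<in> XX n \<and> target (G n) (g n) \<in> XX n"
      using g(2) by eventually_elim (use W fg.s_in fg.t_in in blast)
    have "\<forall>\<^sub>F n in \<UU>. c k n (source (G n) (g n)) = 0 \<or> c k n (source (G n) (g n)) = 1 \<or> c k n (source (G n) (g n)) = 2"
    proof (intro always_eventually allI)
      fix n show "c k n (source (G n) (g n)) = 0 \<or> c k n (source (G n) (g n)) = 1 \<or> c k n (source (G n) (g n)) = 2"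
        using c(1)[of k n "source (G n) (g n)"] by linarith
    qed
    \<comment> \<open>An ultrafilter decides which of finitely many alternatives holds almost
      everywhere; an unbounded number of colours would not allow this.\<close>
    then obtain j where j: "\<forall>\<^sub>F n in \<UU>. c k n (source (G n) (g n)) = j"
      unfolding ev_disj_iff by blast
    have t: "\<forall>\<^sub>F n in \<UU>. c k n (target (G n) (g n)) \<noteq> j"
      using g(2) ne' X j by eventually_elim (use c(2) in metis)
    have "\<forall>\<^sub>F n in \<UU>. source (G n) (g n) \<in> {x \<in> XX n. c k n x = j}"
      using X j by eventually_elim simp
    moreover have "\<forall>\<^sub>F n in \<UU>. \<not> target (G n) (g n) \<in> {x \<in> XX n. c k n x = j}"
      using t by eventually_elim simp
    ultimately have "source H a \<in> B (prod_encode (k, j))" "target H a \<notin> B (prod_encode (k, j))"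
      by (simp_all only: B_def g(1) source_H target_H lift_cl cl_mem_us ev_not_iff prod_encode_inverse fst_conv snd_conv not_False_eq_True)
    then show ?thesis by blast
  qed
  ultimately show ?thesis by blast
qed

lemma bisection_us: assumes "E \<in> ar.internal" "\<And>n. bisection (G n) (E n)" shows "bisection H (us E)"
  unfolding bisection_def arrows_H source_H target_H
  using assms by (auto intro!: ar.us_sets inj_lift simp: bisection_def)

sublocale H: fibred_groupoid H
proof
  have st: "is_st (\<lambda>n. source (G n))" "is_st (\<lambda>n. target (G n))" by (simp_all add: is_st_def)
  interpret pr: prob_space "base H"
  proof
    have "XX \<in> ba.internal" by (simp add: ba_internal)
    then have "emeasure ba.loeb (us XX) = ba.vol XX" by (rule ba.emeasure_us)
    also have "\<dots> = 1"
      unfolding ba.vol_def using prob_space.emeasure_space_1[OF fg.prob_base] by (simp add: LimI)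
    finally show "emeasure (base H) (space (base H)) = 1" by (simp only: space_base_H ba_\<Omega> base_H[symmetric])
  qed
  show "p \<in> arrows H \<rightarrow>\<^sub>M base H" if "p = source H \<or> p = target H" for p
    using that lift_measurable st by (auto simp: source_H target_H arrows_H base_H)
  show "p ` A \<in> sets (base H) \<and> emeasure (base H) (p ` A) = emeasure (arrows H) A"
    if "p = source H \<or> p = target H" "A \<in> sets (arrows H)" "inj_on p A" for p A
    using that lift_image_inj st by (auto simp: source_H target_H arrows_H base_H)
  have "XX \<in> ar.internal" unfolding ar_internal using XX_ball by blast
  then show "space (base H) \<in> sets (arrows H)"
    by (simp only: space_base_H ba_\<Omega> arrows_H ar.us_sets)
  show "\<exists>\<beta> :: nat \<Rightarrow> _. (\<forall>k. bisection H (\<beta> k)) \<and> (\<Union>k. \<beta> k) = space (arrows H)"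
  proof (intro exI[of _ "\<lambda>k. us (W (wd k))"] conjI allI)
    show "bisection H (us (W (wd k)))" for k
      using wd_words[of k] W_bis W_internal by (blast intro: bisection_us)
    show "(\<Union>k. us (W (wd k))) = space (arrows H)" by (simp add: space_arrows_H \<Omega>_words)
  qed
  show "A \<in> null_sets (arrows H)" if "N \<in> null_sets (arrows H)" "A \<subseteq> N" for N A
    using that ar.complete_loeb unfolding arrows_H by blast
  show "A \<in> null_sets (base H)" if "N \<in> null_sets (base H)" "A \<subseteq> N" for N A
    using that ba.complete_loeb unfolding base_H by blast
  show "\<exists>\<B> :: nat \<Rightarrow> _. (\<forall>k. \<B> k \<in> sets (base H)) \<and>
      (\<forall>c\<in>space (arrows H). source H c \<noteq> target H c \<longrightarrow> (\<exists>k. source H c \<in> \<B> k \<and> target H c \<notin> \<B> k))"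
    by (rule separated_H)
  show "emeasure (base H) (space (base H)) = 1" by (rule pr.emeasure_space_1)
  then show "emeasure (base H) (space (base H)) \<noteq> top_class.top" by simp
  show "\<exists>A. countable A \<and> A \<subseteq> sets (base H) \<and> \<Union>A = space (base H) \<and> (\<forall>a\<in>A. emeasure (base H) a \<noteq> \<infinity>)"
    by (rule pr.sigma_finite_countable)
qed

end

section \<open>The action defined by a factor map onto a group\<close>

context fibred_groupoid
begin

text \<open>Countably many bisections cover the arrows, and on each of them p is injective and
  preserves measure; \<open>null_preimage\<close> reads the same argument backwards.\<close>

lemma null_image:
  assumes p: "p = source G \<or> p = target G" and N: "N \<in> null_sets (arrows G)"
  shows "p ` N \<in> null_sets (base G)"
proof -
  obtain \<beta> :: "nat \<Rightarrow> _" where \<beta>: "\<And>k. bisection G (\<beta> k)" "(\<Union>k. \<beta> k) = Ar" using cover by blast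
  have "p ` (N \<inter> \<beta> k) \<in> null_sets (base G)" for k
  proof -
    have "inj_on p (N \<inter> \<beta> k)" using \<beta>(1)[of k] p by (auto simp: bisection_def intro: inj_on_subset)
    moreover have n: "N \<inter> \<beta> k \<in> null_sets (arrows G)" by (rule complete_ar[OF N]) simp
    ultimately show ?thesis using st_image[OF p, of "N \<inter> \<beta> k"] by (simp add: null_sets_def)
  qed
  then have "(\<Union>k. p ` (N \<inter> \<beta> k)) \<in> null_sets (base G)" by (rule null_sets_UN)
  moreover have "N = (\<Union>k. N \<inter> \<beta> k)"
    using sets.sets_into_space[of N "arrows G"] N \<beta>(2) by blast
  then have "p ` N = (\<Union>k. p ` (N \<inter> \<beta> k))" by (metis image_UN)
  ultimately show ?thesis by simp
qed

lemma null_preimage: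
  assumes p: "p = source G \<or> p = target G" and Z: "Z \<in> null_sets (base G)"
  shows "p -` Z \<inter> Ar \<in> null_sets (arrows G)"
proof -
  obtain \<beta> :: "nat \<Rightarrow> _" where \<beta>: "\<And>k. bisection G (\<beta> k)" "(\<Union>k. \<beta> k) = Ar" using cover by blast
  have m: "p -` Z \<inter> Ar \<in> sets (arrows G)" using measurable_sets[OF st_meas[OF p]] Z by blast
  have "p -` Z \<inter> \<beta> k \<in> null_sets (arrows G)" for k
  proof -
    have "\<beta> k \<in> sets (arrows G)" "\<beta> k \<subseteq> Ar" using \<beta>(1)[of k] \<beta>(2) by (auto simp: bisection_def)
    then have s: "p -` Z \<inter> \<beta> k \<in> sets (arrows G)" using sets.Int[OF m, of "\<beta> k"]
      by (simp add: Int_assoc inf_absorb2)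
    have "inj_on p (p -` Z \<inter> \<beta> k)" using \<beta>(1)[of k] p by (auto simp: bisection_def intro: inj_on_subset)
    from st_image[OF p s this] have "emeasure (arrows G) (p -` Z \<inter> \<beta> k) = emeasure (base G) (p ` (p -` Z \<inter> \<beta> k))" by simp
    moreover have "p ` (p -` Z \<inter> \<beta> k) \<in> null_sets (base G)" by (rule complete_ba[OF Z]) blast
    ultimately show ?thesis using s null_setsD1 by (intro null_setsI) simp_all
  qed
  then have "(\<Union>k. p -` Z \<inter> \<beta> k) \<in> null_sets (arrows G)" by (rule null_sets_UN)
  then show ?thesis unfolding Int_UN_distrib[symmetric] \<beta>(2) .
qed

text \<open>The union of the orbits that meet Z. An invariant null set can be discarded without
  affecting the arrows that start outside it, nor their products and inverses.\<close>

definition sat :: "'a set \<Rightarrow> 'a set" where "sat Z = target G ` (source G -` Z \<inter> Ar)"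

lemma sat_null: "Z \<in> null_sets (base G) \<Longrightarrow> sat Z \<in> null_sets (base G)"
  unfolding sat_def by (intro null_image null_preimage) auto

lemma sat_super: "Z \<subseteq> Ob \<Longrightarrow> Z \<subseteq> sat Z"
proof
  fix x assume "Z \<subseteq> Ob" "x \<in> Z"
  then show "x \<in> sat Z"
    unfolding sat_def by (intro image_eqI[of _ _ x]) (auto simp: groupoid_simps subset_iff)
qed

lemma sat_invariant: assumes "g \<in> Ar" shows "source G g \<in> sat Z \<longleftrightarrow> target G g \<in> sat Z"
proof -
  have 1: "target G g \<in> sat Z" if g: "g \<in> Ar" "source G g \<in> sat Z" for g
  proof -
    obtain h where "h \<in> Ar" "source G h \<in> Z" "target G h = source G g" using g(2) unfolding sat_def by auto
    then show ?thesis unfolding sat_def using g(1)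
      by (intro image_eqI[of _ _ "gmult G g h"]) (auto simp: groupoid_simps)
  qed
  from 1[OF assms] 1[OF inv_in[OF assms]] show ?thesis using assms by (auto simp: groupoid_simps)
qed

end

text \<open>
  The null set \<open>discarded\<close> of arrows is removed from the action constructed below. It is the nontrivial
  isotropy in the essentially free case and empty otherwise.
\<close>

locale group_factor = fibred_groupoid G for G :: "'a groupoid" +
  fixes \<Gamma> :: "('g, 'b) monoid_scheme" and T :: "'a \<Rightarrow> 'g" and discarded :: "'a set"
  assumes group: "group \<Gamma>" and countable_group: "countable (carrier \<Gamma>)"
    and factor: "factor_map G (group_groupoid \<Gamma>) T"
    and discarded_null: "discarded \<in> null_sets (arrows G)"
begin

sublocale group \<Gamma> by (rule group)

lemma T_meas: "T \<in> arrows G \<rightarrow>\<^sub>M count_space (carrier \<Gamma>)"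
  using factor by (simp add: factor_map_def group_groupoid_def)

lemma T_in: "g \<in> Ar \<Longrightarrow> T g \<in> carrier \<Gamma>"
  using measurable_space[OF T_meas] by simp

lemma T_unit: "x \<in> Ob \<Longrightarrow> T x = \<one>\<^bsub>\<Gamma>\<^esub>"
  using factor subsetD[OF Ob_sub] s_unit by (auto simp: factor_map_def group_groupoid_def dest!: bspec[of _ _ x])

lemma T_mult: "g \<in> Ar \<Longrightarrow> h \<in> Ar \<Longrightarrow> source G g = target G h \<Longrightarrow> T (gmult G g h) = T g \<otimes>\<^bsub>\<Gamma>\<^esub> T h"
  using factor by (simp add: factor_map_def group_groupoid_def)

lemma T_inv: "g \<in> Ar \<Longrightarrow> T (ginv G g) = inv\<^bsub>\<Gamma>\<^esub> T g"
  using factor by (simp add: factor_map_def group_groupoid_def)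

definition "fib \<gamma> = T -` {\<gamma>} \<inter> Ar"

lemma fib_sets: "\<gamma> \<in> carrier \<Gamma> \<Longrightarrow> fib \<gamma> \<in> sets (arrows G)"
  unfolding fib_def using measurable_sets[OF T_meas, of "{\<gamma>}"] by simp

lemma emeasure_fib: assumes "\<gamma> \<in> carrier \<Gamma>" shows "emeasure (arrows G) (fib \<gamma>) = 1"
proof -
  have "distr (arrows G) (count_space (carrier \<Gamma>)) T = count_space (carrier \<Gamma>)"
    using factor by (simp add: factor_map_def group_groupoid_def)
  then have "emeasure (distr (arrows G) (count_space (carrier \<Gamma>)) T) {\<gamma>} = emeasure (count_space (carrier \<Gamma>)) {\<gamma>}"
    by simp
  then show ?thesis using assms T_meas by (simp add: emeasure_distr fib_def)
qed

definition "kernel_loops = fib \<one>\<^bsub>\<Gamma>\<^esub> - Ob"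

text \<open>
  Both the units and the kernel of \<open>T\<close> have measure 1; this forces \<open>T\<close> to be injective on almost every
  fibre of the source map, although nothing of the kind is required of a factor map.
\<close>

lemma kernel_loops_null: "kernel_loops \<in> null_sets (arrows G)"
proof -
  have sub: "Ob \<subseteq> fib \<one>\<^bsub>\<Gamma>\<^esub>" using T_unit Ob_sub by (auto simp: fib_def)
  have "inj_on (source G) Ob" by (auto simp: inj_on_def s_unit)
  from st_image[OF disjI1[OF refl] Ob_sets this]
  have "emeasure (arrows G) Ob = emeasure (base G) (source G ` Ob)" by simp
  also have "source G ` Ob = Ob" using s_unit by force
  also have "emeasure (base G) Ob = 1" by (rule prob_space.emeasure_space_1[OF prob])
  finally have 1: "emeasure (arrows G) Ob = 1" .
  have "emeasure (arrows G) kernel_loops = emeasure (arrows G) (fib \<one>\<^bsub>\<Gamma>\<^esub>) - emeasure (arrows G) Ob"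
    unfolding kernel_loops_def using sub 1 Ob_sets by (intro emeasure_Diff fib_sets) auto
  then have "emeasure (arrows G) kernel_loops = 0" by (simp add: 1 emeasure_fib)
  then show ?thesis using fib_sets Ob_sets by (auto simp: kernel_loops_def)
qed

text \<open>Saturated so that the quotient of two arrows that start outside the bad set starts
  outside it as well.\<close>

definition "bad0 = sat (source G ` (kernel_loops \<union> discarded))"

lemma bad_null0: "bad0 \<in> null_sets (base G)"
  unfolding bad0_def using kernel_loops_null discarded_null by (intro sat_null null_image null_sets.Un) auto

lemma source_loops_sub: "source G ` (kernel_loops \<union> discarded) \<subseteq> Ob"
  using s_in sets.sets_into_space[OF null_setsD2[OF discarded_null]] by (auto simp: kernel_loops_def fib_def)

lemma source_loops: "g \<in> kernel_loops \<union> discarded \<Longrightarrow> source G g \<in> bad0"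
  unfolding bad0_def using sat_super[OF source_loops_sub] by blast

definition "R \<gamma> = {g \<in> fib \<gamma>. source G g \<notin> bad0}"

lemma R_alt: "R \<gamma> = fib \<gamma> - (source G -` bad0 \<inter> Ar)"
  by (auto simp: R_def fib_def)

lemma R_sets: "\<gamma> \<in> carrier \<Gamma> \<Longrightarrow> R \<gamma> \<in> sets (arrows G)"
  unfolding R_alt using fib_sets null_preimage[OF _ bad_null0, of "source G"] by auto

lemma emeasure_R: "\<gamma> \<in> carrier \<Gamma> \<Longrightarrow> emeasure (arrows G) (R \<gamma>) = 1"
  unfolding R_alt using null_preimage[OF _ bad_null0, of "source G"]
  by (simp add: emeasure_Diff_null_set fib_sets emeasure_fib)

text \<open>The quotient of two arrows with the same source and the same value of \<open>T\<close>
  lies in the kernel; away from \<open>bad0\<close> the kernel consists of units.\<close>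

lemma R_inj_s: "inj_on (source G) (R \<gamma>)"
proof (rule inj_onI)
  fix g h assume "g \<in> R \<gamma>" "h \<in> R \<gamma>" and st: "source G g = source G h"
  then have g: "g \<in> Ar" "T g = \<gamma>" "source G g \<notin> bad0" and h: "h \<in> Ar" "T h = \<gamma>" "source G h \<notin> bad0"
    by (auto simp: R_def fib_def)
  let ?k = "gmult G g (ginv G h)"
  have k: "?k \<in> Ar" "source G ?k = target G h" using g h st by (simp_all add: groupoid_simps)
  have "\<gamma> \<in> carrier \<Gamma>" using T_in[OF g(1)] g(2) by simp
  then have "T ?k = \<one>\<^bsub>\<Gamma>\<^esub>" using g h st by (simp add: T_mult T_inv groupoid_simps)
  moreover have "target G h \<notin> bad0" using h sat_invariant[of h] by (simp add: bad0_def)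
  then have "?k \<notin> kernel_loops" using source_loops[of ?k] k(2) by (metis UnI1)
  ultimately have "?k \<in> Ob" using k(1) by (simp add: kernel_loops_def fib_def)
  then show "g = h" by (rule cancel_right[OF g(1) h(1) st])
qed

lemma R_inj_t: "inj_on (target G) (R \<gamma>)"
proof (rule inj_onI)
  fix g h assume "g \<in> R \<gamma>" "h \<in> R \<gamma>" and st: "target G g = target G h"
  then have g: "g \<in> Ar" "T g = \<gamma>" "source G g \<notin> bad0" and h: "h \<in> Ar" "T h = \<gamma>" "source G h \<notin> bad0"
    by (auto simp: R_def fib_def)
  have gi: "ginv G g \<in> R (inv\<^bsub>\<Gamma>\<^esub> \<gamma>)" "ginv G h \<in> R (inv\<^bsub>\<Gamma>\<^esub> \<gamma>)"
    using g h sat_invariant[of g] sat_invariant[of h] by (simp_all add: R_def fib_def groupoid_simps T_inv bad0_def)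
  have "ginv G g = ginv G h"
    using s_inv[OF g(1)] s_inv[OF h(1)] st by (intro inj_onD[OF R_inj_s _ gi]) simp
  then have "ginv G (ginv G g) = ginv G (ginv G h)" by (rule arg_cong)
  then show "g = h" unfolding ginv_ginv[OF g(1)] ginv_ginv[OF h(1)] .
qed

text \<open>At almost every unit some arrow over \<gamma> starts, because the source is injective on
  \<open>R \<gamma>\<close>, which has measure 1. The countably many exceptional sets are removed
  together with \<open>bad0\<close>, after saturation, so that every \<gamma> acts everywhere on an
  invariant set.\<close>

definition "X0 = Ob - sat (bad0 \<union> (\<Union>\<gamma>\<in>carrier \<Gamma>. Ob - source G ` R \<gamma>))"

lemma bad_null: "bad0 \<union> (\<Union>\<gamma>\<in>carrier \<Gamma>. Ob - source G ` R \<gamma>) \<in> null_sets (base G)"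
proof (intro null_sets.Un bad_null0 null_sets_UN' countable_group)
  fix \<gamma> assume \<gamma>: "\<gamma> \<in> carrier \<Gamma>"
  interpret prob_space "base G" by (rule prob)
  have s: "source G ` R \<gamma> \<in> sets (base G)" "emeasure (base G) (source G ` R \<gamma>) = 1"
    using st_image[OF _ R_sets[OF \<gamma>] R_inj_s] emeasure_R[OF \<gamma>] by auto
  then have "emeasure (base G) (Ob - source G ` R \<gamma>) = 0"
    using emeasure_compl[OF s(1)] emeasure_space_1 by simp
  then show "Ob - source G ` R \<gamma> \<in> null_sets (base G)" using s(1) by auto
qed

lemma X0_sets: "X0 \<in> sets (base G)"
  unfolding X0_def using sat_null[OF bad_null] by auto

lemma X0_Ob: "X0 \<subseteq> Ob" by (auto simp: X0_def)

lemma compl_X0_null: "Ob - X0 \<in> null_sets (base G)"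
proof -
  have "Ob - X0 \<subseteq> sat (bad0 \<union> (\<Union>\<gamma>\<in>carrier \<Gamma>. Ob - source G ` R \<gamma>))" by (auto simp: X0_def)
  then show ?thesis using sat_null[OF bad_null] complete_ba by blast
qed

lemma emeasure_X0: "emeasure (base G) (D \<inter> X0) = emeasure (base G) D" if "D \<in> sets (base G)"
proof -
  have "D \<inter> X0 = D - (Ob - X0)" using sets.sets_into_space[OF that] by blast
  then show ?thesis using emeasure_Diff_null_set[OF compl_X0_null that] by simp
qed

lemma X0_invariant: "g \<in> Ar \<Longrightarrow> source G g \<in> X0 \<longleftrightarrow> target G g \<in> X0"
  using sat_invariant[of g] s_in t_in by (auto simp: X0_def)

lemma X0_not_bad0: "x \<in> X0 \<Longrightarrow> x \<notin> bad0"
proof -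
  have "bad0 \<union> (\<Union>\<gamma>\<in>carrier \<Gamma>. Ob - source G ` R \<gamma>) \<subseteq> Ob"
    using sets.sets_into_space[OF null_setsD2[OF bad_null]] .
  from sat_super[OF this] show "x \<in> X0 \<Longrightarrow> x \<notin> bad0" by (auto simp: X0_def)
qed

lemma X0_R: "x \<in> X0 \<Longrightarrow> \<gamma> \<in> carrier \<Gamma> \<Longrightarrow> x \<in> source G ` R \<gamma>"
proof -
  have "bad0 \<union> (\<Union>\<gamma>\<in>carrier \<Gamma>. Ob - source G ` R \<gamma>) \<subseteq> Ob"
    using sets.sets_into_space[OF null_setsD2[OF bad_null]] .
  from sat_super[OF this] show "x \<in> X0 \<Longrightarrow> \<gamma> \<in> carrier \<Gamma> \<Longrightarrow> x \<in> source G ` R \<gamma>" by (auto simp: X0_def)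
qed

text \<open>On \<open>X0\<close> there is exactly one such arrow for each group element. So
  \<open>T\<close> identifies the arrows that start at x with the group, and following the arrow
  over \<gamma> is the action.\<close>

definition "arr \<gamma> x = (THE g. g \<in> Ar \<and> source G g = x \<and> T g = \<gamma>)"
definition "act \<gamma> x = target G (arr \<gamma> x)"

lemma arr_unique:
  assumes "g \<in> Ar" "source G g \<in> X0" shows "g = arr (T g) (source G g)"
proof -
  have "h = g" if "h \<in> Ar" "source G h = source G g" "T h = T g" for h
  proof -
    have "h \<in> R (T g)" "g \<in> R (T g)" using that assms(1) X0_not_bad0[OF assms(2)] by (simp_all add: R_def fib_def)
    then show ?thesis by (rule inj_onD[OF R_inj_s that(2)])
  qed
  then show ?thesis unfolding arr_def using assms(1) by (intro the_equality[symmetric]) auto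
qed

lemma arr:
  assumes "x \<in> X0" "\<gamma> \<in> carrier \<Gamma>"
  shows "arr \<gamma> x \<in> Ar" "source G (arr \<gamma> x) = x" "T (arr \<gamma> x) = \<gamma>"
proof -
  obtain g where g: "g \<in> R \<gamma>" "source G g = x" using X0_R[OF assms] by blast
  then have "g \<in> Ar" "T g = \<gamma>" by (auto simp: R_def fib_def)
  moreover from this have "arr \<gamma> x = g" using arr_unique[of g] g assms(1) by simp
  ultimately show "arr \<gamma> x \<in> Ar" "source G (arr \<gamma> x) = x" "T (arr \<gamma> x) = \<gamma>" using g by simp_all
qed

lemma act_in: "x \<in> X0 \<Longrightarrow> \<gamma> \<in> carrier \<Gamma> \<Longrightarrow> act \<gamma> x \<in> X0"
  using X0_invariant[of "arr \<gamma> x"] arr by (simp add: act_def)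

lemma arr_eqI: "g \<in> Ar \<Longrightarrow> source G g = x \<Longrightarrow> T g = \<gamma> \<Longrightarrow> x \<in> X0 \<Longrightarrow> arr \<gamma> x = g"
  using arr_unique[of g] by simp

lemma arr_mult:
  assumes "x \<in> X0" "\<gamma> \<in> carrier \<Gamma>" "\<delta> \<in> carrier \<Gamma>"
  shows "arr (\<gamma> \<otimes>\<^bsub>\<Gamma>\<^esub> \<delta>) x = gmult G (arr \<gamma> (act \<delta> x)) (arr \<delta> x)"
    and "act (\<gamma> \<otimes>\<^bsub>\<Gamma>\<^esub> \<delta>) x = act \<gamma> (act \<delta> x)"
proof -
  note d = arr[OF assms(1,3)] and g = arr[OF act_in[OF assms(1,3)] assms(2)]
  have c: "source G (arr \<gamma> (act \<delta> x)) = target G (arr \<delta> x)" unfolding g(2) by (simp add: act_def)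
  show 1: "arr (\<gamma> \<otimes>\<^bsub>\<Gamma>\<^esub> \<delta>) x = gmult G (arr \<gamma> (act \<delta> x)) (arr \<delta> x)"
    using mult_in[OF g(1) d(1) c] s_mult[OF g(1) d(1) c] T_mult[OF g(1) d(1) c] d(2,3) g(3) assms(1)
    by (intro arr_eqI) simp_all
  show "act (\<gamma> \<otimes>\<^bsub>\<Gamma>\<^esub> \<delta>) x = act \<gamma> (act \<delta> x)"
    unfolding act_def[of "\<gamma> \<otimes>\<^bsub>\<Gamma>\<^esub> \<delta>"] 1 t_mult[OF g(1) d(1) c] by (simp add: act_def)
qed

lemma arr_one: "x \<in> X0 \<Longrightarrow> arr \<one>\<^bsub>\<Gamma>\<^esub> x = x"
  using X0_Ob Ob_sub by (intro arr_eqI) (auto simp: s_unit T_unit subset_iff)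

lemma act_one: "x \<in> X0 \<Longrightarrow> act \<one>\<^bsub>\<Gamma>\<^esub> x = x"
  using X0_Ob by (auto simp: act_def arr_one t_unit subset_iff)

lemma arr_inv:
  assumes "x \<in> X0" "\<gamma> \<in> carrier \<Gamma>"
  shows "arr (inv\<^bsub>\<Gamma>\<^esub> \<gamma>) (act \<gamma> x) = ginv G (arr \<gamma> x)"
  using assms arr act_in by (intro arr_eqI) (auto simp: groupoid_simps T_inv act_def)

lemma act_inv: "x \<in> X0 \<Longrightarrow> \<gamma> \<in> carrier \<Gamma> \<Longrightarrow> act (inv\<^bsub>\<Gamma>\<^esub> \<gamma>) (act \<gamma> x) = x"
  using arr_mult(2)[of x "inv\<^bsub>\<Gamma>\<^esub> \<gamma>" \<gamma>] by (simp add: act_one)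

section \<open>Measurability and invariance of the action\<close>

definition "fib0 \<gamma> = {g \<in> fib \<gamma>. source G g \<in> X0}"

lemma fib0_sets: assumes "\<gamma> \<in> carrier \<Gamma>" shows "fib0 \<gamma> \<in> sets (arrows G)"
proof -
  have "source G -` X0 \<inter> Ar \<in> sets (arrows G)" using measurable_sets[OF st_meas X0_sets, of "source G"] by simp
  from sets.Int[OF fib_sets[OF assms] this] show ?thesis
    by (rule back_subst[where P = "\<lambda>A. A \<in> sets (arrows G)"]) (auto simp: fib0_def fib_def)
qed

lemma fib0_R: "fib0 \<gamma> \<subseteq> R \<gamma>"
  using X0_not_bad0 by (auto simp: fib0_def R_def)

lemma fib0_eq: "\<gamma> \<in> carrier \<Gamma> \<Longrightarrow> fib0 \<gamma> = arr \<gamma> ` X0"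
proof (intro Set.set_eqI iffI)
  fix g assume "g \<in> fib0 \<gamma>"
  then have "g = arr \<gamma> (source G g)" "source G g \<in> X0" using arr_unique[of g] by (auto simp: fib0_def fib_def)
  then show "g \<in> arr \<gamma> ` X0" by blast
qed (auto simp: fib0_def fib_def arr)

lemma arr_preimage:
  assumes A: "A \<in> sets (arrows G)" and \<gamma>: "\<gamma> \<in> carrier \<Gamma>"
  shows "{x \<in> X0. arr \<gamma> x \<in> A} \<in> sets (base G)"
    and "emeasure (base G) {x \<in> X0. arr \<gamma> x \<in> A} = emeasure (arrows G) (A \<inter> fib0 \<gamma>)"
proof -
  have eq: "{x \<in> X0. arr \<gamma> x \<in> A} = source G ` (A \<inter> fib0 \<gamma>)"
    unfolding fib0_eq[OF \<gamma>] using arr(2)[OF _ \<gamma>] by force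
  have "inj_on (source G) (A \<inter> fib0 \<gamma>)" using R_inj_s fib0_R by (rule inj_on_subset[OF _ le_infI2])
  from st_image[OF _ sets.Int[OF A fib0_sets[OF \<gamma>]] this]
  show "{x \<in> X0. arr \<gamma> x \<in> A} \<in> sets (base G)"
    "emeasure (base G) {x \<in> X0. arr \<gamma> x \<in> A} = emeasure (arrows G) (A \<inter> fib0 \<gamma>)"
    unfolding eq by simp_all
qed

text \<open>The arrows over \<gamma> that end in D are measured at both ends: the source gives the
  preimage of D, the target gives D itself up to a null set.\<close>

lemma act_preimage:
  assumes D: "D \<in> sets (base G)" and \<gamma>: "\<gamma> \<in> carrier \<Gamma>"
  shows "{x \<in> X0. act \<gamma> x \<in> D} \<in> sets (base G)"
    and "emeasure (base G) {x \<in> X0. act \<gamma> x \<in> D} = emeasure (base G) D"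
proof -
  let ?A = "target G -` D \<inter> Ar"
  have A: "?A \<in> sets (arrows G)" using measurable_sets[OF st_meas D, of "target G"] by simp
  have eq: "{x \<in> X0. act \<gamma> x \<in> D} = {x \<in> X0. arr \<gamma> x \<in> ?A}" using arr(1)[OF _ \<gamma>] by (auto simp: act_def)
  show "{x \<in> X0. act \<gamma> x \<in> D} \<in> sets (base G)" unfolding eq by (rule arr_preimage[OF A \<gamma>])
  have "emeasure (base G) {x \<in> X0. act \<gamma> x \<in> D} = emeasure (arrows G) (?A \<inter> fib0 \<gamma>)"
    unfolding eq by (rule arr_preimage[OF A \<gamma>])
  also have "\<dots> = emeasure (base G) (target G ` (?A \<inter> fib0 \<gamma>))"
  proof -
    have "inj_on (target G) (?A \<inter> fib0 \<gamma>)" using R_inj_t fib0_R by (rule inj_on_subset[OF _ le_infI2])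
    from st_image[OF _ sets.Int[OF A fib0_sets[OF \<gamma>]] this] show ?thesis by simp
  qed
  also have "target G ` (?A \<inter> fib0 \<gamma>) = D \<inter> X0"
  proof (intro Set.set_eqI iffI)
    fix y assume "y \<in> target G ` (?A \<inter> fib0 \<gamma>)"
    then show "y \<in> D \<inter> X0" unfolding fib0_eq[OF \<gamma>] using act_in[OF _ \<gamma>] by (auto simp: act_def)
  next
    fix y assume y: "y \<in> D \<inter> X0"
    let ?x = "act (inv\<^bsub>\<Gamma>\<^esub> \<gamma>) y"
    have x: "?x \<in> X0" using y \<gamma> by (intro act_in) auto
    have "act \<gamma> ?x = y" using act_inv[of y "inv\<^bsub>\<Gamma>\<^esub> \<gamma>"] y \<gamma> by simp
    then have "target G (arr \<gamma> ?x) = y" by (simp add: act_def)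
    moreover have "arr \<gamma> ?x \<in> ?A \<inter> fib0 \<gamma>"
      unfolding fib0_eq[OF \<gamma>] using x y arr(1)[OF x \<gamma>] \<open>target G (arr \<gamma> ?x) = y\<close> by auto
    ultimately show "y \<in> target G ` (?A \<inter> fib0 \<gamma>)" by (metis image_eqI)
  qed
  also have "emeasure (base G) (D \<inter> X0) = emeasure (base G) D" by (rule emeasure_X0[OF D])
  finally show "emeasure (base G) {x \<in> X0. act \<gamma> x \<in> D} = emeasure (base G) D" .
qed

lemma arr_image:
  assumes D: "D \<in> sets (base G)" "D \<subseteq> X0" and \<gamma>: "\<gamma> \<in> carrier \<Gamma>"
  shows "arr \<gamma> ` D \<in> sets (arrows G)" "emeasure (arrows G) (arr \<gamma> ` D) = emeasure (base G) D"
proof -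
  have "source G -` D \<inter> Ar \<in> sets (arrows G)" using measurable_sets[OF st_meas D(1), of "source G"] by simp
  from sets.Int[OF this fib0_sets[OF \<gamma>]] have "(source G -` D \<inter> Ar) \<inter> fib0 \<gamma> \<in> sets (arrows G)" .
  also have "(source G -` D \<inter> Ar) \<inter> fib0 \<gamma> = arr \<gamma> ` D"
    unfolding fib0_eq[OF \<gamma>] using D(2) arr[OF _ \<gamma>] by (auto simp: subset_iff)
  finally show s: "arr \<gamma> ` D \<in> sets (arrows G)" .
  have "inj_on (source G) (arr \<gamma> ` D)"
    using D(2) fib0_R[of \<gamma>] unfolding fib0_eq[OF \<gamma>] by (intro inj_on_subset[OF R_inj_s]) blast
  from st_image[OF _ s this] have "emeasure (arrows G) (arr \<gamma> ` D) = emeasure (base G) (source G ` arr \<gamma> ` D)" by simp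
  also have "source G ` arr \<gamma> ` D = D" using D(2) arr(2)[OF _ \<gamma>] by (force simp: image_image)
  finally show "emeasure (arrows G) (arr \<gamma> ` D) = emeasure (base G) D" .
qed

end

lemma (in fibred_groupoid) isotropy_null:
  assumes "essentially_trivial_isotropy G"
  shows "{g \<in> Ar. source G g = target G g \<and> g \<notin> Ob} \<in> null_sets (arrows G)" (is "?N \<in> _")
proof -
  have "AE g in arrows G. g \<notin> ?N"
    using assms unfolding essentially_trivial_isotropy_def by (rule AE_mp) auto
  then obtain N where "?N \<subseteq> N" "N \<in> null_sets (arrows G)"
    by (rule AE_E) (auto simp: null_sets_def)
  then show ?thesis using complete_ar by blast
qed

locale free_group_factor = group_factor +
  assumes discarded_eq: "discarded = {g \<in> Ar. source G g = target G g \<and> g \<notin> Ob}"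
begin

lemma act_free:
  assumes "x \<in> X0" "\<gamma> \<in> carrier \<Gamma>" "act \<gamma> x = x" shows "\<gamma> = \<one>\<^bsub>\<Gamma>\<^esub>"
proof -
  have "arr \<gamma> x \<notin> discarded" using source_loops[of "arr \<gamma> x"] X0_not_bad0 arr assms by auto
  then have "arr \<gamma> x \<in> Ob" using arr[OF assms(1,2)] assms(3) by (auto simp: discarded_eq act_def)
  then show ?thesis using T_unit arr[OF assms(1,2)] by metis
qed

end

section \<open>Standard free actions on sets of reals\<close>

text \<open>Actions are homomorphisms into \<open>BijGroup\<close>, whose elements are extensional;
  this is why the actions constructed below are restricted functions.\<close>

lemma group_actionI:
  assumes "group \<Gamma>" and ext: "\<And>\<gamma>. \<gamma> \<in> carrier \<Gamma> \<Longrightarrow> a \<gamma> \<in> extensional C"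
    and into: "\<And>\<gamma> x. \<gamma> \<in> carrier \<Gamma> \<Longrightarrow> x \<in> C \<Longrightarrow> a \<gamma> x \<in> C"
    and one: "\<And>x. x \<in> C \<Longrightarrow> a \<one>\<^bsub>\<Gamma>\<^esub> x = x"
    and mult: "\<And>\<gamma> \<delta> x. \<gamma> \<in> carrier \<Gamma> \<Longrightarrow> \<delta> \<in> carrier \<Gamma> \<Longrightarrow> x \<in> C \<Longrightarrow> a (\<gamma> \<otimes>\<^bsub>\<Gamma>\<^esub> \<delta>) x = a \<gamma> (a \<delta> x)"
  shows "group_action \<Gamma> C a"
proof -
  interpret group \<Gamma> by fact
  have bij: "a \<gamma> \<in> Bij C" if \<gamma>: "\<gamma> \<in> carrier \<Gamma>" for \<gamma>
  proof -
    have "bij_betw (a \<gamma>) C C"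
    proof (rule bij_betw_byWitness[where f' = "a (inv\<^bsub>\<Gamma>\<^esub> \<gamma>)"])
      show "\<forall>x\<in>C. a (inv\<^bsub>\<Gamma>\<^esub> \<gamma>) (a \<gamma> x) = x" "\<forall>x\<in>C. a \<gamma> (a (inv\<^bsub>\<Gamma>\<^esub> \<gamma>) x) = x"
        using \<gamma> mult one by (metis inv_closed l_inv, metis inv_closed r_inv)
    qed (use \<gamma> into in auto)
    then show ?thesis using ext[OF \<gamma>] by (simp add: Bij_def)
  qed
  have "a (\<gamma> \<otimes>\<^bsub>\<Gamma>\<^esub> \<delta>) = compose C (a \<gamma>) (a \<delta>)" if "\<gamma> \<in> carrier \<Gamma>" "\<delta> \<in> carrier \<Gamma>" for \<gamma> \<delta>
  proof
    fix x show "a (\<gamma> \<otimes>\<^bsub>\<Gamma>\<^esub> \<delta>) x = compose C (a \<gamma>) (a \<delta>) x"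
      using mult[OF that, of x] ext[of "\<gamma> \<otimes>\<^bsub>\<Gamma>\<^esub> \<delta>"] that by (auto simp: compose_def extensional_def)
  qed
  then have "a \<in> hom \<Gamma> (BijGroup C)"
    using bij by (auto simp: hom_def BijGroup_def)
  then show ?thesis
    by (intro group_action.intro group_hom.intro group_hom_axioms.intro) (auto simp: group_BijGroup assms(1))
qed

locale real_action = group \<Gamma> for \<Gamma> :: "('g, 'b) monoid_scheme" +
  fixes C :: "real set" and M :: "real measure" and a :: "'g \<Rightarrow> real \<Rightarrow> real"
  assumes countable_carrier: "countable (carrier \<Gamma>)"
    and C_borel: "C \<in> sets borel" and sets_M: "sets M = sets (restrict_space borel C)"
    and prob_M: "prob_space M" and action: "pmp_action \<Gamma> M a"
begin

lemma space_M: "space M = C"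
  using sets_eq_imp_space_eq[OF sets_M] C_borel by (simp add: space_restrict_space)

sublocale group_action \<Gamma> C a
  using action by (simp add: pmp_action_def space_M)

lemma a_in: "\<gamma> \<in> carrier \<Gamma> \<Longrightarrow> x \<in> C \<Longrightarrow> a \<gamma> x \<in> C"
  using element_image by blast

lemma a_one: "x \<in> C \<Longrightarrow> a \<one>\<^bsub>\<Gamma>\<^esub> x = x"
  using id_eq_one by (metis restrict_apply')

lemma a_mult: "x \<in> C \<Longrightarrow> \<gamma> \<in> carrier \<Gamma> \<Longrightarrow> \<delta> \<in> carrier \<Gamma> \<Longrightarrow> a (\<gamma> \<otimes>\<^bsub>\<Gamma>\<^esub> \<delta>) x = a \<gamma> (a \<delta> x)"
  using composition_rule by blast

lemma a_meas: "\<gamma> \<in> carrier \<Gamma> \<Longrightarrow> a \<gamma> \<in> M \<rightarrow>\<^sub>M M"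
  using action by (simp add: pmp_action_def)

lemma id_borel: "(\<lambda>x. x) \<in> borel_measurable M"
proof -
  have "(\<lambda>x. x) \<in> restrict_space borel C \<rightarrow>\<^sub>M (borel :: real measure)" by (intro measurable_restrict_space1) simp
  then show ?thesis using measurable_cong_sets[OF sets_M refl] by blast
qed

lemma a_borel: "\<gamma> \<in> carrier \<Gamma> \<Longrightarrow> a \<gamma> \<in> borel_measurable M"
  using measurable_compose[OF a_meas id_borel] by simp

lemma standard: "standard_prob_space M"
proof -
  have "measurable_iso M (restrict_space borel C) (\<lambda>x. x)"
    unfolding measurable_iso_def
  proof (intro conjI)
    show "bij_betw (\<lambda>x. x) (space M) (space (restrict_space borel C))"
      using sets_eq_imp_space_eq[OF sets_M] by (simp add: bij_betw_def)
    show "(\<lambda>x. x) \<in> M \<rightarrow>\<^sub>M restrict_space borel C" using measurable_ident_sets[OF sets_M] by (simp add: id_def)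
    have "the_inv_into (space M) (\<lambda>x. x) \<in> restrict_space borel C \<rightarrow>\<^sub>M M \<longleftrightarrow>
      (\<lambda>x. x) \<in> restrict_space borel C \<rightarrow>\<^sub>M M"
      using sets_eq_imp_space_eq[OF sets_M]
      by (intro measurable_cong) (auto intro!: the_inv_into_f_eq)
    then show "the_inv_into (space M) (\<lambda>x. x) \<in> restrict_space borel C \<rightarrow>\<^sub>M M"
      using measurable_ident_sets[OF sets_M[symmetric]] by (simp add: id_def)
  qed
  with prob_M C_borel show ?thesis unfolding standard_prob_space_def by blast
qed

abbreviation "OG \<equiv> orbit_groupoid \<Gamma> M a"
abbreviation "Rel \<equiv> orbit_relation \<Gamma> M a"

lemma Rel_iff: "(y, x) \<in> Rel \<longleftrightarrow> x \<in> C \<and> (\<exists>\<gamma>\<in>carrier \<Gamma>. y = a \<gamma> x)"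
  by (auto simp: orbit_relation_def orbit_def space_M)

lemma Rel_sub: "Rel \<subseteq> C \<times> C"
  using Rel_iff a_in by auto

definition "PR = restrict_space (M \<Otimes>\<^sub>M M) Rel"

lemma space_PR: "space PR = Rel"
  using Rel_sub by (auto simp: PR_def space_restrict_space space_pair_measure space_M)

lemma arrows_OG: "arrows OG = measure_of Rel (sets PR) (\<lambda>E. \<integral>\<^sup>+x. emeasure (count_space UNIV) {y. (y, x) \<in> E} \<partial>M)"
  by (simp add: orbit_groupoid_def PR_def)

lemma sets_OG: "sets (arrows OG) = sets PR"
  unfolding arrows_OG space_PR[symmetric] by (rule sets.sets_measure_of_eq)

lemma space_OG: "space (arrows OG) = Rel"
  using sets_eq_imp_space_eq[OF sets_OG] by (simp add: space_PR)

lemma section_sets: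
  assumes E: "E \<in> sets PR" and \<gamma>: "\<gamma> \<in> carrier \<Gamma>"
  shows "{x \<in> C. (a \<gamma> x, x) \<in> E} \<in> sets M"
proof -
  obtain F where F: "F \<in> sets (M \<Otimes>\<^sub>M M)" "E = Rel \<inter> F"
    using E by (auto simp: PR_def sets_restrict_space)
  have "(\<lambda>x. (a \<gamma> x, x)) \<in> M \<rightarrow>\<^sub>M M \<Otimes>\<^sub>M M" using a_meas[OF \<gamma>] by (intro measurable_Pair) auto
  from measurable_sets[OF this F(1)] have "(\<lambda>x. (a \<gamma> x, x)) -` F \<inter> C \<in> sets M" by (simp add: space_M)
  also have "(\<lambda>x. (a \<gamma> x, x)) -` F \<inter> C = {x \<in> C. (a \<gamma> x, x) \<in> E}"
    using \<gamma> by (auto simp: F Rel_iff)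
  finally show ?thesis .
qed

lemma eq_sets:
  assumes "\<gamma> \<in> carrier \<Gamma>" "\<delta> \<in> carrier \<Gamma>" shows "{x \<in> C. a \<gamma> x = a \<delta> x} \<in> sets M"
  using borel_measurable_eq[OF a_borel[OF assms(1)] a_borel[OF assms(2)]] by (simp add: space_M)

text \<open>Here it matters that the points are reals: the set where two real-valued measurable
  functions agree is measurable, so graphs lie in the product \<sigma>-algebra. An abstract measure
  space gives no such guarantee.\<close>

lemma graph_sets:
  assumes D: "D \<in> sets M" and \<gamma>: "\<gamma> \<in> carrier \<Gamma>"
  shows "(\<lambda>x. (a \<gamma> x, x)) ` D \<in> sets PR"
proof -
  have D': "D \<subseteq> C" using sets.sets_into_space[OF D] by (simp add: space_M)
  have "fst \<in> borel_measurable (M \<Otimes>\<^sub>M M)" by (rule measurable_compose[OF measurable_fst id_borel])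
  moreover have "(\<lambda>p. a \<gamma> (snd p)) \<in> borel_measurable (M \<Otimes>\<^sub>M M)"
    by (rule measurable_compose[OF measurable_snd a_borel[OF \<gamma>]])
  ultimately have "{p \<in> space (M \<Otimes>\<^sub>M M). fst p = a \<gamma> (snd p)} \<in> sets (M \<Otimes>\<^sub>M M)" by (rule borel_measurable_eq)
  moreover have "C \<times> D \<in> sets (M \<Otimes>\<^sub>M M)" using D sets.top[of M] by (simp add: space_M)
  ultimately have "{p \<in> space (M \<Otimes>\<^sub>M M). fst p = a \<gamma> (snd p)} \<inter> (C \<times> D) \<in> sets (M \<Otimes>\<^sub>M M)" by (rule sets.Int)
  also have "{p \<in> space (M \<Otimes>\<^sub>M M). fst p = a \<gamma> (snd p)} \<inter> (C \<times> D) = (\<lambda>x. (a \<gamma> x, x)) ` D"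
    using D' a_in[OF \<gamma>] by (auto simp: space_pair_measure space_M)
  finally have "(\<lambda>x. (a \<gamma> x, x)) ` D \<in> sets (M \<Otimes>\<^sub>M M)" .
  moreover have "(\<lambda>x. (a \<gamma> x, x)) ` D \<subseteq> Rel" using D' \<gamma> by (auto simp: Rel_iff)
  ultimately show ?thesis unfolding PR_def sets_restrict_space by (intro image_eqI[of _ _ "(\<lambda>x. (a \<gamma> x, x)) ` D"]) auto
qed

definition "gam n = from_nat_into (carrier \<Gamma>) n"

lemma gam: "range gam = carrier \<Gamma>"
  unfolding gam_def using countable_carrier by (intro range_from_nat_into) auto

lemma gam_in: "gam n \<in> carrier \<Gamma>"
  using gam by blast

text \<open>The action need not be free, so a pair \<open>(y, x)\<close> may arise from several
  group elements; it is attributed to the first one in the enumeration. The measure of E becomes a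
  series of measures of these sets.\<close>

definition "fresh E n = {x \<in> C. (a (gam n) x, x) \<in> E \<and> (\<forall>m<n. a (gam m) x \<noteq> a (gam n) x)}"

lemma fresh_sets: assumes "E \<in> sets PR" shows "fresh E n \<in> sets M"
proof -
  have "fresh E n = {x \<in> C. (a (gam n) x, x) \<in> E} - (\<Union>m<n. {x \<in> C. a (gam m) x = a (gam n) x})"
    by (auto simp: fresh_def)
  also have "\<dots> \<in> sets M" using section_sets[OF assms gam_in] eq_sets[OF gam_in gam_in]
    by (intro sets.Diff sets.finite_UN) auto
  finally show ?thesis .
qed

lemma count_section:
  assumes E: "E \<in> sets PR" and x: "x \<in> C"
  shows "emeasure (count_space UNIV) {y. (y, x) \<in> E} = (\<Sum>n. indicator (fresh E n) x)"
proof -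
  define S where "S n = (if x \<in> fresh E n then {a (gam n) x} else {})" for n
  have "E \<subseteq> Rel" using sets.sets_into_space[OF E] by (simp add: space_PR)
  have "{y. (y, x) \<in> E} = (\<Union>n. S n)"
  proof (intro Set.set_eqI iffI)
    fix y assume y: "y \<in> {y. (y, x) \<in> E}"
    then obtain \<gamma> where "\<gamma> \<in> carrier \<Gamma>" "y = a \<gamma> x" using \<open>E \<subseteq> Rel\<close> Rel_iff by blast
    then have "\<exists>n. y = a (gam n) x" using gam by (metis rangeE)
    then obtain n where n: "y = a (gam n) x" "\<And>m. m < n \<Longrightarrow> y \<noteq> a (gam m) x" using exists_least_iff[of "\<lambda>n. y = a (gam n) x"] by blast
    then have "\<forall>m<n. a (gam m) x \<noteq> a (gam n) x" by metis
    then have "x \<in> fresh E n" using x y n(1) by (auto simp: fresh_def)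
    then show "y \<in> (\<Union>n. S n)" using n by (auto simp: S_def)
  qed (auto simp: S_def fresh_def split: if_splits)
  moreover have "disjoint_family S"
    unfolding disjoint_family_on_def
  proof (intro ballI impI)
    fix m n :: nat assume "m \<noteq> n"
    then consider "m < n" | "n < m" by linarith
    then show "S m \<inter> S n = {}" by cases (auto simp: S_def fresh_def)
  qed
  ultimately have "emeasure (count_space UNIV) {y. (y, x) \<in> E} = (\<Sum>n. emeasure (count_space UNIV) (S n))"
    using suminf_emeasure[of S "count_space UNIV"] by simp
  also have "\<dots> = (\<Sum>n. indicator (fresh E n) x)" by (intro suminf_cong) (simp add: S_def)
  finally show ?thesis .
qed

lemma count_meas: assumes "E \<in> sets PR" shows "(\<lambda>x. emeasure (count_space UNIV) {y. (y, x) \<in> E}) \<in> borel_measurable M"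
proof -
  have "(\<lambda>x. \<Sum>n. indicator (fresh E n) x :: ennreal) \<in> borel_measurable M"
    using fresh_sets[OF assms] by (intro borel_measurable_suminf_order) auto
  then show ?thesis using count_section[OF assms] by (subst measurable_cong) (auto simp: space_M)
qed

lemma emeasure_OG:
  assumes "E \<in> sets PR"
  shows "emeasure (arrows OG) E = (\<integral>\<^sup>+x. emeasure (count_space UNIV) {y. (y, x) \<in> E} \<partial>M)"
proof (rule emeasure_measure_of[OF arrows_OG])
  show "sets PR \<subseteq> Pow Rel" using sets.space_closed[of PR] by (simp add: space_PR)
  show "positive (sets (arrows OG)) (\<lambda>E. \<integral>\<^sup>+x. emeasure (count_space UNIV) {y. (y, x) \<in> E} \<partial>M)"
    by (simp add: positive_def)
  show "countably_additive (sets (arrows OG)) (\<lambda>E. \<integral>\<^sup>+x. emeasure (count_space UNIV) {y. (y, x) \<in> E} \<partial>M)"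
  proof (rule countably_additiveI)
    fix A :: "nat \<Rightarrow> _" assume A: "range A \<subseteq> sets (arrows OG)" "disjoint_family A"
    have "(\<Sum>i. \<integral>\<^sup>+x. emeasure (count_space UNIV) {y. (y, x) \<in> A i} \<partial>M) =
      (\<integral>\<^sup>+x. (\<Sum>i. emeasure (count_space UNIV) {y. (y, x) \<in> A i}) \<partial>M)"
      using A(1) by (intro nn_integral_suminf[symmetric] count_meas) (auto simp: sets_OG)
    also have "\<dots> = (\<integral>\<^sup>+x. emeasure (count_space UNIV) {y. (y, x) \<in> (\<Union>i. A i)} \<partial>M)"
    proof (rule nn_integral_cong)
      fix x
      have "disjoint_family (\<lambda>i. {y. (y, x) \<in> A i})" using A(2) by (auto simp: disjoint_family_on_def)
      then have "(\<Sum>i. emeasure (count_space UNIV) {y. (y, x) \<in> A i}) = emeasure (count_space UNIV) (\<Union>i. {y. (y, x) \<in> A i})"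
        by (intro suminf_emeasure) auto
      also have "(\<Union>i. {y. (y, x) \<in> A i}) = {y. (y, x) \<in> (\<Union>i. A i)}" by auto
      finally show "(\<Sum>i. emeasure (count_space UNIV) {y. (y, x) \<in> A i}) =
        emeasure (count_space UNIV) {y. (y, x) \<in> (\<Union>i. A i)}" .
    qed
    finally show "(\<Sum>i. \<integral>\<^sup>+x. emeasure (count_space UNIV) {y. (y, x) \<in> A i} \<partial>M) =
      (\<integral>\<^sup>+x. emeasure (count_space UNIV) {y. (y, x) \<in> (\<Union>i. A i)} \<partial>M)" .
  qed
qed (use assms in \<open>simp add: sets_OG\<close>)

lemma emeasure_graph:
  assumes D: "D \<in> sets M" and \<gamma>: "\<gamma> \<in> carrier \<Gamma>"
  shows "emeasure (arrows OG) ((\<lambda>x. (a \<gamma> x, x)) ` D) = emeasure M D"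
proof -
  have "emeasure (count_space UNIV) {y. (y, x) \<in> (\<lambda>x. (a \<gamma> x, x)) ` D} = indicator D x" for x
  proof -
    have "{y. (y, x) \<in> (\<lambda>x. (a \<gamma> x, x)) ` D} = (if x \<in> D then {a \<gamma> x} else {})" by auto
    then show ?thesis by simp
  qed
  then show ?thesis using emeasure_OG[OF graph_sets[OF assms]] D by simp
qed

lemma OG_simps:
  "source OG (y, x) = (x, x)" "target OG (y, x) = (y, y)" "gmult OG (z, y) (y', x) = (z, x)" "ginv OG (y, x) = (x, y)"
  by (simp_all add: orbit_groupoid_def)

lemma base_OG: "space (base OG) = {(x, x) | x. x \<in> C}"
  by (auto simp: orbit_groupoid_def space_restrict_space space_pair_measure space_M)

lemma cost_in: "essentially_free \<Gamma> M a \<Longrightarrow> cost OG \<in> free_action_costs \<Gamma>"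
  unfolding free_action_costs_def using standard action by blast

end

section \<open>Coding sequences of sets by reals\<close>

text \<open>Digits 0 and 1 in base 3, so that the sum determines its digits.\<close>

definition expansion :: "(nat \<Rightarrow> bool) \<Rightarrow> real" where
  "expansion z = (\<Sum>i. of_bool (z i) * (1 / 3) ^ i)"

primrec remainder :: "nat \<Rightarrow> real \<Rightarrow> real" where
  "remainder 0 r = r"
| "remainder (Suc i) r = 3 * (remainder i r - of_bool (remainder i r \<ge> 1))"

lemma expansion_summable: "summable (\<lambda>i. of_bool (z i) * (1 / 3 :: real) ^ i)"
  by (rule summable_comparison_test'[of "\<lambda>i. (1 / 3 :: real) ^ i" 0]) (auto simp: summable_geometric)

lemma expansion_Suc: "expansion z = of_bool (z 0) + expansion (\<lambda>i. z (Suc i)) / 3"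
proof -
  have "expansion z = (\<Sum>i. of_bool (z (Suc i)) * (1 / 3) ^ Suc i) + of_bool (z 0) * (1 / 3) ^ 0"
    unfolding expansion_def using suminf_split_head[OF expansion_summable[of z]] by simp
  also have "(\<Sum>i. of_bool (z (Suc i)) * (1 / 3 :: real) ^ Suc i) = (\<Sum>i. (1 / 3) * (of_bool (z (Suc i)) * (1 / 3) ^ i))"
    by (simp add: algebra_simps)
  also have "\<dots> = (1 / 3) * expansion (\<lambda>i. z (Suc i))"
    unfolding expansion_def by (rule suminf_mult[OF expansion_summable])
  finally show ?thesis by simp
qed

lemma expansion_bounds: "0 \<le> expansion z" "expansion z \<le> 3 / 2"
proof -
  show "0 \<le> expansion z" unfolding expansion_def by (intro suminf_nonneg expansion_summable) simp
  have "expansion z \<le> (\<Sum>i. (1 / 3 :: real) ^ i)"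
    unfolding expansion_def by (intro suminf_le expansion_summable) (auto simp: summable_geometric)
  also have "\<dots> = 3 / 2" by (subst suminf_geometric) auto
  finally show "expansion z \<le> 3 / 2" .
qed

text \<open>The digits after the first contribute at most \<open>(3 / 2) / 3 = 1 / 2\<close>, so
  comparison with 1 reads off the first digit.\<close>

lemma expansion_ge_1: "expansion z \<ge> 1 \<longleftrightarrow> z 0"
  using expansion_Suc[of z] expansion_bounds[of "\<lambda>i. z (Suc i)"] by (cases "z 0") auto

lemma remainder_expansion: "remainder i (expansion z) = expansion (\<lambda>j. z (i + j))"
proof (induction i)
  case (Suc i)
  then show ?case
    using expansion_Suc[of "\<lambda>j. z (i + j)"] expansion_ge_1[of "\<lambda>j. z (i + j)"] by simp
qed simp

definition digit :: "nat \<Rightarrow> real \<Rightarrow> bool" where "digit i r \<longleftrightarrow> remainder i r \<ge> 1"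

lemma digit_expansion: "digit i (expansion z) = z i"
  unfolding digit_def remainder_expansion expansion_ge_1 by simp

lemma remainder_meas: "remainder i \<in> borel_measurable borel"
proof (induction i)
  case (Suc i)
  note [measurable] = Suc
  have "(\<lambda>r. 3 * (remainder i r - (if remainder i r \<ge> 1 then 1 else 0))) \<in> borel_measurable borel" by measurable
  then show ?case by (simp add: of_bool_def)
qed simp

lemma digit_sets: "{r. digit i r} \<in> sets borel"
proof -
  note [measurable] = remainder_meas
  have "{r \<in> space borel. remainder i r \<ge> 1} \<in> sets borel" by measurable
  then show ?thesis by (simp add: digit_def)
qed

lemma expansion_meas:
  assumes "\<And>i. {x \<in> space N. z x i} \<in> sets N" shows "(\<lambda>x. expansion (z x)) \<in> borel_measurable N"
proof -
  have "(\<lambda>x. \<Sum>i. (if x \<in> {x \<in> space N. z x i} then 1 else 0) * (1 / 3 :: real) ^ i) \<in> borel_measurable N"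
    using assms by (intro borel_measurable_suminf borel_measurable_times measurable_If_set) auto
  then show ?thesis unfolding expansion_def by (subst measurable_cong) (auto simp: of_bool_def intro!: suminf_cong)
qed

text \<open>A family indexed by numbers and group elements is flattened to one sequence of digits;
  positions that are not codes of a pair carry the digit 0.\<close>

definition encode :: "'g set \<Rightarrow> (nat \<Rightarrow> 'g \<Rightarrow> bool) \<Rightarrow> real" where
  "encode I z = expansion (\<lambda>i. \<exists>k. \<exists>g\<in>I. i = prod_encode (k, to_nat_on I g) \<and> z k g)"

definition decode :: "'g set \<Rightarrow> real \<Rightarrow> nat \<Rightarrow> 'g \<Rightarrow> bool" where
  "decode I r k g = digit (prod_encode (k, to_nat_on I g)) r"

lemma decode_encode: "countable I \<Longrightarrow> g \<in> I \<Longrightarrow> decode I (encode I z) k g = z k g"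
  by (auto simp: decode_def encode_def digit_expansion)

lemma encode_cong: "(\<And>k g. g \<in> I \<Longrightarrow> z k g = z' k g) \<Longrightarrow> encode I z = encode I z'"
  unfolding encode_def by (intro arg_cong[where f = expansion]) auto

lemma decode_sets: "{r. decode I r k g} \<in> sets borel"
  unfolding decode_def by (rule digit_sets)

lemma encode_meas:
  assumes I: "countable I" and m: "\<And>k g. g \<in> I \<Longrightarrow> {x \<in> space N. z x k g} \<in> sets N"
  shows "(\<lambda>x. encode I (z x)) \<in> borel_measurable N"
  unfolding encode_def
proof (rule expansion_meas)
  fix i
  have "{x \<in> space N. \<exists>k. \<exists>g\<in>I. i = prod_encode (k, to_nat_on I g) \<and> z x k g} =
    (\<Union>k. \<Union>g\<in>I. if i = prod_encode (k, to_nat_on I g) then {x \<in> space N. z x k g} else {})"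
    by auto
  also have "\<dots> \<in> sets N" using m I by (intro sets.countable_UN sets.countable_UN') auto
  finally show "{x \<in> space N. \<exists>k. \<exists>g\<in>I. i = prod_encode (k, to_nat_on I g) \<and> z x k g} \<in> sets N" .
qed

section \<open>The orbit relation as a groupoid\<close>

context real_action
begin

lemma a_inv: "x \<in> C \<Longrightarrow> \<gamma> \<in> carrier \<Gamma> \<Longrightarrow> a (inv\<^bsub>\<Gamma>\<^esub> \<gamma>) (a \<gamma> x) = x"
  using a_mult[of x "inv\<^bsub>\<Gamma>\<^esub> \<gamma>" \<gamma>] a_one by simp

lemma Rel_sym: "(y, x) \<in> Rel \<Longrightarrow> (x, y) \<in> Rel"
  unfolding Rel_iff using a_in a_inv by (metis inv_closed)

lemma Rel_trans: assumes "(z, y) \<in> Rel" "(y, x) \<in> Rel" shows "(z, x) \<in> Rel"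
proof -
  obtain \<gamma> \<delta> where "\<gamma> \<in> carrier \<Gamma>" "\<delta> \<in> carrier \<Gamma>" "y = a \<gamma> x" "z = a \<delta> y" "x \<in> C"
    using assms by (auto simp: Rel_iff)
  then show ?thesis unfolding Rel_iff using a_mult by (intro conjI bexI[of _ "\<delta> \<otimes>\<^bsub>\<Gamma>\<^esub> \<gamma>"]) auto
qed

lemma Rel_refl: "x \<in> C \<Longrightarrow> (x, x) \<in> Rel"
  unfolding Rel_iff using a_one by (intro conjI bexI[of _ "\<one>\<^bsub>\<Gamma>\<^esub>"]) auto

lemma laws_OG: "groupoid_laws OG"
proof -
  have C: "x \<in> C" "y \<in> C" if "(y, x) \<in> Rel" for x y using that Rel_sub by auto
  show ?thesis
    unfolding groupoid_laws_def space_OG base_OG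
    by (auto simp: OG_simps Rel_refl intro: Rel_trans Rel_sym C)
qed

sublocale OG: groupoid OG by standard (rule laws_OG)

lemma emeasure_OG_fresh:
  assumes "E \<in> sets PR" shows "emeasure (arrows OG) E = (\<Sum>n. emeasure M (fresh E n))"
proof -
  have "emeasure (arrows OG) E = (\<integral>\<^sup>+x. (\<Sum>n. indicator (fresh E n) x) \<partial>M)"
    unfolding emeasure_OG[OF assms] using count_section[OF assms] by (intro nn_integral_cong) (auto simp: space_M)
  also have "\<dots> = (\<Sum>n. \<integral>\<^sup>+x. indicator (fresh E n) x \<partial>M)"
    using fresh_sets[OF assms] by (intro nn_integral_suminf) auto
  also have "\<dots> = (\<Sum>n. emeasure M (fresh E n))"
    using fresh_sets[OF assms] by simp
  finally show ?thesis .
qed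

end

section \<open>Standard factors of groupoids over a group\<close>

locale coded_factor = free_group_factor +
  fixes B :: "nat \<Rightarrow> 'a set"
  assumes B_sets: "\<And>k. B k \<in> sets (base G)"
    and B_sep: "\<And>c. c \<in> Ar \<Longrightarrow> source G c \<noteq> target G c \<Longrightarrow> \<exists>k. source G c \<in> B k \<and> target G c \<notin> B k"
begin

abbreviation "I \<equiv> carrier \<Gamma>"
definition "\<theta> x k \<gamma> \<longleftrightarrow> act \<gamma> x \<in> B k"
definition "\<pi> x = encode I (\<theta> x)"
text \<open>The set of all codes, described by fixed points of decoding followed by encoding and
  thus visibly Borel; described as the image of \<open>encode\<close>, its measurability would not
  be evident.\<close>

definition "C = {r. encode I (decode I r) = r}"
text \<open>A right shift of the group coordinate: \<open>act \<gamma> (act \<delta> x)\<close>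
  equals \<open>act (\<gamma> \<otimes> \<delta>) x\<close>, so shifting the code by \<delta>
  corresponds to moving the point by \<delta>.\<close>

definition "sh \<delta> = (\<lambda>r\<in>C. encode I (\<lambda>k \<gamma>. decode I r k (\<gamma> \<otimes>\<^bsub>\<Gamma>\<^esub> \<delta>)))"
definition "M = restrict_space (distr (restrict_space (base G) X0) borel \<pi>) C"

lemma C_borel: "C \<in> sets borel"
proof -
  have "(\<lambda>r. encode I (decode I r)) \<in> borel_measurable borel"
    using decode_sets by (intro encode_meas countable_group) auto
  from borel_measurable_eq[OF this, of "\<lambda>r. r"] show ?thesis by (simp add: C_def)
qed

lemma encode_in: "encode I z \<in> C"
  unfolding C_def using decode_encode[OF countable_group] by (simp cong: encode_cong)

lemma \<pi>_in: "\<pi> x \<in> C"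
  unfolding \<pi>_def by (rule encode_in)

lemma decode_\<pi>: "\<gamma> \<in> I \<Longrightarrow> decode I (\<pi> x) k \<gamma> \<longleftrightarrow> act \<gamma> x \<in> B k"
  unfolding \<pi>_def using decode_encode[OF countable_group] by (simp add: \<theta>_def)

lemma decode_sh: "\<gamma> \<in> I \<Longrightarrow> r \<in> C \<Longrightarrow> decode I (sh \<delta> r) k \<gamma> \<longleftrightarrow> decode I r k (\<gamma> \<otimes>\<^bsub>\<Gamma>\<^esub> \<delta>)"
  unfolding sh_def using decode_encode[OF countable_group] by simp

lemma C_eqI: "r \<in> C \<Longrightarrow> r' \<in> C \<Longrightarrow> (\<And>k \<gamma>. \<gamma> \<in> I \<Longrightarrow> decode I r k \<gamma> = decode I r' k \<gamma>) \<Longrightarrow> r = r'"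
  unfolding C_def using encode_cong[of I "decode I r" "decode I r'"] by simp

lemma sh_in: "r \<in> C \<Longrightarrow> sh \<delta> r \<in> C"
  unfolding sh_def by (simp add: encode_in)

lemma sh_\<pi>: "x \<in> X0 \<Longrightarrow> \<delta> \<in> I \<Longrightarrow> sh \<delta> (\<pi> x) = \<pi> (act \<delta> x)"
  by (intro C_eqI sh_in \<pi>_in) (simp add: decode_sh \<pi>_in decode_\<pi> arr_mult(2))

lemma space_r: "space (restrict_space (base G) X0) = X0"
  using X0_Ob by (simp add: space_restrict_space inf_absorb1)

lemma sets_r: "D \<in> sets (restrict_space (base G) X0) \<longleftrightarrow> D \<in> sets (base G) \<and> D \<subseteq> X0"
  using X0_sets X0_Ob by (subst sets_restrict_space_iff) (auto simp: inf_absorb2)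

lemma \<pi>_meas: "\<pi> \<in> borel_measurable (restrict_space (base G) X0)"
  unfolding \<pi>_def
proof (rule encode_meas[OF countable_group])
  fix k \<gamma> assume "\<gamma> \<in> I"
  then show "{x \<in> space (restrict_space (base G) X0). \<theta> x k \<gamma>} \<in> sets (restrict_space (base G) X0)"
    unfolding space_r sets_r \<theta>_def using act_preimage(1)[OF B_sets] by auto
qed

lemma sets_M: "sets M = sets (restrict_space borel C)"
  by (simp add: M_def sets_restrict_space)

lemma sets_M_iff: "E \<in> sets M \<longleftrightarrow> E \<in> sets borel \<and> E \<subseteq> C"
  unfolding sets_M using C_borel by (subst sets_restrict_space_iff) auto

lemma space_M: "space M = C"
  using sets_eq_imp_space_eq[OF sets_M] by (simp add: space_restrict_space)

lemma \<pi>_preimage: assumes "E \<in> sets M" shows "{x \<in> X0. \<pi> x \<in> E} \<in> sets (base G)"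
proof -
  have "\<pi> -` E \<inter> space (restrict_space (base G) X0) \<in> sets (restrict_space (base G) X0)"
    using assms \<pi>_meas by (auto simp: sets_M_iff intro: measurable_sets)
  then show ?thesis unfolding space_r sets_r by (simp add: Int_def vimage_def conj_commute)
qed

lemma emeasure_M: assumes "E \<in> sets M" shows "emeasure M E = emeasure (base G) {x \<in> X0. \<pi> x \<in> E}"
proof -
  have E: "E \<in> sets borel" "E \<subseteq> C" using assms by (auto simp: sets_M_iff)
  have "emeasure M E = emeasure (distr (restrict_space (base G) X0) borel \<pi>) E"
    unfolding M_def using E C_borel by (intro emeasure_restrict_space) auto
  also have "\<dots> = emeasure (restrict_space (base G) X0) (\<pi> -` E \<inter> X0)"
    using emeasure_distr[OF \<pi>_meas E(1)] by (simp add: space_r)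
  also have "\<dots> = emeasure (base G) (\<pi> -` E \<inter> X0)"
    using X0_sets X0_Ob by (intro emeasure_restrict_space) (auto simp: inf_absorb2)
  also have "\<pi> -` E \<inter> X0 = {x \<in> X0. \<pi> x \<in> E}" by auto
  finally show ?thesis .
qed

lemma prob_M: "prob_space M"
proof
  have "C \<in> sets M" using C_borel by (simp add: sets_M_iff)
  then have "emeasure M C = emeasure (base G) {x \<in> X0. \<pi> x \<in> C}" by (rule emeasure_M)
  also have "{x \<in> X0. \<pi> x \<in> C} = Ob \<inter> X0" using \<pi>_in X0_Ob by auto
  also have "emeasure (base G) (Ob \<inter> X0) = 1"
    using emeasure_X0[of Ob] prob_space.emeasure_space_1[OF prob] by simp
  finally show "emeasure M (space M) = 1" by (simp add: space_M)
qed

lemma sh_meas: assumes "\<delta> \<in> I" shows "sh \<delta> \<in> M \<rightarrow>\<^sub>M M"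
proof -
  have "(\<lambda>r. encode I (\<lambda>k \<gamma>. decode I r k (\<gamma> \<otimes>\<^bsub>\<Gamma>\<^esub> \<delta>))) \<in> borel_measurable borel"
    using decode_sets by (intro encode_meas countable_group) auto
  then have "(\<lambda>r. encode I (\<lambda>k \<gamma>. decode I r k (\<gamma> \<otimes>\<^bsub>\<Gamma>\<^esub> \<delta>))) \<in> restrict_space borel C \<rightarrow>\<^sub>M restrict_space borel C"
    by (intro measurable_restrict_space3) (auto simp: encode_in)
  then have "(\<lambda>r. encode I (\<lambda>k \<gamma>. decode I r k (\<gamma> \<otimes>\<^bsub>\<Gamma>\<^esub> \<delta>))) \<in> M \<rightarrow>\<^sub>M M"
    using measurable_cong_sets[OF sets_M sets_M] by blast
  then show ?thesis by (subst measurable_cong) (auto simp: space_M sh_def)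
qed

lemma sh_pmp: assumes \<delta>: "\<delta> \<in> I" shows "distr M M (sh \<delta>) = M"
proof (rule measure_eqI)
  fix E assume "E \<in> sets (distr M M (sh \<delta>))"
  then have E: "E \<in> sets M" by simp
  have E': "sh \<delta> -` E \<inter> C \<in> sets M" using measurable_sets[OF sh_meas[OF \<delta>] E] by (simp add: space_M)
  have "emeasure (distr M M (sh \<delta>)) E = emeasure (base G) {x \<in> X0. \<pi> x \<in> sh \<delta> -` E \<inter> C}"
    using emeasure_distr[OF sh_meas[OF \<delta>] E] emeasure_M[OF E'] by (simp add: space_M)
  also have "{x \<in> X0. \<pi> x \<in> sh \<delta> -` E \<inter> C} = {x \<in> X0. act \<delta> x \<in> {x \<in> X0. \<pi> x \<in> E}}"
    using \<delta> by (auto simp: sh_\<pi> act_in \<pi>_in)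
  also have "emeasure (base G) \<dots> = emeasure (base G) {x \<in> X0. \<pi> x \<in> E}"
    by (rule act_preimage(2)[OF \<pi>_preimage[OF E] \<delta>])
  finally show "emeasure (distr M M (sh \<delta>)) E = emeasure M E" by (simp add: emeasure_M[OF E])
qed simp

sublocale ra: real_action \<Gamma> C M sh
proof (intro real_action.intro real_action_axioms.intro group countable_group C_borel sets_M prob_M)
  show "pmp_action \<Gamma> M sh"
    unfolding pmp_action_def space_M
  proof (intro conjI ballI)
    show "group_action \<Gamma> C sh"
    proof (rule group_actionI[OF group])
      show "sh \<one>\<^bsub>\<Gamma>\<^esub> r = r" if "r \<in> C" for r
        using that by (intro C_eqI sh_in) (auto simp: decode_sh)
      show "sh (\<gamma> \<otimes>\<^bsub>\<Gamma>\<^esub> \<delta>) r = sh \<gamma> (sh \<delta> r)" if "\<gamma> \<in> I" "\<delta> \<in> I" "r \<in> C" for \<gamma> \<delta> r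
        using that by (intro C_eqI sh_in) (auto simp: decode_sh sh_in m_assoc)
    qed (auto simp: sh_def encode_in)
  qed (auto intro: sh_meas sh_pmp)
qed

text \<open>Equal codes agree at the neutral element, that is, x and \<open>act \<gamma> x\<close>
  lie in the same sets \<open>B k\<close>. These separate the ends of every arrow that is not a
  loop, and nontrivial loops have been discarded.\<close>

lemma \<pi>_free:
  assumes x: "x \<in> X0" and "\<gamma> \<in> I" and eq: "\<pi> (act \<gamma> x) = \<pi> x" shows "\<gamma> = \<one>\<^bsub>\<Gamma>\<^esub>"
proof (rule ccontr)
  assume "\<gamma> \<noteq> \<one>\<^bsub>\<Gamma>\<^esub>"
  then have "source G (arr \<gamma> x) \<noteq> target G (arr \<gamma> x)"
    using act_free[OF x assms(2)] arr[OF x assms(2)] by (auto simp: act_def)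
  then obtain k where "x \<in> B k" "act \<gamma> x \<notin> B k"
    using B_sep[of "arr \<gamma> x"] arr[OF x assms(2)] by (auto simp: act_def)
  moreover have "act \<one>\<^bsub>\<Gamma>\<^esub> (act \<gamma> x) \<in> B k \<longleftrightarrow> act \<one>\<^bsub>\<Gamma>\<^esub> x \<in> B k"
    using decode_\<pi>[of "\<one>\<^bsub>\<Gamma>\<^esub>" _ k] eq by (metis one_closed)
  ultimately show False using act_one x act_in[OF x assms(2)] by simp
qed

lemma \<pi>_act_inj:
  assumes x: "x \<in> X0" and "\<gamma> \<in> I" "\<delta> \<in> I" and eq: "\<pi> (act \<gamma> x) = \<pi> (act \<delta> x)" shows "\<gamma> = \<delta>"
proof -
  have "act (\<gamma> \<otimes>\<^bsub>\<Gamma>\<^esub> inv\<^bsub>\<Gamma>\<^esub> \<delta>) (act \<delta> x) = act \<gamma> x"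
    using arr_mult(2)[of "act \<delta> x" \<gamma> "inv\<^bsub>\<Gamma>\<^esub> \<delta>"] assms act_in act_inv by simp
  then have "\<gamma> \<otimes>\<^bsub>\<Gamma>\<^esub> inv\<^bsub>\<Gamma>\<^esub> \<delta> = \<one>\<^bsub>\<Gamma>\<^esub>" using assms act_in by (intro \<pi>_free[of "act \<delta> x"]) auto
  then show ?thesis using assms(2,3) by (metis inv_closed inv_equality inv_inv)
qed

lemma ess_free: "essentially_free \<Gamma> M sh"
proof -
  have "{r \<in> C. sh \<gamma> r = r} \<in> null_sets M" if \<gamma>: "\<gamma> \<in> I" "\<gamma> \<noteq> \<one>\<^bsub>\<Gamma>\<^esub>" for \<gamma>
  proof -
    have "{r \<in> C. sh \<gamma> r = sh \<one>\<^bsub>\<Gamma>\<^esub> r} \<in> sets M" using \<gamma> by (intro ra.eq_sets) auto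
    then have s: "{r \<in> C. sh \<gamma> r = r} \<in> sets M" using ra.a_one by (simp cong: conj_cong)
    \<comment> \<open>C may contain fixed points, but none of them is the code of a point of
      \<open>X0\<close>, so the measure of the factor does not see them.\<close>
    have "{x \<in> X0. \<pi> x \<in> {r \<in> C. sh \<gamma> r = r}} = {}"
      using \<pi>_free \<gamma> sh_\<pi> by auto
    then have "emeasure M {r \<in> C. sh \<gamma> r = r} = 0" unfolding emeasure_M[OF s] by (simp only: emeasure_empty)
    then show ?thesis using s by auto
  qed
  then have "(\<Union>\<gamma>\<in>I - {\<one>\<^bsub>\<Gamma>\<^esub>}. {r \<in> C. sh \<gamma> r = r}) \<in> null_sets M"
    using countable_group by (intro null_sets_UN') auto
  then have "AE r in M. r \<notin> (\<Union>\<gamma>\<in>I - {\<one>\<^bsub>\<Gamma>\<^esub>}. {r \<in> C. sh \<gamma> r = r})" by (rule AE_not_in)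
  then show ?thesis unfolding essentially_free_def by (rule AE_mp) (auto simp: space_M)
qed

lemma cost_OG_in: "cost ra.OG \<in> free_action_costs \<Gamma>"
  by (rule ra.cost_in[OF ess_free])

end

section \<open>Comparison of costs with the standard factor\<close>

context coded_factor
begin

definition "pull A = {g \<in> Ar. source G g \<in> X0 \<and> (\<pi> (target G g), \<pi> (source G g)) \<in> A}"

lemma pull_arr: "x \<in> X0 \<Longrightarrow> \<gamma> \<in> I \<Longrightarrow> arr \<gamma> x \<in> pull A \<longleftrightarrow> (sh \<gamma> (\<pi> x), \<pi> x) \<in> A"
  by (simp add: pull_def arr sh_\<pi> flip: act_def)

lemma Ar_X0: assumes "g \<in> Ar" "source G g \<in> X0"
  obtains \<gamma> x where "\<gamma> \<in> I" "x \<in> X0" "g = arr \<gamma> x" "source G g = x" "target G g = act \<gamma> x" "T g = \<gamma>"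
proof
  show "g = arr (T g) (source G g)" using arr_unique[OF assms] .
  then show "target G g = act (T g) (source G g)" unfolding act_def by (rule arg_cong)
qed (use assms T_in in auto)

text \<open>Distinct translates of a point of \<open>X0\<close> have distinct codes, so an arrow
  over \<gamma> belongs to the piece of the first index that enumerates \<gamma>. The pullback of a
  measurable set is thus a countable union of images of measurable sets of units, on which
  \<open>arr_image\<close> applies.\<close>

lemma pull_eq: "pull A = (\<Union>n. arr (ra.gam n) ` {x \<in> X0. \<pi> x \<in> ra.fresh A n})"
proof (intro Set.set_eqI iffI)
  fix g assume g: "g \<in> pull A"
  then have "g \<in> Ar" "source G g \<in> X0" by (auto simp: pull_def)
  then obtain \<gamma> x where x: "\<gamma> \<in> I" "x \<in> X0" "g = arr \<gamma> x" by (rule Ar_X0)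
  define n where "n = (LEAST n. ra.gam n = \<gamma>)"
  have "\<exists>n. ra.gam n = \<gamma>" using x(1) ra.gam by (metis rangeE)
  then have n: "ra.gam n = \<gamma>" unfolding n_def by (rule LeastI_ex)
  have "ra.gam m \<noteq> \<gamma>" if "m < n" for m using that not_less_Least unfolding n_def by blast
  then have "sh (ra.gam m) (\<pi> x) \<noteq> sh (ra.gam n) (\<pi> x)" if "m < n" for m
    using that \<pi>_act_inj[OF x(2) ra.gam_in x(1), of m] x ra.gam_in sh_\<pi> n by metis
  moreover have "(sh \<gamma> (\<pi> x), \<pi> x) \<in> A" using g x pull_arr by simp
  ultimately have "\<pi> x \<in> ra.fresh A n" unfolding ra.fresh_def using \<pi>_in n by auto
  then show "g \<in> (\<Union>n. arr (ra.gam n) ` {x \<in> X0. \<pi> x \<in> ra.fresh A n})" using x n by blast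
next
  fix g assume "g \<in> (\<Union>n. arr (ra.gam n) ` {x \<in> X0. \<pi> x \<in> ra.fresh A n})"
  then obtain n x where "x \<in> X0" "\<pi> x \<in> ra.fresh A n" "g = arr (ra.gam n) x" by blast
  then show "g \<in> pull A" using pull_arr[OF _ ra.gam_in] by (simp add: ra.fresh_def)
qed

lemma pull_sets: assumes "A \<in> sets ra.PR"
  shows "pull A \<in> sets (arrows G)" "emeasure (arrows G) (pull A) \<le> emeasure (arrows ra.OG) A"
proof -
  let ?D = "\<lambda>n. {x \<in> X0. \<pi> x \<in> ra.fresh A n}"
  have D: "?D n \<in> sets (base G)" "?D n \<subseteq> X0" for n using \<pi>_preimage[OF ra.fresh_sets[OF assms]] by auto
  have s: "arr (ra.gam n) ` ?D n \<in> sets (arrows G)" for n by (rule arr_image(1)[OF D ra.gam_in])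
  then show "pull A \<in> sets (arrows G)" unfolding pull_eq by (intro sets.countable_UN) auto
  have "emeasure (arrows G) (pull A) \<le> (\<Sum>n. emeasure (arrows G) (arr (ra.gam n) ` ?D n))"
    unfolding pull_eq using s by (intro emeasure_subadditive_countably) auto
  also have "\<dots> = (\<Sum>n. emeasure M (ra.fresh A n))"
    using arr_image(2)[OF D ra.gam_in] emeasure_M[OF ra.fresh_sets[OF assms]] by (intro suminf_cong) simp
  also have "\<dots> = emeasure (arrows ra.OG) A" by (rule ra.emeasure_OG_fresh[OF assms, symmetric])
  finally show "emeasure (arrows G) (pull A) \<le> emeasure (arrows ra.OG) A" .
qed

lemma \<pi>_loop:
  assumes "g \<in> Ar" "source G g \<in> X0" "\<pi> (source G g) = \<pi> (target G g)" shows "g \<in> Ob"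
proof -
  obtain \<gamma> x where x: "\<gamma> \<in> I" "x \<in> X0" "g = arr \<gamma> x" "source G g = x" "target G g = act \<gamma> x"
    using assms(1,2) by (rule Ar_X0)
  then have "\<gamma> = \<one>\<^bsub>\<Gamma>\<^esub>" using \<pi>_free[of x \<gamma>] assms(3) by simp
  then show ?thesis using x arr_one X0_Ob by auto
qed

text \<open>The quotient of the two arrows joins points with the same code, hence is a unit.\<close>

lemma \<pi>_source_inj:
  assumes g: "g \<in> Ar" and h: "h \<in> Ar" and st: "source G g = source G h" and X: "source G h \<in> X0"
    and eq: "\<pi> (target G g) = \<pi> (target G h)"
  shows "g = h"
proof -
  have c: "source G g = target G (ginv G h)" using st t_inv[OF h] by simp
  have "gmult G g (ginv G h) \<in> Ob"
  proof (rule \<pi>_loop)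
    show "gmult G g (ginv G h) \<in> Ar" by (rule mult_in[OF g inv_in[OF h] c])
    show "source G (gmult G g (ginv G h)) \<in> X0"
      unfolding s_mult[OF g inv_in[OF h] c] s_inv[OF h] using X0_invariant[OF h] X by simp
    show "\<pi> (source G (gmult G g (ginv G h))) = \<pi> (target G (gmult G g (ginv G h)))"
      unfolding s_mult[OF g inv_in[OF h] c] t_mult[OF g inv_in[OF h] c] s_inv[OF h] eq ..
  qed
  then show ?thesis by (rule cancel_right[OF g h st])
qed

lemma pull_bisection: assumes A: "bisection ra.OG A" shows "bisection G (pull A)"
  unfolding bisection_def
proof (intro conjI)
  have A': "A \<in> sets ra.PR" "inj_on (source ra.OG) A" "inj_on (target ra.OG) A"
    using A by (auto simp: bisection_def ra.sets_OG)
  show "pull A \<in> sets (arrows G)" by (rule pull_sets[OF A'(1)])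
  have AR: "A \<subseteq> ra.Rel" using sets.sets_into_space[OF A'(1)] by (simp add: ra.space_PR)
  show "inj_on (source G) (pull A)"
  proof (rule inj_onI)
    fix g h assume g: "g \<in> pull A" and h: "h \<in> pull A" and st: "source G g = source G h"
    have "(\<pi> (target G g), \<pi> (source G g)) = (\<pi> (target G h), \<pi> (source G h))"
    proof (rule inj_onD[OF A'(2)])
      show "source ra.OG (\<pi> (target G g), \<pi> (source G g)) = source ra.OG (\<pi> (target G h), \<pi> (source G h))"
        by (simp only: ra.OG_simps st)
    qed (use g h in \<open>simp_all add: pull_def\<close>)
    then have eq: "\<pi> (target G g) = \<pi> (target G h)" by simp
    show "g = h" by (rule \<pi>_source_inj[OF _ _ st _ eq]) (use g h in \<open>simp_all add: pull_def\<close>)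
  qed
  show "inj_on (target G) (pull A)"
  proof (rule inj_onI)
    fix g h assume g: "g \<in> pull A" and h: "h \<in> pull A" and st: "target G g = target G h"
    have "(\<pi> (target G g), \<pi> (source G g)) = (\<pi> (target G h), \<pi> (source G h))"
    proof (rule inj_onD[OF A'(3)])
      show "target ra.OG (\<pi> (target G g), \<pi> (source G g)) = target ra.OG (\<pi> (target G h), \<pi> (source G h))"
        by (simp only: ra.OG_simps st)
    qed (use g h in \<open>simp_all add: pull_def\<close>)
    then have eq: "\<pi> (source G g) = \<pi> (source G h)" by simp
    have gh: "g \<in> Ar" "h \<in> Ar" "source G h \<in> X0" "source G g \<in> X0" using g h by (auto simp: pull_def)
    have "ginv G g = ginv G h"
    proof (rule \<pi>_source_inj[OF inv_in[OF gh(1)] inv_in[OF gh(2)]])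
      show "source G (ginv G g) = source G (ginv G h)" by (simp only: s_inv[OF gh(1)] s_inv[OF gh(2)] st)
      show "source G (ginv G h) \<in> X0" using X0_invariant[OF gh(2)] gh(3) by (simp only: s_inv[OF gh(2)])
      show "\<pi> (target G (ginv G g)) = \<pi> (target G (ginv G h))" by (simp only: t_inv[OF gh(1)] t_inv[OF gh(2)] eq)
    qed
    then have "ginv G (ginv G g) = ginv G (ginv G h)" by (rule arg_cong)
    then show "g = h" unfolding ginv_ginv[OF gh(1)] ginv_ginv[OF gh(2)] .
  qed
qed

text \<open>The pullback of a generating graphing of the standard factor generates up to a null set.\<close>

lemma cost_le_OG: "cost G \<le> cost ra.OG"
  unfolding cost_def[of ra.OG]
proof (rule Inf_greatest, clarify)
  fix J :: "nat set" and \<Psi> assume gr: "graphing ra.OG J \<Psi>" and gen: "generating ra.OG J \<Psi>"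
  obtain \<beta> :: "nat \<Rightarrow> _" where \<beta>: "\<And>k. bisection G (\<beta> k)" "(\<Union>k. \<beta> k) = Ar" using cover by blast
  \<comment> \<open>Arrows that start outside \<open>X0\<close> are invisible in the factor; cut
    along a countable cover by bisections they become null bisections, which are added to the pulled
    back graphing.\<close>
  define \<nu> where "\<nu> k = \<beta> k \<inter> (source G -` (Ob - X0) \<inter> Ar)" for k
  have N: "source G -` (Ob - X0) \<inter> Ar \<in> null_sets (arrows G)" by (rule null_preimage[OF _ compl_X0_null]) simp
  have \<nu>null: "\<nu> k \<in> null_sets (arrows G)" for k unfolding \<nu>_def by (rule complete_ar[OF N]) blast
  have \<nu>: "bisection G (\<nu> k)" for k
    using \<beta>(1)[of k] null_setsD2[OF \<nu>null[of k]] unfolding bisection_def \<nu>_def by (blast intro: inj_on_subset)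
  have \<nu>U: "(\<Union>k. \<nu> k) = {g \<in> Ar. source G g \<notin> X0}"
    unfolding \<nu>_def Int_UN_distrib2[symmetric] using \<beta>(2) s_in by auto
  have grG: "graphing G J (\<lambda>i. pull (\<Psi> i))" using gr pull_bisection by (auto simp: graphing_def)
  let ?E = "(\<Union>i\<in>J. pull (\<Psi> i)) \<union> (\<Union>k\<in>UNIV. \<nu> k)"
  let ?H = "\<Union>L. arrow_ball G ?E L"
  have E: "?E \<subseteq> Ar" using \<nu>U by (auto simp: pull_def)
  have H: "subgroupoid G ?H" by (rule subgroupoid_balls[OF E])
  have EH: "?E \<subseteq> ?H" using ball_1[OF E] by blast
  note Hmult = subgroupoid_mult[OF H] and Hinv = subgroupoid_inv[OF H] and HOb = subgroupoid_unit[OF H]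
  \<comment> \<open>Pairs all of whose lifts are generated. Quantifying over all lifts admits pairs
    without any lift, which may occur because C can contain more than the codes of points of
    \<open>X0\<close>.\<close>
  define K where "K = {(y, r) \<in> ra.Rel. \<forall>x\<in>X0. \<forall>\<gamma>\<in>I. \<pi> x = r \<longrightarrow> sh \<gamma> r = y \<longrightarrow> arr \<gamma> x \<in> ?H}"
  have KI: "(y, r) \<in> K" if "(y, r) \<in> ra.Rel" "\<And>x \<gamma>. x \<in> X0 \<Longrightarrow> \<gamma> \<in> I \<Longrightarrow> \<pi> x = r \<Longrightarrow> sh \<gamma> r = y \<Longrightarrow> arr \<gamma> x \<in> ?H" for y r
    using that unfolding K_def by auto
  have KD: "arr \<gamma> x \<in> ?H" if "(sh \<gamma> (\<pi> x), \<pi> x) \<in> K" "x \<in> X0" "\<gamma> \<in> I" for \<gamma> x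
    using that unfolding K_def by auto
  have "subgroupoid ra.OG K"
    unfolding subgroupoid_def ra.base_OG ra.space_OG
  proof (intro conjI ballI impI)
    show "{(x, x) | x. x \<in> C} \<subseteq> K"
    proof clarify
      fix r assume r: "r \<in> C"
      show "(r, r) \<in> K"
      proof (rule KI[OF ra.Rel_refl[OF r]])
        fix x \<gamma> assume x: "x \<in> X0" "\<gamma> \<in> I" "\<pi> x = r" "sh \<gamma> r = r"
        then have "\<gamma> = \<one>\<^bsub>\<Gamma>\<^esub>" using \<pi>_free[OF x(1,2)] sh_\<pi>[OF x(1,2)] by simp
        then have "arr \<gamma> x \<in> Ob" using arr_one[OF x(1)] subsetD[OF X0_Ob x(1)] by simp
        then show "arr \<gamma> x \<in> ?H" by (rule HOb)
      qed
    qed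
    show "K \<subseteq> ra.Rel" by (auto simp: K_def)
    show "ginv ra.OG p \<in> K" if p: "p \<in> K" for p
    proof -
      obtain y r where yr: "p = (y, r)" "(y, r) \<in> ra.Rel" using p by (auto simp: K_def)
      have "(r, y) \<in> K"
      proof (rule KI[OF ra.Rel_sym[OF yr(2)]])
        fix x \<gamma> assume x: "x \<in> X0" "\<gamma> \<in> I" "\<pi> x = y" "sh \<gamma> y = r"
        let ?x' = "act \<gamma> x"
        have x': "?x' \<in> X0" "\<pi> ?x' = r" using x act_in sh_\<pi> by auto
        have "sh (inv\<^bsub>\<Gamma>\<^esub> \<gamma>) (\<pi> ?x') = y" using x x' sh_\<pi>[OF x'(1), of "inv\<^bsub>\<Gamma>\<^esub> \<gamma>"] act_inv by simp
        then have "arr (inv\<^bsub>\<Gamma>\<^esub> \<gamma>) ?x' \<in> ?H" using x x' p yr by (intro KD) auto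
        then have "ginv G (ginv G (arr \<gamma> x)) \<in> ?H" unfolding arr_inv[OF x(1,2)] by (rule Hinv)
        then show "arr \<gamma> x \<in> ?H" unfolding ginv_ginv[OF arr(1)[OF x(1,2)]] .
      qed
      then show ?thesis by (simp add: yr ra.OG_simps)
    qed
    show "gmult ra.OG p q \<in> K" if p: "p \<in> K" and q: "q \<in> K" and c: "source ra.OG p = target ra.OG q" for p q
    proof -
      obtain z y where zy: "p = (z, y)" "(z, y) \<in> ra.Rel" using p by (auto simp: K_def)
      obtain y' r where yr: "q = (y', r)" "(y', r) \<in> ra.Rel" using q by (auto simp: K_def)
      have y': "y' = y" using c by (simp add: zy yr ra.OG_simps)
      obtain \<delta> where \<delta>: "\<delta> \<in> I" "y = sh \<delta> r" "r \<in> C" using yr y' ra.Rel_iff by auto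
      have "(z, r) \<in> K"
      proof (rule KI[OF ra.Rel_trans[OF zy(2)]])
        show "(y, r) \<in> ra.Rel" using yr y' by simp
        fix x \<gamma> assume x: "x \<in> X0" "\<gamma> \<in> I" "\<pi> x = r" "sh \<gamma> r = z"
        \<comment> \<open>The element \<delta> leads from r to the middle point y; the lift over
          \<gamma> is factored through the corresponding point above y.\<close>
        let ?x' = "act \<delta> x" and ?\<gamma>' = "\<gamma> \<otimes>\<^bsub>\<Gamma>\<^esub> inv\<^bsub>\<Gamma>\<^esub> \<delta>"
        have x': "?x' \<in> X0" "\<pi> ?x' = y" using x \<delta> act_in sh_\<pi> by auto
        have 1: "arr \<delta> x \<in> ?H" using q yr y' x \<delta> by (intro KD) auto
        have g': "?\<gamma>' \<otimes>\<^bsub>\<Gamma>\<^esub> \<delta> = \<gamma>" "?\<gamma>' \<in> I" using x \<delta> by (simp_all add: m_assoc)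
        have "act ?\<gamma>' ?x' = act \<gamma> x" using arr_mult(2)[OF x(1) g'(2) \<delta>(1)] g'(1) by simp
        then have "sh ?\<gamma>' (\<pi> ?x') = z" using sh_\<pi>[OF x'(1) g'(2)] sh_\<pi>[OF x(1,2)] x by simp
        then have 2: "arr ?\<gamma>' ?x' \<in> ?H" using p zy x' g'(2) by (intro KD) auto
        have "arr \<gamma> x = gmult G (arr ?\<gamma>' ?x') (arr \<delta> x)" using arr_mult(1)[OF x(1) g'(2) \<delta>(1)] g'(1) by simp
        moreover have "source G (arr ?\<gamma>' ?x') = target G (arr \<delta> x)" unfolding arr(2)[OF x'(1) g'(2)] by (simp add: act_def)
        ultimately show "arr \<gamma> x \<in> ?H" using Hmult[OF 2 1] by simp
      qed
      then show ?thesis by (simp add: zy yr ra.OG_simps)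
    qed
  qed
  moreover have "\<forall>i\<in>J. \<Psi> i \<subseteq> K"
  proof (intro ballI subrelI)
    fix i y r assume i: "i \<in> J" and yr: "(y, r) \<in> \<Psi> i"
    have "\<Psi> i \<subseteq> ra.Rel"
      using gr i sets.sets_into_space[of "\<Psi> i" "arrows ra.OG"] by (auto simp: graphing_def bisection_def ra.space_OG)
    show "(y, r) \<in> K"
    proof (rule KI)
      show "(y, r) \<in> ra.Rel" using yr \<open>\<Psi> i \<subseteq> ra.Rel\<close> by blast
      fix x \<gamma> assume "x \<in> X0" "\<gamma> \<in> I" "\<pi> x = r" "sh \<gamma> r = y"
      then have "arr \<gamma> x \<in> pull (\<Psi> i)" using pull_arr yr by simp
      then show "arr \<gamma> x \<in> ?H" using EH i by blast
    qed
  qed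
  ultimately have "ra.Rel \<subseteq> K" using generatingD[OF gen, of K] by (simp only: ra.space_OG)
  have "Ar \<subseteq> ?H"
  proof
    fix g assume g: "g \<in> Ar"
    show "g \<in> ?H"
    proof (cases "source G g \<in> X0")
      case True
      then obtain \<gamma> x where x: "\<gamma> \<in> I" "x \<in> X0" "g = arr \<gamma> x" by (rule Ar_X0[OF g])
      have "(sh \<gamma> (\<pi> x), \<pi> x) \<in> ra.Rel" using x \<pi>_in by (auto simp: ra.Rel_iff)
      then have "(sh \<gamma> (\<pi> x), \<pi> x) \<in> K" using \<open>ra.Rel \<subseteq> K\<close> by blast
      then show ?thesis unfolding x(3) using x(1,2) by (intro KD)
    next
      case False
      then have "g \<in> (\<Union>k. \<nu> k)" using g \<nu>U by simp
      then show ?thesis using EH by blast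
    qed
  qed
  then have "cost G \<le> graphing_cost G J (\<lambda>i. pull (\<Psi> i))"
    using \<nu> \<nu>null by (intro cost_le_null[OF grG, of UNIV \<nu>]) auto
  also have "\<dots> \<le> graphing_cost ra.OG J \<Psi>"
    unfolding graphing_cost_def using gr pull_sets(2)
    by (intro infsum_mono ennreal_summable_on) (auto simp: graphing_def bisection_def ra.sets_OG)
  finally show "cost G \<le> graphing_cost ra.OG J \<Psi>" .
qed

text \<open>
  If the coded sets determine the graphing \<open>\<Psi>\<close>, it descends to the standard factor. The image of \<open>X0\<close>
  need not be measurable there, so the properties of \<open>\<Psi>\<close> are reformulated as Borel conditions that
  hold on it: outside \<open>bad\<close> the descended sets are bisections, and \<open>reach L \<gamma>\<close> consists of the points
  from which words of length at most \<open>L\<close> in the descended graphing lead to \<open>\<gamma>\<close>.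
\<close>

lemma OG_le_cost:
  fixes J :: "nat set"
  assumes gr: "graphing G J \<Psi>" and gen: "generating G J \<Psi>"
    and \<kappa>: "\<And>i \<gamma>. i \<in> J \<Longrightarrow> \<gamma> \<in> I \<Longrightarrow> B (\<kappa> i \<gamma>) = {x \<in> X0. arr \<gamma> x \<in> \<Psi> i}"
  shows "cost ra.OG \<le> graphing_cost G J \<Psi>"
proof -
  \<comment> \<open>The digit at the neutral element tells whether a point lies in the coded set,
    here whether its arrow over \<gamma> belongs to \<open>\<Psi> i\<close>.\<close>
  define P where "P i \<gamma> = {r \<in> C. decode I r (\<kappa> i \<gamma>) \<one>\<^bsub>\<Gamma>\<^esub>}" for i \<gamma>
  have Psets: "P i \<gamma> \<in> sets M" for i \<gamma>
  proof -
    have "P i \<gamma> = C \<inter> {r. decode I r (\<kappa> i \<gamma>) \<one>\<^bsub>\<Gamma>\<^esub>}" by (auto simp: P_def)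
    then show ?thesis using sets.Int[OF C_borel decode_sets] by (simp add: sets_M_iff)
  qed
  have P\<pi>: "\<pi> x \<in> P i \<gamma> \<longleftrightarrow> arr \<gamma> x \<in> \<Psi> i" if "x \<in> X0" "i \<in> J" "\<gamma> \<in> I" for x i \<gamma>
    using that \<kappa>[OF that(2,3)] by (auto simp: P_def \<pi>_in decode_\<pi> act_one)
  \<comment> \<open>Two ways to fail to be a bisection: arrows over \<gamma> and \<delta> have the
    same source r, or they have the same target. In the second case the other source is obtained
    from r by applying \<gamma> and then the inverse of \<delta>.\<close>
  define bad where "bad i \<gamma> \<delta> = (if \<gamma> = \<delta> then {} else P i \<gamma> \<inter> P i \<delta> \<union>
      (P i \<gamma> \<inter> (sh (inv\<^bsub>\<Gamma>\<^esub> \<delta> \<otimes>\<^bsub>\<Gamma>\<^esub> \<gamma>) -` P i \<delta> \<inter> C)))" for i \<gamma> \<delta>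
  define Q where "Q i = C - (\<Union>\<gamma>\<in>I. \<Union>\<delta>\<in>I. bad i \<gamma> \<delta>)" for i
  have badsets: "bad i \<gamma> \<delta> \<in> sets M" if "\<gamma> \<in> I" "\<delta> \<in> I" for i \<gamma> \<delta>
    using Psets measurable_sets[OF sh_meas Psets, of "inv\<^bsub>\<Gamma>\<^esub> \<delta> \<otimes>\<^bsub>\<Gamma>\<^esub> \<gamma>"] that by (auto simp: bad_def space_M)
  have Csets: "C \<in> sets M" using C_borel by (simp add: sets_M_iff)
  have Qsets: "Q i \<in> sets M" for i
    unfolding Q_def using badsets Csets countable_group by (intro sets.Diff sets.countable_UN') auto
  have bis: "bisection G (\<Psi> i)" if "i \<in> J" for i using gr that by (auto simp: graphing_def)
  have \<pi>Q: "\<pi> x \<in> Q i" if x: "x \<in> X0" and i: "i \<in> J" for x i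
  proof -
    have "\<pi> x \<notin> bad i \<gamma> \<delta>" if "\<gamma> \<in> I" "\<delta> \<in> I" for \<gamma> \<delta>
    proof
      assume b: "\<pi> x \<in> bad i \<gamma> \<delta>"
      then have ne: "\<gamma> \<noteq> \<delta>" and 1: "arr \<gamma> x \<in> \<Psi> i" using P\<pi>[OF x i that(1)] by (auto simp: bad_def split: if_splits)
      let ?\<epsilon> = "inv\<^bsub>\<Gamma>\<^esub> \<delta> \<otimes>\<^bsub>\<Gamma>\<^esub> \<gamma>"
      have e: "?\<epsilon> \<in> I" using that by simp
      from b ne consider "\<pi> x \<in> P i \<delta>" | "sh ?\<epsilon> (\<pi> x) \<in> P i \<delta>" by (auto simp: bad_def)
      then show False
      proof cases
        case 1
        then have "arr \<delta> x \<in> \<Psi> i" using P\<pi>[OF x i that(2)] by simp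
        then have "arr \<delta> x = arr \<gamma> x" using \<open>arr \<gamma> x \<in> \<Psi> i\<close> bis[OF i] arr[OF x] that
          by (auto simp: bisection_def intro: inj_onD)
        then show False using ne arr(3)[OF x] that by metis
      next
        case 2
        let ?y = "act ?\<epsilon> x"
        have y: "?y \<in> X0" using act_in[OF x e] .
        have "arr \<delta> ?y \<in> \<Psi> i" using 2 P\<pi>[OF y i that(2)] sh_\<pi>[OF x e] by simp
        moreover have "act \<delta> ?y = act \<gamma> x"
        proof -
          have "\<delta> \<otimes>\<^bsub>\<Gamma>\<^esub> ?\<epsilon> = \<gamma>" using that by (simp flip: m_assoc)
          then show ?thesis using arr_mult(2)[OF x that(2) e] by simp
        qed
        then have "target G (arr \<delta> ?y) = target G (arr \<gamma> x)" by (simp add: act_def)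
        ultimately have "arr \<delta> ?y = arr \<gamma> x"
          using \<open>arr \<gamma> x \<in> \<Psi> i\<close> bis[OF i] by (auto simp: bisection_def intro: inj_onD)
        then show False using ne arr(3)[OF x that(1)] arr(3)[OF y that(2)] by metis
      qed
    qed
    then show ?thesis unfolding Q_def using \<pi>_in by blast
  qed
  define D where "D i \<gamma> = P i \<gamma> \<inter> Q i" for i \<gamma>
  have Dsets: "D i \<gamma> \<in> sets M" for i \<gamma> unfolding D_def using Psets Qsets by (rule sets.Int)
  have DC: "D i \<gamma> \<subseteq> C" for i \<gamma> unfolding D_def P_def by blast
  have D\<pi>: "\<pi> x \<in> D i \<gamma> \<longleftrightarrow> arr \<gamma> x \<in> \<Psi> i" if "x \<in> X0" "i \<in> J" "\<gamma> \<in> I" for x i \<gamma>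
    using P\<pi>[OF that] \<pi>Q[OF that(1,2)] by (simp add: D_def)
  have D1: "\<gamma> = \<delta>" if "r \<in> D i \<gamma>" "r \<in> D i \<delta>" "\<gamma> \<in> I" "\<delta> \<in> I" for r i \<gamma> \<delta>
    using that by (auto simp: D_def Q_def bad_def split: if_splits)
  have D2: "\<gamma> = \<delta>" if "r \<in> D i \<gamma>" "sh (inv\<^bsub>\<Gamma>\<^esub> \<delta> \<otimes>\<^bsub>\<Gamma>\<^esub> \<gamma>) r \<in> D i \<delta>" "\<gamma> \<in> I" "\<delta> \<in> I" for r i \<gamma> \<delta>
    using that DC by (auto simp: D_def Q_def bad_def split: if_splits)
  define gra where "gra \<gamma> A = (\<lambda>r. (sh \<gamma> r, r)) ` A" for \<gamma> and A :: "real set"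
  define \<Theta> where "\<Theta> i = (\<Union>\<gamma>\<in>I. gra \<gamma> (D i \<gamma>))" for i
  have gra_sets: "gra \<gamma> A \<in> sets (arrows ra.OG)" if "A \<in> sets M" "\<gamma> \<in> I" for \<gamma> A
    unfolding gra_def ra.sets_OG using that by (rule ra.graph_sets)
  have \<Theta>sets: "\<Theta> i \<in> sets (arrows ra.OG)" for i
    unfolding \<Theta>_def using gra_sets[OF Dsets] countable_group by (intro sets.countable_UN') auto
  have \<Theta>E: "\<exists>\<gamma>\<in>I. r \<in> D i \<gamma> \<and> y = sh \<gamma> r" if "(y, r) \<in> \<Theta> i" for y r i
    using that by (auto simp: \<Theta>_def gra_def)
  have \<Theta>bis: "bisection ra.OG (\<Theta> i)" for i
    unfolding bisection_def
  proof (intro conjI \<Theta>sets inj_onI)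
    fix p q assume p: "p \<in> \<Theta> i" and q: "q \<in> \<Theta> i" and st: "source ra.OG p = source ra.OG q"
    obtain y r y' r' where pq: "p = (y, r)" "q = (y', r')" by (cases p, cases q)
    show "p = q" using p q st \<Theta>E[of y r i] \<Theta>E[of y' r' i] D1 unfolding pq by (auto simp: ra.OG_simps)
  next
    fix p q assume p: "p \<in> \<Theta> i" and q: "q \<in> \<Theta> i" and st: "target ra.OG p = target ra.OG q"
    obtain y r y' r' where pq: "p = (y, r)" "q = (y', r')" by (cases p, cases q)
    obtain \<gamma> where \<gamma>: "\<gamma> \<in> I" "r \<in> D i \<gamma>" "y = sh \<gamma> r" using \<Theta>E p pq by blast
    obtain \<delta> where \<delta>: "\<delta> \<in> I" "r' \<in> D i \<delta>" "y' = sh \<delta> r'" using \<Theta>E q pq by blast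
    have r: "r \<in> C" "r' \<in> C" using \<gamma> \<delta> DC by auto
    have eq: "sh \<delta> r' = sh \<gamma> r" using st pq \<gamma> \<delta> by (simp add: ra.OG_simps)
    have "r' = sh (inv\<^bsub>\<Gamma>\<^esub> \<delta>) (sh \<delta> r')" using ra.a_inv[OF r(2) \<delta>(1)] by simp
    also have "\<dots> = sh (inv\<^bsub>\<Gamma>\<^esub> \<delta> \<otimes>\<^bsub>\<Gamma>\<^esub> \<gamma>) r" unfolding eq using ra.a_mult[OF r(1), of "inv\<^bsub>\<Gamma>\<^esub> \<delta>" \<gamma>] \<gamma> \<delta> by simp
    finally have r': "r' = sh (inv\<^bsub>\<Gamma>\<^esub> \<delta> \<otimes>\<^bsub>\<Gamma>\<^esub> \<gamma>) r" .
    then have "\<gamma> = \<delta>" using D2[OF \<gamma>(2) _ \<gamma>(1) \<delta>(1)] \<delta>(2) by simp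
    then have "r' = r" using r' \<delta>(1) ra.a_one[OF r(1)] by simp
    then show "p = q" using pq \<gamma> \<delta> \<open>\<gamma> = \<delta>\<close> by simp
  qed
  \<comment> \<open>The pieces that count each pair once lift to disjoint sets of arrows, and these
    lie in \<open>\<Psi> i\<close> because over a point of \<open>X0\<close> the two codes determine
    the group element.\<close>
  have \<Theta>le: "emeasure (arrows ra.OG) (\<Theta> i) \<le> emeasure (arrows G) (\<Psi> i)" if i: "i \<in> J" for i
  proof -
    have ms: "\<Psi> i \<in> sets (arrows G)" using bis[OF i] by (simp add: bisection_def)
    have fr: "emeasure M (ra.fresh (\<Theta> i) n) \<le> emeasure (arrows G) (arr (ra.gam n) ` {x \<in> X0. \<pi> x \<in> ra.fresh (\<Theta> i) n})" for n
      using ra.fresh_sets[of "\<Theta> i" n] \<Theta>sets[of i] \<pi>_preimage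
      by (subst arr_image(2)[OF _ _ ra.gam_in]) (auto simp: emeasure_M ra.sets_OG)
    let ?A = "\<lambda>n. arr (ra.gam n) ` {x \<in> X0. \<pi> x \<in> ra.fresh (\<Theta> i) n}"
    have As: "?A n \<in> sets (arrows G)" for n
      using ra.fresh_sets[of "\<Theta> i" n] \<Theta>sets[of i] \<pi>_preimage by (intro arr_image(1) ra.gam_in) (auto simp: ra.sets_OG)
    have "emeasure (arrows ra.OG) (\<Theta> i) = (\<Sum>n. emeasure M (ra.fresh (\<Theta> i) n))"
      using \<Theta>sets[of i] by (intro ra.emeasure_OG_fresh) (simp add: ra.sets_OG)
    also have "\<dots> \<le> (\<Sum>n. emeasure (arrows G) (?A n))" by (intro suminf_le fr) auto
    also have "\<dots> = emeasure (arrows G) (\<Union>n. ?A n)"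
    proof (rule suminf_emeasure)
      show "range ?A \<subseteq> sets (arrows G)" using As by auto
      show "disjoint_family ?A"
        unfolding disjoint_family_on_def
      proof (intro ballI impI)
        fix m n :: nat assume "m \<noteq> n"
        have *: "?A m \<inter> ?A n = {}" if "m < n" for m n
        proof (rule ccontr)
          assume "?A m \<inter> ?A n \<noteq> {}"
          then obtain x x' where x: "x \<in> X0" "\<pi> x \<in> ra.fresh (\<Theta> i) m" and x': "x' \<in> X0" "\<pi> x' \<in> ra.fresh (\<Theta> i) n"
            and eq: "arr (ra.gam m) x = arr (ra.gam n) x'" by blast
          have "ra.gam m = ra.gam n" using arr(3)[OF x(1) ra.gam_in] arr(3)[OF x'(1) ra.gam_in] eq by metis
          then show False using x'(2) that by (auto simp: ra.fresh_def)
        qed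
        then show "?A m \<inter> ?A n = {}" using \<open>m \<noteq> n\<close> *[of m n] *[of n m] by (metis Int_commute linorder_neqE_nat)
      qed
    qed
    also have "\<dots> \<le> emeasure (arrows G) (\<Psi> i)"
    proof (rule emeasure_mono[OF UN_least ms])
      fix n show "?A n \<subseteq> \<Psi> i"
      proof clarify
        fix x assume x: "x \<in> X0" "\<pi> x \<in> ra.fresh (\<Theta> i) n"
        then have "(sh (ra.gam n) (\<pi> x), \<pi> x) \<in> \<Theta> i" by (simp add: ra.fresh_def)
        then obtain \<gamma> where g: "\<gamma> \<in> I" "\<pi> x \<in> D i \<gamma>" "sh (ra.gam n) (\<pi> x) = sh \<gamma> (\<pi> x)" using \<Theta>E by blast
        then have "ra.gam n = \<gamma>" using \<pi>_act_inj[OF x(1) ra.gam_in g(1)] sh_\<pi>[OF x(1)] ra.gam_in by metis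
        then show "arr (ra.gam n) x \<in> \<Psi> i" using D\<pi>[OF x(1) i g(1)] g(2) by simp
      qed
    qed
    finally show ?thesis .
  qed
  \<comment> \<open>The last applied letter of a word leading to \<gamma> is a piece over \<delta>
    or the inverse of one. In the first case the rest leads to
    \<open>inv \<delta> \<otimes> \<gamma>\<close>, where the letter starts; in the second the rest
    leads to \<open>\<delta> \<otimes> \<gamma>\<close>, and the piece runs there from
    \<gamma>.\<close>
  define step where "step S \<gamma> =
      (S \<gamma> \<union> (\<Union>i\<in>J. \<Union>\<delta>\<in>I. (sh (inv\<^bsub>\<Gamma>\<^esub> \<delta> \<otimes>\<^bsub>\<Gamma>\<^esub> \<gamma>) -` D i \<delta> \<inter> C) \<inter> S (inv\<^bsub>\<Gamma>\<^esub> \<delta> \<otimes>\<^bsub>\<Gamma>\<^esub> \<gamma>))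
        \<union> (\<Union>i\<in>J. \<Union>\<delta>\<in>I. (sh \<gamma> -` D i \<delta> \<inter> C) \<inter> S (\<delta> \<otimes>\<^bsub>\<Gamma>\<^esub> \<gamma>)))" for S :: "_ \<Rightarrow> real set" and \<gamma>
  define reach where "reach L = (step ^^ L) (\<lambda>\<gamma>. if \<gamma> = \<one>\<^bsub>\<Gamma>\<^esub> then C else {})" for L
  have reach_Suc: "reach (Suc L) = step (reach L)" for L by (simp add: reach_def)
  have reach_0: "reach 0 = (\<lambda>\<gamma>. if \<gamma> = \<one>\<^bsub>\<Gamma>\<^esub> then C else {})" by (simp add: reach_def)
  have Jc: "countable J" by simp
  have reach_sets: "reach L \<gamma> \<in> sets M" if "\<gamma> \<in> I" for L \<gamma>
    using that
  proof (induction L arbitrary: \<gamma>)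
    case 0
    then show ?case using Csets by (simp add: reach_0)
  next
    case (Suc L)
    have piece: "sh \<epsilon> -` D i \<delta> \<inter> C \<inter> reach L \<beta> \<in> sets M" if "\<epsilon> \<in> I" "\<beta> \<in> I" for \<epsilon> i \<delta> \<beta>
      using sets.Int[OF measurable_sets[OF sh_meas[OF that(1)] Dsets] Suc.IH[OF that(2)]] by (simp add: space_M)
    have "inv\<^bsub>\<Gamma>\<^esub> \<delta> \<otimes>\<^bsub>\<Gamma>\<^esub> \<gamma> \<in> I" "\<delta> \<otimes>\<^bsub>\<Gamma>\<^esub> \<gamma> \<in> I" if "\<delta> \<in> I" for \<delta>
      using that Suc.prems by simp_all
    then show ?case unfolding reach_Suc step_def
      by (intro sets.Un sets.countable_UN' Jc countable_group Suc.IH Suc.prems image_subsetI piece)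
  qed
  have reach_C: "reach L \<gamma> \<subseteq> C" if "\<gamma> \<in> I" for L \<gamma>
    using sets.sets_into_space[OF reach_sets[OF that]] by (simp add: space_M)
  \<comment> \<open>Where the descended graphing fails to generate: a Borel set that contains no
    code of a point of \<open>X0\<close>, hence a null set. The graphs of the group elements over it
    are null bisections and repair the generation.\<close>
  define Z where "Z = C - (\<Inter>\<gamma>\<in>I. \<Union>L. reach L \<gamma>)"
  have Ine: "I \<noteq> {}" using one_closed by blast
  have Zsets: "Z \<in> sets M"
    unfolding Z_def using reach_sets Csets countable_group Ine
    by (intro sets.Diff sets.countable_INT' sets.countable_UN) auto
  let ?E = "\<Union>i\<in>J. \<Psi> i"
  have ESub: "?E \<subseteq> Ar" using bis sets.sets_into_space by (auto simp: bisection_def)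
  have reach_ball: "\<pi> x \<in> reach L \<gamma>" if "x \<in> X0" "\<gamma> \<in> I" "arr \<gamma> x \<in> arrow_ball G ?E L" for x \<gamma> L
    using that
  proof (induction L arbitrary: \<gamma>)
    case 0
    then have "\<gamma> = \<one>\<^bsub>\<Gamma>\<^esub>" using T_unit arr(3) by (metis arrow_ball.simps(1))
    then show ?case by (simp add: reach_0 \<pi>_in)
  next
    case (Suc L)
    show ?case
    proof (cases "arr \<gamma> x \<in> arrow_ball G ?E L")
      case True
      then show ?thesis using Suc unfolding reach_Suc step_def by blast
    next
      case False
      then have "arr \<gamma> x \<in> gset_mult G (?E \<union> ginv G ` ?E) (arrow_ball G ?E L)" using Suc.prems(3) by simp
      then obtain e h where eh: "arr \<gamma> x = gmult G e h" "e \<in> ?E \<union> ginv G ` ?E" "h \<in> arrow_ball G ?E L"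
        "source G e = target G h" unfolding gset_mult_def by blast
      have Ar: "e \<in> Ar" "h \<in> Ar" using eh ESub inv_image_sub[OF ESub] arrow_ball_sub[OF ESub] by blast+
      have sh: "source G h = x" using s_mult[OF Ar eh(4)] eh(1) arr(2)[OF Suc.prems(1,2)] by simp
      define \<beta> where "\<beta> = T h"
      define \<delta> where "\<delta> = T e"
      have b: "\<beta> \<in> I" "\<delta> \<in> I" using Ar T_in by (auto simp: \<beta>_def \<delta>_def)
      have h: "h = arr \<beta> x" using arr_unique[OF Ar(2)] sh Suc.prems(1) by (simp add: \<beta>_def)
      let ?y = "act \<beta> x"
      have y: "?y \<in> X0" "source G e = ?y" using act_in Suc.prems(1) b eh(4) h by (auto simp: act_def)
      have e: "e = arr \<delta> ?y" using arr_unique[OF Ar(1)] y by (simp add: \<delta>_def)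
      have g: "\<gamma> = \<delta> \<otimes>\<^bsub>\<Gamma>\<^esub> \<beta>"
        using T_mult[OF Ar eh(4)] eh(1) arr(3)[OF Suc.prems(1,2)] by (simp add: \<beta>_def \<delta>_def)
      have IH: "\<pi> x \<in> reach L \<beta>" using Suc.IH[OF Suc.prems(1) b(1)] eh(3) h by simp
      from eh(2) show ?thesis
      proof
        assume "e \<in> ?E"
        then obtain i where i: "i \<in> J" "e \<in> \<Psi> i" by blast
        have "inv\<^bsub>\<Gamma>\<^esub> \<delta> \<otimes>\<^bsub>\<Gamma>\<^esub> \<gamma> = \<beta>" using b by (simp add: g flip: m_assoc)
        moreover have "sh \<beta> (\<pi> x) \<in> D i \<delta>" using D\<pi>[OF y(1) i(1) b(2)] i(2) e sh_\<pi>[OF Suc.prems(1) b(1)] by simp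
        ultimately have "\<pi> x \<in> (sh (inv\<^bsub>\<Gamma>\<^esub> \<delta> \<otimes>\<^bsub>\<Gamma>\<^esub> \<gamma>) -` D i \<delta> \<inter> C) \<inter> reach L (inv\<^bsub>\<Gamma>\<^esub> \<delta> \<otimes>\<^bsub>\<Gamma>\<^esub> \<gamma>)"
          using IH \<pi>_in by simp
        then show ?thesis unfolding reach_Suc step_def using i(1) b(2) by blast
      next
        assume "e \<in> ginv G ` ?E"
        then obtain i k where i: "i \<in> J" "k \<in> \<Psi> i" "e = ginv G k" by blast
        have kA: "k \<in> Ar" using i ESub by blast
        have d: "inv\<^bsub>\<Gamma>\<^esub> \<delta> \<in> I" using b by simp
        have k: "k = arr (inv\<^bsub>\<Gamma>\<^esub> \<delta>) (act \<gamma> x)"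
        proof -
          have "k = ginv G e" using i(3) ginv_ginv[OF kA] by simp
          also have "\<dots> = arr (inv\<^bsub>\<Gamma>\<^esub> \<delta>) (act \<delta> ?y)" using arr_inv[OF y(1) b(2)] e by simp
          also have "act \<delta> ?y = act \<gamma> x" using arr_mult(2)[OF Suc.prems(1) b(2,1)] g by simp
          finally show ?thesis .
        qed
        have gx: "act \<gamma> x \<in> X0" using act_in Suc.prems by blast
        have "sh \<gamma> (\<pi> x) \<in> D i (inv\<^bsub>\<Gamma>\<^esub> \<delta>)"
          using D\<pi>[OF gx i(1) d] i(2) k sh_\<pi>[OF Suc.prems(1,2)] by simp
        moreover have "inv\<^bsub>\<Gamma>\<^esub> \<delta> \<otimes>\<^bsub>\<Gamma>\<^esub> \<gamma> = \<beta>" using b by (simp add: g flip: m_assoc)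
        ultimately have "\<pi> x \<in> (sh \<gamma> -` D i (inv\<^bsub>\<Gamma>\<^esub> \<delta>) \<inter> C) \<inter> reach L (inv\<^bsub>\<Gamma>\<^esub> \<delta> \<otimes>\<^bsub>\<Gamma>\<^esub> \<gamma>)"
          using IH \<pi>_in by simp
        then show ?thesis unfolding reach_Suc step_def using i(1) d by blast
      qed
    qed
  qed
  have ArE: "Ar \<subseteq> (\<Union>L. arrow_ball G ?E L)" using gen generating_iff[OF ESub] by simp
  have "\<pi> x \<notin> Z" if x: "x \<in> X0" for x
  proof -
    have "\<pi> x \<in> (\<Union>L. reach L \<gamma>)" if "\<gamma> \<in> I" for \<gamma>
      using reach_ball[OF x that] arr(1)[OF x that] ArE by blast
    then show ?thesis by (simp add: Z_def)
  qed
  then have "{x \<in> X0. \<pi> x \<in> Z} = {}" by blast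
  then have "emeasure M Z = 0" unfolding emeasure_M[OF Zsets] by (simp only: emeasure_empty)
  define \<nu> where "\<nu> \<gamma> = gra \<gamma> Z" for \<gamma>
  have \<nu>0: "emeasure (arrows ra.OG) (\<nu> \<gamma>) = 0" if "\<gamma> \<in> I" for \<gamma>
    unfolding \<nu>_def gra_def using ra.emeasure_graph[OF Zsets that] \<open>emeasure M Z = 0\<close> by simp
  have \<nu>bis: "bisection ra.OG (\<nu> \<gamma>)" if "\<gamma> \<in> I" for \<gamma>
  proof -
    have "inj_on (sh \<gamma>) Z" using ra.inj_prop[OF that] by (rule inj_on_subset) (auto simp: Z_def)
    then show ?thesis
      unfolding bisection_def \<nu>_def using gra_sets[OF Zsets that]
      by (auto simp: gra_def ra.OG_simps inj_on_def)
  qed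
  let ?F = "(\<Union>i\<in>J. \<Theta> i) \<union> (\<Union>\<gamma>\<in>I. \<nu> \<gamma>)"
  have \<Theta>R: "\<Theta> i \<subseteq> ra.Rel" for i using sets.sets_into_space[OF \<Theta>sets] by (simp add: ra.space_OG)
  have FR: "?F \<subseteq> space (arrows ra.OG)"
  proof (intro Un_least UN_least)
    show "\<Theta> i \<subseteq> space (arrows ra.OG)" for i by (simp only: ra.space_OG \<Theta>R)
    show "\<nu> \<gamma> \<subseteq> space (arrows ra.OG)" if "\<gamma> \<in> I" for \<gamma>
      using \<nu>bis[OF that] unfolding bisection_def by (intro sets.sets_into_space) simp
  qed
  let ?H = "\<Union>L. arrow_ball ra.OG ?F L"
  have FH: "?F \<subseteq> ?H" using ra.OG.ball_1[OF FR] by blast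
  have H: "subgroupoid ra.OG ?H" by (rule ra.OG.subgroupoid_balls[OF FR])
  have Hmult: "(z, x) \<in> ?H" if "(z, y) \<in> ?H" "(y, x) \<in> ?H" for x y z
  proof -
    have "gmult ra.OG (z, y) (y, x) \<in> ?H"
      by (rule subgroupoid_mult[OF H that]) (simp only: ra.OG_simps)
    then show ?thesis by (simp add: ra.OG_simps)
  qed
  have Hinv: "(x, y) \<in> ?H" if "(y, x) \<in> ?H" for x y
  proof -
    have "ginv ra.OG (y, x) \<in> ?H" by (rule subgroupoid_inv[OF H that])
    then show ?thesis by (simp add: ra.OG_simps)
  qed
  have Hone: "(r, r) \<in> ?H" if "r \<in> C" for r
    using that by (intro subgroupoid_unit[OF H]) (auto simp: ra.base_OG)
  have \<Theta>H: "(sh \<delta> r, r) \<in> ?H" if "i \<in> J" "\<delta> \<in> I" "r \<in> D i \<delta>" for i \<delta> r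
  proof -
    have "(sh \<delta> r, r) \<in> \<Theta> i" using that by (auto simp: \<Theta>_def gra_def)
    then show ?thesis using FH that(1) by blast
  qed
  have reach_H: "(sh \<gamma> r, r) \<in> ?H" if "\<gamma> \<in> I" "r \<in> reach L \<gamma>" for \<gamma> r L
    using that
  proof (induction L arbitrary: \<gamma>)
    case 0
    then show ?case using Hone ra.a_one by (auto simp: reach_0 split: if_splits)
  next
    case (Suc L)
    have r: "r \<in> C" using reach_C[OF Suc.prems(1)] Suc.prems(2) by blast
    from Suc.prems(2) consider "r \<in> reach L \<gamma>"
      | i \<delta> where "i \<in> J" "\<delta> \<in> I" "sh (inv\<^bsub>\<Gamma>\<^esub> \<delta> \<otimes>\<^bsub>\<Gamma>\<^esub> \<gamma>) r \<in> D i \<delta>" "r \<in> reach L (inv\<^bsub>\<Gamma>\<^esub> \<delta> \<otimes>\<^bsub>\<Gamma>\<^esub> \<gamma>)"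
      | i \<delta> where "i \<in> J" "\<delta> \<in> I" "sh \<gamma> r \<in> D i \<delta>" "r \<in> reach L (\<delta> \<otimes>\<^bsub>\<Gamma>\<^esub> \<gamma>)"
      unfolding reach_Suc step_def by blast
    then show ?case
    proof cases
      case 1
      then show ?thesis using Suc by blast
    next
      case 2
      let ?\<beta> = "inv\<^bsub>\<Gamma>\<^esub> \<delta> \<otimes>\<^bsub>\<Gamma>\<^esub> \<gamma>"
      have b: "?\<beta> \<in> I" using 2 Suc.prems by simp
      have "sh \<delta> (sh ?\<beta> r) = sh \<gamma> r"
        using ra.a_mult[OF r 2(2) b] 2(2) Suc.prems(1) by (simp flip: m_assoc)
      then have "(sh \<gamma> r, sh ?\<beta> r) \<in> ?H" using \<Theta>H[OF 2(1,2,3)] by simp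
      from Hmult[OF this Suc.IH[OF b 2(4)]] show ?thesis .
    next
      case 3
      let ?\<beta> = "\<delta> \<otimes>\<^bsub>\<Gamma>\<^esub> \<gamma>"
      have b: "?\<beta> \<in> I" using 3 Suc.prems by simp
      have "sh \<delta> (sh \<gamma> r) = sh ?\<beta> r"
        using ra.a_mult[OF r 3(2) Suc.prems(1)] by simp
      then have "(sh ?\<beta> r, sh \<gamma> r) \<in> ?H" using \<Theta>H[OF 3(1,2,3)] by simp
      from Hmult[OF Hinv[OF this] Suc.IH[OF b 3(4)]] show ?thesis .
    qed
  qed
  have "space (arrows ra.OG) \<subseteq> ?H"
    unfolding ra.space_OG
  proof (rule subrelI)
    fix y r assume "(y, r) \<in> ra.Rel"
    then obtain \<gamma> where g: "r \<in> C" "\<gamma> \<in> I" "y = sh \<gamma> r" using ra.Rel_iff by blast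
    show "(y, r) \<in> ?H"
    proof (cases "r \<in> Z")
      case True
      then have "(y, r) \<in> \<nu> \<gamma>" using g by (auto simp: \<nu>_def gra_def)
      then show ?thesis using FH g(2) by blast
    next
      case False
      then obtain L where "r \<in> reach L \<gamma>" using g by (auto simp: Z_def)
      then show ?thesis using reach_H g by blast
    qed
  qed
  then have "cost ra.OG \<le> graphing_cost ra.OG J \<Theta>"
    using \<Theta>bis \<nu>bis \<nu>0 countable_group by (intro ra.OG.cost_le_null[of J \<Theta> I \<nu>]) (auto simp: graphing_def)
  also have "\<dots> \<le> graphing_cost G J \<Psi>"
    unfolding graphing_cost_def using \<Theta>le by (intro infsum_mono ennreal_summable_on)
  finally show ?thesis .
qed

end

context free_group_factor
begin

lemma cost_le_sup: "cost G \<le> sup_cost \<Gamma>"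
proof -
  obtain B :: "nat \<Rightarrow> _" where B: "\<And>k. B k \<in> sets (base G)"
    "\<And>c. c \<in> Ar \<Longrightarrow> source G c \<noteq> target G c \<Longrightarrow> \<exists>k. source G c \<in> B k \<and> target G c \<notin> B k"
    using separated by blast
  interpret coded_factor G \<Gamma> T discarded B by standard (fact B)+
  have "cost G \<le> cost ra.OG" by (rule cost_le_OG)
  also have "\<dots> \<le> sup_cost \<Gamma>" unfolding sup_cost_def by (rule Sup_upper[OF cost_OG_in])
  finally show ?thesis .
qed

lemma inf_le_cost: "inf_cost \<Gamma> \<le> cost G"
  unfolding cost_def
proof (rule Inf_greatest, clarify)
  fix J :: "nat set" and \<Psi> assume gr: "graphing G J \<Psi>" and gen: "generating G J \<Psi>"
  obtain B0 :: "nat \<Rightarrow> _" where B0: "\<And>k. B0 k \<in> sets (base G)"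
    "\<And>c. c \<in> Ar \<Longrightarrow> source G c \<noteq> target G c \<Longrightarrow> \<exists>k. source G c \<in> B0 k \<and> target G c \<notin> B0 k"
    using separated by blast
  define D where "D i n = (if i \<in> J then {x \<in> X0. arr (from_nat_into (carrier \<Gamma>) n) x \<in> \<Psi> i} else {})" for i n
  \<comment> \<open>Even places separate the ends of arrows, which makes the factor free. Odd places
    record, for each piece of the graphing and each group element, at which points the arrow belongs
    to the piece; \<open>\<kappa>\<close> locates them.\<close>
  define B where "B m = (if even m then B0 (m div 2) else case_prod D (prod_decode (m div 2)))" for m
  define \<kappa> where "\<kappa> i \<gamma> = Suc (2 * prod_encode (i, to_nat_on (carrier \<Gamma>) \<gamma>))" for i \<gamma>
  have D: "D i n \<in> sets (base G)" for i n
  proof -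
    have "from_nat_into (carrier \<Gamma>) n \<in> carrier \<Gamma>" by (intro from_nat_into) auto
    then show ?thesis using gr unfolding D_def by (auto intro!: arr_preimage(1) simp: graphing_def bisection_def)
  qed
  interpret coded_factor G \<Gamma> T discarded B
  proof
    show "B k \<in> sets (base G)" for k using B0(1) D by (auto simp: B_def split: prod.splits)
    fix c assume c: "c \<in> Ar" "source G c \<noteq> target G c"
    then obtain k where k: "source G c \<in> B0 k \<and> target G c \<notin> B0 k" using B0(2) by blast
    have "B (2 * k) = B0 k" by (simp add: B_def)
    then show "\<exists>k. source G c \<in> B k \<and> target G c \<notin> B k" using k by metis
  qed
  have "inf_cost \<Gamma> \<le> cost ra.OG" unfolding inf_cost_def by (rule Inf_lower[OF cost_OG_in])
  also have "\<dots> \<le> graphing_cost G J \<Psi>"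
  proof (rule OG_le_cost[OF gr gen, of \<kappa>])
    fix i \<gamma> assume "i \<in> J" "\<gamma> \<in> carrier \<Gamma>"
    then show "B (\<kappa> i \<gamma>) = {x \<in> X0. arr \<gamma> x \<in> \<Psi> i}"
      by (simp add: B_def \<kappa>_def D_def countable_group)
  qed
  finally show "inf_cost \<Gamma> \<le> graphing_cost G J \<Psi>" .
qed

end

section \<open>Cost and combinatorial cost of the ultraproduct\<close>

text \<open>A word has finitely many letters, all of which occur in one member of an increasing
  sequence.\<close>

lemma arrow_ball_incseq:
  assumes "incseq E" shows "arrow_ball G (\<Union>k. E k) L \<subseteq> (\<Union>k. arrow_ball G (E k) L)"
proof (induction L)
  case (Suc L)
  have "gset_mult G ((\<Union>k. E k) \<union> ginv G ` (\<Union>k. E k)) (arrow_ball G (\<Union>k. E k) L) \<subseteq> (\<Union>k. arrow_ball G (E k) (Suc L))"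
  proof
    fix g assume "g \<in> gset_mult G ((\<Union>k. E k) \<union> ginv G ` (\<Union>k. E k)) (arrow_ball G (\<Union>k. E k) L)"
    then obtain e h where eh: "g = gmult G e h" "e \<in> (\<Union>k. E k) \<union> ginv G ` (\<Union>k. E k)"
      "h \<in> arrow_ball G (\<Union>k. E k) L" "source G e = target G h" unfolding gset_mult_def by blast
    obtain i where i: "e \<in> E i \<union> ginv G ` E i" using eh(2) by blast
    obtain j where j: "h \<in> arrow_ball G (E j) L" using eh(3) Suc by blast
    let ?k = "max i j"
    have "E i \<subseteq> E ?k" "E j \<subseteq> E ?k" using assms by (simp_all add: incseqD)
    then have "e \<in> E ?k \<union> ginv G ` E ?k" "h \<in> arrow_ball G (E ?k) L"
      using i j arrow_ball_mono[of "E j" "E ?k" G L] by auto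
    then have "g \<in> gset_mult G (E ?k \<union> ginv G ` E ?k) (arrow_ball G (E ?k) L)"
      unfolding gset_mult_def using eh by blast
    then show "g \<in> (\<Union>k. arrow_ball G (E k) (Suc L))" by auto
  qed
  with Suc show ?case by auto
qed simp

text \<open>Z is invariant, so a word that starts outside Z never enters it, and its letters then
  come from \<open>E'\<close> and inverses. The exceptional set does not grow with the
  length.\<close>

lemma (in groupoid) arrow_ball_modulo:
  assumes E: "E \<subseteq> Ar" "E' \<subseteq> Ar" and sub: "E \<subseteq> E' \<union> {g \<in> Ar. source G g \<in> Z}"
    and Z: "\<And>g. g \<in> Ar \<Longrightarrow> source G g \<in> Z \<longleftrightarrow> target G g \<in> Z"
  shows "arrow_ball G E L \<subseteq> arrow_ball G E' L \<union> {g \<in> Ar. source G g \<in> Z}"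
proof (induction L)
  case (Suc L)
  have "gset_mult G (E \<union> ginv G ` E) (arrow_ball G E L) \<subseteq> arrow_ball G E' (Suc L) \<union> {g \<in> Ar. source G g \<in> Z}"
  proof
    fix g assume "g \<in> gset_mult G (E \<union> ginv G ` E) (arrow_ball G E L)"
    then obtain e h where eh: "g = gmult G e h" "e \<in> E \<union> ginv G ` E" "h \<in> arrow_ball G E L"
      "source G e = target G h" unfolding gset_mult_def by blast
    have Are: "e \<in> Ar" using eh(2) E(1) inv_image_sub[OF E(1)] by blast
    have Arh: "h \<in> Ar" using eh(3) arrow_ball_sub[OF E(1)] by blast
    have g: "g \<in> Ar" "source G g = source G h"
      unfolding eh(1) using mult_in[OF Are Arh eh(4)] s_mult[OF Are Arh eh(4)] by auto
    show "g \<in> arrow_ball G E' (Suc L) \<union> {g \<in> Ar. source G g \<in> Z}"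
    proof (cases "source G g \<in> Z")
      case False
      then have hZ: "source G h \<notin> Z" "target G h \<notin> Z" using g(2) Z[OF Arh] by auto
      then have h: "h \<in> arrow_ball G E' L" using Suc eh(3) by blast
      have "source G e \<notin> Z" "target G e \<notin> Z" using hZ eh(4) Z[OF Are] by auto
      moreover have "k \<in> E'" if "k \<in> E" "source G k \<notin> Z" for k using sub that by blast
      moreover have "source G (ginv G k) = target G k" if "k \<in> E" for k using s_inv that E(1) by blast
      moreover have "target G (ginv G k) = source G k" if "k \<in> E" for k using t_inv that E(1) by blast
      ultimately have "e \<in> E' \<union> ginv G ` E'" using eh(2) by auto
      then have "g \<in> gset_mult G (E' \<union> ginv G ` E') (arrow_ball G E' L)"
        unfolding gset_mult_def using eh h by blast
      then show ?thesis by simp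
    qed (use g in simp)
  qed
  with Suc show ?case by auto
qed simp

lemma (in fin_groupoid) null_iff: "A \<subseteq> Ar \<Longrightarrow> A \<in> null_sets (arrows G) \<longleftrightarrow> (\<forall>g\<in>A. w (source G g) = 0)"
  using finite_subset[OF _ fin_Ar] by (auto simp: null_sets_def sets_Ar emeasure_Ar_s)

section \<open>Passage of graphings between the finite groupoids and the ultraproduct\<close>

context graphed_ultraproduct
begin

lemma \<Phi>_internal: "s \<in> S \<Longrightarrow> (\<lambda>n. \<Phi> n s) \<in> ar.internal"
  unfolding ar_internal wball_eq
  using fg.ball_1[OF \<Phi>_sub] by (intro exI[of _ "Suc 0"]) blast

lemma arrow_ball_internal: "E \<in> ar.internal \<Longrightarrow> (\<lambda>n. arrow_ball (G n) (E n) L) \<in> ar.internal"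
  unfolding ar_internal wball_eq using fg.ball_ball[OF \<Phi>_sub] by blast

lemma Ar_H: "space (arrows H) = (\<Union>L. arrow_ball H (us (\<lambda>n. \<Union>s\<in>S. \<Phi> n s)) L)"
  unfolding space_arrows_H ar.\<Omega>_eq arrow_ball_us wball_eq by simp

text \<open>The number \<open>K\<close> of pieces does not depend on \<open>n\<close>, so the pieces pass to the ultraproduct.\<close>

lemma decompose:
  assumes "E \<in> ar.internal"
  obtains K :: nat and P where "\<And>k. k < K \<Longrightarrow> P k \<in> ar.internal" "\<And>k n. k < K \<Longrightarrow> bisection (G n) (P k n)"
    "\<And>n. E n = (\<Union>k<K. P k n)" "\<And>n. emeasure (arrows (G n)) (E n) = (\<Sum>k<K. emeasure (arrows (G n)) (P k n))"
proof -
  obtain L where L: "\<And>n. E n \<subseteq> wball L n" using assms ar_internal by blast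
  obtain w :: "nat \<Rightarrow> _" where w: "bij_betw w {..<card (words L)} (words L)"
    using ex_bij_betw_nat_finite[OF finite_words] unfolding atLeast0LessThan by blast
  let ?K = "card (words L)"
  define P where "P k n = E n \<inter> disjointed (\<lambda>k. W (w k) n) k" for k n
  have wk: "w k \<in> words L" if "k < ?K" for k using w that by (auto simp: bij_betw_def)
  have sub: "P k n \<subseteq> W (w k) n" "P k n \<subseteq> E n" for k n
    unfolding P_def using disjointed_subset[of "\<lambda>k. W (w k) n" k] by auto
  have E: "E n = (\<Union>k<?K. P k n)" for n
  proof -
    have "words L = w ` {..<?K}" using w by (simp add: bij_betw_def)
    then have "(\<Union>v\<in>words L. W v n) = (\<Union>v\<in>w ` {..<?K}. W v n)" by (rule arg_cong)
    then have "E n \<subseteq> (\<Union>k\<in>{0..<?K}. W (w k) n)"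
      using L[of n] unfolding words_ball atLeast0LessThan by simp
    also have "\<dots> = (\<Union>k\<in>{0..<?K}. disjointed (\<lambda>k. W (w k) n) k)" by (rule finite_UN_disjointed_eq[symmetric])
    finally show ?thesis unfolding P_def atLeast0LessThan by blast
  qed
  have disj: "disjoint_family_on (\<lambda>k. P k n) {..<?K}" for n
    unfolding P_def using disjoint_family_disjointed[of "\<lambda>k. W (w k) n"]
    by (auto simp: disjoint_family_on_def)
  show thesis
  proof (rule that[of ?K P])
    show "P k \<in> ar.internal" for k by (rule ar_internal_sub[OF assms]) (rule sub)
    show "bisection (G n) (P k n)" if "k < ?K" for k n
      by (rule fg.bisection_sub[OF W_bis[OF wk[OF that]] sub(1)])
    show "E n = (\<Union>k<?K. P k n)" for n by (rule E)
    show "emeasure (arrows (G n)) (E n) = (\<Sum>k<?K. emeasure (arrows (G n)) (P k n))" for n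
    proof -
      have "P k n \<subseteq> AA n" for k using sub(2)[of k n] L[of n] wball_sub by blast
      then show ?thesis unfolding E[of n]
        by (intro sum_emeasure[symmetric] disj) (auto simp: fg.sets_Ar)
    qed
  qed
qed

lemma vol_sum: "(\<And>n. emeasure (arrows (G n)) (E n) = (\<Sum>k<K. emeasure (arrows (G n)) (P k n))) \<Longrightarrow>
    ar.vol E = (\<Sum>k<K. ar.vol (P k))"
  unfolding ar.vol_def by (simp add: Lim_sum)

text \<open>Words in \<open>us E\<close> recover the generators up to null parts, which are internal
  and can be added for free. The price is the volume of E because \<open>decompose\<close> cuts E
  into boundedly many bisections whose measures add up to that of E.\<close>

lemma cost_H_le_internal:
  assumes E: "E \<in> ar.internal"
    and gen: "\<forall>\<^sub>F n in \<UU>. \<forall>s\<in>S. \<exists>N\<in>null_sets (arrows (G n)). \<Phi> n s \<subseteq> arrow_ball (G n) (E n) L \<union> N"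
  shows "cost H \<le> ar.vol E"
proof -
  obtain K :: nat and P where P: "\<And>k. k < K \<Longrightarrow> P k \<in> ar.internal" "\<And>k n. k < K \<Longrightarrow> bisection (G n) (P k n)"
    "\<And>n. E n = (\<Union>k<K. P k n)" "\<And>n. emeasure (arrows (G n)) (E n) = (\<Sum>k<K. emeasure (arrows (G n)) (P k n))"
    using decompose[OF E] by blast
  \<comment> \<open>A finite groupoid has a largest null set of arrows, those over units of weight
    zero; it replaces the null sets of the hypothesis, which vary with s.\<close>
  define N where "N n = {g \<in> AA n. fg.w n (source (G n) g) = 0}" for n
  define \<nu> where "\<nu> s = us (\<lambda>n. \<Phi> n s \<inter> N n)" for s
  have \<nu>i: "(\<lambda>n. \<Phi> n s \<inter> N n) \<in> ar.internal" if "s \<in> S" for s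
    by (rule ar_internal_sub[OF \<Phi>_internal[OF that]]) simp
  have gr: "graphing H {..<K} (\<lambda>k. us (P k))"
    using P(1,2) by (auto simp: graphing_def intro: bisection_us)
  have \<nu>b: "bisection H (\<nu> s)" if "s \<in> S" for s
    unfolding \<nu>_def by (intro bisection_us \<nu>i that fg.bisection_sub[OF \<Phi>_bis[OF that]]) simp
  have \<nu>0: "emeasure (arrows H) (\<nu> s) = 0" if "s \<in> S" for s
  proof -
    have "emeasure (arrows (G n)) (\<Phi> n s \<inter> N n) = 0" for n
    proof -
      have "\<Phi> n s \<inter> N n \<in> null_sets (arrows (G n))"
        by (subst fg.null_iff) (auto simp: N_def)
      then show ?thesis by blast
    qed
    then have "ar.vol (\<lambda>n. \<Phi> n s \<inter> N n) = 0" unfolding ar.vol_def by (simp add: LimI)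
    then show ?thesis unfolding \<nu>_def arrows_H by (simp add: ar.emeasure_us[OF \<nu>i[OF that]])
  qed
  let ?F = "(\<Union>k\<in>{..<K}. us (P k)) \<union> (\<Union>s\<in>S. \<nu> s)"
  have usE: "us E = (\<Union>k\<in>{..<K}. us (P k))"
  proof -
    have "us E = us (\<lambda>n. \<Union>k\<in>{..<K}. P k n)" using P(3) by presburger
    then show ?thesis by (simp add: us_UN)
  qed
  have FA: "?F \<subseteq> space (arrows H)"
    using gr \<nu>b sets.sets_into_space[of _ "arrows H"] by (auto simp: graphing_def bisection_def)
  have "us (\<lambda>n. \<Union>s\<in>S. \<Phi> n s) \<subseteq> arrow_ball H ?F (Suc L)"
    unfolding us_UN[OF fin_S]
  proof (rule UN_least)
    fix s assume s: "s \<in> S"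
    have "\<forall>\<^sub>F n in \<UU>. \<Phi> n s \<subseteq> arrow_ball (G n) (E n) L \<union> (\<Phi> n s \<inter> N n)"
      using gen
    proof eventually_elim
      case (elim n)
      then obtain N' where N': "N' \<in> null_sets (arrows (G n))" "\<Phi> n s \<subseteq> arrow_ball (G n) (E n) L \<union> N'" using s by blast
      have "N' \<subseteq> AA n" using sets.sets_into_space[OF null_setsD2[OF N'(1)]] .
      then have "N' \<subseteq> N n" using N'(1) fg.null_iff unfolding N_def by blast
      then show ?case using N'(2) by blast
    qed
    then have "us (\<lambda>n. \<Phi> n s) \<subseteq> us (\<lambda>n. arrow_ball (G n) (E n) L \<union> (\<Phi> n s \<inter> N n))"
      by (simp only: us_subset_iff)
    also have "\<dots> = arrow_ball H (us E) L \<union> \<nu> s" unfolding us_Un \<nu>_def arrow_ball_us ..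
    also have "\<dots> \<subseteq> arrow_ball H ?F (Suc L)"
    proof (rule Un_least)
      have "arrow_ball H (us E) L \<subseteq> arrow_ball H ?F L" unfolding usE by (rule arrow_ball_mono) blast
      then show "arrow_ball H (us E) L \<subseteq> arrow_ball H ?F (Suc L)" by auto
      have "\<nu> s \<subseteq> ?F" using s by blast
      also have "\<dots> \<subseteq> arrow_ball H ?F (Suc 0)" using H.ball_1[OF FA] by blast
      also have "\<dots> \<subseteq> arrow_ball H ?F (Suc L)" by (rule arrow_ball_mono_len) simp
      finally show "\<nu> s \<subseteq> arrow_ball H ?F (Suc L)" .
    qed
    finally show "us (\<lambda>n. \<Phi> n s) \<subseteq> arrow_ball H ?F (Suc L)" .
  qed
  from H.ball_ball[OF FA this] have "space (arrows H) \<subseteq> (\<Union>L. arrow_ball H ?F L)"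
    unfolding Ar_H by blast
  then have "cost H \<le> graphing_cost H {..<K} (\<lambda>k. us (P k))"
    using \<nu>b \<nu>0 fin_S by (intro H.cost_le_null[OF gr, of S \<nu>]) (auto intro: countable_finite)
  also have "\<dots> = (\<Sum>k<K. ar.vol (P k))"
    using P(1) by (simp add: graphing_cost_finite arrows_H ar.emeasure_us)
  also have "\<dots> = ar.vol E" by (rule vol_sum[OF P(4), symmetric])
  finally show ?thesis .
qed

text \<open>Almost optimal graphings are chosen at almost every index. One half of Lipschitz
  equivalence bounds the words in \<Phi> that make up the graphing, so that its union becomes
  internal; the other half bounds the words that recover \<Phi>, so that the recovery survives in
  the ultraproduct.\<close>

lemma cost_H_le_lipschitz: "cost H \<le> Lim \<UU> (\<lambda>n. lipschitz_cost L (G n) S (\<Phi> n))" (is "_ \<le> ?c")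
proof (cases "?c = \<infinity>")
  case False
  show ?thesis
  proof (rule ennreal_le_epsilon)
    fix e :: real assume e: "e > 0"
    let ?lc = "\<lambda>n. lipschitz_cost L (G n) S (\<Phi> n)"
    let ?good = "\<lambda>n J \<Psi>. finite J \<and> graphing (G n) (J :: nat set) \<Psi> \<and> lipschitz_equivalent (G n) L J \<Psi> S (\<Phi> n) \<and>
      graphing_cost (G n) J \<Psi> \<le> ?lc n + ennreal e"
    have "\<forall>\<^sub>F n in \<UU>. ?lc n < \<infinity>"
      using has_Lim[of ?lc] False by (intro order_tendstoD(2)[of _ ?c]) (auto simp: less_top)
    then have ex: "\<forall>\<^sub>F n in \<UU>. \<exists>J \<Psi>. ?good n J \<Psi>"
    proof eventually_elim
      case (elim n)
      have "?lc n < ?lc n + ennreal e" using elim e by (simp add: ennreal_add_left_cancel_less[of _ 0, simplified])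
      then have "Inf {graphing_cost (G n) J \<Psi> | (J :: nat set) \<Psi>. finite J \<and> graphing (G n) J \<Psi> \<and>
          lipschitz_equivalent (G n) L J \<Psi> S (\<Phi> n)} < ?lc n + ennreal e"
        unfolding lipschitz_cost_def .
      then show ?case unfolding Inf_less_iff by (auto intro: less_imp_le)
    qed
    define J where "J n = (SOME J. \<exists>\<Psi>. ?good n J \<Psi>)" for n
    define \<Psi> where "\<Psi> n = (SOME \<Psi>. ?good n (J n) \<Psi>)" for n
    have good: "\<forall>\<^sub>F n in \<UU>. ?good n (J n) (\<Psi> n)"
      using ex
    proof eventually_elim
      case (elim n)
      then have "\<exists>\<Psi>. ?good n (J n) \<Psi>" unfolding J_def by (rule someI_ex)
      then show ?case unfolding \<Psi>_def by (rule someI_ex)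
    qed
    \<comment> \<open>The union lies in the ball only modulo a null set and only at almost every
      index. The intersection is bounded everywhere and, at the good indices, loses only arrows over
      units of weight zero.\<close>
    define E where "E n = (\<Union>j\<in>J n. \<Psi> n j) \<inter> wball L n" for n
    have Ei: "E \<in> ar.internal" by (rule ar_internal_sub[OF ar.internal_B[of L]]) (simp add: E_def)
    have "\<forall>\<^sub>F n in \<UU>. \<forall>s\<in>S. \<exists>N\<in>null_sets (arrows (G n)). \<Phi> n s \<subseteq> arrow_ball (G n) (E n) L \<union> N"
      using good
    proof (eventually_elim, intro ballI)
      fix n s assume g: "?good n (J n) (\<Psi> n)" and s: "s \<in> S"
      let ?F = "\<Union>j\<in>J n. \<Psi> n j" and ?Z = "{x. fg.w n x = 0}"
      have FA: "?F \<subseteq> AA n" using g by (auto simp: graphing_def fg.bisection_iff)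
      have E: "E n \<subseteq> AA n" unfolding E_def using wball_sub by blast
      have "?F \<subseteq> E n \<union> {g \<in> AA n. source (G n) g \<in> ?Z}"
      proof
        fix h assume h: "h \<in> ?F"
        then obtain j where j: "j \<in> J n" "h \<in> \<Psi> n j" by blast
        then obtain N where N: "N \<in> null_sets (arrows (G n))" "\<Psi> n j \<subseteq> wball L n \<union> N"
          using g unfolding lipschitz_equivalent_def lipschitz_sub_def wball_def by blast
        show "h \<in> E n \<union> {g \<in> AA n. source (G n) g \<in> ?Z}"
        proof (cases "h \<in> wball L n")
          case False
          then have "h \<in> N" using N j by blast
          moreover have "N \<subseteq> AA n" using sets.sets_into_space[OF null_setsD2[OF N(1)]] .
          ultimately show ?thesis using N(1) fg.null_iff by blast
        qed (use h in \<open>auto simp: E_def\<close>)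
      qed
      then have *: "arrow_ball (G n) ?F L \<subseteq> arrow_ball (G n) (E n) L \<union> {g \<in> AA n. source (G n) g \<in> ?Z}"
        by (intro fg.arrow_ball_modulo FA E) (simp_all add: fg.w_st)
      obtain N where N: "N \<in> null_sets (arrows (G n))" "\<Phi> n s \<subseteq> arrow_ball (G n) ?F L \<union> N"
        using g s unfolding lipschitz_equivalent_def lipschitz_sub_def word_ball_eq by blast
      have "{g \<in> AA n. source (G n) g \<in> ?Z} \<in> null_sets (arrows (G n))" by (subst fg.null_iff) auto
      then have "{g \<in> AA n. source (G n) g \<in> ?Z} \<union> N \<in> null_sets (arrows (G n))" using N(1) by (rule null_sets.Un)
      moreover have "\<Phi> n s \<subseteq> arrow_ball (G n) (E n) L \<union> ({g \<in> AA n. source (G n) g \<in> ?Z} \<union> N)" using N(2) * by blast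
      ultimately show "\<exists>N\<in>null_sets (arrows (G n)). \<Phi> n s \<subseteq> arrow_ball (G n) (E n) L \<union> N" by blast
    qed
    from cost_H_le_internal[OF Ei this] have "cost H \<le> ar.vol E" .
    also have "\<dots> \<le> Lim \<UU> (\<lambda>n. ?lc n + ennreal e)"
      unfolding ar.vol_def
    proof (rule Lim_mono, use good in eventually_elim)
      case (elim n)
      have "emeasure (arrows (G n)) (E n) \<le> emeasure (arrows (G n)) (\<Union>j\<in>J n. \<Psi> n j)"
        using elim by (intro emeasure_mono) (auto simp: E_def fg.sets_Ar graphing_def fg.bisection_iff)
      also have "\<dots> \<le> graphing_cost (G n) (J n) (\<Psi> n)" using elim by (intro emeasure_UN_le_graphing_cost) simp
      also have "\<dots> \<le> ?lc n + ennreal e" using elim by simp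
      finally show ?case .
    qed
    also have "\<dots> = ?c + ennreal e" unfolding Lim_add by (simp add: LimI)
    finally show "cost H \<le> ?c + ennreal e" .
  qed
qed simp

lemma lipschitz_le_internal:
  assumes E: "E \<in> ar.internal" and gen: "\<And>n s. s \<in> S \<Longrightarrow> \<Phi> n s \<subseteq> arrow_ball (G n) (E n) k"
  shows "\<exists>L. Lim \<UU> (\<lambda>n. lipschitz_cost L (G n) S (\<Phi> n)) \<le> ar.vol E"
proof -
  obtain L0 where L0: "\<And>n. E n \<subseteq> wball L0 n" using E ar_internal by blast
  \<comment> \<open>\<open>L0\<close> bounds the words in \<Phi> that make up E, and k bounds the
    words in E that recover \<Phi>.\<close>
  define L where "L = max L0 k"
  obtain K :: nat and P where P: "\<And>k. k < K \<Longrightarrow> P k \<in> ar.internal" "\<And>k n. k < K \<Longrightarrow> bisection (G n) (P k n)"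
    "\<And>n. E n = (\<Union>k<K. P k n)" "\<And>n. emeasure (arrows (G n)) (E n) = (\<Sum>k<K. emeasure (arrows (G n)) (P k n))"
    using decompose[OF E] by blast
  have "lipschitz_cost L (G n) S (\<Phi> n) \<le> emeasure (arrows (G n)) (E n)" for n
  proof -
    have "lipschitz_equivalent (G n) L {..<K} (\<lambda>k. P k n) S (\<Phi> n)"
      unfolding lipschitz_equivalent_def lipschitz_sub_def
    proof (intro conjI ballI)
      fix j assume j: "j \<in> {..<K}"
      have "P j n \<subseteq> wball L0 n" using L0[of n] P(3)[of n] j by blast
      also have "\<dots> \<subseteq> wball L n" by (rule wball_mono) (simp add: L_def)
      finally show "\<exists>N\<in>null_sets (arrows (G n)). P j n \<subseteq> word_ball (G n) (\<Phi> n ` S) L \<union> N"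
        unfolding wball_def by blast
    next
      fix s assume "s \<in> S"
      then have "\<Phi> n s \<subseteq> arrow_ball (G n) (E n) k" by (rule gen)
      also have "\<dots> \<subseteq> arrow_ball (G n) (E n) L" by (rule arrow_ball_mono_len) (simp add: L_def)
      also have "\<dots> = word_ball (G n) ((\<lambda>k. P k n) ` {..<K}) L" unfolding word_ball_eq P(3)[of n, symmetric] ..
      finally show "\<exists>N\<in>null_sets (arrows (G n)). \<Phi> n s \<subseteq> word_ball (G n) ((\<lambda>k. P k n) ` {..<K}) L \<union> N" by blast
    qed
    then have "lipschitz_cost L (G n) S (\<Phi> n) \<le> graphing_cost (G n) {..<K} (\<lambda>k. P k n)"
      using P(2) by (intro lipschitz_cost_le) (auto simp: graphing_def)
    then show ?thesis using P(4)[of n] by (simp add: graphing_cost_finite)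
  qed
  then have "Lim \<UU> (\<lambda>n. lipschitz_cost L (G n) S (\<Phi> n)) \<le> ar.vol E"
    unfolding ar.vol_def by (intro Lim_mono always_eventually allI)
  then show ?thesis ..
qed

text \<open>
  Finitely many pieces of bounded word length already generate \<open>\<Phi>\<close> up to measure \<open>e\<close>; they are internal
  modulo null sets, and the part \<open>\<rho>\<close> of \<open>\<Phi>\<close> that they miss is added as it is.
\<close>

lemma combinatorial_le_graphing:
  fixes J :: "nat set"
  assumes gr: "graphing H J \<Psi>" and gen: "generating H J \<Psi>"
  shows "combinatorial_cost_ultra \<UU> G S \<Phi> \<le> graphing_cost H J \<Psi>"
proof (rule ennreal_le_epsilon)
  fix e :: real assume e: "e > 0"
  \<comment> \<open>Finitely many members of the graphing, cut to a ball so that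
    \<open>internal_approx\<close> applies; the graphing is exhausted as k grows.\<close>
  define A where "A k = (\<Union>i\<in>J \<inter> {..<k}. \<Psi> i \<inter> us (wball k))" for k
  have \<Psi>s: "\<Psi> i \<in> sets ar.loeb" if "i \<in> J" for i using gr that by (simp add: graphing_def bisection_def arrows_H)
  have As: "A k \<in> sets ar.loeb" for k
    unfolding A_def using \<Psi>s ar.us_B_sets by (intro sets.finite_UN) auto
  have AB: "A k \<subseteq> us (wball k)" for k unfolding A_def by blast
  have inc: "incseq A"
  proof (rule monoI)
    fix k l :: nat assume "k \<le> l"
    then have "us (wball k) \<subseteq> us (wball l)" "{..<k} \<subseteq> {..<l}" using ar.us_B_mono by auto
    then show "A k \<subseteq> A l" unfolding A_def by (intro UN_mono Int_mono) auto
  qed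
  have sub: "(\<Union>i\<in>J. \<Psi> i) \<subseteq> space (arrows H)"
    using \<Psi>s sets.sets_into_space by (fastforce simp: arrows_H)
  have AU: "(\<Union>k. A k) = (\<Union>i\<in>J. \<Psi> i)"
  proof (intro antisym subsetI)
    fix g assume "g \<in> (\<Union>i\<in>J. \<Psi> i)"
    then obtain i where i: "i \<in> J" "g \<in> \<Psi> i" by blast
    then obtain L where "g \<in> us (wball L)" using sub unfolding space_arrows_H ar.\<Omega>_eq by blast
    then have "g \<in> us (wball (max (Suc i) L))" using ar.us_B_mono[of L "max (Suc i) L"] by auto
    then have "g \<in> A (max (Suc i) L)" unfolding A_def using i by (intro UN_I[of i]) auto
    then show "g \<in> (\<Union>k. A k)" by blast
  qed (auto simp: A_def)
  have "\<exists>F. F \<in> ar.internal \<and> us F \<subseteq> us (wball k) \<and> sym_diff (A k) (us F) \<in> null_sets ar.loeb" for k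
    using ar.internal_approx[OF As AB] by metis
  then obtain F where F: "\<And>k. F k \<in> ar.internal" "\<And>k. sym_diff (A k) (us (F k)) \<in> null_sets ar.loeb" by metis
  define N where "N = (\<Union>k. sym_diff (A k) (us (F k)))"
  have N: "N \<in> null_sets (arrows H)" unfolding N_def arrows_H using F(2) by (rule null_sets_UN)
  \<comment> \<open>The approximation errors of all stages together are null; their saturation
    serves in \<open>arrow_ball_modulo\<close> for every stage at once.\<close>
  define Z where "Z = H.sat (source H ` N)"
  define N' where "N' = {g \<in> space (arrows H). source H g \<in> Z}"
  have Z: "Z \<in> null_sets (base H)" unfolding Z_def using N by (intro H.sat_null H.null_image) auto
  have N': "N' \<in> null_sets ar.loeb"
    using H.null_preimage[OF _ Z, of "source H"] by (simp add: N'_def arrows_H Int_def vimage_def conj_commute)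
  have NZ: "source H g \<in> Z" if "g \<in> N" for g
  proof -
    have "source H ` N \<subseteq> space (base H)" using sets.sets_into_space[OF null_setsD2[OF N]] H.s_in by blast
    from H.sat_super[OF this] show ?thesis using that unfolding Z_def by blast
  qed
  have FA: "us (F k) \<subseteq> space (arrows H)" for k using ar.us_internal_\<Omega>[OF F(1)] by (simp add: space_arrows_H)
  have AA: "A k \<subseteq> space (arrows H)" for k using AU sub by blast
  have modulo: "arrow_ball H (A k) L \<subseteq> arrow_ball H (us (F k)) L \<union> N'" for k L
    unfolding N'_def
  proof (rule H.arrow_ball_modulo[OF AA FA])
    show "A k \<subseteq> us (F k) \<union> {g \<in> space (arrows H). source H g \<in> Z}" using AA[of k] NZ unfolding N_def by blast
    show "source H g \<in> Z \<longleftrightarrow> target H g \<in> Z" if "g \<in> space (arrows H)" for g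
      unfolding Z_def by (rule H.sat_invariant[OF that])
  qed
  define f where "f n = (\<Union>s\<in>S. \<Phi> n s)" for n
  have fi: "f \<in> ar.internal" unfolding f_def using \<Phi>_internal by (intro ar.internal_UN fin_S)
  \<comment> \<open>One index bounds both the stage of the approximation and the word length, so
    that the sets to be exhausted form a single sequence.\<close>
  define b where "b j n = arrow_ball (G n) (F j n) j" for j n
  have bi: "b j \<in> ar.internal" for j unfolding b_def by (rule arrow_ball_internal[OF F(1)])
  have usb: "us (b j) = arrow_ball H (us (F j)) j" for j unfolding b_def arrow_ball_us ..
  have cover: "us f \<subseteq> (\<Union>j. us (b j)) \<union> N'"
  proof
    fix g assume "g \<in> us f"
    then have "g \<in> space (arrows H)" using ar.us_internal_\<Omega>[OF fi] by (auto simp: space_arrows_H)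
    then obtain L where "g \<in> arrow_ball H (\<Union>i\<in>J. \<Psi> i) L" using gen H.generating_iff[OF sub] by blast
    then obtain k where k: "g \<in> arrow_ball H (A k) L" using arrow_ball_incseq[OF inc, of H L] unfolding AU by blast
    let ?m = "max k L"
    have "arrow_ball H (A k) L \<subseteq> arrow_ball H (A ?m) L" using inc by (intro arrow_ball_mono) (simp add: incseqD)
    also have "\<dots> \<subseteq> arrow_ball H (A ?m) ?m" by (rule arrow_ball_mono_len) simp
    also have "\<dots> \<subseteq> us (b ?m) \<union> N'" unfolding usb by (rule modulo)
    finally show "g \<in> (\<Union>j. us (b j)) \<union> N'" using k by blast
  qed
  let ?D = "\<lambda>k. us f - (\<Union>j\<le>k. us (b j))"
  have Ds: "?D k \<in> sets ar.loeb" for k using ar.us_sets[OF fi] ar.us_sets[OF bi] by auto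
  have lim: "(\<lambda>k. emeasure ar.loeb (?D k)) \<longlonglongrightarrow> emeasure ar.loeb (\<Inter>k. ?D k)"
  proof (rule Lim_emeasure_decseq)
    show "emeasure ar.loeb (?D k) \<noteq> \<infinity>" for k
      using ar.emeasure_us_fin[OF fi] emeasure_mono[of "?D k" "us f" ar.loeb] ar.us_sets[OF fi]
      by (metis Diff_subset infinity_ennreal_def neq_top_trans)
  qed (use Ds in \<open>auto simp: decseq_def\<close>)
  have "(\<Inter>k. ?D k) \<in> null_sets ar.loeb" by (rule ar.complete_loeb[OF N']) (use cover in blast)
  then have "emeasure ar.loeb (\<Inter>k. ?D k) < ennreal e" using e by (simp add: null_setsD1)
  from order_tendstoD(2)[OF lim this] obtain k where k: "emeasure ar.loeb (?D k) < ennreal e"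
    by (auto simp: eventually_sequentially)
  define F' where "F' n = (\<Union>j\<in>{..k}. F j n)" for n
  have F'i: "F' \<in> ar.internal" unfolding F'_def using F(1) by (intro ar.internal_UN) auto
  define \<rho> where "\<rho> n = f n - (\<Union>j\<in>{..k}. b j n)" for n
  have \<rho>i: "\<rho> \<in> ar.internal" by (rule ar_internal_sub[OF fi]) (simp add: \<rho>_def)
  have "us \<rho> = ?D k" unfolding \<rho>_def us_Diff by (simp add: us_UN)
  then have \<rho>e: "ar.vol \<rho> \<le> ennreal e" using k ar.emeasure_us[OF \<rho>i] by simp
  have "us F' = (\<Union>j\<le>k. us (F j))" unfolding F'_def by (simp add: us_UN)
  \<comment> \<open>Since A increases, \<open>A k\<close> contains the earlier stages; joining the
    internal approximations up to k therefore does not raise the volume above that of the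
    graphing.\<close>
  then have "sym_diff (us F') (A k) \<subseteq> N"
    using incseqD[OF inc] unfolding N_def by fastforce
  then have "sym_diff (us F') (A k) \<in> null_sets ar.loeb" using N ar.complete_loeb unfolding arrows_H by blast
  from ar.null_diff_sets(2)[OF As this] have "ar.vol F' = emeasure ar.loeb (A k)" by (simp add: ar.emeasure_us[OF F'i])
  also have "\<dots> \<le> emeasure ar.loeb (\<Union>i\<in>J. \<Psi> i)"
    using AU \<Psi>s by (intro emeasure_mono sets.countable_UN') auto
  also have "\<dots> \<le> graphing_cost H J \<Psi>"
    using emeasure_UN_le_graphing_cost[OF gr] by (simp add: arrows_H)
  finally have F'c: "ar.vol F' \<le> graphing_cost H J \<Psi>" .
  define E where "E n = F' n \<union> \<rho> n" for n
  have Ei: "E \<in> ar.internal" unfolding E_def by (rule ar.internal_Un[OF F'i \<rho>i])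
  have EA: "E n \<subseteq> AA n" for n using Ei wball_sub unfolding ar_internal by blast
  \<comment> \<open>Radius \<open>Suc k\<close> serves both kinds of arrows: those of \<rho> are
    letters and lie in the ball of radius 1, the others in a ball of radius at most k.\<close>
  have gen': "\<Phi> n s \<subseteq> arrow_ball (G n) (E n) (Suc k)" if "s \<in> S" for n s
  proof
    fix g assume "g \<in> \<Phi> n s"
    then have "g \<in> f n" using that by (auto simp: f_def)
    then consider "g \<in> E n" | j where "j \<le> k" "g \<in> b j n" by (auto simp: E_def \<rho>_def)
    then show "g \<in> arrow_ball (G n) (E n) (Suc k)"
    proof cases
      case 1
      then have "g \<in> arrow_ball (G n) (E n) (Suc 0)" using fg.ball_1[OF EA] by blast
      then show ?thesis using arrow_ball_mono_len[of "Suc 0" "Suc k" "G n" "E n"] by auto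
    next
      case 2
      have "F j n \<subseteq> E n" using 2(1) by (auto simp: E_def F'_def)
      then have "b j n \<subseteq> arrow_ball (G n) (E n) j" unfolding b_def by (rule arrow_ball_mono)
      then show ?thesis using 2 arrow_ball_mono_len[of j "Suc k" "G n" "E n"] by auto
    qed
  qed
  obtain L where L: "Lim \<UU> (\<lambda>n. lipschitz_cost L (G n) S (\<Phi> n)) \<le> ar.vol E"
    using lipschitz_le_internal[OF Ei gen'] by blast
  have "combinatorial_cost_ultra \<UU> G S \<Phi> \<le> Lim \<UU> (\<lambda>n. lipschitz_cost L (G n) S (\<Phi> n))"
    unfolding combinatorial_cost_ultra_def by (rule INF_lower) simp
  also note L
  also have "ar.vol E \<le> ar.vol F' + ar.vol \<rho>"
    unfolding ar.vol_def Lim_add[symmetric] E_def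
    by (intro Lim_mono always_eventually allI emeasure_subadditive ar.internal_sets F'i \<rho>i)
  also have "\<dots> \<le> graphing_cost H J \<Psi> + ennreal e" by (rule add_mono[OF F'c \<rho>e])
  finally show "combinatorial_cost_ultra \<UU> G S \<Phi> \<le> graphing_cost H J \<Psi> + ennreal e" .
qed

theorem cost_ultraproduct: "cost H = combinatorial_cost_ultra \<UU> G S \<Phi>"
proof (rule antisym)
  show "cost H \<le> combinatorial_cost_ultra \<UU> G S \<Phi>"
    unfolding combinatorial_cost_ultra_def by (intro INF_greatest cost_H_le_lipschitz)
  show "combinatorial_cost_ultra \<UU> G S \<Phi> \<le> cost H"
    unfolding cost_def by (rule Inf_greatest) (auto intro: combinatorial_le_graphing)
qed

text \<open>A Lipschitz equivalent graphing generates up to the null parts of \<Phi> that its words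
  miss; these are bisections and are added for free.\<close>

lemma cost_G_le_lipschitz: "cost (G n) \<le> lipschitz_cost L (G n) S (\<Phi> n)"
  unfolding lipschitz_cost_def
proof (rule Inf_greatest, clarify)
  fix J :: "nat set" and \<Psi> assume J: "finite J" "graphing (G n) J \<Psi>" "lipschitz_equivalent (G n) L J \<Psi> S (\<Phi> n)"
  let ?F = "\<Union>j\<in>J. \<Psi> j"
  define N where "N s = \<Phi> n s - arrow_ball (G n) ?F L" for s
  have FA: "?F \<subseteq> AA n" using J(2) by (auto simp: graphing_def fg.bisection_iff)
  have Nb: "bisection (G n) (N s)" if "s \<in> S" for s
    unfolding N_def by (rule fg.bisection_sub[OF \<Phi>_bis[OF that]]) blast
  have N0: "emeasure (arrows (G n)) (N s) = 0" if s: "s \<in> S" for s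
  proof -
    obtain N' where N': "N' \<in> null_sets (arrows (G n))" "\<Phi> n s \<subseteq> arrow_ball (G n) ?F L \<union> N'"
      using J(3)[unfolded lipschitz_equivalent_def lipschitz_sub_def word_ball_eq, THEN conjunct2, THEN bspec, OF s]
      by blast
    have "emeasure (arrows (G n)) (N s) \<le> emeasure (arrows (G n)) N'"
      using N' by (intro emeasure_mono) (auto simp: N_def)
    then show ?thesis using N'(1) by (simp add: null_setsD1)
  qed
  let ?E = "?F \<union> (\<Union>s\<in>S. N s)"
  have EA: "?E \<subseteq> AA n" using FA Nb by (auto simp: fg.bisection_iff)
  have "(\<Union>s\<in>S. \<Phi> n s) \<subseteq> arrow_ball (G n) ?E (Suc L)"
  proof (rule UN_least)
    fix s assume s: "s \<in> S"
    have "\<Phi> n s \<subseteq> arrow_ball (G n) ?F L \<union> N s" by (auto simp: N_def)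
    moreover have "arrow_ball (G n) ?F L \<subseteq> arrow_ball (G n) ?E (Suc L)"
      using arrow_ball_mono[of ?F ?E "G n" L] by auto
    moreover have "N s \<subseteq> arrow_ball (G n) ?E (Suc L)"
      using fg.ball_1[OF EA] arrow_ball_mono_len[of "Suc 0" "Suc L" "G n" ?E] s by blast
    ultimately show "\<Phi> n s \<subseteq> arrow_ball (G n) ?E (Suc L)" by blast
  qed
  from fg.ball_ball[OF EA this] have "AA n \<subseteq> (\<Union>L. arrow_ball (G n) ?E L)"
    unfolding \<Phi>_gen wball_eq by blast
  then show "cost (G n) \<le> graphing_cost (G n) J \<Psi>"
    using Nb N0 fin_S by (intro fg.cost_le_null[OF J(2), of S N]) (auto intro: countable_finite)
qed

lemma Lim_cost_le: "Lim \<UU> (\<lambda>n. cost (G n)) \<le> combinatorial_cost_ultra \<UU> G S \<Phi>"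
  unfolding combinatorial_cost_ultra_def
  by (intro INF_greatest Lim_mono always_eventually allI cost_G_le_lipschitz)

end

section \<open>The lower bound on the cost of finite groupoids\<close>

text \<open>Each vertex except the root is charged to an edge leading one step closer to the root.\<close>

lemma connected_card_le:
  fixes X :: "'v set" and D :: "'e set" and s t :: "'e \<Rightarrow> 'v"
  assumes fin: "finite X" "finite D" and root: "r \<in> X"
    and conn: "\<And>Y. r \<in> Y \<Longrightarrow> (\<And>e. e \<in> D \<Longrightarrow> s e \<in> Y \<longleftrightarrow> t e \<in> Y) \<Longrightarrow> X \<subseteq> Y"
  shows "card X \<le> Suc (card D)"
proof -
  \<comment> \<open>Vertices at distance at most n from the root.\<close>
  define B :: "nat \<Rightarrow> 'v set" where
    "B n = rec_nat {r} (\<lambda>_ Y. Y \<union> t ` {e \<in> D. s e \<in> Y} \<union> s ` {e \<in> D. t e \<in> Y}) n" for n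
  have B0: "B 0 = {r}" and BS: "B (Suc n) = B n \<union> t ` {e \<in> D. s e \<in> B n} \<union> s ` {e \<in> D. t e \<in> B n}" for n
    by (simp_all add: B_def)
  have mono: "m \<le> n \<Longrightarrow> B m \<subseteq> B n" for m n by (rule lift_Suc_mono_le[of B]) (auto simp: BS)
  have "X \<subseteq> (\<Union>n. B n)"
  proof (rule conn)
    show "r \<in> (\<Union>n. B n)" using B0 by blast
    fix e assume e: "e \<in> D"
    show "s e \<in> (\<Union>n. B n) \<longleftrightarrow> t e \<in> (\<Union>n. B n)"
    proof
      assume "s e \<in> (\<Union>n. B n)"
      then obtain n where "s e \<in> B n" by blast
      then have "t e \<in> B (Suc n)" using e by (auto simp: BS)
      then show "t e \<in> (\<Union>n. B n)" by blast
    next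
      assume "t e \<in> (\<Union>n. B n)"
      then obtain n where "t e \<in> B n" by blast
      then have "s e \<in> B (Suc n)" using e by (auto simp: BS)
      then show "s e \<in> (\<Union>n. B n)" by blast
    qed
  qed
  define d where "d x = (LEAST n. x \<in> B n)" for x
  have d: "x \<in> B (d x)" if x: "x \<in> X" for x
  proof -
    obtain n where "x \<in> B n" using \<open>X \<subseteq> (\<Union>n. B n)\<close> x by blast
    then show ?thesis unfolding d_def by (rule LeastI)
  qed
  have dle: "d x \<le> n" if "x \<in> B n" for x n unfolding d_def using that by (rule Least_le)
  have "\<exists>e\<in>D. (s e = x \<and> d (t e) < d x) \<or> (t e = x \<and> d (s e) < d x)" if x: "x \<in> X - {r}" for x
  proof -
    have "d x \<noteq> 0"
    proof
      assume "d x = 0"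
      then have "x \<in> B 0" using d[of x] x by (metis DiffD1)
      then show False using x by (simp add: B0)
    qed
    then obtain n where n: "d x = Suc n" by (cases "d x") auto
    have "x \<notin> B n" using dle[of x n] n by auto
    then have "x \<in> t ` {e \<in> D. s e \<in> B n} \<union> s ` {e \<in> D. t e \<in> B n}" using d[of x] x by (auto simp: n BS)
    then show ?thesis using dle n by (fastforce simp: less_Suc_eq_le)
  qed
  then obtain f where f: "\<And>x. x \<in> X - {r} \<Longrightarrow> f x \<in> D"
    "\<And>x. x \<in> X - {r} \<Longrightarrow> (s (f x) = x \<and> d (t (f x)) < d x) \<or> (t (f x) = x \<and> d (s (f x)) < d x)"
    by metis
  \<comment> \<open>An edge charged by x has its other end strictly closer to the root, so that end
    cannot charge it too.\<close>
  have "inj_on f (X - {r})"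
  proof (rule inj_onI)
    fix x y assume "x \<in> X - {r}" "y \<in> X - {r}" "f x = f y"
    then show "x = y" using f(2)[of x] f(2)[of y] by auto
  qed
  then have "card (X - {r}) \<le> card D" using f(1) fin(2) by (intro card_inj_on_le[of f]) auto
  then show ?thesis using root fin(1) by simp
qed

section \<open>Counting arrows and edges in a finite groupoid\<close>

context fin_groupoid
begin

definition "star x = {g \<in> Ar. source G g = x}"

lemma fin_star: "finite (star x)" unfolding star_def using fin_Ar by simp

lemma star_ne: "x \<in> Ob \<Longrightarrow> x \<in> star x"
  unfolding star_def using Ob_sub s_unit by auto

lemma card_star_pos: "x \<in> Ob \<Longrightarrow> card (star x) > 0"
  using star_ne fin_star card_gt_0_iff by blast

text \<open>Right multiplication by g carries the arrows that start at its target injectively to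
  arrows that start at its source.\<close>

lemma card_star_le: assumes "g \<in> Ar" shows "card (star (target G g)) \<le> card (star (source G g))"
proof (rule card_inj_on_le[OF _ _ fin_star])
  show "(\<lambda>h. gmult G h g) ` star (target G g) \<subseteq> star (source G g)"
    using assms by (auto simp: star_def groupoid_simps)
  show "inj_on (\<lambda>h. gmult G h g) (star (target G g))"
  proof (rule inj_onI)
    fix h k assume h: "h \<in> star (target G g)" and k: "k \<in> star (target G g)" and eq: "gmult G h g = gmult G k g"
    have *: "gmult G (gmult G h g) (ginv G g) = h" if "h \<in> star (target G g)" for h
    proof -
      have h: "h \<in> Ar" "source G h = target G g" using that by (auto simp: star_def)
      have "gmult G (gmult G h g) (ginv G g) = gmult G h (gmult G g (ginv G g))"
        by (rule mult_assoc[OF h(1) assms inv_in[OF assms] h(2)]) (simp only: t_inv[OF assms])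
      also have "\<dots> = gmult G h (source G h)" unfolding mult_inv[OF assms] h(2) ..
      also have "\<dots> = h" by (rule mult_s[OF h(1)])
      finally show ?thesis .
    qed
    have "gmult G (gmult G h g) (ginv G g) = gmult G (gmult G k g) (ginv G g)" unfolding eq ..
    then show "h = k" unfolding *[OF h] *[OF k] .
  qed
qed

lemma card_star_st: "g \<in> Ar \<Longrightarrow> card (star (target G g)) = card (star (source G g))"
  using card_star_le[of g] card_star_le[OF inv_in, of g] by (simp add: s_inv t_inv)

lemma card_costar: assumes "y \<in> Ob" shows "card {g \<in> Ar. target G g = y} = card (star y)"
proof (rule bij_betw_same_card)
  show "bij_betw (ginv G) {g \<in> Ar. target G g = y} (star y)"
    by (rule bij_betw_byWitness[where f' = "ginv G"]) (auto simp: star_def inv_in s_inv t_inv ginv_ginv)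
qed

text \<open>The arrows with source x are the vertices of a graph like a Cayley graph: an element e
  of E that starts at the target of h joins h to the product of e and h. It is connected because E
  generates; with arrows instead of units as vertices, isotropy is counted as well.\<close>

lemma card_star_edges:
  assumes E: "E \<subseteq> Ar" and gen: "Ar \<subseteq> (\<Union>L. arrow_ball G E L)" and x: "x \<in> Ob"
  shows "card (star x) \<le> Suc (\<Sum>h\<in>star x. card (E \<inter> star (target G h)))"
proof -
  let ?D = "Sigma (star x) (\<lambda>h. E \<inter> star (target G h))"
  have finD: "finite ?D" using fin_star by (intro finite_SigmaI) auto
  have "card (star x) \<le> Suc (card ?D)"
  proof (rule connected_card_le[where s = fst and t = "\<lambda>(h, e). gmult G e h"])
    show "x \<in> star x" by (rule star_ne[OF x])
    fix Y assume Y: "x \<in> Y" and cl: "\<And>p. p \<in> ?D \<Longrightarrow> fst p \<in> Y \<longleftrightarrow> (case p of (h, e) \<Rightarrow> gmult G e h) \<in> Y"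
    have "g \<in> Y" if "g \<in> arrow_ball G E L" "source G g = x" for g L
      using that
    proof (induction L arbitrary: g)
      case 0
      then show ?case using Y s_unit by simp
    next
      case (Suc L)
      show ?case
      proof (cases "g \<in> arrow_ball G E L")
        case True
        then show ?thesis using Suc by blast
      next
        case False
        then have "g \<in> gset_mult G (E \<union> ginv G ` E) (arrow_ball G E L)" using Suc.prems(1) by simp
        then obtain e h where eh: "g = gmult G e h" "e \<in> E \<union> ginv G ` E" "h \<in> arrow_ball G E L"
          "source G e = target G h" unfolding gset_mult_def by blast
        have Are: "e \<in> Ar" using eh(2) E inv_image_sub[OF E] by blast
        have Arh: "h \<in> Ar" using eh(3) arrow_ball_sub[OF E] by blast
        have hx: "source G h = x" using s_mult[OF Are Arh eh(4)] eh(1) Suc.prems(2) by simp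
        have hY: "h \<in> Y" by (rule Suc.IH[OF eh(3) hx])
        from eh(2) show ?thesis
        proof
          assume "e \<in> E"
          then have "(h, e) \<in> ?D" using Are Arh hx eh(4) by (simp add: star_def)
          from cl[OF this] show ?thesis using hY eh(1) by simp
        next
          assume "e \<in> ginv G ` E"
          \<comment> \<open>An inverse letter traverses an edge backwards: multiplying g by k leads
            back to h.\<close>
          then obtain k where k: "k \<in> E" "e = ginv G k" by blast
          have Ark: "k \<in> Ar" using k(1) E by blast
          have g: "g \<in> Ar" "target G g = target G e" unfolding eh(1)
            using mult_in[OF Are Arh eh(4)] t_mult[OF Are Arh eh(4)] by auto
          have kg: "source G k = target G g" using g(2) k(2) t_inv[OF Ark] by simp
          have "gmult G k g = gmult G (gmult G k e) h"
            unfolding eh(1) using kg g(2) by (intro mult_assoc[symmetric] Ark Are Arh eh(4)) simp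
          also have "gmult G k e = target G h"
            using mult_inv[OF Ark] s_inv[OF Ark] k(2) eh(4) by simp
          also have "gmult G (target G h) h = h" by (rule mult_t[OF Arh])
          finally have "gmult G k g = h" .
          moreover have "(g, k) \<in> ?D" using g(1) Suc.prems(2) k(1) Ark kg by (simp add: star_def)
          ultimately show ?thesis using cl[of "(g, k)"] hY by simp
        qed
      qed
    qed
    then show "star x \<subseteq> Y" using gen unfolding star_def by blast
  qed (use fin_star finD in auto)
  also have "card ?D = (\<Sum>h\<in>star x. card (E \<inter> star (target G h)))"
    using fin_star by (intro card_SigmaI) auto
  finally show ?thesis .
qed

definition "wr x = enn2real (w x)"

lemma w_fin: "x \<in> Ob \<Longrightarrow> w x \<noteq> \<infinity>"
proof -
  assume "x \<in> Ob"
  then have "w x \<le> 1" using w_sum fin_Ob member_le_sum[of x Ob w] by simp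
  then show ?thesis by (metis ennreal_one_less_top infinity_ennreal_def leD)
qed

lemma w_wr: "x \<in> Ob \<Longrightarrow> w x = ennreal (wr x)"
  unfolding wr_def using w_fin by (simp add: less_top)

lemma wr_nonneg: "wr x \<ge> 0" by (simp add: wr_def)

lemma wr_st: "g \<in> Ar \<Longrightarrow> wr (target G g) = wr (source G g)"
  by (simp add: wr_def w_st)

text \<open>
  The edges leaving the targets of the arrows in \<open>star x\<close> connect \<open>star x\<close>, isotropy included. Weighting
  \<open>x\<close> by \<open>q x\<close>, which is constant on orbits, and exchanging sums counts every edge once.
\<close>

lemma sum_edges_le:
  assumes E: "E \<subseteq> Ar" and gen: "Ar \<subseteq> (\<Union>L. arrow_ball G E L)"
  shows "(\<Sum>x\<in>Ob. wr x * (1 - 1 / card (star x))) \<le> (\<Sum>g\<in>E. wr (source G g))"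
proof -
  define q where "q x = wr x / card (star x)" for x
  define deg where "deg x = real (card (E \<inter> star x))" for x
  have q0: "q x \<ge> 0" for x by (simp add: q_def wr_nonneg)
  have "(\<Sum>x\<in>Ob. wr x * (1 - 1 / card (star x))) = (\<Sum>x\<in>Ob. q x * (real (card (star x)) - 1))"
    using card_star_pos by (intro sum.cong) (auto simp: q_def field_simps)
  also have "\<dots> \<le> (\<Sum>x\<in>Ob. q x * (\<Sum>h\<in>star x. deg (target G h)))"
  proof (intro sum_mono mult_left_mono q0)
    fix x assume "x \<in> Ob"
    from card_star_edges[OF E gen this]
    have "real (card (star x)) \<le> real (Suc (\<Sum>h\<in>star x. card (E \<inter> star (target G h))))" by (rule of_nat_mono)
    then show "real (card (star x)) - 1 \<le> (\<Sum>h\<in>star x. deg (target G h))" by (simp add: deg_def)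
  qed
  also have "\<dots> = (\<Sum>x\<in>Ob. \<Sum>h\<in>{h \<in> Ar. source G h = x}. q (target G h) * deg (target G h))"
    unfolding sum_distrib_left star_def[symmetric]
    by (intro sum.cong refl) (auto simp: q_def star_def wr_st card_star_st[unfolded star_def])
  also have "\<dots> = (\<Sum>h\<in>Ar. q (target G h) * deg (target G h))"
    by (rule sum.group[OF fin_Ar fin_Ob]) (auto intro: s_in)
  also have "\<dots> = (\<Sum>y\<in>Ob. \<Sum>h\<in>{h \<in> Ar. target G h = y}. q (target G h) * deg (target G h))"
    by (rule sum.group[OF fin_Ar fin_Ob, symmetric]) (auto intro: t_in)
  also have "\<dots> = (\<Sum>y\<in>Ob. wr y * deg y)"
  proof (intro sum.cong refl)
    fix y assume y: "y \<in> Ob"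
    have "(\<Sum>h\<in>{h \<in> Ar. target G h = y}. q (target G h) * deg (target G h)) = card (star y) * (q y * deg y)"
      using card_costar[OF y] by simp
    also have "\<dots> = wr y * deg y" using card_star_pos[OF y] by (simp add: q_def)
    finally show "(\<Sum>h\<in>{h \<in> Ar. target G h = y}. q (target G h) * deg (target G h)) = wr y * deg y" .
  qed
  also have "\<dots> = (\<Sum>y\<in>Ob. \<Sum>g\<in>{g \<in> E. source G g = y}. wr (source G g))"
  proof (intro sum.cong refl)
    fix y
    have "E \<inter> star y = {g \<in> E. source G g = y}" using E by (auto simp: star_def)
    then show "wr y * deg y = (\<Sum>g\<in>{g \<in> E. source G g = y}. wr (source G g))" by (simp add: deg_def)
  qed
  also have "\<dots> = (\<Sum>g\<in>E. wr (source G g))"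
    using E fin_Ar finite_subset s_in by (intro sum.group fin_Ob) auto
  finally show ?thesis .
qed

lemma cost_ge: "ennreal (\<Sum>x\<in>Ob. wr x * (1 - 1 / card (star x))) \<le> cost G"
  unfolding cost_def
proof (rule Inf_greatest, clarify)
  fix J :: "nat set" and \<Psi> assume gr: "graphing G J \<Psi>" and gen: "generating G J \<Psi>"
  let ?E = "\<Union>i\<in>J. \<Psi> i"
  have E: "?E \<subseteq> Ar" using gr by (auto simp: graphing_def bisection_iff)
  have "Ar \<subseteq> (\<Union>L. arrow_ball G ?E L)" using gen generating_iff[OF E] by simp
  from sum_edges_le[OF E this]
  have "ennreal (\<Sum>x\<in>Ob. wr x * (1 - 1 / card (star x))) \<le> ennreal (\<Sum>g\<in>?E. wr (source G g))" by (rule ennreal_leI)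
  also have "\<dots> = (\<Sum>g\<in>?E. ennreal (wr (source G g)))" by (rule sum_ennreal[symmetric]) (rule wr_nonneg)
  also have "\<dots> = (\<Sum>g\<in>?E. w (source G g))"
    by (rule sum.cong[OF refl]) (metis E s_in subsetD w_wr)
  also have "\<dots> = emeasure (arrows G) ?E" by (rule emeasure_Ar_s[OF E, symmetric])
  also have "\<dots> \<le> graphing_cost G J \<Psi>" by (rule emeasure_UN_le_graphing_cost[OF gr])
  finally show "ennreal (\<Sum>x\<in>Ob. wr x * (1 - 1 / card (star x))) \<le> graphing_cost G J \<Psi>" .
qed

lemma cost_ge_large:
  assumes "X \<subseteq> Ob" "k > 0" "\<And>x. x \<in> X \<Longrightarrow> k \<le> card (star x)"
  shows "ennreal (1 - 1 / k) * emeasure (base G) X \<le> cost G"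
proof -
  have "emeasure (base G) X = (\<Sum>x\<in>X. ennreal (wr x))"
    unfolding emeasure_Ob[OF assms(1)] by (rule sum.cong[OF refl]) (metis assms(1) subsetD w_wr)
  also have "\<dots> = ennreal (\<Sum>x\<in>X. wr x)" by (rule sum_ennreal) (rule wr_nonneg)
  finally have "ennreal (1 - 1 / k) * emeasure (base G) X = ennreal (1 - 1 / k) * ennreal (\<Sum>x\<in>X. wr x)"
    by (rule arg_cong)
  also have "\<dots> = ennreal (\<Sum>x\<in>X. wr x * (1 - 1 / k))"
    using assms(2) by (subst ennreal_mult[symmetric]) (auto simp: sum_nonneg wr_nonneg sum_distrib_right[symmetric] mult.commute)
  also have "\<dots> \<le> ennreal (\<Sum>x\<in>Ob. wr x * (1 - 1 / card (star x)))"
  proof (rule ennreal_leI)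
    have "(\<Sum>x\<in>X. wr x * (1 - 1 / k)) \<le> (\<Sum>x\<in>X. wr x * (1 - 1 / card (star x)))"
      using assms(2,3) by (intro sum_mono mult_left_mono wr_nonneg) (simp add: frac_le)
    also have "\<dots> \<le> (\<Sum>x\<in>Ob. wr x * (1 - 1 / card (star x)))"
    proof (rule sum_mono2[OF fin_Ob assms(1)])
      fix x assume "x \<in> Ob - X"
      then have "1 \<le> card (star x)" using card_star_pos[of x] by simp
      then have "1 / real (card (star x)) \<le> 1" by (simp add: divide_le_eq_1)
      then show "0 \<le> wr x * (1 - 1 / card (star x))" by (intro mult_nonneg_nonneg wr_nonneg) simp
    qed
    finally show "(\<Sum>x\<in>X. wr x * (1 - 1 / k)) \<le> (\<Sum>x\<in>Ob. wr x * (1 - 1 / card (star x)))" .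
  qed
  also have "\<dots> \<le> cost G" by (rule cost_ge)
  finally show ?thesis .
qed

end

section \<open>Factors onto infinite groups\<close>

locale ultraproduct_factor = graphed_ultraproduct \<UU> G S \<Phi> + group_factor "ultraproduct \<UU> G S \<Phi>" \<Gamma> T discarded
  for \<UU> and G :: "nat \<Rightarrow> 'a groupoid" and S :: "'i set" and \<Phi>
    and \<Gamma> :: "('g, 'b) monoid_scheme" and T discarded
begin

text \<open>The arrows over \<gamma> need not have bounded length, but their measure is finite, so
  all but e of it lies in one ball, where Loeb sets are internal modulo null sets.\<close>

lemma fib0_approx:
  assumes \<gamma>: "\<gamma> \<in> carrier \<Gamma>" and e: "e > 0"
  obtains E where "E \<in> ar.internal" "us E - fib0 \<gamma> \<in> null_sets ar.loeb" "fib0 \<gamma> \<inter> us E \<in> sets ar.loeb"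
    "emeasure ar.loeb (fib0 \<gamma> - us E) \<le> ennreal e"
proof -
  have f: "fib0 \<gamma> \<in> sets ar.loeb" using fib0_sets[OF \<gamma>] by (simp add: arrows_H)
  have "fib0 \<gamma> = arr \<gamma> ` X0" by (rule fib0_eq[OF \<gamma>])
  then have "emeasure ar.loeb (fib0 \<gamma>) = emeasure (base H) X0"
    using arr_image(2)[OF X0_sets subset_refl \<gamma>] by (simp add: arrows_H)
  also have "\<dots> \<le> 1" using prob_space.measure_le_1[OF H.prob] prob_space.finite_measure[OF H.prob]
    by (simp add: finite_measure.emeasure_eq_measure)
  finally have fin: "emeasure ar.loeb (fib0 \<gamma>) \<noteq> \<infinity>" by (auto simp: top_unique)
  let ?D = "\<lambda>L. fib0 \<gamma> - us (wball L)"
  have Ds: "?D L \<in> sets ar.loeb" for L using f ar.us_B_sets by auto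
  have lim: "(\<lambda>L. emeasure ar.loeb (?D L)) \<longlonglongrightarrow> emeasure ar.loeb (\<Inter>L. ?D L)"
  proof (rule Lim_emeasure_decseq)
    show "emeasure ar.loeb (?D L) \<noteq> \<infinity>" for L
      using fin emeasure_mono[of "?D L" "fib0 \<gamma>" ar.loeb] f by (metis Diff_subset infinity_ennreal_def neq_top_trans)
    show "decseq ?D" using ar.us_B_mono unfolding decseq_def by blast
  qed (use Ds in auto)
  have "fib0 \<gamma> \<subseteq> (\<Union>L. us (wball L))" using sets.sets_into_space[OF f] unfolding ar.space_loeb ar.\<Omega>_eq .
  then have "(\<Inter>L. ?D L) = {}" by blast
  then have "emeasure ar.loeb (\<Inter>L. ?D L) < ennreal e" using e by (simp only: emeasure_empty ennreal_less_zero_iff)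
  from order_tendstoD(2)[OF lim this] obtain L where L: "emeasure ar.loeb (?D L) < ennreal e"
    by (auto simp: eventually_sequentially)
  obtain E where E: "E \<in> ar.internal" "us E \<subseteq> us (wball L)" "sym_diff (fib0 \<gamma> \<inter> us (wball L)) (us E) \<in> null_sets ar.loeb"
    using ar.internal_approx[OF sets.Int[OF f ar.us_B_sets[of L]] Int_lower2] by blast
  show thesis
  proof (rule that[OF E(1)])
    show "us E - fib0 \<gamma> \<in> null_sets ar.loeb" by (rule ar.complete_loeb[OF E(3)]) blast
    show "fib0 \<gamma> \<inter> us E \<in> sets ar.loeb" using f ar.us_sets[OF E(1)] by (rule sets.Int)
    have n: "(fib0 \<gamma> \<inter> us (wball L)) - us E \<in> null_sets ar.loeb" by (rule ar.complete_loeb[OF E(3)]) blast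
    have "fib0 \<gamma> - us E = ?D L \<union> ((fib0 \<gamma> \<inter> us (wball L)) - us E)" using E(2) by blast
    then have "emeasure ar.loeb (fib0 \<gamma> - us E) = emeasure ar.loeb (?D L)"
      using emeasure_Un_null_set[OF Ds n] by simp
    then show "emeasure ar.loeb (fib0 \<gamma> - us E) \<le> ennreal e" using L by simp
  qed
qed

lemma fib0_disjoint: "\<gamma> \<noteq> \<delta> \<Longrightarrow> fib0 \<gamma> \<inter> fib0 \<delta> = {}"
  by (auto simp: fib0_def fib_def)

text \<open>A unit of \<open>X0\<close> at which no arrow of E starts is the source of an arrow over
  \<gamma> that E misses. The source is injective on these missed arrows and preserves their
  measure.\<close>

lemma source_vol:
  assumes \<gamma>: "\<gamma> \<in> carrier \<Gamma>" and E: "E \<in> ar.internal" "emeasure ar.loeb (fib0 \<gamma> - us E) \<le> ennreal e"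
  shows "ba.vol (\<lambda>n. XX n - source (G n) ` E n) \<le> ennreal e"
proof -
  have f: "fib0 \<gamma> \<in> sets ar.loeb" using fib0_sets[OF \<gamma>] by (simp add: arrows_H)
  have EA: "E n \<subseteq> AA n" for n using E(1) wball_sub unfolding ar_internal by blast
  let ?Y = "\<lambda>n. XX n - source (G n) ` E n"
  have Y: "?Y \<in> ba.internal" by (simp add: ba_internal)
  have d: "fib0 \<gamma> - us E \<in> sets (arrows H)" using f ar.us_sets[OF E(1)] by (auto simp: arrows_H)
  have "inj_on (source H) (fib0 \<gamma> - us E)"
    by (rule inj_on_subset[OF R_inj_s]) (use fib0_R in blast)
  from H.st_image[OF disjI1[OF refl] d this]
  have s: "source H ` (fib0 \<gamma> - us E) \<in> sets (base H)"
    "emeasure (base H) (source H ` (fib0 \<gamma> - us E)) = emeasure ar.loeb (fib0 \<gamma> - us E)"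
    by (simp_all add: arrows_H)
  have "us ?Y \<subseteq> source H ` (fib0 \<gamma> - us E) \<union> (space (base H) - X0)"
  proof
    fix x assume "x \<in> us ?Y"
    then have x: "x \<in> us XX" "x \<notin> source H ` us E" unfolding us_Diff source_H lift_image by auto
    show "x \<in> source H ` (fib0 \<gamma> - us E) \<union> (space (base H) - X0)"
    proof (cases "x \<in> X0")
      case True
      then have "arr \<gamma> x \<in> fib0 \<gamma>" "source H (arr \<gamma> x) = x" using fib0_eq[OF \<gamma>] arr(2)[OF True \<gamma>] by auto
      then show ?thesis using x(2) by (metis DiffI UnI1 image_eqI)
    qed (use x(1) in \<open>auto simp: space_base_H ba_\<Omega>\<close>)
  qed
  then have "emeasure (base H) (us ?Y) \<le> emeasure (base H) (source H ` (fib0 \<gamma> - us E) \<union> (space (base H) - X0))"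
    using s(1) compl_X0_null by (intro emeasure_mono) auto
  also have "\<dots> = emeasure (base H) (source H ` (fib0 \<gamma> - us E))" by (rule emeasure_Un_null_set[OF s(1) compl_X0_null])
  also have "\<dots> \<le> ennreal e" using s(2) E(2) by simp
  finally show ?thesis using ba.emeasure_us[OF Y] by (simp add: base_H)
qed

text \<open>The fibres of \<open>T\<close> over K group elements are disjoint, and almost every unit
  is the source of an arrow in each. Disjoint internal approximations carry this to the finite
  groupoids, where a unit that is a source for all of them has K different arrows.\<close>

lemma many_arrows:
  fixes K :: nat and e :: real
  assumes K: "K > 0" "finite \<Delta>" "\<Delta> \<subseteq> carrier \<Gamma>" "card \<Delta> = K" and e: "e > 0"
  obtains X where "\<And>n. X n \<subseteq> XX n" "\<And>n x. x \<in> X n \<Longrightarrow> K \<le> card (fg.star n x)"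
    "1 \<le> ba.vol X + ennreal (K * e)"
proof -
  have "\<exists>E. E \<in> ar.internal \<and> us E - fib0 \<gamma> \<in> null_sets ar.loeb \<and> emeasure ar.loeb (fib0 \<gamma> - us E) \<le> ennreal e"
    if "\<gamma> \<in> \<Delta>" for \<gamma>
    by (rule fib0_approx[OF subsetD[OF K(3) that] e]) blast
  then obtain E where E: "\<And>\<gamma>. \<gamma> \<in> \<Delta> \<Longrightarrow> E \<gamma> \<in> ar.internal"
    "\<And>\<gamma>. \<gamma> \<in> \<Delta> \<Longrightarrow> us (E \<gamma>) - fib0 \<gamma> \<in> null_sets ar.loeb"
    "\<And>\<gamma>. \<gamma> \<in> \<Delta> \<Longrightarrow> emeasure ar.loeb (fib0 \<gamma> - us (E \<gamma>)) \<le> ennreal e" by metis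
  \<comment> \<open>Overlaps are removed at every index, so that the arrows chosen below are
    distinct. Since the fibres are disjoint, \<open>fib0 \<gamma>\<close> loses only a null
    part.\<close>
  define P where "P \<gamma> n = E \<gamma> n - (\<Union>\<delta>\<in>\<Delta> - {\<gamma>}. E \<delta> n)" for \<gamma> n
  have Pi: "P \<gamma> \<in> ar.internal" if "\<gamma> \<in> \<Delta>" for \<gamma>
    by (rule ar_internal_sub[OF E(1)[OF that]]) (auto simp: P_def)
  have Pe: "emeasure ar.loeb (fib0 \<gamma> - us (P \<gamma>)) \<le> ennreal e" if \<gamma>: "\<gamma> \<in> \<Delta>" for \<gamma>
  proof -
    have f: "fib0 \<gamma> \<in> sets ar.loeb" using fib0_sets \<gamma> K(3) by (auto simp: arrows_H)
    have usP: "us (P \<gamma>) = us (E \<gamma>) - (\<Union>\<delta>\<in>\<Delta> - {\<gamma>}. us (E \<delta>))"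
      unfolding P_def us_Diff using K(2) by (simp add: us_UN)
    have N: "(\<Union>\<delta>\<in>\<Delta> - {\<gamma>}. us (E \<delta>) - fib0 \<delta>) \<in> null_sets ar.loeb"
      using E(2) K(2) by (intro null_sets_UN') (auto intro: countable_finite)
    have "fib0 \<gamma> - us (P \<gamma>) \<subseteq> (fib0 \<gamma> - us (E \<gamma>)) \<union> (\<Union>\<delta>\<in>\<Delta> - {\<gamma>}. us (E \<delta>) - fib0 \<delta>)"
    proof
      fix g assume g: "g \<in> fib0 \<gamma> - us (P \<gamma>)"
      then consider "g \<notin> us (E \<gamma>)" | \<delta> where "\<delta> \<in> \<Delta> - {\<gamma>}" "g \<in> us (E \<delta>)" unfolding usP by blast
      then show "g \<in> (fib0 \<gamma> - us (E \<gamma>)) \<union> (\<Union>\<delta>\<in>\<Delta> - {\<gamma>}. us (E \<delta>) - fib0 \<delta>)"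
      proof cases
        case 2
        then have "g \<notin> fib0 \<delta>" using g fib0_disjoint[of \<gamma> \<delta>] by auto
        then show ?thesis using 2 by (intro UnI2 UN_I[of \<delta>]) auto
      qed (use g in simp)
    qed
    then have "emeasure ar.loeb (fib0 \<gamma> - us (P \<gamma>)) \<le>
        emeasure ar.loeb ((fib0 \<gamma> - us (E \<gamma>)) \<union> (\<Union>\<delta>\<in>\<Delta> - {\<gamma>}. us (E \<delta>) - fib0 \<delta>))"
      using f N ar.us_sets[OF E(1)[OF \<gamma>]] by (intro emeasure_mono sets.Un) auto
    also have "\<dots> = emeasure ar.loeb (fib0 \<gamma> - us (E \<gamma>))"
      using f N ar.us_sets[OF E(1)[OF \<gamma>]] by (intro emeasure_Un_null_set) auto
    finally show ?thesis using E(3)[OF \<gamma>] by (rule order_trans)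
  qed
  define X where "X n = {x \<in> XX n. \<forall>\<gamma>\<in>\<Delta>. x \<in> source (G n) ` P \<gamma> n}" for n
  have PA: "P \<gamma> n \<subseteq> AA n" if "\<gamma> \<in> \<Delta>" for \<gamma> n using Pi[OF that] wball_sub unfolding ar_internal by blast
  show thesis
  proof (rule that)
    show "X n \<subseteq> XX n" for n by (auto simp: X_def)
    show "K \<le> card (fg.star n x)" if "x \<in> X n" for n x
    proof -
      have "\<forall>\<gamma>\<in>\<Delta>. \<exists>g. g \<in> P \<gamma> n \<and> source (G n) g = x" using that by (auto simp: X_def)
      then obtain g where g: "\<And>\<gamma>. \<gamma> \<in> \<Delta> \<Longrightarrow> g \<gamma> \<in> P \<gamma> n" "\<And>\<gamma>. \<gamma> \<in> \<Delta> \<Longrightarrow> source (G n) (g \<gamma>) = x" by metis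
      have "card \<Delta> \<le> card (fg.star n x)"
      proof (rule card_inj_on_le[of g])
        show "inj_on g \<Delta>"
        proof (rule inj_onI, rule ccontr)
          fix \<gamma> \<delta> assume a: "\<gamma> \<in> \<Delta>" "\<delta> \<in> \<Delta>" "g \<gamma> = g \<delta>" "\<gamma> \<noteq> \<delta>"
          have "g \<gamma> \<in> P \<gamma> n" "g \<gamma> \<in> P \<delta> n" using g(1)[OF a(1)] g(1)[OF a(2)] a(3) by simp_all
          then show False using a unfolding P_def by blast
        qed
        show "g ` \<Delta> \<subseteq> fg.star n x"
          using g(2) subsetD[OF PA g(1)] by (auto simp: fg.star_def)
      qed (rule fg.fin_star)
      then show ?thesis using K(4) by simp
    qed
    let ?Y = "\<lambda>\<gamma> n. XX n - source (G n) ` P \<gamma> n"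
    have "emeasure (base (G n)) (XX n) \<le> emeasure (base (G n)) (X n) + (\<Sum>\<gamma>\<in>\<Delta>. emeasure (base (G n)) (?Y \<gamma> n))" for n
    proof -
      have "XX n \<subseteq> X n \<union> (\<Union>\<gamma>\<in>\<Delta>. ?Y \<gamma> n)" by (auto simp: X_def)
      then have "emeasure (base (G n)) (XX n) \<le> emeasure (base (G n)) (X n \<union> (\<Union>\<gamma>\<in>\<Delta>. ?Y \<gamma> n))"
        by (intro emeasure_mono) (auto simp: fg.sets_Ob X_def)
      also have "\<dots> \<le> emeasure (base (G n)) (X n) + emeasure (base (G n)) (\<Union>\<gamma>\<in>\<Delta>. ?Y \<gamma> n)"
        by (intro emeasure_subadditive) (auto simp: fg.sets_Ob X_def)
      also have "\<dots> \<le> emeasure (base (G n)) (X n) + (\<Sum>\<gamma>\<in>\<Delta>. emeasure (base (G n)) (?Y \<gamma> n))"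
        using K(2) by (intro add_left_mono emeasure_subadditive_finite) (auto simp: fg.sets_Ob)
      finally show ?thesis .
    qed
    then have "1 \<le> emeasure (base (G n)) (X n) + (\<Sum>\<gamma>\<in>\<Delta>. emeasure (base (G n)) (?Y \<gamma> n))" for n
      using prob_space.emeasure_space_1[OF fg.prob_base] by metis
    then have "1 \<le> Lim \<UU> (\<lambda>n. emeasure (base (G n)) (X n) + (\<Sum>\<gamma>\<in>\<Delta>. emeasure (base (G n)) (?Y \<gamma> n)))"
      by (intro Lim_ge always_eventually allI)
    also have "\<dots> = ba.vol X + (\<Sum>\<gamma>\<in>\<Delta>. ba.vol (?Y \<gamma>))" unfolding Lim_add Lim_sum ba.vol_def ..
    also have "\<dots> \<le> ba.vol X + (\<Sum>\<gamma>\<in>\<Delta>. ennreal e)"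
      using source_vol[OF _ Pi Pe] K(3) by (intro add_left_mono sum_mono) auto
    also have "(\<Sum>\<gamma>\<in>\<Delta>. ennreal e) = ennreal (K * e)"
      using K(4) e by (simp add: ennreal_mult ennreal_of_nat_eq_real_of_nat)
    finally show "1 \<le> ba.vol X + ennreal (K * e)" .
  qed
qed

lemma Lim_cost_ge_1:
  assumes "infinite (carrier \<Gamma>)" shows "1 \<le> Lim \<UU> (\<lambda>n. cost (G n))"
proof -
  have bound: "ennreal ((1 - 1 / Suc k) * (1 - 1 / Suc k)) \<le> Lim \<UU> (\<lambda>n. cost (G n))" for k :: nat
  proof -
    let ?K = "Suc k"
    obtain \<Delta> where \<Delta>: "finite \<Delta>" "\<Delta> \<subseteq> carrier \<Gamma>" "card \<Delta> = ?K"
      using infinite_arbitrarily_large[OF assms] by metis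
    \<comment> \<open>The K group elements lose measure e each, in total \<open>1 / K\<close>, and a
      unit with K arrows contributes at least \<open>1 - 1 / K\<close> of its weight. The two
      factors in \<open>bound\<close> come from these two losses.\<close>
    define e where "e = 1 / (real ?K * real ?K)"
    have e: "e > 0" by (simp add: e_def)
    obtain X where X: "\<And>n. X n \<subseteq> XX n" "\<And>n x. x \<in> X n \<Longrightarrow> ?K \<le> card (fg.star n x)"
      "1 \<le> ba.vol X + ennreal (?K * e)"
      using many_arrows[OF _ \<Delta> e] by blast
    have "ennreal (1 - 1 / ?K) \<le> ba.vol X"
    proof (cases "ba.vol X")
      case (real r)
      then have "ennreal 1 \<le> ennreal (r + ?K * e)" using X(3) e by (simp add: ennreal_plus)
      then have "1 \<le> r + ?K * e" using real e by (subst (asm) ennreal_le_iff) auto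
      moreover have "?K * e = 1 / ?K" by (simp add: e_def)
      ultimately show ?thesis using real by (auto intro!: ennreal_leI)
    qed simp
    then have "ennreal (1 - 1 / ?K) * ennreal (1 - 1 / ?K) \<le> ennreal (1 - 1 / ?K) * ba.vol X"
      by (rule mult_left_mono) simp
    also have "\<dots> = Lim \<UU> (\<lambda>n. ennreal (1 - 1 / ?K) * emeasure (base (G n)) (X n))"
      unfolding ba.vol_def by (intro LimI[symmetric] ennreal_tendsto_cmult has_Lim) simp
    also have "\<dots> \<le> Lim \<UU> (\<lambda>n. cost (G n))"
      using X(1,2) by (intro Lim_mono always_eventually allI fg.cost_ge_large) auto
    finally show ?thesis by (subst ennreal_mult) auto
  qed
  have "(\<lambda>k. ennreal ((1 - 1 / Suc k) * (1 - 1 / Suc k))) \<longlonglongrightarrow> ennreal ((1 - 0) * (1 - 0))"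
    by (intro tendsto_ennrealI tendsto_mult tendsto_diff tendsto_const LIMSEQ_Suc[OF lim_1_over_n])
  then have "ennreal ((1 - 0) * (1 - 0)) \<le> Lim \<UU> (\<lambda>n. cost (G n))"
    by (rule Lim_bounded) (use bound in auto)
  then show ?thesis by simp
qed

end

section \<open>Finite groups\<close>

text \<open>The translation action on the group with uniform measure is free, and a star of k - 1
  edges at one point, each of mass 1/k, generates its orbit relation. Hence a group with
  \<open>inf_cost\<close> equal to 1 is infinite.\<close>

lemma inf_cost_finite_group:
  fixes \<Gamma> :: "('g, 'b) monoid_scheme"
  assumes "group \<Gamma>" and fin: "finite (carrier \<Gamma>)"
  shows "inf_cost \<Gamma> < 1"
proof -
  interpret group \<Gamma> by fact
  let ?k = "card (carrier \<Gamma>)"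
  have kpos: "?k > 0" using fin one_closed card_gt_0_iff by blast
  define f :: "'g \<Rightarrow> real" where "f \<gamma> = real (to_nat_on (carrier \<Gamma>) \<gamma>)" for \<gamma>
  have inj: "inj_on f (carrier \<Gamma>)"
    using inj_on_to_nat_on[OF countable_finite[OF fin]] by (auto simp: f_def inj_on_def)
  define C where "C = f ` carrier \<Gamma>"
  define h where "h = the_inv_into (carrier \<Gamma>) f"
  have hf: "h (f \<gamma>) = \<gamma>" if "\<gamma> \<in> carrier \<Gamma>" for \<gamma>
    unfolding h_def using inj that by (rule the_inv_into_f_f)
  have finC: "finite C" and cardC: "card C = ?k" using fin inj by (auto simp: C_def card_image)
  define a where "a \<gamma> = (\<lambda>r\<in>C. f (\<gamma> \<otimes>\<^bsub>\<Gamma>\<^esub> h r))" for \<gamma>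
  have af: "a \<gamma> (f \<delta>) = f (\<gamma> \<otimes>\<^bsub>\<Gamma>\<^esub> \<delta>)" if "\<delta> \<in> carrier \<Gamma>" for \<gamma> \<delta>
    using that by (simp add: a_def C_def hf)
  define M where "M = uniform_count_measure C"
  have spM: "space M = C" and setsM: "sets M = Pow C" by (simp_all add: M_def space_uniform_count_measure sets_uniform_count_measure)
  have emM: "emeasure M X = ennreal (card X / ?k)" if "X \<subseteq> C" for X
    unfolding M_def using emeasure_uniform_count_measure[OF finC that] cardC by simp
  have restr: "sets (restrict_space (borel :: real measure) C) = Pow C"
  proof -
    have "X \<in> (\<inter>) C ` sets borel" if "X \<subseteq> C" for X
      using finite_imp_closed[OF finite_subset[OF that finC]] that by (intro image_eqI[of _ _ X] borel_closed) auto
    then show ?thesis by (auto simp: sets_restrict_space)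
  qed
  have act: "group_action \<Gamma> C a"
  proof (rule group_actionI[OF assms(1)])
    show "a \<one>\<^bsub>\<Gamma>\<^esub> x = x" if "x \<in> C" for x using that by (auto simp: C_def af)
    show "a (\<gamma> \<otimes>\<^bsub>\<Gamma>\<^esub> \<delta>) x = a \<gamma> (a \<delta> x)" if "\<gamma> \<in> carrier \<Gamma>" "\<delta> \<in> carrier \<Gamma>" "x \<in> C" for \<gamma> \<delta> x
      using that by (auto simp: C_def af m_assoc)
    show "a \<gamma> x \<in> C" if "\<gamma> \<in> carrier \<Gamma>" "x \<in> C" for \<gamma> x using that by (auto simp: C_def af)
  qed (simp add: a_def)
  then interpret ga: group_action \<Gamma> C a .
  interpret ra: real_action \<Gamma> C M a
  proof (intro real_action.intro real_action_axioms.intro assms(1))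
    show "countable (carrier \<Gamma>)" using fin by (rule countable_finite)
    show "C \<in> sets borel" using finC by (intro borel_closed finite_imp_closed)
    show "sets M = sets (restrict_space borel C)" by (simp add: setsM restr)
    show "prob_space M" unfolding M_def
      using finC kpos cardC by (intro prob_space_uniform_count_measure) auto
    show "pmp_action \<Gamma> M a"
      unfolding pmp_action_def spM
    proof (intro conjI ballI act)
      fix \<gamma> assume \<gamma>: "\<gamma> \<in> carrier \<Gamma>"
      show m: "a \<gamma> \<in> M \<rightarrow>\<^sub>M M"
        using ga.element_image[OF \<gamma>] by (auto simp: measurable_def spM setsM)
      show "distr M M (a \<gamma>) = M"
      proof (rule measure_eqI)
        fix X assume "X \<in> sets (distr M M (a \<gamma>))"
        then have X: "X \<subseteq> C" by (simp add: setsM)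
        have "a \<gamma> ` (a \<gamma> -` X \<inter> C) = X \<inter> a \<gamma> ` C" by auto
        then have "a \<gamma> ` (a \<gamma> -` X \<inter> C) = X" using ga.surj_prop[OF \<gamma>] X by (simp only: inf_absorb1)
        then have "card (a \<gamma> -` X \<inter> C) = card X"
          using card_image[OF inj_on_subset[OF ga.inj_prop[OF \<gamma>] Int_lower2[of "a \<gamma> -` X"]]] by simp
        then show "emeasure (distr M M (a \<gamma>)) X = emeasure M X"
          using emeasure_distr[OF m, of X] X emM by (simp add: setsM spM)
      qed simp
    qed
  qed
  have free: "essentially_free \<Gamma> M a"
    unfolding essentially_free_def
  proof (rule AE_I2, intro ballI impI)
    fix x \<gamma> assume x: "x \<in> space M" and g: "\<gamma> \<in> carrier \<Gamma>" "a \<gamma> x = x"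
    obtain \<delta> where d: "\<delta> \<in> carrier \<Gamma>" "x = f \<delta>" using x by (auto simp: spM C_def)
    then have "\<gamma> \<otimes>\<^bsub>\<Gamma>\<^esub> \<delta> = \<delta>" using g af inj by (auto dest: inj_onD)
    then show "\<gamma> = \<one>\<^bsub>\<Gamma>\<^esub>" using g(1) d(1) by (simp add: r_cancel_one)
  qed
  let ?r = "f \<one>\<^bsub>\<Gamma>\<^esub>" and ?J = "carrier \<Gamma> - {\<one>\<^bsub>\<Gamma>\<^esub>}"
  define \<Psi> where "\<Psi> \<gamma> = (\<lambda>x. (a \<gamma> x, x)) ` {?r}" for \<gamma>
  have r: "?r \<in> C" by (simp add: C_def)
  then have rs: "{?r} \<in> sets M" by (simp add: setsM)
  have gr: "graphing ra.OG ?J \<Psi>"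
    using fin ra.graph_sets[OF rs] by (auto simp: graphing_def bisection_def \<Psi>_def ra.sets_OG countable_finite)
  have gen: "generating ra.OG ?J \<Psi>"
    unfolding generating_def
  proof (rule antisym)
    have "subgroupoid ra.OG (space (arrows ra.OG))"
      unfolding subgroupoid_def using ra.OG.Ob_sub ra.OG.inv_in ra.OG.mult_in by auto
    moreover have "\<Psi> \<gamma> \<subseteq> space (arrows ra.OG)" if "\<gamma> \<in> ?J" for \<gamma>
      using gr that sets.sets_into_space[of "\<Psi> \<gamma>"] by (auto simp: graphing_def bisection_def)
    ultimately show "\<Inter>{H. subgroupoid ra.OG H \<and> (\<forall>i\<in>?J. \<Psi> i \<subseteq> H)} \<subseteq> space (arrows ra.OG)"
      by (intro Inter_lower) blast
    show "space (arrows ra.OG) \<subseteq> \<Inter>{H. subgroupoid ra.OG H \<and> (\<forall>i\<in>?J. \<Psi> i \<subseteq> H)}"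
    proof (rule Inter_greatest, clarify)
      fix H y x assume H: "subgroupoid ra.OG H" and \<Psi>: "\<forall>i\<in>?J. \<Psi> i \<subseteq> H" and yx: "(y, x) \<in> space (arrows ra.OG)"
      have root: "(z, ?r) \<in> H" if z: "z \<in> C" for z
      proof -
        obtain \<gamma> where \<gamma>: "\<gamma> \<in> carrier \<Gamma>" "z = f \<gamma>" using z by (auto simp: C_def)
        show ?thesis
        proof (cases "\<gamma> = \<one>\<^bsub>\<Gamma>\<^esub>")
          case True
          then show ?thesis using subgroupoid_unit[OF H, of "(?r, ?r)"] r \<gamma> by (auto simp: ra.base_OG)
        next
          case False
          then have "(a \<gamma> ?r, ?r) \<in> H" using \<Psi> \<gamma>(1) by (auto simp: \<Psi>_def)
          then show ?thesis using \<gamma> af[OF one_closed] by simp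
        qed
      qed
      have "y \<in> C" "x \<in> C" using yx ra.Rel_sub by (auto simp: ra.space_OG)
      then have "(y, ?r) \<in> H" "(?r, x) \<in> H"
        using root subgroupoid_inv[OF H, of "(x, ?r)"] by (auto simp: ra.OG_simps)
      from subgroupoid_mult[OF H this] show "(y, x) \<in> H" by (simp add: ra.OG_simps)
    qed
  qed
  have "inf_cost \<Gamma> \<le> cost ra.OG" unfolding inf_cost_def by (rule Inf_lower[OF ra.cost_in[OF free]])
  also have "\<dots> \<le> graphing_cost ra.OG ?J \<Psi>" by (rule cost_le[OF gr gen])
  also have "\<dots> = (\<Sum>\<gamma>\<in>?J. ennreal (1 / ?k))"
    using fin ra.emeasure_graph[OF rs] emM[of "{?r}"] r by (simp add: graphing_cost_finite \<Psi>_def)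
  also have "\<dots> = ennreal ((?k - 1) * (1 / ?k))"
    using fin by (subst ennreal_mult) (simp_all add: ennreal_of_nat_eq_real_of_nat card_Diff_singleton)
  also have "\<dots> < 1"
    using kpos by (simp add: ennreal_less_one_iff field_simps)
  finally show ?thesis .
qed

section \<open>Lower limits along ultrafilters\<close>

text \<open>Infinitely many values lie below a strict upper bound of the lower limit, and an
  ultrafilter can be chosen to contain the set of their indices.\<close>

lemma ex_ultrafilter_Lim_le:
  fixes f :: "nat \<Rightarrow> 'b :: {complete_linorder, linorder_topology}"
  assumes "liminf f < c"
  obtains \<UU> where "nonprincipal_ultrafilter \<UU>" "Lim \<UU> f \<le> c"
proof -
  have "\<not> (\<forall>\<^sub>F n in sequentially. c \<le> f n)"
    using assms Liminf_bounded[of c f sequentially] by (auto simp: not_le[symmetric])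
  then have "\<exists>\<^sub>F n in sequentially. f n < c" by (simp add: not_eventually not_le)
  then have "infinite {n. f n < c}" by (simp add: frequently_cofinite[symmetric] cofinite_eq_sequentially)
  then obtain \<UU> where U: "nonprincipal_ultrafilter \<UU>" "\<forall>\<^sub>F n in \<UU>. f n < c" by (rule ex_nonprincipal_ultrafilter)
  interpret np_ultrafilter \<UU> by standard fact
  have "Lim \<UU> f \<le> c" using U(2) by (intro Lim_le) (auto elim: eventually_mono)
  with U(1) show thesis by (rule that)
qed

lemma liminf_ge_ultrafilters:
  fixes f :: "nat \<Rightarrow> ennreal"
  assumes "\<And>\<UU>. nonprincipal_ultrafilter \<UU> \<Longrightarrow> c \<le> Lim \<UU> f" shows "c \<le> liminf f"
proof (rule ccontr)
  assume "\<not> ?thesis"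
  then obtain d where d: "liminf f < d" "d < c" using dense[of "liminf f" c] by (auto simp: not_le)
  from d(1) obtain \<UU> where "nonprincipal_ultrafilter \<UU>" "Lim \<UU> f \<le> d" by (rule ex_ultrafilter_Lim_le)
  with assms d(2) show False by (metis leD order_trans)
qed

lemma limsup_le_ultrafilters:
  fixes f :: "nat \<Rightarrow> ennreal"
  assumes "\<And>\<UU>. nonprincipal_ultrafilter \<UU> \<Longrightarrow> Lim \<UU> f \<le> c" shows "limsup f \<le> c"
proof (rule ccontr)
  assume "\<not> ?thesis"
  then obtain d where d: "c < d" "d < limsup f" using dense[of c "limsup f"] by (auto simp: not_le)
  have "\<not> (\<forall>\<^sub>F n in sequentially. f n \<le> d)"
    using d(2) Limsup_bounded[of f d sequentially] by (auto simp: not_le[symmetric])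
  then have "\<exists>\<^sub>F n in sequentially. d < f n" by (simp add: not_eventually not_le)
  then have "infinite {n. d < f n}" by (simp add: frequently_cofinite[symmetric] cofinite_eq_sequentially)
  then obtain \<UU> where U: "nonprincipal_ultrafilter \<UU>" "\<forall>\<^sub>F n in \<UU>. d < f n" by (rule ex_nonprincipal_ultrafilter)
  interpret np_ultrafilter \<UU> by standard (rule U)
  have "d \<le> Lim \<UU> f" using U(2) by (intro Lim_ge) (auto elim: eventually_mono)
  with assms[OF U(1)] d(1) show False by (metis leD order_trans)
qed

section \<open>Sofic approximations\<close>

lemma countable_generate:
  assumes "group \<Gamma>" "countable S" "S \<subseteq> carrier \<Gamma>" shows "countable (generate \<Gamma> S)"
proof -
  interpret group \<Gamma> by fact
  define f where "f = (\<lambda>(s, b). if b then s else inv\<^bsub>\<Gamma>\<^esub> s)"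
  \<comment> \<open>Evaluation of words over S and formal inverses; it presents the generated group
    as an image of a countable set of lists.\<close>
  define v where "v = (\<lambda>l. foldr (\<lambda>p x. f p \<otimes>\<^bsub>\<Gamma>\<^esub> x) l \<one>\<^bsub>\<Gamma>\<^esub>)"
  have f_in: "f p \<in> carrier \<Gamma>" if "p \<in> S \<times> (UNIV :: bool set)" for p using that assms(3) by (auto simp: f_def)
  have v_in: "v l \<in> carrier \<Gamma>" if "l \<in> lists (S \<times> UNIV)" for l
    using that by (induction l) (auto simp: v_def f_in)
  have v_app: "v (l @ l') = v l \<otimes>\<^bsub>\<Gamma>\<^esub> v l'" if "l \<in> lists (S \<times> UNIV)" "l' \<in> lists (S \<times> UNIV)" for l l'
    using that(1)
  proof (induction l)
    case Nil
    then show ?case using v_in[OF that(2)] by (simp add: v_def)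
  next
    case (Cons p l)
    then have "v ((p # l) @ l') = f p \<otimes>\<^bsub>\<Gamma>\<^esub> (v l \<otimes>\<^bsub>\<Gamma>\<^esub> v l')" by (simp add: v_def)
    also have "\<dots> = v (p # l) \<otimes>\<^bsub>\<Gamma>\<^esub> v l'"
      using Cons v_in[OF that(2)] v_in[of l] f_in[of p] by (simp add: v_def m_assoc)
    finally show ?case .
  qed
  have "generate \<Gamma> S \<subseteq> v ` lists (S \<times> UNIV)"
  proof
    fix x assume "x \<in> generate \<Gamma> S"
    then show "x \<in> v ` lists (S \<times> UNIV)"
    proof induction
      case one
      then show ?case by (intro image_eqI[of _ _ "[]"]) (auto simp: v_def)
    next
      case (incl s)
      then show ?case using assms(3) by (intro image_eqI[of _ _ "[(s, True)]"]) (auto simp: v_def f_def)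
    next
      case (inv s)
      then show ?case using assms(3) by (intro image_eqI[of _ _ "[(s, False)]"]) (auto simp: v_def f_def)
    next
      case (eng x y)
      then obtain l l' where "x = v l" "l \<in> lists (S \<times> UNIV)" "y = v l'" "l' \<in> lists (S \<times> UNIV)" by blast
      then show ?case using v_app by (intro image_eqI[of _ _ "l @ l'"]) auto
    qed
  qed
  moreover have "countable (v ` lists (S \<times> (UNIV :: bool set)))"
    using assms(2) by (intro countable_image countable_lists countable_SIGMA) auto
  ultimately show ?thesis by (rule countable_subset)
qed

lemma sofic_approximation_costs:
  fixes \<Gamma> :: "('g, 'b) monoid_scheme" and \<G> :: "nat \<Rightarrow> 'a groupoid"
  assumes "group \<Gamma>" "finite S" "S \<subseteq> carrier \<Gamma>" "generate \<Gamma> S = carrier \<Gamma>"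
    and sofic: "sofic_approximation \<Gamma> S \<G> \<Phi>" and np: "nonprincipal_ultrafilter \<UU>"
  shows "cost (ultraproduct \<UU> \<G> S \<Phi>) = combinatorial_cost_ultra \<UU> \<G> S \<Phi>"
    and "Lim \<UU> (\<lambda>n. cost (\<G> n)) \<le> combinatorial_cost_ultra \<UU> \<G> S \<Phi>"
    and "infinite (carrier \<Gamma>) \<Longrightarrow> 1 \<le> Lim \<UU> (\<lambda>n. cost (\<G> n))"
    and "essentially_trivial_isotropy (ultraproduct \<UU> \<G> S \<Phi>) \<Longrightarrow> cost (ultraproduct \<UU> \<G> S \<Phi>) \<le> sup_cost \<Gamma>"
    and "essentially_trivial_isotropy (ultraproduct \<UU> \<G> S \<Phi>) \<Longrightarrow> inf_cost \<Gamma> \<le> cost (ultraproduct \<UU> \<G> S \<Phi>)"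
proof -
  have fin: "finite_pmp_groupoid (\<G> n)" and graphed: "graphed_groupoid (\<G> n) S (\<Phi> n)" for n
    using sofic by (auto simp: sofic_approximation_def)
  interpret gu: graphed_ultraproduct \<UU> \<G> S \<Phi>
    by standard (rule np assms(2) fin graphed)+
  show "cost (ultraproduct \<UU> \<G> S \<Phi>) = combinatorial_cost_ultra \<UU> \<G> S \<Phi>" by (rule gu.cost_ultraproduct)
  show "Lim \<UU> (\<lambda>n. cost (\<G> n)) \<le> combinatorial_cost_ultra \<UU> \<G> S \<Phi>" by (rule gu.Lim_cost_le)
  obtain T where T: "factor_map (ultraproduct \<UU> \<G> S \<Phi>) (group_groupoid \<Gamma>) T"
    using sofic np unfolding sofic_approximation_def by blast
  have cou: "countable (carrier \<Gamma>)"
    using countable_generate[OF assms(1) countable_finite[OF assms(2)] assms(3)] assms(4) by simp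
  have gf: "group_factor (ultraproduct \<UU> \<G> S \<Phi>) \<Gamma> T N" if "N \<in> null_sets (arrows (ultraproduct \<UU> \<G> S \<Phi>))" for N
    by (intro group_factor.intro group_factor_axioms.intro gu.H.fibred_groupoid_axioms assms(1) cou T that)
  show "1 \<le> Lim \<UU> (\<lambda>n. cost (\<G> n))" if "infinite (carrier \<Gamma>)"
  proof -
    \<comment> \<open>Nothing is discarded: the lower bound counts arrows, and isotropy contributes
      to their number.\<close>
    interpret ultraproduct_factor \<UU> \<G> S \<Phi> \<Gamma> T "{}"
      by (intro ultraproduct_factor.intro gu.graphed_ultraproduct_axioms gf) simp
    show ?thesis using that by (rule Lim_cost_ge_1)
  qed
  have free: "free_group_factor (ultraproduct \<UU> \<G> S \<Phi>) \<Gamma> T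
      {g \<in> space (arrows (ultraproduct \<UU> \<G> S \<Phi>)). source (ultraproduct \<UU> \<G> S \<Phi>) g = target (ultraproduct \<UU> \<G> S \<Phi>) g \<and>
        g \<notin> space (base (ultraproduct \<UU> \<G> S \<Phi>))}"
    if "essentially_trivial_isotropy (ultraproduct \<UU> \<G> S \<Phi>)"
    by (intro free_group_factor.intro free_group_factor_axioms.intro gf gu.H.isotropy_null that refl)
  show "cost (ultraproduct \<UU> \<G> S \<Phi>) \<le> sup_cost \<Gamma>"
    if "essentially_trivial_isotropy (ultraproduct \<UU> \<G> S \<Phi>)"
    by (rule free_group_factor.cost_le_sup[OF free[OF that]])
  show "inf_cost \<Gamma> \<le> cost (ultraproduct \<UU> \<G> S \<Phi>)"
    if "essentially_trivial_isotropy (ultraproduct \<UU> \<G> S \<Phi>)"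
    by (rule free_group_factor.inf_le_cost[OF free[OF that]])
qed

text \<open>Fixed price makes the two bounds for the ultraproduct coincide, so its cost is the same
  for every ultrafilter. For a fixed L the lower limit is approached along ultrafilters that depend
  on L; a value common to all of them makes this harmless.\<close>

lemma fixed_price_combinatorial_cost:
  fixes \<Gamma> :: "('g, 'b) monoid_scheme" and \<G> :: "nat \<Rightarrow> 'a groupoid"
  assumes hyps: "group \<Gamma>" "finite S" "S \<subseteq> carrier \<Gamma>" "generate \<Gamma> S = carrier \<Gamma>" "sofic_approximation \<Gamma> S \<G> \<Phi>"
    and np: "nonprincipal_ultrafilter \<UU>"
    and triv: "\<And>\<W>. nonprincipal_ultrafilter \<W> \<Longrightarrow> essentially_trivial_isotropy (ultraproduct \<W> \<G> S \<Phi>)"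
    and fp: "fixed_price \<Gamma>"
  shows "inf_cost \<Gamma> = combinatorial_cost \<G> S \<Phi>"
    and "\<And>\<W>. nonprincipal_ultrafilter \<W> \<Longrightarrow> combinatorial_cost_ultra \<W> \<G> S \<Phi> = inf_cost \<Gamma>"
proof -
  show eq: "combinatorial_cost_ultra \<W> \<G> S \<Phi> = inf_cost \<Gamma>" if "nonprincipal_ultrafilter \<W>" for \<W>
    using sofic_approximation_costs(1,4,5)[OF hyps that] triv[OF that] fp by (simp add: fixed_price_def)
  show "inf_cost \<Gamma> = combinatorial_cost \<G> S \<Phi>"
  proof (rule antisym)
    show "inf_cost \<Gamma> \<le> combinatorial_cost \<G> S \<Phi>"
      unfolding combinatorial_cost_def
    proof (intro INF_greatest liminf_ge_ultrafilters)
      fix L and \<W> assume W: "nonprincipal_ultrafilter \<W>"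
      have "combinatorial_cost_ultra \<W> \<G> S \<Phi> \<le> Lim \<W> (\<lambda>n. lipschitz_cost L (\<G> n) S (\<Phi> n))"
        unfolding combinatorial_cost_ultra_def by (rule INF_lower) simp
      then show "inf_cost \<Gamma> \<le> Lim \<W> (\<lambda>n. lipschitz_cost L (\<G> n) S (\<Phi> n))" using eq[OF W] by simp
    qed
    have "combinatorial_cost \<G> S \<Phi> \<le> combinatorial_cost_ultra \<UU> \<G> S \<Phi>"
      unfolding combinatorial_cost_def combinatorial_cost_ultra_def
      by (intro INF_mono' liminf_le_Lim np)
    then show "combinatorial_cost \<G> S \<Phi> \<le> inf_cost \<Gamma>" using eq[OF np] by simp
  qed
qed

theorem corollary1p4:
  fixes \<Gamma> :: "('g, 'b) monoid_scheme" and S :: "'g set"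
    and \<G> :: "nat \<Rightarrow> 'a groupoid" and \<Phi> :: "nat \<Rightarrow> 'g \<Rightarrow> 'a set"
    and \<UU> :: "nat filter"
  assumes "group \<Gamma>" and "sofic_group \<Gamma>"
    and "finite S" and "S \<subseteq> carrier \<Gamma>" and "generate \<Gamma> S = carrier \<Gamma>"
    and "sofic_approximation \<Gamma> S \<G> \<Phi>"
    and "nonprincipal_ultrafilter \<UU>"
  shows
    "(essentially_trivial_isotropy (ultraproduct \<UU> \<G> S \<Phi>) \<longrightarrow>
        sup_cost \<Gamma> \<ge> cost (ultraproduct \<UU> \<G> S \<Phi>)) \<and>
     cost (ultraproduct \<UU> \<G> S \<Phi>) = combinatorial_cost_ultra \<UU> \<G> S \<Phi> \<and>
     combinatorial_cost_ultra \<UU> \<G> S \<Phi> \<ge> Lim \<UU> (\<lambda>n. cost (\<G> n)) \<and>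
     Lim \<UU> (\<lambda>n. cost (\<G> n)) \<ge> liminf (\<lambda>n. cost (\<G> n)) \<and>
     (infinite (carrier \<Gamma>) \<longrightarrow> liminf (\<lambda>n. cost (\<G> n)) \<ge> 1) \<and>
     ((\<forall>\<W>. nonprincipal_ultrafilter \<W> \<longrightarrow>
           essentially_trivial_isotropy (ultraproduct \<W> \<G> S \<Phi>)) \<longrightarrow>
        (fixed_price \<Gamma> \<longrightarrow> inf_cost \<Gamma> = combinatorial_cost \<G> S \<Phi>) \<and>
        (fixed_price \<Gamma> \<and> inf_cost \<Gamma> = 1 \<longrightarrow>
           combinatorial_cost \<G> S \<Phi> = 1 \<and> (\<lambda>n. cost (\<G> n)) \<longlonglongrightarrow> 1))"
proof -
  note costs = sofic_approximation_costs[OF assms(1,3-6)]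
  have lower: "1 \<le> liminf (\<lambda>n. cost (\<G> n))" if "infinite (carrier \<Gamma>)"
    using costs(3) that by (intro liminf_ge_ultrafilters)
  have fixed: "(fixed_price \<Gamma> \<longrightarrow> inf_cost \<Gamma> = combinatorial_cost \<G> S \<Phi>) \<and>
      (fixed_price \<Gamma> \<and> inf_cost \<Gamma> = 1 \<longrightarrow>
         combinatorial_cost \<G> S \<Phi> = 1 \<and> (\<lambda>n. cost (\<G> n)) \<longlonglongrightarrow> 1)"
    if triv: "\<forall>\<W>. nonprincipal_ultrafilter \<W> \<longrightarrow> essentially_trivial_isotropy (ultraproduct \<W> \<G> S \<Phi>)"
  proof (intro conjI impI)
    note fp = fixed_price_combinatorial_cost[OF assms(1,3-7) triv[rule_format]]
    show "inf_cost \<Gamma> = combinatorial_cost \<G> S \<Phi>" if "fixed_price \<Gamma>" using fp(1)[OF _ that] by blast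
    assume p: "fixed_price \<Gamma> \<and> inf_cost \<Gamma> = 1"
    then show "combinatorial_cost \<G> S \<Phi> = 1" using fp(1) by simp
    \<comment> \<open>Finite groups have \<open>inf_cost\<close> below 1, so price 1 supplies the
      infiniteness on which the lower bound depends.\<close>
    have "infinite (carrier \<Gamma>)" using inf_cost_finite_group[OF assms(1)] p by auto
    then have "1 \<le> liminf (\<lambda>n. cost (\<G> n))" by (rule lower)
    \<comment> \<open>Along each ultrafilter the limit of the costs is at most the combinatorial
      cost for that ultrafilter, which fixed price makes equal to 1.\<close>
    moreover have "limsup (\<lambda>n. cost (\<G> n)) \<le> 1"
    proof (rule limsup_le_ultrafilters)
      fix \<W> assume W: "nonprincipal_ultrafilter \<W>"
      show "Lim \<W> (\<lambda>n. cost (\<G> n)) \<le> 1" using costs(2)[OF W] fp(2)[OF _ _ W] p by simp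
    qed
    moreover have "liminf (\<lambda>n. cost (\<G> n)) \<le> limsup (\<lambda>n. cost (\<G> n))" by (rule Liminf_le_Limsup) simp
    ultimately show "(\<lambda>n. cost (\<G> n)) \<longlonglongrightarrow> 1"
      by (intro Liminf_eq_Limsup) auto
  qed
  show ?thesis
    using costs(1,2,4)[OF assms(7)] liminf_le_Lim[OF assms(7), of "\<lambda>n. cost (\<G> n)"] lower fixed by blast
qed

end
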